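(* Let $\vec\mu=(\mu_1,\mu_2)$ be an Angelesco system with $\Delta_1<\Delta_2$ and fix $X\in\mathcal V$, with children $X_i=X_{(ch),i}$, $i\in\{1,2\}$. The function $\widehat\Psi(X;x)$ is a generalized eigenfunction of $\mathcal J_{\vec\kappa}$, that is, $$\mathcal J_{\vec\kappa}\widehat\Psi(X;x)=x\widehat\Psi(X;x).$$ Moreover, for $i\in\{1,2\}$ let $g_i^{(X)}\in\widehat{\mathfrak C}^{(X)}$ be given by $$g_i^{(X)}=\int\alpha(X_i;x)\widehat\Psi(X;x)\,d\widetilde\rho_X(x),\qquad\alpha(X_i;x)=(-1)^iW_{X_i}^{1/2}\nu_{X_i}(x).$$ Then $\chi_ig_i^{(X)}=\chi_i\delta^{(X_i)}$ for $i\in\{1,2\}$, and $$\widehat{\mathfrak C}^{(X)}=\overline{\mathrm{span}\{\mathcal J_{\vec\kappa}^ng_i^{(X)}:n\in\mathbb Z_+\}},$$ that is, each $g_i^{(X)}$ is a generator of the cyclic subspace $\widehat{\mathfrak C}^{(X)}$. In particular, the formula $$\alpha(\mathcal J_{\vec\kappa})g_i^{(X)}=\int\alpha(x)\alpha(X_i;x)\widehat\Psi(X;x)\,d\widetilde\rho_X(x)$$ (valid for continuous $\alpha$) extends the definition of $\alpha(\mathcal J_{\vec\kappa})g_i^{(X)}$ from continuous functions to all $\alpha\in L^2(\widetilde\rho_X)$. Furthermore, the spectral measure $\rho_{X,i}$ of $g_i^{(X)}$ with respect to $\mathcal J_{\vec\kappa}$ satisfies $$d\rho_{X,i}(x)=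\sum_{k=1}^2\frac{W_{X_i}}{W_{X_k}}\frac{\nu_{X_i}^2(x)}{\nu_{X_k}(x)}\,d\widetilde\rho_X(x).$$
   Context: Angelesco system: $\mu_1,\mu_2$ are finite positive Borel measures on $\mathbb R$ with compact supports of infinite cardinality; $\Delta_i=[\alpha_i,\beta_i]$ is the convex hull of $\operatorname{supp}\mu_i$; $\Delta_1\cap\Delta_2=\varnothing$, labelled so that $\beta_1<\alpha_2$ (written $\Delta_1<\Delta_2$). $\mu^\star=\chi_{\Delta_1}\mu_1+\chi_{\Delta_2}\mu_2$, $\widehat\mu_k(z)=\int\frac{d\mu_k(x)}{z-x}$. Multiple orthogonality. For $\vec n\in\mathbb Z_+^2\setminus\{(0,0)\}$, $A^{(1)}_{\vec n},A^{(2)}_{\vec n}$ are the polynomials with $\deg A_{\vec n}^{(k)}\le n_k-1$ ($A_{\vec n}^{(k)}=0$ if $n_k=0$), $\int x^m(A_{\vec n}^{(1)}d\mu_1+A_{\vec n}^{(2)}d\mu_2)=0$ for $0\le m\le|\vec n|-2$ and $=1$ for $m=|\vec n|-1$; $P_{\vec n}$ is the monic polynomial of degree $|\vec n|=n_1+n_2$ with $\int P_{\vec n}x^md\mu_k=0$, $0\le m<n_k$, $k=1,2$. Angelesco systems are perfect (these polynomials exist uniquely), and there are uniformly bounded real recurrence coefficients with $xP_{\vec n}=P_{\vec n+\vec e_i}+b_{\vec n,i}P_{\vec n}+a_{\vec n,1}P_{\vec n-\vec e_1}+a_{\vec n,2}P_{\vec n-\vec e_2}$, $i\in\{1,2\}$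 ($\vec e_1=(1,0)$, $\vec e_2=(0,1)$; terms with negative indices are $0$), where $a_{\vec n,i}>0$ for $\vec n\in\mathbb N^2$. Set $A_{\vec n}^{(0)}(z)=\sum_{k=1}^2\int\frac{A_{\vec n}^{(k)}(z)-A_{\vec n}^{(k)}(x)}{z-x}d\mu_k(x)$, $L_{\vec n}(z)=\int\frac{A^{(1)}_{\vec n}(x)d\mu_1(x)+A^{(2)}_{\vec n}(x)d\mu_2(x)}{z-x}$, $L_{\vec n+}(E)=\lim_{\epsilon\to0^+}L_{\vec n}(E+i\epsilon)$. For $\vec n\in\mathbb N^2$ all zeros of $A_{\vec n}^{(k)}$ are simple and lie in $\Delta_k$; $E_{\vec n}$ is the set of zeros of $A_{\vec n}^{(1)}A_{\vec n}^{(2)}$, and $L_{\vec n+}(E)$ exists and is nonzero for $E\in E_{\vec n}$. Reference measure. For $\vec n\in\mathbb N^2$, $\xi\in(\beta_1,\alpha_2)$ let $D_{\vec n,\xi}(z)=(-1)^{n_2}(z-\xi)A_{\vec n}^{(1)}(z)A_{\vec n}^{(2)}(z)$ and $S_{\vec n,\xi}(x)=|x-\xi|^{-1}\big(\chi_{\Delta_1}(x)|A_{\vec n}^{(2)}(x)|^{-1}+\chi_{\Delta_2}(x)|A_{\vec n}^{(1)}(x)|^{-1}\big)$. $\omega_{\vec n}$ is the non-negative measure on $\Delta_1\cup\Delta_2$, independent of $\xi$ and without atoms in $E_{\vec n}$, such that for every such $\xi$ and $\Im z>0$ $$\frac1{D_{\vec n,\xi}(z)L_{\vec n}(z)}=\int\frac{S_{\vec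 n,\xi}(x)d\omega_{\vec n}(x)}{x-z}+\sum_{E\in E_{\vec n}\cup\{\xi\}}\frac{\zeta_{\vec n,\xi}(E)}{E-z}+a_{\vec n,\xi}+b_{\vec n,\xi}z,$$ with $a_{\vec n,\xi}\in\mathbb R$, $b_{\vec n,\xi}>0$, $\zeta_{\vec n,\xi}(E)=-(D_{\vec n,\xi}'(E)L_{\vec n+}(E))^{-1}>0$. Tree and operator. $\mathcal V$ is the vertex set of the infinite rooted binary tree with root $O$: each $Y$ has two children $Y_{(ch),1},Y_{(ch),2}$; $Y_{(p)}$ is the parent of $Y\ne O$. $\Pi(O)=(1,1)$, $\Pi(Y_{(ch),i})=\Pi(Y)+\vec e_i$; $\iota_Y=i$ if $Y$ is the $i$-th child of its parent. Objects indexed by $\vec n\in\mathbb N^2$ are also indexed by vertices via $\Pi$ ($\omega_Y=\omega_{\Pi(Y)}$, $E_Y=E_{\Pi(Y)}$, $L_Y=L_{\Pi(Y)}$, $A_Y^{(k)}=A_{\Pi(Y)}^{(k)}$). For a fixed $\vec\kappa\in\mathbb R^2$ with $\kappa_1+\kappa_2=1$: $V_O=\kappa_1b_{(0,1),1}+\kappa_2b_{(1,0),2}$, $W_O=1$; $V_Y=b_{\Pi(Y_{(p)}),\iota_Y}$, $W_Y=a_{\Pi(Y_{(p)}),\iota_Y}>0$ for $Y\neq O$; with $f_{O_{(p)}}:=0$, $$(\mathcal J_{\vec\kappa}f)_Y=V_Yf_Y+W_Y^{1/2}f_{Y_{(p)}}+W_{Y_{(ch),1}}^{1/2}f_{Y_{(ch),1}}+W_{Y_{(ch),2}}^{1/2}f_{Y_{(ch),2}},$$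 a bounded self-adjoint operator on $\ell^2(\mathcal V)$, acting by the same formula on arbitrary functions on $\mathcal V$. $\mathcal V_{[X]}$ consists of $X$ and all its descendants. $\delta^{(Y)}$ is the Kronecker delta. The spectral measure $\rho_f$ of $f$ is defined by $\langle(\mathcal J_{\vec\kappa}-z)^{-1}f,f\rangle=\int\frac{d\rho_f(x)}{x-z}$. Generalized eigenfunctions. $m_Y=\prod_{Z\in\mathrm{path}(Y,O)}W_Z^{-1/2}$ (both ends included); $\Lambda^{(k)}_Y=m_Y^{-1}A^{(k)}_{\Pi(Y)}$, $k\in\{0,1,2\}$; $[f,g]^{(Z)}=f_Zg-fg_Z$. For $Z\ne O$ and $x\in\Delta_1\cup\Delta_2$, $$\widetilde\Psi(Z;x)=m_{Z_{(p)}}m_Z\sum_{k=1}^2\Big([\Lambda^{(k)}(x),\Lambda^{(0)}(x)]^{(Z_{(p)})}+[\Lambda^{(3-k)}(x),\Lambda^{(k)}(x)]^{(Z_{(p)})}\,\widehat\mu_{3-k}(x)\Big)\chi_{\Delta_k}(x),$$ $S_Z(x)=\widetilde\Psi_Z(Z;x)$ (positive and continuous on $\Delta_1\cup\Delta_2$), $\Psi(Z;x)=S_Z^{-1}(x)\widetilde\Psi(Z;x)$ on $\mathcal V_{[Z]}$. For $X\in\mathcal V$: $\widetilde\rho_X=\omega_X+\sum_{E\in E_X}\mu^\star(\{E\})\delta_E$; $\nu_{X_i}(x)=S_{X_i}(x)$ for $x\in(\Delta_1\cup\Delta_2)\setminus E_X$ and $\nu_{X_i}(E)=A_{X_i}^{(k)}(E)L_{X+}^{-1}(E)$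 for $E\in E_X\cap\Delta_k$ (these functions are bounded above and below by positive constants); $$\widehat\Psi_Y(X;x)=(-1)^iW_{X_i}^{-1/2}\Psi_Y(X_i;x)\ \text{ for }Y\in\mathcal V_{[X_i]},\ i\in\{1,2\},\qquad\widehat\Psi_Y(X;x)=0\ \text{ otherwise};$$ $$\widehat{\mathfrak C}^{(X)}=\Big\{\int\alpha(x)\widehat\Psi(X;x)\,d\widetilde\rho_X(x):\alpha\in L^2(\widetilde\rho_X)\Big\}\subset\ell^2(\mathcal V).$$ $\chi_i$ denotes restriction of functions on $\mathcal V$ to $\mathcal V_{[X_i]}$. *)

theory Defs
  imports "HOL-Analysis.Analysis" "HOL-Computational_Algebra.Polynomial"
begin

text \<open>
  Everything that carries an index \<open>k \<in> {1, 2}\<close> takes it as a natural number; values at other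
  indices are irrelevant. Multi-indices are pairs of natural numbers.
\<close>

definition entry :: "'a \<times> 'a \<Rightarrow> nat \<Rightarrow> 'a" where
  "entry v k = (if k = 1 then fst v else snd v)"

definition unit_index :: "nat \<Rightarrow> nat \<times> nat" where
  "unit_index i = (if i = 1 then (1, 0) else (0, 1))"

definition index_size :: "nat \<times> nat \<Rightarrow> nat" where
  "index_size n = fst n + snd n"

definition measure_support :: "real measure \<Rightarrow> real set" where
  "measure_support M = {x. \<forall>U. open U \<and> x \<in> U \<longrightarrow> emeasure M U > 0}"

definition Delta :: "(nat \<Rightarrow> real measure) \<Rightarrow> nat \<Rightarrow> real set" where
  "Delta \<mu> k = convex hull (measure_support (\<mu> k))"

definition angelesco :: "(nat \<Rightarrow> real measure) \<Rightarrow> bool" where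
  "angelesco \<mu> \<longleftrightarrow>
     (\<forall>k\<in>{1, 2}. sets (\<mu> k) = sets borel \<and> finite_measure (\<mu> k) \<and>
        compact (measure_support (\<mu> k)) \<and> infinite (measure_support (\<mu> k))) \<and>
     (\<forall>x\<in>Delta \<mu> 1. \<forall>y\<in>Delta \<mu> 2. x < y)"

definition gap :: "(nat \<Rightarrow> real measure) \<Rightarrow> real set" where
  "gap \<mu> = {Sup (Delta \<mu> 1) <..< Inf (Delta \<mu> 2)}"

definition mu_star :: "(nat \<Rightarrow> real measure) \<Rightarrow> real measure" where
  "mu_star \<mu> = measure_of UNIV (sets borel) (\<lambda>B. \<Sum>k\<in>{1, 2}. emeasure (\<mu> k) (B \<inter> Delta \<mu> k))"

definition mu_hat :: "(nat \<Rightarrow> real measure) \<Rightarrow> nat \<Rightarrow> real \<Rightarrow> real" where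
  "mu_hat \<mu> k z = (\<integral>x. 1 / (z - x) \<partial>\<mu> k)"

definition is_type_I ::
  "(nat \<Rightarrow> real measure) \<Rightarrow> nat \<times> nat \<Rightarrow> real poly \<times> real poly \<Rightarrow> bool" where
  "is_type_I \<mu> n A \<longleftrightarrow>
     (\<forall>k\<in>{1, 2}. if entry n k = 0 then entry A k = 0 else degree (entry A k) \<le> entry n k - 1) \<and>
     (\<forall>m. m + 2 \<le> index_size n \<longrightarrow> (\<Sum>k\<in>{1, 2}. \<integral>x. x ^ m * poly (entry A k) x \<partial>\<mu> k) = 0) \<and>
     (\<forall>m. m + 1 = index_size n \<longrightarrow> (\<Sum>k\<in>{1, 2}. \<integral>x. x ^ m * poly (entry A k) x \<partial>\<mu> k) = 1)"

definition type_I :: "(nat \<Rightarrow> real measure) \<Rightarrow> nat \<Rightarrow> nat \<times> nat \<Rightarrow> real poly" where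
  "type_I \<mu> k n = entry (THE A. is_type_I \<mu> n A) k"

definition is_type_II :: "(nat \<Rightarrow> real measure) \<Rightarrow> nat \<times> nat \<Rightarrow> real poly \<Rightarrow> bool" where
  "is_type_II \<mu> n P \<longleftrightarrow>
     degree P = index_size n \<and> lead_coeff P = 1 \<and>
     (\<forall>k\<in>{1, 2}. \<forall>m < entry n k. (\<integral>x. poly P x * x ^ m \<partial>\<mu> k) = 0)"

definition type_II :: "(nat \<Rightarrow> real measure) \<Rightarrow> nat \<times> nat \<Rightarrow> real poly" where
  "type_II \<mu> n = (THE P. is_type_II \<mu> n P)"

text \<open>
  The coefficient \<open>a n j\<close> with \<open>entry n j = 0\<close> multiplies a zero term and is left unconstrained;
  it is never used below.
\<close>

definition recurrence_coefficients ::
  "(nat \<Rightarrow> real measure) \<Rightarrow> (nat \<times> nat \<Rightarrow> nat \<Rightarrow> real) \<Rightarrow> (nat \<times> nat \<Rightarrow> nat \<Rightarrow> real) \<Rightarrow> bool" where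
  "recurrence_coefficients \<mu> a b \<longleftrightarrow>
     (\<forall>n. \<forall>i\<in>{1, 2}. [:0, 1:] * type_II \<mu> n =
        type_II \<mu> (n + unit_index i) + smult (b n i) (type_II \<mu> n) +
        (\<Sum>j\<in>{1, 2}. if entry n j = 0 then 0 else smult (a n j) (type_II \<mu> (n - unit_index j)))) \<and>
     (\<exists>C. \<forall>n. \<forall>i\<in>{1, 2}. \<bar>b n i\<bar> \<le> C \<and> (entry n i > 0 \<longrightarrow> \<bar>a n i\<bar> \<le> C)) \<and>
     (\<forall>n. fst n > 0 \<and> snd n > 0 \<longrightarrow> (\<forall>i\<in>{1, 2}. a n i > 0))"

text \<open>
  \<^term>\<open>synthetic_div p x\<close> is the polynomial \<open>(p(z) - p(x)) / (z - x)\<close> in \<open>z\<close>. It is used in place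
  of the quotient because the latter would be \<open>0\<close> instead of \<open>p'(x)\<close> at \<open>z = x\<close>, which matters if
  the measures have atoms.
\<close>

definition type_I_0 :: "(nat \<Rightarrow> real measure) \<Rightarrow> nat \<times> nat \<Rightarrow> real \<Rightarrow> real" where
  "type_I_0 \<mu> n z = (\<Sum>k\<in>{1, 2}. \<integral>x. poly (synthetic_div (type_I \<mu> k n) x) z \<partial>\<mu> k)"

definition L_fun :: "(nat \<Rightarrow> real measure) \<Rightarrow> nat \<times> nat \<Rightarrow> complex \<Rightarrow> complex" where
  "L_fun \<mu> n z =
     (\<Sum>k\<in>{1, 2}. \<integral>x. complex_of_real (poly (type_I \<mu> k n) x) / (z - complex_of_real x) \<partial>\<mu> k)"

definition L_plus :: "(nat \<Rightarrow> real measure) \<Rightarrow> nat \<times> nat \<Rightarrow> real \<Rightarrow> complex" where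
  "L_plus \<mu> n E = Lim (at_right 0) (\<lambda>\<epsilon>::real. L_fun \<mu> n (Complex E \<epsilon>))"

definition zeros_I :: "(nat \<Rightarrow> real measure) \<Rightarrow> nat \<times> nat \<Rightarrow> real set" where
  "zeros_I \<mu> n = {x. poly (type_I \<mu> 1 n * type_I \<mu> 2 n) x = 0}"

definition D_poly :: "(nat \<Rightarrow> real measure) \<Rightarrow> nat \<times> nat \<Rightarrow> real \<Rightarrow> real poly" where
  "D_poly \<mu> n \<xi> = smult ((-1) ^ snd n) ([:- \<xi>, 1:] * type_I \<mu> 1 n * type_I \<mu> 2 n)"

definition S_weight :: "(nat \<Rightarrow> real measure) \<Rightarrow> nat \<times> nat \<Rightarrow> real \<Rightarrow> real \<Rightarrow> real" where
  "S_weight \<mu> n \<xi> x =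
     1 / \<bar>x - \<xi>\<bar> * (\<Sum>k\<in>{1, 2}. indicator (Delta \<mu> k) x * (1 / \<bar>poly (type_I \<mu> (3 - k) n) x\<bar>))"

text \<open>
  The residues are real, but \<^term>\<open>L_plus\<close> is complex-valued by type, so reality is part of
  the description of the reference measure below.
\<close>

definition zeta :: "(nat \<Rightarrow> real measure) \<Rightarrow> nat \<times> nat \<Rightarrow> real \<Rightarrow> real \<Rightarrow> complex" where
  "zeta \<mu> n \<xi> E = - (1 / (complex_of_real (poly (pderiv (D_poly \<mu> n \<xi>)) E) * L_plus \<mu> n E))"

definition reference_measure ::
  "(nat \<Rightarrow> real measure) \<Rightarrow> nat \<times> nat \<Rightarrow> real measure \<Rightarrow> bool" where
  "reference_measure \<mu> n \<omega> \<longleftrightarrow>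
     sets \<omega> = sets borel \<and> finite_measure \<omega> \<and>
     emeasure \<omega> (- (Delta \<mu> 1 \<union> Delta \<mu> 2)) = 0 \<and>
     (\<forall>E\<in>zeros_I \<mu> n. emeasure \<omega> {E} = 0) \<and>
     (\<forall>\<xi>\<in>gap \<mu>.
        (\<forall>E\<in>zeros_I \<mu> n \<union> {\<xi>}. zeta \<mu> n \<xi> E \<in> \<real> \<and> Re (zeta \<mu> n \<xi> E) > 0) \<and>
        (\<exists>a b :: real. b > 0 \<and>
          (\<forall>z. Im z > 0 \<longrightarrow>
             1 / (poly (map_poly complex_of_real (D_poly \<mu> n \<xi>)) z * L_fun \<mu> n z) =
               (\<integral>x. complex_of_real (S_weight \<mu> n \<xi> x) / (complex_of_real x - z) \<partial>\<omega>) +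
               (\<Sum>E\<in>zeros_I \<mu> n \<union> {\<xi>}. zeta \<mu> n \<xi> E / (complex_of_real E - z)) +
               complex_of_real a + complex_of_real b * z)))"

datatype vertex = Root | Child1 vertex | Child2 vertex

definition ch :: "nat \<Rightarrow> vertex \<Rightarrow> vertex" where
  "ch i Y = (if i = 1 then Child1 Y else Child2 Y)"

fun parent :: "vertex \<Rightarrow> vertex" where
  "parent Root = Root"
| "parent (Child1 Y) = Y"
| "parent (Child2 Y) = Y"

fun iota :: "vertex \<Rightarrow> nat" where
  "iota Root = 0"
| "iota (Child1 Y) = 1"
| "iota (Child2 Y) = 2"

primrec Pi_idx :: "vertex \<Rightarrow> nat \<times> nat" where
  "Pi_idx Root = (1, 1)"
| "Pi_idx (Child1 Y) = Pi_idx Y + unit_index 1"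
| "Pi_idx (Child2 Y) = Pi_idx Y + unit_index 2"

primrec path_to_root :: "vertex \<Rightarrow> vertex set" where
  "path_to_root Root = {Root}"
| "path_to_root (Child1 Y) = insert (Child1 Y) (path_to_root Y)"
| "path_to_root (Child2 Y) = insert (Child2 Y) (path_to_root Y)"

definition subtree :: "vertex \<Rightarrow> vertex set" where
  "subtree X = {Y. X \<in> path_to_root Y}"

definition V_pot :: "(nat \<times> nat \<Rightarrow> nat \<Rightarrow> real) \<Rightarrow> real \<times> real \<Rightarrow> vertex \<Rightarrow> real" where
  "V_pot b \<kappa> Y =
     (if Y = Root then fst \<kappa> * b (0, 1) 1 + snd \<kappa> * b (1, 0) 2
      else b (Pi_idx (parent Y)) (iota Y))"

definition W_pot :: "(nat \<times> nat \<Rightarrow> nat \<Rightarrow> real) \<Rightarrow> vertex \<Rightarrow> real" where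
  "W_pot a Y = (if Y = Root then 1 else a (Pi_idx (parent Y)) (iota Y))"

definition Jacobi ::
  "(nat \<times> nat \<Rightarrow> nat \<Rightarrow> real) \<Rightarrow> (nat \<times> nat \<Rightarrow> nat \<Rightarrow> real) \<Rightarrow> real \<times> real \<Rightarrow>
   (vertex \<Rightarrow> complex) \<Rightarrow> vertex \<Rightarrow> complex" where
  "Jacobi a b \<kappa> f Y =
     complex_of_real (V_pot b \<kappa> Y) * f Y +
     (if Y = Root then 0 else complex_of_real (sqrt (W_pot a Y)) * f (parent Y)) +
     (\<Sum>i\<in>{1, 2}. complex_of_real (sqrt (W_pot a (ch i Y))) * f (ch i Y))"

definition restrict_to :: "vertex set \<Rightarrow> (vertex \<Rightarrow> complex) \<Rightarrow> vertex \<Rightarrow> complex" where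
  "restrict_to U f = (\<lambda>Y. if Y \<in> U then f Y else 0)"

definition delta :: "vertex \<Rightarrow> vertex \<Rightarrow> complex" where
  "delta X = (\<lambda>Y. if Y = X then 1 else 0)"

definition ell2 :: "('a \<Rightarrow> complex) set" where
  "ell2 = {f. (\<lambda>y. (cmod (f y))\<^sup>2) summable_on UNIV}"

definition ell2_inner :: "('a \<Rightarrow> complex) \<Rightarrow> ('a \<Rightarrow> complex) \<Rightarrow> complex" where
  "ell2_inner f g = (\<Sum>\<^sub>\<infinity>y. f y * cnj (g y))"

definition ell2_norm :: "('a \<Rightarrow> complex) \<Rightarrow> real" where
  "ell2_norm f = sqrt (\<Sum>\<^sub>\<infinity>y. (cmod (f y))\<^sup>2)"

definition ell2_tendsto :: "(nat \<Rightarrow> 'a \<Rightarrow> complex) \<Rightarrow> ('a \<Rightarrow> complex) \<Rightarrow> bool" where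
  "ell2_tendsto s f \<longleftrightarrow>
     (\<forall>n. s n \<in> ell2) \<and> f \<in> ell2 \<and> (\<lambda>n. ell2_norm (\<lambda>y. s n y - f y)) \<longlonglongrightarrow> 0"

definition complex_span :: "('a \<Rightarrow> complex) set \<Rightarrow> ('a \<Rightarrow> complex) set" where
  "complex_span F = {\<lambda>y. \<Sum>f\<in>t. c f * f y | t c. finite t \<and> t \<subseteq> F}"

definition ell2_closure :: "('a \<Rightarrow> complex) set \<Rightarrow> ('a \<Rightarrow> complex) set" where
  "ell2_closure F = {f. \<exists>s. (\<forall>n. s n \<in> F) \<and> ell2_tendsto s f}"

definition op_shift ::
  "(('a \<Rightarrow> complex) \<Rightarrow> 'a \<Rightarrow> complex) \<Rightarrow> complex \<Rightarrow> ('a \<Rightarrow> complex) \<Rightarrow> 'a \<Rightarrow> complex" where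
  "op_shift T z f = (\<lambda>y. T f y - z * f y)"

definition op_spectrum :: "(('a \<Rightarrow> complex) \<Rightarrow> 'a \<Rightarrow> complex) \<Rightarrow> complex set" where
  "op_spectrum T =
     {z. \<not> (bij_betw (op_shift T z) ell2 ell2 \<and>
            (\<exists>C. \<forall>f\<in>ell2. ell2_norm f \<le> C * ell2_norm (op_shift T z f)))}"

definition resolvent ::
  "(('a \<Rightarrow> complex) \<Rightarrow> 'a \<Rightarrow> complex) \<Rightarrow> complex \<Rightarrow> ('a \<Rightarrow> complex) \<Rightarrow> 'a \<Rightarrow> complex" where
  "resolvent T z = inv_into ell2 (op_shift T z)"

definition is_spectral_measure ::
  "(('a \<Rightarrow> complex) \<Rightarrow> 'a \<Rightarrow> complex) \<Rightarrow> ('a \<Rightarrow> complex) \<Rightarrow> real measure \<Rightarrow> bool" where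
  "is_spectral_measure T f \<rho> \<longleftrightarrow>
     f \<in> ell2 \<and> sets \<rho> = sets borel \<and> finite_measure \<rho> \<and>
     (\<forall>z. Im z \<noteq> 0 \<longrightarrow> z \<notin> op_spectrum T \<and>
        ell2_inner (resolvent T z f) f = (\<integral>x. 1 / (complex_of_real x - z) \<partial>\<rho>))"

text \<open>
  Continuous functional calculus of a bounded self-adjoint operator: \<open>\<alpha>(T) f\<close> is the limit of
  \<open>p\<^sub>n(T) f\<close> for polynomials \<open>p\<^sub>n\<close> that converge to \<open>\<alpha>\<close> uniformly on the spectrum.
\<close>

definition poly_op ::
  "(('a \<Rightarrow> complex) \<Rightarrow> 'a \<Rightarrow> complex) \<Rightarrow> complex poly \<Rightarrow> ('a \<Rightarrow> complex) \<Rightarrow> 'a \<Rightarrow> complex" where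
  "poly_op T p f = (\<lambda>y. \<Sum>j\<le>degree p. coeff p j * (T ^^ j) f y)"

definition fun_op ::
  "(('a \<Rightarrow> complex) \<Rightarrow> 'a \<Rightarrow> complex) \<Rightarrow> (real \<Rightarrow> complex) \<Rightarrow> ('a \<Rightarrow> complex) \<Rightarrow> 'a \<Rightarrow> complex" where
  "fun_op T \<alpha> f =
     (THE h. \<forall>p. uniform_limit {x. complex_of_real x \<in> op_spectrum T}
                   (\<lambda>n x. poly (p n) (complex_of_real x)) \<alpha> sequentially \<longrightarrow>
                 ell2_tendsto (\<lambda>n. poly_op T (p n) f) h)"

definition L2 :: "real measure \<Rightarrow> (real \<Rightarrow> complex) set" where
  "L2 M = {\<alpha> \<in> borel_measurable M. integrable M (\<lambda>x. (cmod (\<alpha> x))\<^sup>2)}"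

definition L2_tendsto ::
  "real measure \<Rightarrow> (nat \<Rightarrow> real \<Rightarrow> complex) \<Rightarrow> (real \<Rightarrow> complex) \<Rightarrow> bool" where
  "L2_tendsto M s \<alpha> \<longleftrightarrow>
     (\<forall>n. s n \<in> L2 M) \<and> \<alpha> \<in> L2 M \<and> (\<lambda>n. sqrt (\<integral>x. (cmod (s n x - \<alpha> x))\<^sup>2 \<partial>M)) \<longlonglongrightarrow> 0"

definition m_prod :: "(nat \<times> nat \<Rightarrow> nat \<Rightarrow> real) \<Rightarrow> vertex \<Rightarrow> real" where
  "m_prod a Y = (\<Prod>Z\<in>path_to_root Y. 1 / sqrt (W_pot a Z))"

definition Lambda ::
  "(nat \<Rightarrow> real measure) \<Rightarrow> (nat \<times> nat \<Rightarrow> nat \<Rightarrow> real) \<Rightarrow> nat \<Rightarrow> real \<Rightarrow> vertex \<Rightarrow> real" where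
  "Lambda \<mu> a k x Y =
     1 / m_prod a Y *
     (if k = 0 then type_I_0 \<mu> (Pi_idx Y) x else poly (type_I \<mu> k (Pi_idx Y)) x)"

definition bracket :: "(vertex \<Rightarrow> real) \<Rightarrow> (vertex \<Rightarrow> real) \<Rightarrow> vertex \<Rightarrow> vertex \<Rightarrow> real" where
  "bracket f g Z = (\<lambda>Y. f Z * g Y - f Y * g Z)"

definition Psi_tilde ::
  "(nat \<Rightarrow> real measure) \<Rightarrow> (nat \<times> nat \<Rightarrow> nat \<Rightarrow> real) \<Rightarrow> vertex \<Rightarrow> real \<Rightarrow> vertex \<Rightarrow> real" where
  "Psi_tilde \<mu> a Z x Y =
     m_prod a (parent Z) * m_prod a Z *
     (\<Sum>k\<in>{1, 2}.
        (bracket (Lambda \<mu> a k x) (Lambda \<mu> a 0 x) (parent Z) Y +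
         bracket (Lambda \<mu> a (3 - k) x) (Lambda \<mu> a k x) (parent Z) Y * mu_hat \<mu> (3 - k) x) *
        indicator (Delta \<mu> k) x)"

definition S_root ::
  "(nat \<Rightarrow> real measure) \<Rightarrow> (nat \<times> nat \<Rightarrow> nat \<Rightarrow> real) \<Rightarrow> vertex \<Rightarrow> real \<Rightarrow> real" where
  "S_root \<mu> a Z x = Psi_tilde \<mu> a Z x Z"

definition Psi ::
  "(nat \<Rightarrow> real measure) \<Rightarrow> (nat \<times> nat \<Rightarrow> nat \<Rightarrow> real) \<Rightarrow> vertex \<Rightarrow> real \<Rightarrow> vertex \<Rightarrow> real" where
  "Psi \<mu> a Z x Y = 1 / S_root \<mu> a Z x * Psi_tilde \<mu> a Z x Y"

definition rho_tilde ::
  "(nat \<Rightarrow> real measure) \<Rightarrow> (nat \<times> nat \<Rightarrow> real measure) \<Rightarrow> vertex \<Rightarrow> real measure" where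
  "rho_tilde \<mu> \<omega> X =
     measure_of UNIV (sets borel)
       (\<lambda>B. emeasure (\<omega> (Pi_idx X)) B +
            (\<Sum>E\<in>zeros_I \<mu> (Pi_idx X). emeasure (mu_star \<mu>) {E} * indicator B E))"

text \<open>
  The limit \<^term>\<open>L_plus \<mu> n E\<close> is real at the zeros \<open>E\<close> of the type I polynomials, so that taking
  the real part below only changes the type.
\<close>

definition nu ::
  "(nat \<Rightarrow> real measure) \<Rightarrow> (nat \<times> nat \<Rightarrow> nat \<Rightarrow> real) \<Rightarrow> vertex \<Rightarrow> nat \<Rightarrow> real \<Rightarrow> real" where
  "nu \<mu> a X i x =
     (if x \<in> zeros_I \<mu> (Pi_idx X)
      then Re (complex_of_real
                 (poly (type_I \<mu> (if x \<in> Delta \<mu> 1 then 1 else 2) (Pi_idx (ch i X))) x) /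
               L_plus \<mu> (Pi_idx X) x)
      else S_root \<mu> a (ch i X) x)"

text \<open>The two subtrees below are disjoint, so at most one summand is nonzero.\<close>

definition Psi_hat ::
  "(nat \<Rightarrow> real measure) \<Rightarrow> (nat \<times> nat \<Rightarrow> nat \<Rightarrow> real) \<Rightarrow> vertex \<Rightarrow> real \<Rightarrow> vertex \<Rightarrow> complex" where
  "Psi_hat \<mu> a X x Y = complex_of_real
     (\<Sum>i\<in>{1, 2}. if Y \<in> subtree (ch i X)
        then (-1) ^ i * (1 / sqrt (W_pot a (ch i X))) * Psi \<mu> a (ch i X) x Y else 0)"

definition Psi_transform ::
  "(nat \<Rightarrow> real measure) \<Rightarrow> (nat \<times> nat \<Rightarrow> nat \<Rightarrow> real) \<Rightarrow> (nat \<times> nat \<Rightarrow> real measure) \<Rightarrow> vertex \<Rightarrow>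
   (real \<Rightarrow> complex) \<Rightarrow> vertex \<Rightarrow> complex" where
  "Psi_transform \<mu> a \<omega> X \<alpha> = (\<lambda>Y. \<integral>x. \<alpha> x * Psi_hat \<mu> a X x Y \<partial>rho_tilde \<mu> \<omega> X)"

definition C_hat ::
  "(nat \<Rightarrow> real measure) \<Rightarrow> (nat \<times> nat \<Rightarrow> nat \<Rightarrow> real) \<Rightarrow> (nat \<times> nat \<Rightarrow> real measure) \<Rightarrow> vertex \<Rightarrow>
   (vertex \<Rightarrow> complex) set" where
  "C_hat \<mu> a \<omega> X = {Psi_transform \<mu> a \<omega> X \<alpha> | \<alpha>. \<alpha> \<in> L2 (rho_tilde \<mu> \<omega> X)}"

definition alpha_gen ::
  "(nat \<Rightarrow> real measure) \<Rightarrow> (nat \<times> nat \<Rightarrow> nat \<Rightarrow> real) \<Rightarrow> vertex \<Rightarrow> nat \<Rightarrow> real \<Rightarrow> complex" where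
  "alpha_gen \<mu> a X i x = complex_of_real ((-1) ^ i * sqrt (W_pot a (ch i X)) * nu \<mu> a X i x)"

definition g_gen ::
  "(nat \<Rightarrow> real measure) \<Rightarrow> (nat \<times> nat \<Rightarrow> nat \<Rightarrow> real) \<Rightarrow> (nat \<times> nat \<Rightarrow> real measure) \<Rightarrow> vertex \<Rightarrow>
   nat \<Rightarrow> vertex \<Rightarrow> complex" where
  "g_gen \<mu> a \<omega> X i = Psi_transform \<mu> a \<omega> X (alpha_gen \<mu> a X i)"

end

theory Submission
  imports Defs
begin

text \<open>
  By the integral representation of \<open>1 / (D L)\<close>, the reciprocal of \<open>L\<close> at the vertex \<open>X\<close> is a polynomial \<open>p\<close>
  minus a Cauchy transform with respect to \<open>\<omega>\<close>. Integrating \<open>p\<close> against the type I form of a vertex \<open>Y\<close> below the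
  child \<open>X\<^sub>i\<close> gives, on the one hand, \<open>1\<close> or \<open>0\<close> according to whether \<open>Y = X\<^sub>i\<close>, by orthogonality, and on the other
  hand the integral of \<open>\<nu>\<^sub>i\<close> times the eigenfunction at \<open>Y\<close>. So the transform of \<open>\<nu>\<^sub>i\<close> is the delta function at \<open>X\<^sub>i\<close>,
  and the transform of \<open>q \<nu>\<^sub>i\<close> is \<open>q(J\<^sub>i)\<close> applied to it, for polynomials \<open>q\<close> and the restriction \<open>J\<^sub>i\<close> of the
  operator to the subtree. Since \<open>J\<^sub>i\<close> is symmetric, the transform is isometric on polynomials; adding the two
  subtrees and passing to limits, it is an isometry for the weight \<open>1 / (W\<^sub>1 \<nu>\<^sub>1) + 1 / (W\<^sub>2 \<nu>\<^sub>2)\<close>, bounded above and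
  below, which turns multiplication by \<open>x\<close> into the Jacobi operator.
\<close>

text \<open>The measures may have atoms and need not have densities, so boundary values of L are
  under control only at the zeros of the type I polynomials. Everything else is extracted from the
  behaviour at infinity: Cauchy transforms are multiplied out, polynomial and decaying parts are
  separated, and a polynomial that tends to 0 along the imaginary axis is 0. The natural test
  function is the quotient B / A of the type I polynomials of Y and of X. It is singular at the
  zeros E of A, exactly where an atom of mu_k may sit. A C^1 regularization loses this atom on both
  sides of the identity, and the two losses differ by B(E) mu_k({E}) / L_+(E). This is the origin of
  the point masses in \<open>rho_tilde\<close> and of the exceptional values of \<open>nu\<close>.
  The descriptions \<open>type_I\<close> and \<open>type_II\<close> say nothing before existence and
  uniqueness are known, and the recurrence is given for type II only; hence the preparations on
  zeros, signs and recurrences. The sign information also makes the eigenfunction positive at the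
  root of its subtree, so that \<open>nu\<close> is a weight bounded from above and below.\<close>

abbreviation (input) "cor == complex_of_real"
abbreviation (input) "sdiv == synthetic_div"

section \<open>Divided differences of polynomials\<close>

lemma poly_synthetic_div_eq:
 fixes p :: "'a::field poly"
 assumes "y \<noteq> c"
 shows "poly (sdiv p c) y = (poly p y - poly p c) / (y - c)"
proof -
 have "poly ([:-c, 1:] * sdiv p c + [:poly p c:]) y = poly p y"
  by (simp only: synthetic_div_correct')
 then show ?thesis using assms by (simp add: field_simps)
qed

lemma poly_synthetic_div_commute:
 fixes p :: "'a::comm_ring_1 poly"
 shows "poly (sdiv p c) y = poly (sdiv p y) c"
proof (induction p)
 case 0
 then show ?case by simp
next
 case (pCons a p)
 have "poly ([:-c, 1:] * sdiv p c + [:poly p c:]) y = poly p y"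
  by (simp only: synthetic_div_correct')
 then show ?case using pCons by (simp add: algebra_simps)
qed

lemma poly_synthetic_div_self:
 fixes p :: "'a::idom poly"
 shows "poly (sdiv p c) c = poly (pderiv p) c"
 by (induction p) (simp_all add: pderiv_pCons)

lemma synthetic_div_add: "sdiv (p + q) c = sdiv p c + sdiv q (c::'a::comm_ring_1)"
proof (induction p arbitrary: q)
 case 0 then show ?case by simp
next
 case (pCons a p)
 show ?case
 proof (cases q)
  case (pCons b q')
  then show ?thesis using pCons.IH[of q'] by simp
 qed
qed

lemma synthetic_div_smult: "sdiv (smult r p) c = smult r (sdiv p (c::'a::comm_ring_1))"
 by (induction p) (simp_all)

text \<open>The complement of the support is a union of open null sets, and by Lindelof countably
  many of them suffice.\<close>

lemma AE_measure_support:
 fixes M :: "real measure"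
 assumes s: "sets M = sets borel"
 shows "AE x in M. x \<in> measure_support M"
proof -
 define F where "F = {U. open U \<and> emeasure M U = 0}"
 obtain F' where F': "F' \<subseteq> F" "countable F'" "\<Union>F' = \<Union>F"
  using Lindelof[of F] unfolding F_def by blast
 have "(\<Union>U\<in>F'. U) \<in> null_sets M"
  using F' by (intro null_sets_UN') (auto simp: F_def null_sets_def s)
 moreover have "{x \<in> space M. \<not> x \<in> measure_support M} \<subseteq> (\<Union>U\<in>F'. U)"
 proof -
  have "{x \<in> space M. \<not> x \<in> measure_support M} \<subseteq> \<Union>F"
   by (force simp: measure_support_def F_def)
  then show ?thesis using F'(3) by simp
 qed
 ultimately show ?thesis
  by (blast intro: AE_I')
qed

section \<open>Supports, intervals and integrability\<close>

locale angelesco_system =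
 fixes \<mu> :: "nat => real measure"
 assumes angelesco: "angelesco \<mu>"
begin

lemma sets_mu [measurable_cong]: "k \<in> {1,2} ==> sets (\<mu> k) = sets borel"
 using angelesco unfolding angelesco_def by blast

lemma sets_mu' [simp, measurable_cong]:
 "sets (\<mu> 1) = sets borel" "sets (\<mu> (Suc 0)) = sets borel" "sets (\<mu> 2) = sets borel"
 using sets_mu by simp_all

lemma finite_mu: "k \<in> {1,2} ==> finite_measure (\<mu> k)"
 using angelesco unfolding angelesco_def by blast

lemma space_mu: "k \<in> {1,2} ==> space (\<mu> k) = UNIV"
 using sets_eq_imp_space_eq[OF sets_mu] by simp

lemma infinite_support: "k \<in> {1,2} ==> infinite (measure_support (\<mu> k))"
 using angelesco unfolding angelesco_def by blast

lemma support_subset: "measure_support (\<mu> k) \<subseteq> Delta \<mu> k"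
 unfolding Delta_def by (rule hull_subset)

lemma infinite_Delta: "k \<in> {1,2} ==> infinite (Delta \<mu> k)"
 using infinite_support support_subset infinite_super by blast

lemma compact_Delta: "k \<in> {1,2} ==> compact (Delta \<mu> k)"
 using angelesco unfolding angelesco_def Delta_def by (blast intro: compact_convex_hull)

lemma Delta_less: "x \<in> Delta \<mu> 1 ==> y \<in> Delta \<mu> 2 ==> x < y"
 using angelesco unfolding angelesco_def by blast

lemma Inf_Sup_in_Delta:
 assumes "k \<in> {1,2}"
 shows "Inf (Delta \<mu> k) \<in> Delta \<mu> k" "Sup (Delta \<mu> k) \<in> Delta \<mu> k"
 using compact_imp_closed[OF compact_Delta[OF assms]] compact_imp_bounded[OF compact_Delta[OF assms]] infinite_Delta[OF assms]
 by (auto intro: closed_contains_Inf closed_contains_Sup simp: bounded_imp_bdd_above bounded_imp_bdd_below)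

lemma gap_nonempty: "Sup (Delta \<mu> 1) < Inf (Delta \<mu> 2)"
 by (intro Delta_less Inf_Sup_in_Delta) simp_all

lemma Delta_bounds:
 assumes "k \<in> {1,2}" "x \<in> Delta \<mu> k"
 shows "Inf (Delta \<mu> k) \<le> x" "x \<le> Sup (Delta \<mu> k)"
 using assms compact_imp_bounded[OF compact_Delta]
 by (auto intro: cInf_lower cSup_upper simp: bounded_imp_bdd_above bounded_imp_bdd_below)

lemma gap_between:
 assumes "\<xi> \<in> gap \<mu>"
 shows "x \<in> Delta \<mu> 1 ==> x < \<xi>" "y \<in> Delta \<mu> 2 ==> \<xi> < y"
 using assms Delta_bounds[of 1 x] Delta_bounds[of 2 y] unfolding gap_def by auto

lemma Delta_disjoint: "x \<in> Delta \<mu> 1 ==> x \<notin> Delta \<mu> 2"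
 using Delta_less by blast

lemma AE_mu:
 assumes "k \<in> {1,2}"
 shows "AE x in \<mu> k. x \<in> Delta \<mu> k"
 using AE_measure_support[OF sets_mu[OF assms]] by eventually_elim (rule subsetD[OF support_subset])

lemma integrable_mu:
 fixes f :: "real => 'b::{banach, second_countable_topology}"
 assumes k: "k \<in> {1,2}" and f: "f \<in> borel_measurable borel" and B: "\<And>x. x \<in> Delta \<mu> k ==> norm (f x) \<le> B"
 shows "integrable (\<mu> k) f"
proof -
 interpret finite_measure "\<mu> k" by (rule finite_mu[OF k])
 show ?thesis
 proof (rule integrable_const_bound[of _ B])
  show "AE x in \<mu> k. norm (f x) \<le> B" using AE_mu[OF k] by eventually_elim (rule B)
  show "f \<in> borel_measurable (\<mu> k)" using f by (simp add: measurable_cong_sets[OF sets_mu[OF k]])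
 qed
qed

lemma integrable_mu_continuous:
 fixes f :: "real => 'b::{banach, second_countable_topology}"
 assumes k: "k \<in> {1,2}" and f: "f \<in> borel_measurable borel" and c: "continuous_on (Delta \<mu> k) f"
 shows "integrable (\<mu> k) f"
proof -
 have "bounded (f ` Delta \<mu> k)"
  using compact_continuous_image[OF c compact_Delta[OF k]] by (rule compact_imp_bounded)
 then obtain B where "\<And>x. x \<in> Delta \<mu> k ==> norm (f x) \<le> B"
  unfolding bounded_iff by blast
 then show ?thesis using integrable_mu[OF k f] by blast
qed

lemma integrable_mu_poly: "k \<in> {1,2} ==> integrable (\<mu> k) (\<lambda>x. poly p x)"
 by (rule integrable_mu_continuous) (auto intro!: borel_measurable_continuous_onI continuous_intros)

lemma integral_mu_cong:
 fixes f :: "real => 'b::{banach, second_countable_topology}"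
 assumes k: "k \<in> {1,2}" and m: "f \<in> borel_measurable borel" "g \<in> borel_measurable borel"
  and eq: "\<And>x. x \<in> Delta \<mu> k ==> f x = g x"
 shows "integral\<^sup>L (\<mu> k) f = integral\<^sup>L (\<mu> k) g"
proof (rule integral_cong_AE)
 show "AE x in \<mu> k. f x = g x" using AE_mu[OF k] by eventually_elim (rule eq)
qed (use m in \<open>simp_all add: measurable_cong_sets[OF sets_mu[OF k]]\<close>)

text \<open>The set where \<open>p\<close> is nonzero is open and null, so it misses the support;
  the infinite support would then consist of zeros of \<open>p\<close>.\<close>

lemma poly_AE_zero:
 assumes k: "k \<in> {1,2}" and ae: "AE x in \<mu> k. poly p x = 0"
 shows "p = 0"
proof (rule ccontr)
 assume "p \<noteq> 0"
 then have fin: "finite {x. poly p x = 0}" by (rule poly_roots_finite)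
 have "measure_support (\<mu> k) \<subseteq> {x. poly p x = 0}"
 proof
  fix x assume x: "x \<in> measure_support (\<mu> k)"
  have op: "open {x. poly p x \<noteq> 0}"
   by (intro open_Collect_neq continuous_intros)
  have "emeasure (\<mu> k) {x. poly p x \<noteq> 0} = 0"
   using ae op by (subst (asm) AE_iff_measurable[OF _ refl]) (auto simp: space_mu[OF k] sets_mu[OF k])
  then show "x \<in> {x. poly p x = 0}"
   using x op unfolding measure_support_def by force
 qed
 then show False using fin infinite_support[OF k] finite_subset by blast
qed

end

section \<open>Type I and type II polynomials\<close>

text \<open>Elimination by induction on the equations: the unknown of a nonzero entry in equation
  \<open>i0\<close> is solved for last. With coefficients as unknowns and moment conditions as
  equations, this produces the candidates for both kinds of orthogonal polynomials.\<close>

lemma homogeneous_system_nontrivial: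
 fixes M :: "'i => 'j => 'a::field"
 assumes "finite I" "finite J" "card I < card J"
 shows "\<exists>c. (\<exists>j\<in>J. c j \<noteq> 0) \<and> (\<forall>i\<in>I. (\<Sum>j\<in>J. M i j * c j) = 0)"
 using assms
proof (induction I arbitrary: J M rule: finite_induct)
 case empty
 then have "J \<noteq> {}" by auto
 then show ?case by (intro exI[of _ "\<lambda>_. 1"]) auto
next
 case (insert i0 I)
 show ?case
 proof (cases "\<forall>j\<in>J. M i0 j = 0")
  case True
  have "card I < card J" using insert by simp
  from insert.IH[OF insert.prems(1) this] obtain c where
   c: "\<exists>j\<in>J. c j \<noteq> 0" "\<forall>i\<in>I. (\<Sum>j\<in>J. M i j * c j) = 0" by blast
  have "(\<Sum>j\<in>J. M i0 j * c j) = 0" using True by (intro sum.neutral) simp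
  then show ?thesis using c by blast
 next
  case False
  then obtain j0 where j0: "j0 \<in> J" "M i0 j0 \<noteq> 0" by blast
  define J' where "J' = J - {j0}"
  have J': "finite J'" "j0 \<notin> J'" "J = insert j0 J'" using insert.prems j0 by (auto simp: J'_def)
  have "card I < card J'" using insert J' by simp
  from insert.IH[OF J'(1) this, of "\<lambda>i j. M i j - M i j0 * M i0 j / M i0 j0"] obtain c' where
   c': "\<exists>j\<in>J'. c' j \<noteq> 0" "\<forall>i\<in>I. (\<Sum>j\<in>J'. (M i j - M i j0 * M i0 j / M i0 j0) * c' j) = 0" by blast
  define S where "S = (\<Sum>j\<in>J'. M i0 j * c' j)"
  define c where "c = c'(j0 := - S / M i0 j0)"
  have sumJ: "(\<Sum>j\<in>J. M i j * c j) = M i j0 * (- S / M i0 j0) + (\<Sum>j\<in>J'. M i j * c' j)" for i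
  proof -
   have "(\<Sum>j\<in>J'. M i j * c j) = (\<Sum>j\<in>J'. M i j * c' j)"
    using J'(2) by (intro sum.cong) (auto simp: c_def)
   then show ?thesis using J' by (simp add: c_def)
  qed
  have "(\<Sum>j\<in>J. M i j * c j) = 0" if "i \<in> I" for i
  proof -
   have "(\<Sum>j\<in>J'. (M i j - M i j0 * M i0 j / M i0 j0) * c' j)
    = (\<Sum>j\<in>J'. M i j * c' j) - (M i j0 / M i0 j0) * S"
    by (simp add: S_def sum_distrib_left flip: sum_subtractf) (intro sum.cong, simp_all add: field_simps)
   then show ?thesis using c'(2) that by (simp add: sumJ)
  qed
  moreover have "(\<Sum>j\<in>J. M i0 j * c j) = 0"
   using j0 by (simp add: sumJ S_def[symmetric])
  moreover have "\<exists>j\<in>J. c j \<noteq> 0" using c'(1) J' by (auto simp: c_def)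
  ultimately show ?thesis by blast
 qed
qed

section \<open>Real polynomials with prescribed zeros and their signs\<close>

definition splits_in :: "real set => real poly => bool" where
 "splits_in I p \<longleftrightarrow> (\<exists>cs. set cs \<subseteq> I \<and> p = (\<Prod>c\<leftarrow>cs. [:-c, 1:]))"

lemma splits_in_1 [simp]: "splits_in I 1"
 unfolding splits_in_def by (intro exI[of _ "[]"]) simp

lemma splits_in_linear: "splits_in I p ==> c \<in> I ==> splits_in I ([:-c, 1:] * p)"
 unfolding splits_in_def by (elim exE conjE, rule_tac x="c # cs" in exI) simp

lemma splits_in_monic: "splits_in I p ==> lead_coeff p = 1"
 unfolding splits_in_def
proof (elim exE conjE)
 fix cs assume "p = (\<Prod>c\<leftarrow>cs. [:-c, 1:])"
 then show "lead_coeff p = 1"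
  by (induction cs arbitrary: p) (simp_all only: list.map prod_list.Nil prod_list.Cons lead_coeff_mult, simp_all)
qed

lemma splits_in_nonzero: "splits_in I p ==> p \<noteq> 0"
 using splits_in_monic by fastforce

lemma splits_in_pos:
 assumes "splits_in I p" "\<And>c. c \<in> I ==> c < x"
 shows "poly p x > 0"
proof -
 obtain cs where cs: "set cs \<subseteq> I" "p = (\<Prod>c\<leftarrow>cs. [:-c, 1:])" using assms unfolding splits_in_def by blast
 have "0 < poly (\<Prod>c\<leftarrow>cs. [:-c, 1:]) x"
  using cs(1)
 proof (induction cs)
  case Nil then show ?case by simp
 next
  case (Cons c cs)
  then have "0 < (x - c) * poly (\<Prod>c\<leftarrow>cs. [:-c, 1:]) x" using assms(2) by simp
  then show ?case by (simp add: algebra_simps)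
 qed
 then show ?thesis using cs by simp
qed

lemma splits_in_neg:
 assumes "splits_in I p" "\<And>c. c \<in> I ==> x < c"
 shows "(-1) ^ degree p * poly p x > 0"
proof -
 obtain cs where cs: "set cs \<subseteq> I" "p = (\<Prod>c\<leftarrow>cs. [:-c, 1:])" using assms unfolding splits_in_def by blast
 show ?thesis using cs
 proof (induction cs arbitrary: p)
  case Nil then show ?case by simp
 next
  case (Cons c cs)
  define q where "q = (\<Prod>c\<leftarrow>cs. [:-c, 1:])"
  have sq: "splits_in I q" unfolding splits_in_def q_def using Cons.prems by auto
  have q: "(-1) ^ degree q * poly q x > 0" using Cons.IH[OF _ q_def] Cons.prems by simp
  have p: "p = [:-c, 1:] * q" using Cons.prems by (simp add: q_def)
  have d: "degree p = Suc (degree q)" unfolding p using splits_in_nonzero[OF sq] by (subst degree_mult_eq) auto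
  have "x < c" using Cons.prems assms(2) by simp
  then have "(c - x) * ((-1) ^ degree q * poly q x) > 0" using q by simp
  then show ?case unfolding d by (simp add: p algebra_simps)
 qed
qed

lemma splits_in_nonreal:
 assumes "splits_in I p" "Im z \<noteq> 0"
 shows "poly (map_poly cor p) z \<noteq> 0"
proof -
 obtain cs where cs: "set cs \<subseteq> I" "p = (\<Prod>c\<leftarrow>cs. [:-c, 1:])" using assms unfolding splits_in_def by blast
 have "poly (map_poly cor (\<Prod>c\<leftarrow>cs. [:-c, 1:])) z \<noteq> 0"
 proof (induction cs)
  case Nil then show ?case by simp
 next
  case (Cons c cs)
  have "z \<noteq> cor c" using assms(2) by auto
  moreover have "map_poly cor ([:-c, 1:] * (\<Prod>c\<leftarrow>cs. [:-c, 1:]))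
   = [:- cor c, 1:] * map_poly cor (\<Prod>c\<leftarrow>cs. [:-c, 1:])"
   by (rule poly_eqI) (simp add: coeff_map_poly coeff_pCons split: nat.splits)
  ultimately show ?case using Cons by (simp only: list.map prod_list.Cons) simp
 qed
 then show ?thesis using cs by simp
qed

text \<open>Splitting off all zeros in \<open>I\<close> with multiplicity leaves a factor without
  zeros there, hence of constant sign when \<open>I\<close> is an interval.\<close>

lemma peel_roots:
 fixes p :: "real poly"
 assumes "p \<noteq> 0"
 shows "\<exists>r s. p = r * s \<and> splits_in I s \<and> (\<forall>x\<in>I. poly r x \<noteq> 0)"
 using assms
proof (induction "degree p" arbitrary: p rule: less_induct)
 case less
 show ?case
 proof (cases "\<exists>c\<in>I. poly p c = 0")
  case False
  then show ?thesis by (intro exI[of _ p] exI[of _ 1]) auto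
 next
  case True
  then obtain c p' where c: "c \<in> I" "p = [:-c, 1:] * p'" by (auto simp: poly_eq_0_iff_dvd dvd_def)
  have "p' \<noteq> 0" using less.prems c by auto
  then have "degree p = Suc (degree p')" unfolding c(2) by (subst degree_mult_eq) auto
  then obtain r s where "p' = r * s" "splits_in I s" "\<forall>x\<in>I. poly r x \<noteq> 0"
   using less.hyps[of p'] \<open>p' \<noteq> 0\<close> by auto
  then have "p = r * ([:-c, 1:] * s)" "splits_in I ([:-c, 1:] * s)"
   using c splits_in_linear[of I s c] by (simp_all only: mult_ac)
  then show ?thesis using \<open>\<forall>x\<in>I. poly r x \<noteq> 0\<close> by blast
 qed
qed

lemma nonzero_const_sign:
 fixes f :: "real => real"
 assumes "connected I" "continuous_on I f" "\<And>x. x \<in> I ==> f x \<noteq> 0"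
 shows "\<exists>\<epsilon>\<in>{1,-1}. \<forall>x\<in>I. 0 < \<epsilon> * f x"
proof (rule ccontr)
 assume n: "\<not> ?thesis"
 then obtain x y where x: "x \<in> I" "f x \<le> 0" and y: "y \<in> I" "f y \<ge> 0"
  by (auto simp: not_less)
 have "connected (f ` I)" using assms connected_continuous_image by blast
 then have "0 \<in> f ` I" using connected_iff_interval[of "f ` I"] x y by blast
 then show False using assms(3) by auto
qed

lemma borel_measurable_poly [measurable]:
 fixes p :: "'a::{real_normed_field, second_countable_topology} poly"
 assumes "f \<in> borel_measurable M"
 shows "(\<lambda>x. poly p (f x)) \<in> borel_measurable M"
proof -
 have "poly p \<in> borel_measurable borel"
  by (intro borel_measurable_continuous_onI continuous_intros)
 then show ?thesis by (rule measurable_compose[OF assms])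
qed

section \<open>Uniqueness for forms; existence of type I and type II polynomials\<close>

context angelesco_system
begin

lemma connected_Delta: "connected (Delta \<mu> k)"
 by (simp add: Delta_def convex_connected)

text \<open>With \<open>p = r * s\<close> as in \<open>peel_roots\<close>, the product
  \<open>s * p\<close> is \<open>r * s^2\<close>, and \<open>r\<close> has constant sign on the
  interval. For \<open>p = 0\<close> the choice \<open>s = 1\<close> keeps the degree bound.\<close>

lemma peel_sign:
 fixes p :: "real poly"
 shows "\<exists>s \<epsilon>. splits_in (Delta \<mu> k) s \<and> (p \<noteq> 0 \<longrightarrow> s dvd p) \<and> degree s \<le> degree p \<and> \<epsilon> \<in> {1,-1} \<and>
  (\<forall>x\<in>Delta \<mu> k. 0 \<le> \<epsilon> * (poly s x * poly p x))"
proof (cases "p = 0")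
 case True
 then show ?thesis by (intro exI[of _ 1]) auto
next
 case False
 then obtain r s where rs: "p = r * s" "splits_in (Delta \<mu> k) s" "\<forall>x\<in>Delta \<mu> k. poly r x \<noteq> 0"
  using peel_roots by blast
 obtain \<epsilon> where e: "\<epsilon> \<in> {1,-1::real}" "\<forall>x\<in>Delta \<mu> k. 0 < \<epsilon> * poly r x"
  using nonzero_const_sign[OF connected_Delta[of k], of "poly r"] rs(3) continuous_on_poly[OF continuous_on_id, of _ r]
  by (simp only: ball_simps) blast
 have "0 \<le> \<epsilon> * (poly s x * poly p x)" if "x \<in> Delta \<mu> k" for x
 proof -
  have "\<epsilon> * (poly s x * poly p x) = (\<epsilon> * poly r x) * (poly s x)^2"
   by (simp add: rs(1) power2_eq_square)
  moreover have "0 \<le> (\<epsilon> * poly r x) * (poly s x)^2" using e(2) that by (intro mult_nonneg_nonneg[of "_ * _" "_^2"]) (auto intro: less_imp_le)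
  ultimately show ?thesis by (simp only:)
 qed
 moreover have "s dvd p" using rs by simp
 moreover have "degree s \<le> degree p" using \<open>s dvd p\<close> False by (rule dvd_imp_degree_le)
 ultimately show ?thesis using rs e by blast
qed

lemma gap_ex: "\<exists>\<xi>. \<xi> \<in> gap \<mu>"
 using gap_nonempty dense unfolding gap_def by auto

text \<open>
 A single polynomial of small degree makes both components of a form keep the same sign; a factor
 with a root in the gap corrects a mismatch of the two signs.
\<close>

lemma common_sign_multiplier:
 fixes p :: "nat => real poly"
 obtains s q \<epsilon> where "\<And>k. k \<in> {1,2} ==> splits_in (Delta \<mu> k) (s k)"
  "\<And>k. k \<in> {1,2} ==> p k \<noteq> 0 ==> s k dvd p k" "\<And>k. k \<in> {1,2} ==> degree (s k) \<le> degree (p k)"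
  "q \<noteq> 0" "q = s 1 * s 2 \<or> p 1 \<noteq> 0 \<and> p 2 \<noteq> 0 \<and> (\<exists>\<xi>\<in>gap \<mu>. q = s 1 * s 2 * [:-\<xi>, 1:])"
  "\<epsilon> \<in> {1,-1::real}" "\<And>k x. k \<in> {1,2} ==> x \<in> Delta \<mu> k ==> 0 \<le> \<epsilon> * (poly q x * poly (p k) x)"
proof -
 have "\<forall>k. \<exists>s \<epsilon>. splits_in (Delta \<mu> k) s \<and> (p k \<noteq> 0 \<longrightarrow> s dvd p k) \<and> degree s \<le> degree (p k) \<and> \<epsilon> \<in> {1,-1} \<and>
  (\<forall>x\<in>Delta \<mu> k. 0 \<le> \<epsilon> * (poly s x * poly (p k) x))" using peel_sign by blast
 then obtain s \<epsilon> where s: "\<And>k. splits_in (Delta \<mu> k) (s k)" "\<And>k. p k \<noteq> 0 ==> s k dvd p k"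
  "\<And>k. degree (s k) \<le> degree (p k)" and e: "\<And>k. \<epsilon> k \<in> {1,-1::real}"
  "\<And>k x. x \<in> Delta \<mu> k ==> 0 \<le> \<epsilon> k * (poly (s k) x * poly (p k) x)"
  by metis
 obtain \<xi> where xi: "\<xi> \<in> gap \<mu>" using gap_ex by blast
 have q0: "s 1 * s 2 \<noteq> 0" using splits_in_nonzero[OF s(1)] by simp
 \<comment> \<open>All zeros of \<open>s 2\<close> lie to the right of \<open>Delta \<mu> 1\<close>,
   so it has the sign \<open>(-1) ^ degree (s 2)\<close> there, while \<open>s 1\<close> is positive
   on \<open>Delta \<mu> 2\<close>.\<close>
 define \<epsilon>' where "\<epsilon>' = \<epsilon> 1 * (-1) ^ degree (s 2)"
 have e': "\<epsilon>' \<in> {1,-1}" using e(1)[of 1] by (auto simp: \<epsilon>'_def minus_one_power_iff)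
 have s1: "0 \<le> \<epsilon>' * (poly (s 1 * s 2) x * poly (p 1) x)" if x: "x \<in> Delta \<mu> 1" for x
 proof -
  have "\<epsilon>' * (poly (s 1 * s 2) x * poly (p 1) x)
   = (\<epsilon> 1 * (poly (s 1) x * poly (p 1) x)) * ((-1) ^ degree (s 2) * poly (s 2) x)"
   by (simp add: \<epsilon>'_def mult_ac)
  also have "... \<ge> 0"
   using e(2)[OF x] splits_in_neg[OF s(1)[of 2], of x] Delta_less[OF x]
   by (intro mult_nonneg_nonneg[of "_ * (_ * _)" "(-1) ^ _ * _"]) (auto intro: less_imp_le)
  finally show ?thesis .
 qed
 have s2: "0 \<le> \<epsilon> 2 * (poly (s 1 * s 2) x * poly (p 2) x)" if x: "x \<in> Delta \<mu> 2" for x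
 proof -
  have "\<epsilon> 2 * (poly (s 1 * s 2) x * poly (p 2) x) = (\<epsilon> 2 * (poly (s 2) x * poly (p 2) x)) * poly (s 1) x"
   by (simp add: mult_ac)
  also have "... \<ge> 0"
   using e(2)[OF x] splits_in_pos[OF s(1)[of 1], of x] Delta_less[OF _ x]
   by (intro mult_nonneg_nonneg[of "_ * (_ * _)"]) (auto intro: less_imp_le)
  finally show ?thesis .
 qed
 consider "\<epsilon>' = \<epsilon> 2 \<or> p 2 = 0" | "p 1 = 0" | "\<epsilon>' = - \<epsilon> 2" "p 1 \<noteq> 0" "p 2 \<noteq> 0"
 proof -
  have "\<epsilon>' = \<epsilon> 2 \<or> \<epsilon>' = - \<epsilon> 2" using e' e(1)[of 2] by auto
  then show ?thesis using that by blast
 qed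
 then show thesis
 proof cases
  case 1
  then show ?thesis using s q0 e' s1 s2 by (intro that[of s "s 1 * s 2" \<epsilon>']) auto
 next
  case 2
  then show ?thesis using s q0 e(1)[of 2] s2 by (intro that[of s "s 1 * s 2" "\<epsilon> 2"]) auto
 next
  case 3
  have a: "0 \<le> \<epsilon> 2 * (poly (s 1 * s 2 * [:-\<xi>,1:]) x * poly (p 1) x)" if x: "x \<in> Delta \<mu> 1" for x
  proof -
   have "\<epsilon> 2 * (poly (s 1 * s 2 * [:-\<xi>,1:]) x * poly (p 1) x) = (\<epsilon>' * (poly (s 1 * s 2) x * poly (p 1) x)) * (\<xi> - x)"
    using 3 by (simp add: algebra_simps)
   also have "... \<ge> 0" using s1[OF x] gap_between(1)[OF xi x] by (intro mult_nonneg_nonneg[of "_ * (_ * _)"]) auto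
   finally show ?thesis .
  qed
  have b: "0 \<le> \<epsilon> 2 * (poly (s 1 * s 2 * [:-\<xi>,1:]) x * poly (p 2) x)" if x: "x \<in> Delta \<mu> 2" for x
  proof -
   have "\<epsilon> 2 * (poly (s 1 * s 2 * [:-\<xi>,1:]) x * poly (p 2) x) = (\<epsilon> 2 * (poly (s 1 * s 2) x * poly (p 2) x)) * (x - \<xi>)"
    by (simp add: algebra_simps)
   also have "... \<ge> 0" using s2[OF x] gap_between(2)[OF xi x] by (intro mult_nonneg_nonneg[of "_ * (_ * _)"]) auto
   finally show ?thesis .
  qed
  have "s 1 * s 2 * [:-\<xi>,1:] \<noteq> 0"
   using q0 by (simp only: mult_eq_0_iff) simp
  then show ?thesis using 3 s q0 e(1)[of 2] a b xi
   by (intro that[of s "s 1 * s 2 * [:-\<xi>,1:]" "\<epsilon> 2"]) (auto simp del: mult_pCons_right mult_eq_0_iff poly_mult)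
 qed
qed

lemma nonneg_integral_zero:
 assumes k: "k \<in> {1,2}" and w: "w \<in> borel_measurable borel" "\<And>x. x \<in> Delta \<mu> k ==> 0 < w x"
  "\<And>x. x \<in> Delta \<mu> k ==> w x \<le> B"
  and p: "\<And>x. x \<in> Delta \<mu> k ==> 0 \<le> \<epsilon> * poly p x" and e: "\<epsilon> \<in> {1,-1}"
 shows "integrable (\<mu> k) (\<lambda>x. poly p x * w x)" "0 \<le> \<epsilon> * (\<integral>x. poly p x * w x \<partial>\<mu> k)"
  "(\<integral>x. poly p x * w x \<partial>\<mu> k) = 0 ==> p = 0"
proof -
 have m: "(\<lambda>x. poly p x * w x) \<in> borel_measurable borel"
  using w(1) by measurable
 have "bounded (poly p ` Delta \<mu> k)"
  by (intro compact_imp_bounded compact_continuous_image compact_Delta k continuous_intros)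
 then obtain C where C: "\<And>x. x \<in> Delta \<mu> k ==> \<bar>poly p x\<bar> \<le> C" unfolding bounded_iff by auto
 show i: "integrable (\<mu> k) (\<lambda>x. poly p x * w x)"
 proof (rule integrable_mu[OF k m])
  fix x assume x: "x \<in> Delta \<mu> k"
  show "norm (poly p x * w x) \<le> C * B"
   using w(2,3)[OF x] C[OF x] by (auto simp: abs_mult intro!: mult_mono)
 qed
 have ae: "AE x in \<mu> k. 0 \<le> \<epsilon> * (poly p x * w x)"
  using AE_mu[OF k] by eventually_elim (use p w(2) in \<open>metis less_imp_le mult.assoc mult_nonneg_nonneg\<close>)
 show "0 \<le> \<epsilon> * (\<integral>x. poly p x * w x \<partial>\<mu> k)"
  using integral_nonneg_AE[OF ae] by simp
 assume z: "(\<integral>x. poly p x * w x \<partial>\<mu> k) = 0"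
 have "AE x in \<mu> k. \<epsilon> * (poly p x * w x) = 0"
  using z by (subst integral_nonneg_eq_0_iff_AE[OF _ ae, symmetric]) (auto intro: i)
 then have "AE x in \<mu> k. poly p x = 0"
  using AE_mu[OF k] by eventually_elim (use w(2) e in force)
 then show "p = 0" by (rule poly_AE_zero[OF k])
qed

text \<open>If some component were nonzero, \<open>common_sign_multiplier\<close> would give a
  \<open>q\<close> for which the two integrals cannot cancel. Its degree is small enough:
  \<open>degree (s k) \<le> degree (p k) < N k\<close>, and the extra linear factor occurs only if
  both components are nonzero, when \<open>s 1 * s 2\<close> has degree at most
  \<open>N 1 + N 2 - 2\<close>. Weights are allowed because \<open>Fm_nonzero\<close> divides a form
  by a linear polynomial.\<close>

lemma orthogonal_form_zero:
 fixes p :: "nat => real poly" and w :: "nat => real => real" and N :: "nat => nat"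
 assumes deg: "\<And>k. k \<in> {1,2} ==> p k = 0 \<or> degree (p k) < N k"
  and wm: "\<And>k. k \<in> {1,2} ==> w k \<in> borel_measurable borel"
  and wp: "\<And>k x. k \<in> {1,2} ==> x \<in> Delta \<mu> k ==> 0 < w k x"
  and wb: "\<And>k x. k \<in> {1,2} ==> x \<in> Delta \<mu> k ==> w k x \<le> B"
  and orth: "\<And>q. degree q < N 1 + N 2 ==> (\<Sum>k\<in>{1,2}. \<integral>x. poly q x * poly (p k) x * w k x \<partial>\<mu> k) = 0"
  and k: "k \<in> {1,2}"
 shows "p k = 0"
proof (rule ccontr)
 assume nz: "p k \<noteq> 0"
 obtain s q \<epsilon> where s: "\<And>k. k \<in> {1,2} ==> splits_in (Delta \<mu> k) (s k)"
  "\<And>k. k \<in> {1,2} ==> p k \<noteq> 0 ==> s k dvd p k" "\<And>k. k \<in> {1,2} ==> degree (s k) \<le> degree (p k)"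
  "q \<noteq> 0" and q: "q = s 1 * s 2 \<or> p 1 \<noteq> 0 \<and> p 2 \<noteq> 0 \<and> (\<exists>\<xi>\<in>gap \<mu>. q = s 1 * s 2 * [:-\<xi>, 1:])"
  and e: "\<epsilon> \<in> {1,-1::real}" "\<And>k x. k \<in> {1,2} ==> x \<in> Delta \<mu> k ==> 0 \<le> \<epsilon> * (poly q x * poly (p k) x)"
  by (rule common_sign_multiplier[of p]; rule that; assumption)
 have d: "degree (s 1) \<le> degree (p 1)" "degree (s 2) \<le> degree (p 2)" using s(3) by simp_all
 have le: "degree (s 1 * s 2) \<le> degree (p 1) + degree (p 2)"
  using degree_mult_le[of "s 1" "s 2"] d by linarith
 have "degree q < N 1 + N 2"
 proof (cases "p 1 = 0 \<or> p 2 = 0")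
  case True
  then show ?thesis using q le deg[of 1] deg[of 2] nz k by auto
 next
  case False
  have "degree (s 1 * s 2 * [:-\<xi>, 1:]) \<le> degree (s 1 * s 2) + 1" for \<xi>
   using degree_mult_le[of "s 1 * s 2" "[:-\<xi>, 1:]"] by simp
  then have "degree q \<le> degree (s 1 * s 2) + 1" using q by (elim disjE) (blast | simp)+
  then show ?thesis using False le deg[of 1] deg[of 2] by simp
 qed
 from orth[OF this] have z: "(\<integral>x. poly (q * p 1) x * w 1 x \<partial>\<mu> 1) + (\<integral>x. poly (q * p 2) x * w 2 x \<partial>\<mu> 2) = 0"
  by simp
 have nn: "0 \<le> \<epsilon> * (\<integral>x. poly (q * p j) x * w j x \<partial>\<mu> j)" if j: "j \<in> {1,2}" for j
  using nonneg_integral_zero(2)[OF j wm[OF j] wp[OF j] wb[OF j], of \<epsilon> "q * p j"] e j by simp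
 have "(\<integral>x. poly (q * p k) x * w k x \<partial>\<mu> k) = 0"
  using z nn[of 1] nn[of 2] e(1) k by auto
 then have "q * p k = 0"
  using nonneg_integral_zero(3)[OF k wm[OF k] wp[OF k] wb[OF k], of \<epsilon> "q * p k"] e k by simp
 then show False using nz \<open>q \<noteq> 0\<close> by simp
qed

definition form :: "(nat => real poly) => real poly => real" where
 "form p q = (\<Sum>k\<in>{1, 2}. \<integral>x. poly q x * poly (p k) x \<partial>\<mu> k)"

lemma integrable_poly_mult: "k \<in> {1,2} ==> integrable (\<mu> k) (\<lambda>x. poly p x * poly q x)"
 using integrable_mu_poly[of k "p * q"] by simp

lemma form_0 [simp]: "form p 0 = 0"
 by (simp add: form_def)

lemma form_add: "form p (q + r) = form p q + form p r"
 using integrable_poly_mult[of 1] integrable_poly_mult[of 2]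
 by (simp add: form_def distrib_right)

lemma form_smult: "form p (smult c q) = c * form p q"
 by (simp add: form_def mult.assoc distrib_left)

lemma form_sum: "form p (\<Sum>i\<in>I. q i) = (\<Sum>i\<in>I. form p (q i))"
 by (induction I rule: infinite_finite_induct) (simp_all add: form_add)

lemma form_add_left: "form (\<lambda>k. p k + r k) q = form p q + form r q"
 using integrable_poly_mult[of 1] integrable_poly_mult[of 2]
 by (simp add: form_def distrib_left)

lemma form_smult_left: "form (\<lambda>k. smult c (p k)) q = c * form p q"
 by (simp add: form_def mult.left_commute distrib_left)

lemma form_diff_left: "form (\<lambda>k. p k - r k) q = form p q - form r q"
 using form_add_left[of p "\<lambda>k. smult (-1) (r k)" q] form_smult_left[of "-1" r q] by simp

lemma form_mult_left: "form (\<lambda>k. u * p k) q = form p (u * q)"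
 by (simp add: form_def mult_ac)

lemma form_expand:
 assumes "degree q \<le> N"
 shows "form p q = (\<Sum>m\<le>N. coeff q m * form p (monom 1 m))"
proof -
 have "q = (\<Sum>m\<le>N. smult (coeff q m) (monom 1 m))"
  using poly_as_sum_of_monoms'[OF assms] by (simp add: smult_monom)
 then have "form p q = form p (\<Sum>m\<le>N. smult (coeff q m) (monom 1 m))" by simp
 then show ?thesis by (simp add: form_sum form_smult)
qed

lemma form_zero:
 assumes deg: "\<And>k. k \<in> {1,2} ==> p k = 0 \<or> degree (p k) < entry n k"
  and orth: "\<And>q. degree q < index_size n ==> form p q = 0" and k: "k \<in> {1,2}"
 shows "p k = 0"
proof (rule orthogonal_form_zero[of p "entry n" "\<lambda>_ _. 1" 1])
 fix q :: "real poly"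
 assume "degree q < entry n 1 + entry n 2"
 then show "(\<Sum>k\<in>{1,2}. \<integral>x. poly q x * poly (p k) x * 1 \<partial>\<mu> k) = 0"
  using orth[of q] by (simp add: form_def index_size_def entry_def)
qed (use deg k in simp_all)

lemma is_type_I_iff:
 "is_type_I \<mu> n A \<longleftrightarrow>
   (\<forall>k\<in>{1, 2}. entry A k = 0 \<or> degree (entry A k) < entry n k) \<and>
   (\<forall>m. m + 2 \<le> index_size n \<longrightarrow> form (entry A) (monom 1 m) = 0) \<and>
   (\<forall>m. m + 1 = index_size n \<longrightarrow> form (entry A) (monom 1 m) = 1)"
proof -
 have "(if entry n k = 0 then entry A k = 0 else degree (entry A k) \<le> entry n k - 1) \<longleftrightarrow>
  (entry A k = 0 \<or> degree (entry A k) < entry n k)" for k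
  by auto
 then show ?thesis unfolding is_type_I_def form_def by (simp add: poly_monom)
qed

lemma is_type_I_top:
 assumes "is_type_I \<mu> n A" "degree q < index_size n"
 shows "form (entry A) q = coeff q (index_size n - 1)"
proof -
 obtain N where N: "index_size n = Suc N" using assms(2) by (cases "index_size n") auto
 have "form (entry A) q = (\<Sum>m\<le>N. coeff q m * form (entry A) (monom 1 m))"
  using assms(2) N by (intro form_expand) simp
 also have "... = (\<Sum>m\<le>N. if m = N then coeff q m else 0)"
  using assms(1) N unfolding is_type_I_iff by (intro sum.cong) auto
 finally show ?thesis using N by simp
qed

lemma is_type_I_unique:
 assumes "is_type_I \<mu> n A" "is_type_I \<mu> n B"
 shows "A = B"
proof -
 have z: "entry A k - entry B k = 0" if "k \<in> {1,2}" for k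
 proof (rule form_zero[of "\<lambda>k. entry A k - entry B k" n])
  fix k :: nat assume "k \<in> {1,2}"
  then show "entry A k - entry B k = 0 \<or> degree (entry A k - entry B k) < entry n k"
   using assms degree_diff_less[of "entry A k" "entry n k" "entry B k"] unfolding is_type_I_iff
   by (cases "entry A k = 0"; cases "entry B k = 0") auto
 next
  fix q :: "real poly" assume "degree q < index_size n"
  then show "form (\<lambda>k. entry A k - entry B k) q = 0"
   using assms by (simp add: form_diff_left is_type_I_top)
 qed (rule that)
 show ?thesis using z[of 1] z[of 2] by (auto simp: entry_def prod_eq_iff)
qed

text \<open>There are \<open>index_size n\<close> unknown coefficients and one homogeneous condition
  fewer. The remaining moment \<open>t\<close> cannot vanish, since \<open>form_zero\<close> would
  then kill the nontrivial solution; dividing by \<open>t\<close> normalizes.\<close>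

lemma is_type_I_ex:
 assumes "index_size n > 0"
 shows "\<exists>A. is_type_I \<mu> n A"
proof -
 define J where "J = (SIGMA k:{1,2}. {..<entry n k})"
 define I where "I = {..<index_size n - 1}"
 have cJ: "card J = index_size n"
  by (simp add: J_def index_size_def entry_def)
 have "card I < card J" using assms by (simp add: cJ I_def)
 moreover have "finite I" "finite J" by (auto simp: I_def J_def)
 ultimately obtain c where c: "\<exists>j\<in>J. c j \<noteq> 0"
  "\<forall>m\<in>I. (\<Sum>j\<in>J. (\<integral>x. x ^ m * x ^ snd j \<partial>\<mu> (fst j)) * c j) = 0"
  using homogeneous_system_nontrivial[of I J "\<lambda>m j. \<integral>x. x ^ m * x ^ snd j \<partial>\<mu> (fst j)"] by blast
 define p where "p k = (\<Sum>j<entry n k. monom (c (k, j)) j)" for k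
 have deg: "p k = 0 \<or> degree (p k) < entry n k" if "k \<in> {1,2}" for k
 proof (cases "entry n k")
  case (Suc N)
  then show ?thesis unfolding p_def
   by (intro disjI2 degree_sum_less) (auto intro: le_less_trans[OF degree_monom_le])
 qed (simp add: p_def)
 have F: "form p (monom 1 m) = (\<Sum>j\<in>J. (\<integral>x. x ^ m * x ^ snd j \<partial>\<mu> (fst j)) * c j)" for m
 proof -
  have "(\<integral>x. poly (monom 1 m) x * poly (p k) x \<partial>\<mu> k) = (\<Sum>j<entry n k. (\<integral>x. x ^ m * x ^ j \<partial>\<mu> k) * c (k, j))"
   if k: "k \<in> {1,2}" for k
  proof -
   have i: "integrable (\<mu> k) (\<lambda>x. x ^ m * x ^ j)" for j
    using integrable_poly_mult[OF k, of "monom 1 m" "monom 1 j"] by (simp add: poly_monom)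
   have "(\<integral>x. poly (monom 1 m) x * poly (p k) x \<partial>\<mu> k) = (\<integral>x. (\<Sum>j<entry n k. x ^ m * x ^ j * c (k, j)) \<partial>\<mu> k)"
    by (intro Bochner_Integration.integral_cong refl) (simp add: p_def poly_sum poly_monom sum_distrib_left mult_ac)
   also have "... = (\<Sum>j<entry n k. (\<integral>x. x ^ m * x ^ j \<partial>\<mu> k) * c (k, j))"
    using i by (subst Bochner_Integration.integral_sum) auto
   finally show ?thesis .
  qed
  then have "form p (monom 1 m) = (\<Sum>k\<in>{1,2}. \<Sum>j<entry n k. (\<integral>x. x ^ m * x ^ j \<partial>\<mu> k) * c (k, j))"
   unfolding form_def by (intro sum.cong) auto
  also have "... = (\<Sum>j\<in>J. (\<integral>x. x ^ m * x ^ snd j \<partial>\<mu> (fst j)) * c j)"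
   unfolding J_def by (subst sum.Sigma) (auto simp: split_beta)
  finally show ?thesis .
 qed
 have orth: "form p (monom 1 m) = 0" if "m + 2 \<le> index_size n" for m
  using c(2) that unfolding F by (simp add: I_def)
 define t where "t = form p (monom 1 (index_size n - 1))"
 have "t \<noteq> 0"
 proof
  assume "t = 0"
  then have z: "form p (monom 1 m) = 0" if "m < index_size n" for m
   using orth[of m] that unfolding t_def by (cases "m = index_size n - 1") auto
  have "form p q = 0" if "degree q < index_size n" for q
   using that by (subst form_expand[OF order_refl]) (auto intro!: sum.neutral z)
  then have p0: "p k = 0" if "k \<in> {1,2}" for k
   using form_zero[of p n, OF deg] that by blast
  obtain k j where kj: "k \<in> {1,2}" "j < entry n k" "c (k, j) \<noteq> 0" using c(1) by (auto simp: J_def)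
  have "coeff (p k) j = c (k, j)"
   using kj(2) by (simp add: p_def coeff_sum if_distrib sum.delta' cong: if_cong)
  then show False using p0[OF kj(1)] kj(3) by simp
 qed
 have e: "entry (smult (1/t) (p 1), smult (1/t) (p 2)) k = smult (1/t) (p k)" if "k \<in> {1,2}" for k
  using that by (auto simp: entry_def)
 have f: "form (entry (smult (1/t) (p 1), smult (1/t) (p 2))) q = (1/t) * form p q" for q
  using form_smult_left[of "1/t" p q] by (simp add: form_def entry_def)
 have "is_type_I \<mu> n (smult (1/t) (p 1), smult (1/t) (p 2))"
  unfolding is_type_I_iff f
 proof (intro conjI ballI allI impI)
  fix k :: nat assume k: "k \<in> {1,2}"
  show "entry (smult (1/t) (p 1), smult (1/t) (p 2)) k = 0 \<or>
   degree (entry (smult (1/t) (p 1), smult (1/t) (p 2)) k) < entry n k"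
   using deg[OF k] k \<open>t \<noteq> 0\<close> unfolding e[OF k] by auto
 next
  fix m assume "m + 2 \<le> index_size n"
  then show "1 / t * form p (monom 1 m) = 0" using orth by simp
 next
  fix m assume "m + 1 = index_size n"
  then have "form p (monom 1 m) = t" unfolding t_def by (metis add_diff_cancel_right')
  then show "1 / t * form p (monom 1 m) = 1" using \<open>t \<noteq> 0\<close> by simp
 qed
 then show ?thesis by blast
qed

abbreviation TI :: "nat \<times> nat => nat => real poly" where
 "TI n k \<equiv> type_I \<mu> k n"

abbreviation "TP n k == poly (TI n k)"
abbreviation "DD == Delta \<mu> 1 \<union> Delta \<mu> 2"

lemma is_type_I_TI:
 assumes "index_size n > 0"
 shows "is_type_I \<mu> n (TI n 1, TI n 2)" "\<And>q. form (entry (TI n 1, TI n 2)) q = form (TI n) q"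
proof -
 have "\<exists>!A. is_type_I \<mu> n A" using is_type_I_ex[OF assms] is_type_I_unique by blast
 then have "is_type_I \<mu> n (THE A. is_type_I \<mu> n A)" by (rule theI')
 then show "is_type_I \<mu> n (TI n 1, TI n 2)" by (simp add: type_I_def entry_def)
 show "form (entry (TI n 1, TI n 2)) q = form (TI n) q" for q
  by (simp add: form_def entry_def)
qed

lemma type_I_degree:
 assumes "index_size n > 0" "k \<in> {1,2}"
 shows "TI n k = 0 \<or> degree (TI n k) < entry n k"
 using is_type_I_TI(1)[OF assms(1)] assms(2) unfolding is_type_I_iff by (auto simp: entry_def)

lemma type_I_form:
 assumes "degree q < index_size n"
 shows "form (TI n) q = coeff q (index_size n - 1)"
 using is_type_I_top[OF is_type_I_TI(1) assms] is_type_I_TI(2)[of n q] assms by simp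

text \<open>If \<open>P\<close> had fewer than \<open>entry n k\<close> zeros in
  \<open>Delta \<mu> k\<close>, the product \<open>s\<close> of the corresponding linear factors
  would be an admissible test polynomial, and \<open>P * s\<close> keeps one sign there. The
  intervals are disjoint, so the two numbers of zeros add up.\<close>

lemma type_II_degree_ge:
 assumes "P \<noteq> 0" and orth: "\<And>k q. k \<in> {1,2} ==> degree q < entry n k ==> (\<integral>x. poly P x * poly q x \<partial>\<mu> k) = 0"
 shows "index_size n \<le> degree P"
proof -
 have key: "entry n k \<le> degree s" if k: "k \<in> {1,2}" and P: "P = r * u * s" and s: "splits_in (Delta \<mu> k) s"
  and nz: "\<forall>x\<in>Delta \<mu> k. poly (r * u) x \<noteq> 0" for k r s u
 proof (rule ccontr)
  assume "\<not> ?thesis"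
  then have z: "(\<integral>x. poly (P * s) x * 1 \<partial>\<mu> k) = 0" using orth[OF k, of s] by simp
  obtain \<epsilon> where e: "\<epsilon> \<in> {1,-1::real}" "\<forall>x\<in>Delta \<mu> k. 0 < \<epsilon> * poly (r * u) x"
   using nonzero_const_sign[OF connected_Delta[of k], of "poly (r * u)"] nz continuous_on_poly[OF continuous_on_id, of _ "r * u"]
   by (simp only: ball_simps) blast
  have "0 \<le> \<epsilon> * poly (P * s) x" if "x \<in> Delta \<mu> k" for x
  proof -
   have "\<epsilon> * poly (P * s) x = (\<epsilon> * poly (r * u) x) * (poly s x)^2" by (simp add: P power2_eq_square)
   moreover have "0 \<le> (\<epsilon> * poly (r * u) x) * (poly s x)^2" using e(2) that
    by (intro mult_nonneg_nonneg[of "_ * _" "_^2"]) (auto intro: less_imp_le simp del: poly_mult)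
   ultimately show ?thesis by (simp only:)
  qed
  then have "P * s = 0"
   using nonneg_integral_zero(3)[OF k, of "\<lambda>_. 1" 1 \<epsilon> "P * s"] e(1) z by simp
  then show False using assms(1) splits_in_nonzero[OF s] by simp
 qed
 obtain r1 s1 where 1: "P = r1 * s1" "splits_in (Delta \<mu> 1) s1" "\<forall>x\<in>Delta \<mu> 1. poly r1 x \<noteq> 0"
  using peel_roots[OF assms(1)] by blast
 then have "r1 \<noteq> 0" using assms(1) by auto
 obtain r2 s2 where 2: "r1 = r2 * s2" "splits_in (Delta \<mu> 2) s2" "\<forall>x\<in>Delta \<mu> 2. poly r2 x \<noteq> 0"
  using peel_roots[OF \<open>r1 \<noteq> 0\<close>] by blast
 have "entry n 1 \<le> degree s1"
  using 1 by (intro key[of 1 r1 1]) auto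
 moreover have "entry n 2 \<le> degree s2"
 proof (rule key[of 2 r2 s1])
  show "\<forall>x\<in>Delta \<mu> 2. poly (r2 * s1) x \<noteq> 0"
   using 2(3) splits_in_pos[OF 1(2)] Delta_less by force
 qed (use 1 2 in auto)
 moreover have "degree P = degree r2 + degree s2 + degree s1"
  using 1 2 assms(1) by (auto simp: degree_mult_eq)
 ultimately show ?thesis by (simp add: index_size_def entry_def)
qed

lemma is_type_II_orth:
 assumes orth: "\<forall>k\<in>{1, 2}. \<forall>m < entry n k. (\<integral>x. poly P x * x ^ m \<partial>\<mu> k) = 0" and k: "k \<in> {1,2}"
  and q: "degree q < entry n k"
 shows "(\<integral>x. poly P x * poly q x \<partial>\<mu> k) = 0"
proof -
 have i: "integrable (\<mu> k) (\<lambda>x. poly P x * x ^ j)" for j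
  using integrable_poly_mult[OF k, of P "monom 1 j"] by (simp add: poly_monom)
 have "(\<integral>x. poly P x * poly q x \<partial>\<mu> k) = (\<integral>x. (\<Sum>j\<le>degree q. coeff q j * (poly P x * x ^ j)) \<partial>\<mu> k)"
  by (simp add: poly_altdef sum_distrib_left mult_ac)
 also have "... = (\<Sum>j\<le>degree q. coeff q j * (\<integral>x. poly P x * x ^ j \<partial>\<mu> k))"
  using i by (subst Bochner_Integration.integral_sum) auto
 also have "... = 0" using orth k q by (intro sum.neutral) auto
 finally show ?thesis .
qed

text \<open>The difference of two monic candidates has too small a degree for
  \<open>type_II_degree_ge\<close>.\<close>

lemma is_type_II_unique:
 assumes "is_type_II \<mu> n P" "is_type_II \<mu> n Q"
 shows "P = Q"
proof (rule ccontr)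
 assume "P \<noteq> Q"
 then have nz: "P - Q \<noteq> 0" by simp
 have le: "degree (P - Q) \<le> index_size n" using assms unfolding is_type_II_def by (intro degree_diff_le) auto
 have "degree P = index_size n" "lead_coeff P = 1" "degree Q = index_size n" "lead_coeff Q = 1"
  using assms by (auto simp: is_type_II_def)
 then have "coeff (P - Q) (index_size n) = 0" by simp
 then have "degree (P - Q) \<noteq> index_size n" using nz by (metis leading_coeff_0_iff)
 moreover have "index_size n \<le> degree (P - Q)"
 proof (rule type_II_degree_ge[OF nz])
  fix k :: nat and q :: "real poly" assume k: "k \<in> {1,2}" and q: "degree q < entry n k"
  have "(\<integral>x. poly (P - Q) x * poly q x \<partial>\<mu> k) = (\<integral>x. poly P x * poly q x \<partial>\<mu> k) - (\<integral>x. poly Q x * poly q x \<partial>\<mu> k)"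
   using integrable_poly_mult[OF k] by (simp add: left_diff_distrib)
  then show "(\<integral>x. poly (P - Q) x * poly q x \<partial>\<mu> k) = 0"
   using is_type_II_orth[OF _ k q, of P] is_type_II_orth[OF _ k q, of Q] assms unfolding is_type_II_def by simp
 qed
 ultimately show False using le by simp
qed

text \<open>There is one more coefficient than conditions; \<open>type_II_degree_ge\<close> shows
  that the solution has full degree, so that it can be made monic.\<close>

lemma is_type_II_ex: "\<exists>P. is_type_II \<mu> n P"
proof -
 define I where "I = (SIGMA k:{1,2}. {..<entry n k})"
 define J where "J = {..index_size n}"
 have "card I < card J"
  by (simp add: J_def I_def index_size_def entry_def)
 moreover have "finite I" "finite J" by (auto simp: I_def J_def)
 ultimately obtain c where c: "\<exists>j\<in>J. c j \<noteq> 0"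
  "\<forall>i\<in>I. (\<Sum>j\<in>J. (\<integral>x. x ^ j * x ^ snd i \<partial>\<mu> (fst i)) * c j) = 0"
  using homogeneous_system_nontrivial[of I J "\<lambda>i j. \<integral>x. x ^ j * x ^ snd i \<partial>\<mu> (fst i)"] by blast
 define P where "P = (\<Sum>j\<in>J. monom (c j) j)"
 have "P \<noteq> 0"
 proof -
  obtain j where j: "j \<in> J" "c j \<noteq> 0" using c(1) by blast
  have "coeff P j = c j"
   using j(1) by (simp add: P_def J_def coeff_sum if_distrib sum.delta' cong: if_cong)
  then show ?thesis using j by auto
 qed
 have orth: "\<forall>k\<in>{1, 2}. \<forall>m < entry n k. (\<integral>x. poly P x * x ^ m \<partial>\<mu> k) = 0"
 proof (intro ballI allI impI)
  fix k m :: nat assume k: "k \<in> {1,2}" and m: "m < entry n k"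
  have i: "integrable (\<mu> k) (\<lambda>x. x ^ j * x ^ m)" for j
   using integrable_poly_mult[OF k, of "monom 1 j" "monom 1 m"] by (simp add: poly_monom)
  have "(\<integral>x. poly P x * x ^ m \<partial>\<mu> k) = (\<integral>x. (\<Sum>j\<in>J. x ^ j * x ^ m * c j) \<partial>\<mu> k)"
   by (intro Bochner_Integration.integral_cong refl) (simp add: P_def poly_sum poly_monom sum_distrib_left mult_ac)
  also have "... = (\<Sum>j\<in>J. (\<integral>x. x ^ j * x ^ m \<partial>\<mu> k) * c j)"
   using i by (subst Bochner_Integration.integral_sum) auto
  also have "... = 0"
   using c(2)[rule_format, of "(k, m)"] k m by (simp add: I_def)
  finally show "(\<integral>x. poly P x * x ^ m \<partial>\<mu> k) = 0" .
 qed
 have "degree P \<le> index_size n" unfolding P_def J_def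
  by (intro degree_sum_le) (auto intro: order_trans[OF degree_monom_le])
 moreover have "index_size n \<le> degree P"
  using type_II_degree_ge[OF \<open>P \<noteq> 0\<close>] is_type_II_orth[OF orth] by blast
 ultimately have d: "degree P = index_size n" by simp
 define l where "l = lead_coeff P"
 have l: "l \<noteq> 0" using \<open>P \<noteq> 0\<close> by (simp add: l_def)
 have "is_type_II \<mu> n (smult (1/l) P)"
  using d l orth unfolding is_type_II_def by (auto simp: l_def mult.assoc)
 then show ?thesis by blast
qed

lemma type_II:
 shows degree_type_II: "degree (type_II \<mu> n) = index_size n"
  and lead_coeff_type_II: "coeff (type_II \<mu> n) (index_size n) = 1"
  and type_II_orth: "k \<in> {1,2} ==> degree q < entry n k ==> (\<integral>x. poly (type_II \<mu> n) x * poly q x \<partial>\<mu> k) = 0"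
proof -
 have "\<exists>!P. is_type_II \<mu> n P" using is_type_II_ex is_type_II_unique by blast
 then have t: "is_type_II \<mu> n (type_II \<mu> n)" unfolding type_II_def by (rule theI')
 then show "degree (type_II \<mu> n) = index_size n" "coeff (type_II \<mu> n) (index_size n) = 1"
  unfolding is_type_II_def by auto
 show "k \<in> {1,2} ==> degree q < entry n k ==> (\<integral>x. poly (type_II \<mu> n) x * poly q x \<partial>\<mu> k) = 0"
  using t is_type_II_orth unfolding is_type_II_def by blast
qed

end

lemma splits_in_root:
 assumes "splits_in I p" "poly p x = 0"
 shows "x \<in> I"
proof -
 obtain cs where cs: "set cs \<subseteq> I" "p = (\<Prod>c\<leftarrow>cs. [:-c, 1:])" using assms unfolding splits_in_def by blast
 have "poly (\<Prod>c\<leftarrow>cs. [:-c, 1:]) x = 0 ==> x \<in> set cs"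
  by (induction cs) (auto simp: algebra_simps)
 then show ?thesis using cs assms(2) by auto
qed

lemma degree_poly_minus_value:
 fixes q :: "'a::comm_ring_1 poly"
 shows "q = [:poly q x:] + [:-x, 1:] * sdiv q x"
 using synthetic_div_correct'[of x q] by (simp add: algebra_simps)

section \<open>Zeros, signs and recurrence of the type I polynomials\<close>

context angelesco_system
begin

text \<open>The multiplier \<open>q\<close> of \<open>common_sign_multiplier\<close> cannot be
  orthogonal to the form, so its degree is at least \<open>index_size n - 1\<close>. As
  \<open>degree (s k) \<le> entry n k - 1\<close>, this forces the factor with a zero in the gap and
  equality in all degree bounds, so every zero of \<open>TI n k\<close> lies in
  \<open>Delta \<mu> k\<close>. The form takes the value 1 at the monic \<open>q\<close>, which
  fixes \<open>\<epsilon> = 1\<close> and with it the signs of the leading coefficients.\<close>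

lemma type_I_structure:
 assumes n: "fst n > 0" "snd n > 0"
 obtains s c where "\<And>k. k \<in> {1,2} ==> TI n k = smult (c k) (s k)"
  "\<And>k. k \<in> {1,2} ==> splits_in (Delta \<mu> k) (s k)" "\<And>k. k \<in> {1,2} ==> degree (s k) = entry n k - 1"
  "0 < c 2" "0 < (-1) ^ snd n * c 1"
proof -
 have e: "entry n 1 = fst n" "entry n 2 = snd n" by (simp_all add: entry_def)
 have N: "index_size n = fst n + snd n" by (simp add: index_size_def)
 then have N0: "index_size n > 0" using n by simp
 have dT: "degree (TI n k) \<le> entry n k - 1" if "k \<in> {1,2}" for k
  using type_I_degree[OF N0 that] by auto
 obtain s q \<epsilon> where s: "\<And>k. k \<in> {1,2} ==> splits_in (Delta \<mu> k) (s k)"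
  "\<And>k. k \<in> {1,2} ==> TI n k \<noteq> 0 ==> s k dvd TI n k" "\<And>k. k \<in> {1,2} ==> degree (s k) \<le> degree (TI n k)"
  "q \<noteq> 0" and q: "q = s 1 * s 2 \<or> TI n 1 \<noteq> 0 \<and> TI n 2 \<noteq> 0 \<and> (\<exists>\<xi>\<in>gap \<mu>. q = s 1 * s 2 * [:-\<xi>, 1:])"
  and \<epsilon>: "\<epsilon> \<in> {1,-1::real}" "\<And>k x. k \<in> {1,2} ==> x \<in> Delta \<mu> k ==> 0 \<le> \<epsilon> * (poly q x * TP n k x)"
  by (rule common_sign_multiplier[of "TI n"]; rule that; assumption)
 have i0: "0 \<le> \<epsilon> * (\<integral>x. poly (q * TI n k) x * 1 \<partial>\<mu> k)" "(\<integral>x. poly (q * TI n k) x * 1 \<partial>\<mu> k) = 0 ==> q * TI n k = 0"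
  if k: "k \<in> {1,2}" for k
  using nonneg_integral_zero(2,3)[OF k, of "\<lambda>_. 1" 1 \<epsilon> "q * TI n k"] \<epsilon> k by simp_all
 have F: "form (TI n) q = (\<integral>x. poly (q * TI n 1) x * 1 \<partial>\<mu> 1) + (\<integral>x. poly (q * TI n 2) x * 1 \<partial>\<mu> 2)"
  by (simp add: form_def)
 have F0: "form (TI n) q \<noteq> 0"
 proof
  assume "form (TI n) q = 0"
  then have "q * TI n 1 = 0" "q * TI n 2 = 0"
   using i0(1)[of 1] i0(1)[of 2] i0(2)[of 1] i0(2)[of 2] \<epsilon>(1) unfolding F by auto
  then have "TI n 1 = 0" "TI n 2 = 0" using \<open>q \<noteq> 0\<close> by simp_all
  then have "form (TI n) (monom 1 (index_size n - 1)) = 0" by (simp add: form_def)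
  moreover have "degree (monom (1::real) (index_size n - 1)) < index_size n" using N0 by (simp add: degree_monom_eq)
  ultimately show False using type_I_form[of "monom 1 (index_size n - 1)" n] by simp
 qed
 have ds: "degree (s 1) \<le> fst n - 1" "degree (s 2) \<le> snd n - 1"
  using s(3)[of 1] s(3)[of 2] dT[of 1] dT[of 2] e by simp_all
 have nz: "s 1 \<noteq> 0" "s 2 \<noteq> 0" using splits_in_nonzero[OF s(1)] by simp_all
 have d0: "degree (s 1 * s 2) = degree (s 1) + degree (s 2)" using nz by (rule degree_mult_eq)
 have dq: "\<not> degree q < index_size n - 1"
 proof
  assume d: "degree q < index_size n - 1"
  then have "form (TI n) q = coeff q (index_size n - 1)" by (intro type_I_form) simp
  then show False using F0 d by (simp add: coeff_eq_0)
 qed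
 then have "q \<noteq> s 1 * s 2" using d0 ds n N by auto
 then obtain \<xi> where xi: "\<xi> \<in> gap \<mu>" "q = s 1 * s 2 * [:-\<xi>, 1:]" and T0: "TI n 1 \<noteq> 0" "TI n 2 \<noteq> 0"
  using q by blast
 have dq': "degree q = degree (s 1) + degree (s 2) + 1"
  unfolding xi(2) using nz by (subst degree_mult_eq) (auto simp: degree_mult_eq)
 have eq: "degree (s 1) = fst n - 1" "degree (s 2) = snd n - 1" "degree q = index_size n - 1"
  using dq dq' ds n N by auto
 have "lead_coeff q = 1" unfolding xi(2)
  by (simp only: lead_coeff_mult splits_in_monic[OF s(1)[of 1]] splits_in_monic[OF s(1)[of 2]] insertI1 insertI2) simp
 then have "form (TI n) q = 1" using type_I_form[of q n] eq(3) N0 by simp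
 then have "\<epsilon> * 1 = \<epsilon> * (\<integral>x. poly (q * TI n 1) x * 1 \<partial>\<mu> 1) + \<epsilon> * (\<integral>x. poly (q * TI n 2) x * 1 \<partial>\<mu> 2)"
  unfolding F distrib_left[symmetric] by (simp only:)
 then have "0 \<le> \<epsilon> * 1" using i0(1)[OF insertI1] i0(1)[OF insertI2[OF insertI1]] by linarith
 then have e1: "\<epsilon> = 1" using \<epsilon>(1) by auto
 have "\<exists>c. TI n k = smult c (s k)" if k: "k \<in> {1,2}" for k
 proof -
  have "TI n k \<noteq> 0" using T0 k by auto
  then obtain u where u: "TI n k = s k * u" using s(2)[OF k] by (auto simp: dvd_def)
  then have "degree (TI n k) = degree (s k) + degree u" using \<open>TI n k \<noteq> 0\<close> by (auto simp: degree_mult_eq)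
  then have "degree u = 0" using dT[OF k] eq e k by auto
  then obtain c where "u = [:c:]" by (auto elim: degree_eq_zeroE)
  then show ?thesis using u by auto
 qed
 then obtain c where c: "\<And>k. k \<in> {1,2} ==> TI n k = smult (c k) (s k)" by metis
 have c0: "c 1 \<noteq> 0" "c 2 \<noteq> 0" using T0 c by auto
 \<comment> \<open>The sign of \<open>c k\<close> is read off at a point of the interval that is no
   zero of \<open>s k\<close>.\<close>
 have pick: "\<exists>x\<in>Delta \<mu> k. poly (s k) x \<noteq> 0" if k: "k \<in> {1,2}" for k
 proof (rule ccontr)
  assume "\<not> ?thesis"
  then have "Delta \<mu> k \<subseteq> {x. poly (s k) x = 0}" by auto
  then show False using infinite_Delta[OF k] poly_roots_finite[OF splits_in_nonzero[OF s(1)[OF k]]] finite_subset by blast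
 qed
 have c2: "0 < c 2"
 proof -
  obtain x where x: "x \<in> Delta \<mu> 2" "poly (s 2) x \<noteq> 0" using pick by blast
  have "0 \<le> poly q x * TP n 2 x" using \<epsilon>(2)[OF _ x(1)] e1 by simp
  also have "... = c 2 * ((poly (s 2) x)^2 * (poly (s 1) x * (x - \<xi>)))"
   by (simp add: c xi(2) power2_eq_square algebra_simps)
  finally have "0 \<le> c 2 * ((poly (s 2) x)^2 * (poly (s 1) x * (x - \<xi>)))" .
  moreover have "0 < (poly (s 2) x)^2 * (poly (s 1) x * (x - \<xi>))"
   using x gap_between(2)[OF xi(1) x(1)] splits_in_pos[OF s(1)[of 1], of x] Delta_less[OF _ x(1)]
   by (intro mult_pos_pos) auto
  ultimately show ?thesis using c0 by (simp add: zero_le_mult_iff)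
 qed
 have c1: "0 < (-1) ^ snd n * c 1"
 proof -
  obtain x where x: "x \<in> Delta \<mu> 1" "poly (s 1) x \<noteq> 0" using pick by blast
  define m where "m = snd n - 1"
  have m: "snd n = Suc m" using n by (simp add: m_def)
  have sg: "(-1) ^ m * ((-1) ^ m * r) = (r::real)" for r by (simp add: minus_one_power_iff)
  have "0 \<le> poly q x * TP n 1 x" using \<epsilon>(2)[OF _ x(1)] e1 by simp
  also have "... = c 1 * (poly (s 1) x)^2 * poly (s 2) x * (x - \<xi>)"
   by (simp add: c xi(2) power2_eq_square algebra_simps)
  also have "... = ((-1) ^ snd n * c 1) * ((poly (s 1) x)^2 * (((-1) ^ m * poly (s 2) x) * (\<xi> - x)))"
   using sg[of 1] unfolding m by (simp add: algebra_simps)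
  finally have "0 \<le> ((-1) ^ snd n * c 1) * ((poly (s 1) x)^2 * (((-1) ^ m * poly (s 2) x) * (\<xi> - x)))" .
  moreover have "0 < (poly (s 1) x)^2 * (((-1) ^ m * poly (s 2) x) * (\<xi> - x))"
   using x gap_between(1)[OF xi(1) x(1)] splits_in_neg[OF s(1)[of 2], of x] Delta_less[OF x(1)] eq(2)
   by (intro mult_pos_pos[of "_^2"] mult_pos_pos[of "_ * _" "\<xi> - x"]) (auto simp: m_def)
  ultimately have "0 \<le> (-1) ^ snd n * c 1" by (simp only: zero_le_mult_iff) linarith
  then show ?thesis using c0 by (metis less_eq_real_def mult_eq_0_iff power_eq_0_iff zero_neq_neg_one)
 qed
 show thesis
 proof (rule that[of c s])
  show "degree (s k) = entry n k - 1" if "k \<in> {1,2}" for k using that eq e by auto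
 qed (use c s(1) c1 c2 in auto)
qed

lemma type_I_nonzero: "fst n > 0 ==> snd n > 0 ==> k \<in> {1,2} ==> TI n k \<noteq> 0"
 using type_I_structure[of n] splits_in_nonzero by (metis (no_types, lifting) insertE insertI1 insertI2 less_irrefl mult_zero_right singletonD smult_eq_0_iff)

text \<open>On \<open>Delta \<mu> k\<close> this is the cofactor of \<open>TI n k\<close> in
  \<open>D_poly\<close>; its positivity makes the absolute values in \<open>S_weight\<close> cancel
  against \<open>D_poly\<close>.\<close>

lemma type_I_sign:
 assumes n: "fst n > 0" "snd n > 0" and xi: "\<xi> \<in> gap \<mu>" and k: "k \<in> {1,2}" and x: "x \<in> Delta \<mu> k"
 shows "0 < (-1) ^ snd n * ((x - \<xi>) * TP n (3 - k) x)"
proof -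
 obtain s c where s: "\<And>k. k \<in> {1,2} ==> TI n k = smult (c k) (s k)"
  "\<And>k. k \<in> {1,2} ==> splits_in (Delta \<mu> k) (s k)" "\<And>k. k \<in> {1,2} ==> degree (s k) = entry n k - 1"
  "0 < c 2" "0 < (-1) ^ snd n * c 1"
  by (rule type_I_structure[OF n]; rule that; assumption)
 consider "k = 1" | "k = 2" using k by auto
 then show ?thesis
 proof cases
  case 1
  define m where "m = snd n - 1"
  have m: "snd n = Suc m" using n by (simp add: m_def)
  have "0 < c 2 * (((-1) ^ m * poly (s 2) x) * (\<xi> - x))"
   using 1 s(3)[of 2] s(4) gap_between(1)[OF xi] splits_in_neg[OF s(2)[of 2], of x] Delta_less x
   by (intro mult_pos_pos[of "c 2"] mult_pos_pos[of "_ * _" "\<xi> - x"]) (auto simp: entry_def m_def)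
  then show ?thesis using 1 s(1)[of 2] unfolding m by (simp add: algebra_simps)
 next
  case 2
  have "0 < ((-1) ^ snd n * c 1) * (poly (s 1) x * (x - \<xi>))"
   using 2 s(5) gap_between(2)[OF xi] splits_in_pos[OF s(2)[of 1], of x] Delta_less x
   by (intro mult_pos_pos[of "_ * _"] mult_pos_pos[of _ "x - \<xi>"]) auto
  then show ?thesis using 2 s(1)[of 1] by (simp add: algebra_simps)
 qed
qed

lemma type_I_nonreal:
 assumes n: "fst n > 0" "snd n > 0" and k: "k \<in> {1,2}" and z: "Im z \<noteq> 0"
 shows "poly (map_poly cor (TI n k)) z \<noteq> 0"
proof -
 obtain s c where s: "\<And>k. k \<in> {1,2} ==> TI n k = smult (c k) (s k)"
  "\<And>k. k \<in> {1,2} ==> splits_in (Delta \<mu> k) (s k)" "\<And>k. k \<in> {1,2} ==> degree (s k) = entry n k - 1"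
  "0 < c 2" "0 < (-1) ^ snd n * c 1"
  by (rule type_I_structure[OF n]; rule that; assumption)
 have "map_poly cor (TI n k) = smult (cor (c k)) (map_poly cor (s k))"
  by (rule poly_eqI) (simp add: s(1)[OF k] coeff_map_poly)
 moreover have "c k \<noteq> 0" using s(4,5) k by auto
 ultimately show ?thesis using splits_in_nonreal[OF s(2)[OF k] z] by simp
qed

lemma zeros_I_Delta:
 assumes n: "fst n > 0" "snd n > 0" and E: "E \<in> zeros_I \<mu> n"
 shows "\<exists>k\<in>{1,2}. E \<in> Delta \<mu> k \<and> TP n k E = 0"
proof -
 obtain s c where s: "\<And>k. k \<in> {1,2} ==> TI n k = smult (c k) (s k)"
  "\<And>k. k \<in> {1,2} ==> splits_in (Delta \<mu> k) (s k)" "\<And>k. k \<in> {1,2} ==> degree (s k) = entry n k - 1"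
  "0 < c 2" "0 < (-1) ^ snd n * c 1"
  by (rule type_I_structure[OF n]; rule that; assumption)
 obtain k where k: "k \<in> {1,2}" "TP n k E = 0" using E unfolding zeros_I_def by auto
 have "c k \<noteq> 0" using s(4,5) k by auto
 then have "poly (s k) E = 0" using k(2) s(1)[OF k(1)] by simp
 then show ?thesis using splits_in_root[OF s(2)[OF k(1)]] k by blast
qed

lemma finite_zeros_I: "fst n > 0 ==> snd n > 0 ==> finite (zeros_I \<mu> n)"
 unfolding zeros_I_def using type_I_nonzero[of n 1] type_I_nonzero[of n 2] by (intro poly_roots_finite) simp

text \<open>These signs beyond the intervals determine the sign of \<open>Fm\<close> at infinity,
  and thereby on the intervals, in \<open>Fm_pos\<close>.\<close>

lemma type_I_sign_at_infinity:
 assumes n: "fst n > 0" "snd n > 0"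
 shows "(\<And>y. y \<in> Delta \<mu> 2 ==> y < x) ==> 0 < TP n 2 x"
  "(\<And>y. y \<in> Delta \<mu> 1 ==> x < y) ==> 0 < (-1) ^ (index_size n - 1) * TP n 1 x"
proof -
 obtain s c where s: "\<And>k. k \<in> {1,2} ==> TI n k = smult (c k) (s k)"
  "\<And>k. k \<in> {1,2} ==> splits_in (Delta \<mu> k) (s k)" "\<And>k. k \<in> {1,2} ==> degree (s k) = entry n k - 1"
  "0 < c 2" "0 < (-1) ^ snd n * c 1"
  by (rule type_I_structure[OF n]; rule that; assumption)
 show "(\<And>y. y \<in> Delta \<mu> 2 ==> y < x) ==> 0 < TP n 2 x"
  using s(1)[of 2] s(4) splits_in_pos[OF s(2)[of 2]] by simp
 assume x: "\<And>y. y \<in> Delta \<mu> 1 ==> x < y"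
 have "index_size n - 1 = snd n + (fst n - 1)" using n by (simp add: index_size_def)
 moreover have "0 < ((-1) ^ snd n * c 1) * ((-1) ^ (fst n - 1) * poly (s 1) x)"
  using s(3)[of 1] s(5) splits_in_neg[OF s(2)[of 1], of x] x
  by (intro mult_pos_pos[of "_ * _"]) (auto simp: entry_def)
 ultimately show "0 < (-1) ^ (index_size n - 1) * TP n 1 x"
  using s(1)[of 1] by (simp add: power_add algebra_simps)
qed

text \<open>\<open>type_II \<mu> n\<close> is orthogonal to component \<open>k\<close> below degree
  \<open>entry n k\<close> and to all of the other component, so a single leading coefficient
  survives.\<close>

lemma form_type_II_component:
 assumes k: "k \<in> {1,2}" and p: "\<And>j. j \<in> {1,2} ==> j \<noteq> k ==> p j = 0 \<or> degree (p j) < entry n j" and pk: "degree (p k) \<le> entry n k"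
 shows "form p (type_II \<mu> n) = coeff (p k) (entry n k) * (\<integral>x. poly (type_II \<mu> n) x * x ^ entry n k \<partial>\<mu> k)"
proof -
 let ?P = "type_II \<mu> n" and ?N = "entry n k"
 have z: "(\<integral>x. poly ?P x * poly (p j) x \<partial>\<mu> j) = 0" if "j \<in> {1,2}" "j \<noteq> k" for j
  using p[OF that] type_II_orth[OF that(1), of "p j" n] by auto
 have "p k - monom (coeff (p k) ?N) ?N = 0 \<or> degree (p k - monom (coeff (p k) ?N) ?N) < ?N"
 proof -
  have "degree (p k - monom (coeff (p k) ?N) ?N) \<le> ?N"
   using pk by (intro degree_diff_le degree_monom_le)
  moreover have "coeff (p k - monom (coeff (p k) ?N) ?N) ?N = 0" by simp
  ultimately show ?thesis by (metis leading_coeff_0_iff le_neq_implies_less)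
 qed
 then have "(\<integral>x. poly ?P x * poly (p k - monom (coeff (p k) ?N) ?N) x \<partial>\<mu> k) = 0"
  using type_II_orth[OF k, of "p k - monom (coeff (p k) ?N) ?N" n] by auto
 moreover have "integrable (\<mu> k) (\<lambda>x. poly ?P x * x ^ ?N)"
  using integrable_poly_mult[OF k, of ?P "monom 1 ?N"] by (simp add: poly_monom)
 ultimately have "(\<integral>x. poly ?P x * poly (p k) x \<partial>\<mu> k) = coeff (p k) ?N * (\<integral>x. poly ?P x * x ^ ?N \<partial>\<mu> k)"
  using integrable_poly_mult[OF k, of ?P "p k"]
  by (simp add: right_diff_distrib poly_monom mult.left_commute[of _ "coeff (p k) ?N"])
 moreover have "form p ?P = (\<integral>x. poly ?P x * poly (p k) x \<partial>\<mu> k)"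
  using z[of 1] z[of 2] k by (auto simp: form_def)
 ultimately show ?thesis by simp
qed

lemma entry_plus_unit:
 "k \<in> {1,2} ==> entry (n + unit_index k) k = Suc (entry n k)"
 "k \<in> {1,2} ==> j \<in> {1,2} ==> j \<noteq> k ==> entry (n + unit_index j) k = entry n k"
 "index_size (n + unit_index j) = Suc (index_size n)"
 by (auto simp: entry_def unit_index_def index_size_def)

text \<open>Evaluating the form of \<open>n + unit_index k\<close> at \<open>type_II \<mu> n\<close>
  gives 1 by normalization; by orthogonality it is a leading coefficient times the norm integral of
  \<open>type_II \<mu> n\<close>.\<close>

lemma type_I_lead:
 assumes k: "k \<in> {1,2}"
 shows "coeff (TI (n + unit_index k) k) (entry n k) * (\<integral>x. poly (type_II \<mu> n) x * x ^ entry n k \<partial>\<mu> k) = 1"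
proof -
 let ?m = "n + unit_index k"
 have m0: "index_size ?m > 0" by (simp add: entry_plus_unit)
 have "form (TI ?m) (type_II \<mu> n) = coeff (type_II \<mu> n) (index_size n)"
  using type_I_form[of "type_II \<mu> n" ?m] by (simp add: entry_plus_unit degree_type_II)
 moreover have "TI ?m j = 0 \<or> degree (TI ?m j) < entry n j" if "j \<in> {1,2}" "j \<noteq> k" for j
  using type_I_degree[OF m0 that(1)] entry_plus_unit(2)[OF that(1) k] that by auto
 moreover have "degree (TI ?m k) \<le> entry n k"
  using type_I_degree[OF m0 k] entry_plus_unit(1)[OF k] by auto
 ultimately show ?thesis
  using form_type_II_component[OF k, of "TI ?m" n] by (simp add: lead_coeff_type_II)
qed

text \<open>The type II recurrence at \<open>n + unit_index k\<close>, integrated against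
  \<open>x ^ entry n k\<close>: every term but the one with index \<open>n\<close> is orthogonal to
  this power. So \<open>a\<close> is a quotient of consecutive norm integrals.\<close>

lemma type_II_moment_recurrence:
 assumes rc: "recurrence_coefficients \<mu> a b" and k: "k \<in> {1,2}"
 shows "(\<integral>x. poly (type_II \<mu> (n + unit_index k)) x * x ^ Suc (entry n k) \<partial>\<mu> k)
  = a (n + unit_index k) k * (\<integral>x. poly (type_II \<mu> n) x * x ^ entry n k \<partial>\<mu> k)"
proof -
 let ?m = "n + unit_index k" and ?x = "monom (1::real) (entry n k)"
 define I where "I P = (\<integral>x. poly P x * poly ?x x \<partial>\<mu> k)" for P
 have I_add: "I (P + Q) = I P + I Q" for P Q
  using integrable_poly_mult[OF k] by (simp add: I_def distrib_right)
 have I_smult: "I (smult c P) = c * I P" for c P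
  by (simp add: I_def mult.assoc)
 have I0: "I (type_II \<mu> l) = 0" if "entry n k < entry l k" for l
  unfolding I_def using that by (intro type_II_orth[OF k] le_less_trans[OF degree_monom_le])
 have "[:0, 1:] * type_II \<mu> ?m = type_II \<mu> (?m + unit_index k) + smult (b ?m k) (type_II \<mu> ?m) +
    (\<Sum>j\<in>{1, 2}. if entry ?m j = 0 then 0 else smult (a ?m j) (type_II \<mu> (?m - unit_index j)))"
  using rc k unfolding recurrence_coefficients_def by blast
 then have "I ([:0, 1:] * type_II \<mu> ?m) = I (type_II \<mu> (?m + unit_index k)) + b ?m k * I (type_II \<mu> ?m) +
    (\<Sum>j\<in>{1, 2}. if entry ?m j = 0 then 0 else a ?m j * I (type_II \<mu> (?m - unit_index j)))"
  by (simp add: I_add I_smult) (simp add: I_def)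
 also have "... = (\<Sum>j\<in>{1, 2}. if entry ?m j = 0 then 0 else a ?m j * I (type_II \<mu> (?m - unit_index j)))"
  using k by (simp add: I0 entry_plus_unit)
 also have "... = (\<Sum>j\<in>{1, 2}. if j = k then a ?m k * I (type_II \<mu> n) else 0)"
 proof (rule sum.cong[OF refl])
  fix j :: nat assume j: "j \<in> {1,2}"
  show "(if entry ?m j = 0 then 0 else a ?m j * I (type_II \<mu> (?m - unit_index j))) =
   (if j = k then a ?m k * I (type_II \<mu> n) else 0)"
  proof (cases "j = k")
   case True
   then show ?thesis using k by (simp add: entry_plus_unit)
  next
   case False
   have "entry n k < entry (?m - unit_index j) k"
    using False j k by (auto simp: entry_def unit_index_def)
   then show ?thesis using False I0 by simp
  qed
 qed
 also have "... = a ?m k * I (type_II \<mu> n)" using k by auto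
 finally show ?thesis by (simp add: I_def poly_monom mult_ac)
qed

text \<open>The type I recurrence is dual to the given type II recurrence. The difference
  \<open>R\<close> of the two sides has the degrees that \<open>form_zero\<close> asks for, because
  the leading coefficients match, and its form annihilates all polynomials of degree below
  \<open>index_size n\<close>.\<close>

theorem type_I_recurrence:
 assumes rc: "recurrence_coefficients \<mu> a b" and i: "i \<in> {1,2}" and m: "fst m > 0" "snd m > 0"
  and n: "n = m + unit_index i" and k: "k \<in> {1,2}"
 shows "[:0,1:] * TI n k = TI m k + smult (b m i) (TI n k) + smult (a n 1) (TI (n + unit_index 1) k)
  + smult (a n 2) (TI (n + unit_index 2) k)"
proof -
 have sn: "index_size n = Suc (index_size m)" by (simp add: n entry_plus_unit)
 have n0: "index_size n > 0" and m0: "index_size m > 0" using sn m by (auto simp: index_size_def)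
 have np: "entry n k > 0" if "k \<in> {1,2}" for k using m by (auto simp: n entry_def unit_index_def)
 have mn: "entry m k \<le> entry n k" for k by (auto simp: n entry_def unit_index_def)
 have p0: "index_size (n + unit_index j) > 0" for j by (simp add: entry_plus_unit)
 define R where "R k = [:0,1:] * TI n k - TI m k - smult (b m i) (TI n k) - smult (a n 1) (TI (n + unit_index 1) k)
  - smult (a n 2) (TI (n + unit_index 2) k)" for k
 have dn: "degree (TI n k) \<le> entry n k - 1" if "k \<in> {1,2}" for k
  using type_I_degree[OF n0 that] by auto
 have "R k = 0"
 proof (rule form_zero[of R n])
  fix k :: nat assume k: "k \<in> {1,2}"
  have d1: "degree ([:0,1:] * TI n k) \<le> entry n k"
   using dn[OF k] np[OF k] degree_mult_le[of "[:0,1:]" "TI n k"] by simp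
  have d2: "degree (TI m k) \<le> entry n k"
   using type_I_degree[OF m0 k] mn[of k] by auto
  have d3: "degree (TI (n + unit_index j) k) \<le> entry n k" if "j \<in> {1,2}" for j
   using type_I_degree[OF p0 k, of j] entry_plus_unit(1)[OF k, of n] entry_plus_unit(2)[OF k that, of n] by (cases "j = k") auto
  have dR: "degree (R k) \<le> entry n k" unfolding R_def
   by (intro degree_diff_le d1 d2 order_trans[OF degree_smult_le d3] order_trans[OF degree_smult_le order_trans[OF dn[OF k]]]) auto
  obtain n' where n': "n = n' + unit_index k"
  proof -
   have "n = (n - unit_index k) + unit_index k"
    using np[of 1] np[of 2] k by (auto simp: unit_index_def entry_def prod_eq_iff)
   then show ?thesis using that by blast
  qed
  have en: "entry n k = Suc (entry n' k)" using k by (simp add: n' entry_plus_unit)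
  define h' where "h' = (\<integral>x. poly (type_II \<mu> n') x * x ^ entry n' k \<partial>\<mu> k)"
  define h where "h = (\<integral>x. poly (type_II \<mu> n) x * x ^ entry n k \<partial>\<mu> k)"
  have l1: "coeff (TI n k) (entry n' k) * h' = 1" using type_I_lead[OF k, of n'] by (simp add: h'_def n')
  have l2: "coeff (TI (n + unit_index k) k) (entry n k) * h = 1" using type_I_lead[OF k, of n] by (simp add: h_def)
  have l3: "h = a n k * h'" using type_II_moment_recurrence[OF rc k, of n'] en by (simp add: h_def h'_def n')
  \<comment> \<open>By \<open>l1\<close> to \<open>l3\<close> both leading coefficients are
    reciprocals of norm integrals whose quotient is \<open>a n k\<close>.\<close>
  have l4: "coeff (TI n k) (entry n' k) = a n k * coeff (TI (n + unit_index k) k) (entry n k)"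
  proof -
   have "h' \<noteq> 0" using l1 by auto
   moreover have "(a n k * coeff (TI (n + unit_index k) k) (entry n k)) * h' = 1" using l2 l3 by (simp add: mult_ac)
   ultimately show ?thesis using l1 by (metis mult_cancel_right)
  qed
  have c0: "coeff (TI m k) (entry n k) = 0" "coeff (TI n k) (entry n k) = 0"
   using type_I_degree[OF m0 k] mn[of k] type_I_degree[OF n0 k] by (auto intro: coeff_eq_0)
  have c1: "coeff (TI (n + unit_index j) k) (entry n k) = 0" if "j \<in> {1,2}" "j \<noteq> k" for j
   using type_I_degree[OF p0 k, of j] entry_plus_unit(2)[OF k that, of n] by (auto intro: coeff_eq_0)
  have "coeff (R k) (entry n k) = coeff (TI n k) (entry n' k) - a n k * coeff (TI (n + unit_index k) k) (entry n k)"
  proof -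
   have "coeff ([:0,1:] * TI n k) (entry n k) = coeff (TI n k) (entry n' k)" by (simp add: en)
   then show ?thesis using c0 c1[of 1] c1[of 2] k unfolding R_def by auto
  qed
  then have "coeff (R k) (entry n k) = 0" using l4 by simp
  then show "R k = 0 \<or> degree (R k) < entry n k"
   using dR by (metis leading_coeff_0_iff le_neq_implies_less)
 next
  fix q :: "real poly" assume q: "degree q < index_size n"
  have FR: "form R q = form (TI n) ([:0,1:] * q) - form (TI m) q - b m i * form (TI n) q
   - a n 1 * form (TI (n + unit_index 1)) q - a n 2 * form (TI (n + unit_index 2)) q" for q
   unfolding R_def by (simp only: form_diff_left form_smult_left form_mult_left)
  have F0: "form (TI (n + unit_index j)) q = 0" if "degree q < index_size n" for j q
   using that by (subst type_I_form) (auto simp: entry_plus_unit intro: coeff_eq_0)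
  \<comment> \<open>Polynomials of degree below \<open>index_size m\<close> together with
    \<open>type_II \<mu> m\<close> span the degrees below \<open>index_size n\<close>; on
    \<open>type_II \<mu> m\<close> the value is computed from the type II recurrence at
    \<open>m\<close>.\<close>
  have FRP: "form R (type_II \<mu> m) = 0"
  proof -
   let ?P = "type_II \<mu> m"
   have "[:0, 1:] * ?P = type_II \<mu> n + smult (b m i) ?P +
    (\<Sum>j\<in>{1, 2}. if entry m j = 0 then 0 else smult (a m j) (type_II \<mu> (m - unit_index j)))"
    using rc i unfolding recurrence_coefficients_def n by blast
   then have "form (TI n) ([:0, 1:] * ?P) = form (TI n) (type_II \<mu> n) + b m i * form (TI n) ?P +
    (\<Sum>j\<in>{1, 2}. if entry m j = 0 then 0 else a m j * form (TI n) (type_II \<mu> (m - unit_index j)))"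
    by (simp add: form_add form_smult)
   moreover have "form (TI l) (type_II \<mu> l) = 0" if "index_size l > 0" for l
   proof -
    have "(\<integral>x. poly (type_II \<mu> l) x * TP l k x \<partial>\<mu> k) = 0" if "k \<in> {1,2}" for k
     using type_I_degree[OF \<open>index_size l > 0\<close> that] type_II_orth[OF that, of "TI l k" l] by auto
    then show ?thesis unfolding form_def by (intro sum.neutral) auto
   qed
   moreover have "form (TI n) (type_II \<mu> (m - unit_index j)) = 0" if "j \<in> {1,2}" for j
   proof -
    have "index_size (m - unit_index j) < index_size m" using m that by (auto simp: index_size_def unit_index_def)
    then show ?thesis using sn by (subst type_I_form) (auto simp: degree_type_II coeff_eq_0)
   qed
   moreover have "form (TI n) ?P = 1"
    using sn by (subst type_I_form) (auto simp: degree_type_II lead_coeff_type_II)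
   ultimately show ?thesis using F0[of ?P] n0 m0 sn by (simp add: FR degree_type_II)
  qed
  have FRr: "form R r = 0" if r: "degree r < index_size m" for r
  proof -
   have "degree ([:0,1:] * r) < index_size n"
    using r sn degree_mult_le[of "[:0,1:]" r] by simp
   then have "form (TI n) ([:0,1:] * r) = coeff ([:0,1:] * r) (index_size m)"
    using sn by (simp add: type_I_form)
   also have "... = form (TI m) r" using r m0 by (cases "index_size m") (simp_all add: type_I_form)
   finally show ?thesis using r sn F0[of r] type_I_form[of r n] by (simp add: FR coeff_eq_0)
  qed
  define r where "r = q - smult (coeff q (index_size m)) (type_II \<mu> m)"
  have "degree r \<le> index_size m" unfolding r_def using q sn
   by (intro degree_diff_le order_trans[OF degree_smult_le]) (auto simp: degree_type_II)
  moreover have "coeff r (index_size m) = 0" by (simp add: r_def lead_coeff_type_II)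
  ultimately have "degree r < index_size m" using m0
   by (metis degree_0 leading_coeff_0_iff le_neq_implies_less)
  then have "form R (r + smult (coeff q (index_size m)) (type_II \<mu> m)) = 0"
   using FRr FRP by (simp add: form_add form_smult)
  then show "form R q = 0" by (simp add: r_def)
 qed (rule k)
 then show ?thesis by (simp add: R_def algebra_simps)
qed

end

section \<open>Positivity of second-kind determinants\<close>

lemma cauchy_transform_tendsto_0:
 fixes f :: "real => real"
 assumes M: "finite_measure M" "sets M = sets borel" and f: "f \<in> borel_measurable borel"
  and B: "AE t in M. \<bar>t\<bar> \<le> B \<and> \<bar>f t\<bar> \<le> C"
 shows "((\<lambda>z::'a::{real_normed_field, banach, second_countable_topology}.
   \<integral>t. of_real (f t) / (z - of_real t) \<partial>M) \<longlongrightarrow> 0) at_infinity"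
proof (rule Lim_null_comparison)
 interpret finite_measure M by (rule M(1))
 have b: "norm (\<integral>t. of_real (f t) / (z - of_real t) \<partial>M) \<le> (\<bar>C\<bar> * measure M (space M)) / (norm z - B)"
  if z: "B < norm z" for z :: 'a
 proof -
  have le: "AE t in M. norm (of_real (f t) / (z - of_real t)) \<le> \<bar>C\<bar> / (norm z - B)"
   using B
  proof eventually_elim
   case (elim t)
   have "norm z - B \<le> norm (z - of_real t)"
    using elim norm_triangle_ineq2[of z "of_real t"] by simp
   then show ?case using elim z by (simp add: norm_divide) (intro frac_le, auto)
  qed
  have "norm (\<integral>t. of_real (f t) / (z - of_real t) \<partial>M) \<le> (\<integral>t. \<bar>C\<bar> / (norm z - B) \<partial>M)"
   by (intro order_trans[OF integral_norm_bound integral_mono_AE'] le) (use z in auto)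
  then show ?thesis by (simp add: mult.commute)
 qed
 show "eventually (\<lambda>z::'a. norm (\<integral>t. of_real (f t) / (z - of_real t) \<partial>M) \<le> (\<bar>C\<bar> * measure M (space M)) / (norm z - B)) at_infinity"
  using b by (auto simp: eventually_at_infinity intro!: exI[of _ "B + 1"])
 show "((\<lambda>z::'a. (\<bar>C\<bar> * measure M (space M)) / (norm z - B)) \<longlongrightarrow> 0) at_infinity"
 proof (rule tendsto_divide_0[OF tendsto_const])
  have "filterlim (\<lambda>z::'a. - B + norm z) at_top at_infinity"
   by (intro filterlim_tendsto_add_at_top[OF tendsto_const] filterlim_norm_at_top)
  then show "filterlim (\<lambda>z::'a. norm z - B) at_infinity at_infinity"
   by (intro filterlim_at_top_imp_at_infinity) simp
 qed
qed

lemma continuous_on_poly_id [simp]: "continuous_on S (poly (p :: 'a::real_normed_field poly))"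
 by (intro continuous_intros)

lemma integral_of_real_field:
 assumes "integrable M f"
 shows "(\<integral>x. (of_real (f x) :: 'a::{real_normed_field, banach, second_countable_topology}) \<partial>M) = of_real (integral\<^sup>L M f)"
 by (rule integral_bounded_linear[OF bounded_linear_of_real assms])

lemma geometric_resolvent:
 fixes z t :: "'a::field"
 assumes "z \<noteq> t"
 shows "z ^ N / (z - t) = (\<Sum>j<N. z ^ (N - Suc j) * t ^ j) + t ^ N / (z - t)"
proof -
 have "(z - t) * (\<Sum>j<N. z ^ (N - Suc j) * t ^ j) = z ^ N - t ^ N"
  using power_diff_sumr2[of t N z] by (simp add: algebra_simps)
 then show ?thesis using assms by (simp add: field_simps)
qed

lemma dependent_pair_solution:
 fixes a b c d :: real
 assumes "a * d = b * c"
 shows "\<exists>u v. (u \<noteq> 0 \<or> v \<noteq> 0) \<and> u * a + v * b = 0 \<and> u * c + v * d = 0"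
proof -
 consider "a = 0" "b = 0" "c = 0" "d = 0" | "a = 0" "b = 0" "c \<noteq> 0 \<or> d \<noteq> 0" | "a \<noteq> 0 \<or> b \<noteq> 0" by blast
 then show ?thesis
 proof cases
  case 1
  then show ?thesis by (intro exI[of _ 1] exI[of _ 0]) simp
 next
  case 2
  then show ?thesis by (intro exI[of _ d] exI[of _ "- c"]) auto
 next
  case 3
  then show ?thesis using assms by (intro exI[of _ b] exI[of _ "- a"]) (auto simp: mult_ac)
 qed
qed

section \<open>Determinants of type I polynomials and second-kind functions\<close>

context angelesco_system
begin

text \<open>The function \<open>type_I_0\<close> for an arbitrary pair of polynomials, so that it
  becomes linear in the pair; parameter and integration variable are exchanged by symmetry of the
  divided difference.\<close>

definition sec_kind :: "(nat => real poly) => real => real" where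
 "sec_kind p x = (\<Sum>k\<in>{1,2}. \<integral>t. poly (sdiv (p k) x) t \<partial>\<mu> k)"

lemma type_I_0_sec_kind: "type_I_0 \<mu> n x = sec_kind (TI n) x"
 by (simp add: type_I_0_def sec_kind_def poly_synthetic_div_commute[of _ x])

lemma sec_kind_add: "sec_kind (\<lambda>k. p k + q k) x = sec_kind p x + sec_kind q x"
 using integrable_mu_poly[of 1] integrable_mu_poly[of 2]
 by (simp add: sec_kind_def synthetic_div_add)

lemma sec_kind_smult: "sec_kind (\<lambda>k. smult c (p k)) x = c * sec_kind p x"
 by (simp add: sec_kind_def synthetic_div_smult distrib_left)

lemma sec_kind_cong: "p 1 = q 1 ==> p 2 = q 2 ==> sec_kind p x = sec_kind q x"
 by (simp add: sec_kind_def)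

lemma poly_synthetic_div_shift: "poly (sdiv (pCons 0 p) x) t = x * poly (sdiv p x) t + poly p (t::real)"
proof -
 have "poly ([:-x, 1:] * sdiv p x + [:poly p x:]) t = poly p t"
  by (simp only: synthetic_div_correct')
 then show ?thesis by (simp add: algebra_simps)
qed

text \<open>The defect \<open>form p 1\<close> vanishes for type I forms of size at least 2, so
  \<open>type_I_0\<close> inherits the recurrence of the polynomials.\<close>

lemma sec_kind_shift: "sec_kind (\<lambda>k. [:0,1:] * p k) x = x * sec_kind p x + form p 1"
 using integrable_mu_poly[of 1] integrable_mu_poly[of 2]
 by (simp add: sec_kind_def form_def poly_synthetic_div_shift distrib_left del: synthetic_div_pCons)

lemma type_I_0_recurrence:
 assumes rc: "recurrence_coefficients \<mu> a b" and i: "i \<in> {1,2}" and m: "fst m > 0" "snd m > 0"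
  and n: "n = m + unit_index i"
 shows "x * type_I_0 \<mu> n x = type_I_0 \<mu> m x + b m i * type_I_0 \<mu> n x + a n 1 * type_I_0 \<mu> (n + unit_index 1) x
  + a n 2 * type_I_0 \<mu> (n + unit_index 2) x"
proof -
 have "form (TI n) 1 = 0"
 proof -
  have "index_size n \<ge> 2" using m by (auto simp: n entry_plus_unit index_size_def)
  then have "form (TI n) 1 = coeff 1 (index_size n - 1)" by (intro type_I_form) simp
  then show ?thesis using \<open>index_size n \<ge> 2\<close> by (simp add: coeff_eq_0)
 qed
 then have "x * sec_kind (TI n) x = sec_kind (\<lambda>k. [:0,1:] * TI n k) x" by (simp only: sec_kind_shift)
 also have "... = sec_kind (\<lambda>k. TI m k + smult (b m i) (TI n k) + smult (a n 1) (TI (n + unit_index 1) k)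
  + smult (a n 2) (TI (n + unit_index 2) k)) x"
  by (intro sec_kind_cong type_I_recurrence[OF rc i m n]) simp_all
 finally show ?thesis by (simp add: type_I_0_sec_kind sec_kind_add sec_kind_smult)
qed

text \<open>Off the intervals this is \<open>TP n k x * mu_hat \<mu> k x\<close> minus the
  second-kind function (see the proof of \<open>Fm_cauchy\<close>); unlike these two terms it makes
  sense on \<open>Delta \<mu> k\<close>.\<close>

definition Rf :: "nat \<times> nat => nat => real => real" where
 "Rf n k x = type_I_0 \<mu> n x - TP n (3 - k) x * mu_hat \<mu> (3 - k) x"

text \<open>The determinant hidden in \<open>Psi_tilde\<close>: on \<open>Delta \<mu> k\<close> the
  two agree up to factors \<open>m_prod\<close>, see \<open>Psi_tilde_Fm\<close>.\<close>

definition Fm :: "nat \<times> nat => nat \<times> nat => nat => real => real" where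
 "Fm m n k x = TP m k x * Rf n k x - TP n k x * Rf m k x"

lemma Fm_self [simp]: "Fm m m k x = 0"
 by (simp add: Fm_def)

lemma Fm_recurrence:
 assumes rc: "recurrence_coefficients \<mu> a b" and i: "i \<in> {1,2}" and m: "fst m > 0" "snd m > 0"
  and n: "n = m + unit_index i" and k: "k \<in> {1,2}"
 shows "x * Fm l n k x = Fm l m k x + b m i * Fm l n k x + a n 1 * Fm l (n + unit_index 1) k x
  + a n 2 * Fm l (n + unit_index 2) k x"
proof -
 have p: "x * TP n j x = TP m j x + b m i * TP n j x + a n 1 * TP (n + unit_index 1) j x
  + a n 2 * TP (n + unit_index 2) j x" if "j \<in> {1,2}" for j
  using arg_cong[OF type_I_recurrence[OF rc i m n that], of "\<lambda>p. poly p x"] by simp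
 have k': "3 - k \<in> {1,2}" using k by auto
 have R: "x * Rf n k x = Rf m k x + b m i * Rf n k x + a n 1 * Rf (n + unit_index 1) k x
  + a n 2 * Rf (n + unit_index 2) k x"
  using type_I_0_recurrence[OF rc i m n, of x] arg_cong[OF p[OF k'], of "\<lambda>r. r * mu_hat \<mu> (3 - k) x"]
  unfolding Rf_def by (simp add: algebra_simps)
 have "x * Fm l n k x = TP l k x * (x * Rf n k x) - (x * TP n k x) * Rf l k x"
  by (simp add: Fm_def algebra_simps)
 also have "... = Fm l m k x + b m i * Fm l n k x + a n 1 * Fm l (n + unit_index 1) k x
  + a n 2 * Fm l (n + unit_index 2) k x"
  unfolding R p[OF k] by (simp add: Fm_def algebra_simps)
 finally show ?thesis .
qed

lemma Delta_other_disjoint: "k \<in> {1,2} ==> x \<in> Delta \<mu> k ==> x \<notin> Delta \<mu> (3 - k)"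
 using Delta_disjoint by auto

lemma other_index: "k \<in> {1,2} ==> 3 - k \<in> {1,2::nat}"
 by auto

lemma integrable_cauchy_kernel:
 fixes f :: "real => real"
 assumes j: "j \<in> {1,2}" and z: "\<And>t. t \<in> Delta \<mu> j ==> z \<noteq> of_real t"
  and f: "f \<in> borel_measurable borel" "continuous_on (Delta \<mu> j) f"
 shows "integrable (\<mu> j) (\<lambda>t. of_real (f t) / (z - of_real t) :: 'a::{real_normed_field, banach, second_countable_topology})"
proof (rule integrable_mu_continuous[OF j])
 show "(\<lambda>t. of_real (f t) / (z - of_real t)) \<in> borel_measurable borel" using f(1) by measurable
 show "continuous_on (Delta \<mu> j) (\<lambda>t. of_real (f t) / (z - of_real t))"
  using z f(2) by (auto intro!: continuous_intros)
qed

text \<open>On the other interval the divided difference splits into two Cauchy kernels and the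
  \<open>mu_hat\<close> terms cancel; on the interval \<open>k\<close> it stays a polynomial, so an
  atom at \<open>x\<close> does no harm.\<close>

lemma Rf_eq:
 assumes k: "k \<in> {1,2}" and x: "x \<notin> Delta \<mu> (3 - k)"
 shows "Rf n k x = (\<integral>t. poly (sdiv (TI n k) x) t \<partial>\<mu> k) - (\<integral>t. TP n (3 - k) t / (x - t) \<partial>\<mu> (3 - k))"
proof -
 let ?j = "3 - k"
 let ?A = "TI n ?j"
 note j = other_index[OF k]
 have i1: "integrable (\<mu> ?j) (\<lambda>t. 1 / (x - t))" "integrable (\<mu> ?j) (\<lambda>t. poly ?A t / (x - t))"
  using integrable_cauchy_kernel[OF j, of x "\<lambda>_. 1"] integrable_cauchy_kernel[OF j, of x "poly ?A"] x
  by (auto intro: continuous_intros)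
 have "(\<integral>t. poly (sdiv ?A x) t \<partial>\<mu> ?j) = (\<integral>t. poly ?A x * (1 / (x - t)) - poly ?A t / (x - t) \<partial>\<mu> ?j)"
 proof (rule integral_mu_cong[OF j])
  fix t assume "t \<in> Delta \<mu> ?j"
  then have "x \<noteq> t" using x by auto
  then show "poly (sdiv ?A x) t = poly ?A x * (1 / (x - t)) - poly ?A t / (x - t)"
   using minus_divide_divide[of "poly ?A x - poly ?A t" "x - t"] by (simp add: poly_synthetic_div_eq diff_divide_distrib)
 qed measurable
 also have "... = poly ?A x * mu_hat \<mu> ?j x - (\<integral>t. poly ?A t / (x - t) \<partial>\<mu> ?j)"
  using i1 by (simp add: mu_hat_def del: times_divide_eq_right)
 finally have "(\<integral>t. poly (sdiv ?A x) t \<partial>\<mu> ?j) = poly ?A x * mu_hat \<mu> ?j x - (\<integral>t. poly ?A t / (x - t) \<partial>\<mu> ?j)" .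
 moreover have "type_I_0 \<mu> n x = (\<integral>t. poly (sdiv (TI n k) x) t \<partial>\<mu> k) + (\<integral>t. poly (sdiv ?A x) t \<partial>\<mu> ?j)"
  using k by (auto simp: type_I_0_sec_kind sec_kind_def)
 ultimately show ?thesis by (simp add: Rf_def)
qed

text \<open>
 If it vanished, a nontrivial combination of the two neighbouring type I forms would have a \<open>k\<close>-th component
 divisible by \<open>t - x\<close>; after division it is a form for the Angelesco system with weight \<open>1 / \<bar>x - t\<bar>\<close>
 on the other interval that is orthogonal to too many polynomials.
\<close>

lemma Fm_nonzero:
 assumes m: "fst m > 0" "snd m > 0" and i: "i \<in> {1,2}" and n: "n = m + unit_index i"
  and k: "k \<in> {1,2}" and x: "x \<notin> Delta \<mu> (3 - k)"
 shows "Fm m n k x \<noteq> 0"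
proof
 let ?j = "3 - k"
 note j = other_index[OF k]
 have sn: "index_size n = Suc (index_size m)" by (simp add: n entry_plus_unit)
 have n0: "index_size n > 0" and m0: "index_size m > 0" using sn m by (auto simp: index_size_def)
 have np: "entry n k > 0" for k using m by (auto simp: n entry_def unit_index_def)
 have mn: "entry m k \<le> entry n k" for k by (auto simp: n entry_def unit_index_def)
 assume "Fm m n k x = 0"
 then have "TP n k x * Rf m k x = TP m k x * Rf n k x" by (simp add: Fm_def)
 from dependent_pair_solution[OF this] obtain u v where uv: "u \<noteq> 0 \<or> v \<noteq> 0"
  "u * TP n k x + v * TP m k x = 0" "u * Rf n k x + v * Rf m k x = 0" by blast
 define p where "p l = smult u (TI n l) + smult v (TI m l)" for l
 have px: "poly (p k) x = 0" using uv(2) by (simp add: p_def)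
 have dp: "p l = 0 \<or> degree (p l) < entry n l" if "l \<in> {1,2}" for l
 proof -
  have "degree (smult u (TI n l)) < entry n l" "degree (smult v (TI m l)) < entry n l"
   using type_I_degree[OF n0 that] type_I_degree[OF m0 that] np[of l] mn[of l]
   by (auto intro: le_less_trans[OF degree_smult_le])
  then show ?thesis unfolding p_def by (intro disjI2 degree_add_less)
 qed
 \<comment> \<open>\<open>x - t\<close> has no zero on the other interval, so its sign
   \<open>\<sigma>\<close> is constant there and
   \<open>\<bar>x - t\<bar> = \<sigma> * (x - t)\<close>.\<close>
 obtain \<sigma> where \<sigma>: "\<sigma> \<in> {1,-1::real}" "\<forall>t\<in>Delta \<mu> ?j. 0 < \<sigma> * (x - t)"
 proof -
  have "\<exists>\<sigma>\<in>{1,-1::real}. \<forall>t\<in>Delta \<mu> ?j. 0 < \<sigma> * (x - t)"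
   using x by (intro nonzero_const_sign connected_Delta continuous_intros) auto
  then show ?thesis using that by blast
 qed
 \<comment> \<open>Both components of \<open>p\<close> divided by \<open>t - x\<close>: exactly for
   \<open>k\<close>; for the other index the size of the divisor goes into the weight and its sign
   into the polynomial.\<close>
 define C where "C l = (if l = k then sdiv (p k) x else smult (- \<sigma>) (p l))" for l
 define w :: "nat => real => real" where "w l t = (if l = k then 1 else 1 / \<bar>x - t\<bar>)" for l t
 define N where "N l = (if l = k then entry n k - 1 else entry n l)" for l
 have cpt: "compact (Delta \<mu> ?j)" by (rule compact_Delta[OF j])
 have "continuous_on (Delta \<mu> ?j) (\<lambda>t. 1 / \<bar>x - t\<bar>)" using x by (auto intro!: continuous_intros)
 then have "bounded ((\<lambda>t. 1 / \<bar>x - t\<bar>) ` Delta \<mu> ?j)"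
  using cpt compact_continuous_image compact_imp_bounded by blast
 then obtain B where B: "\<And>t. t \<in> Delta \<mu> ?j ==> 1 / \<bar>x - t\<bar> \<le> B" unfolding bounded_iff by (auto simp: abs_le_iff)
 have ne: "l \<in> {1,2} ==> l \<noteq> k ==> l = ?j" for l using k by auto
 have z: "C l = 0" if "l \<in> {1,2}" for l
 proof (rule orthogonal_form_zero[of C N w "max 1 B"])
  fix l :: nat assume l: "l \<in> {1,2}"
  show "C l = 0 \<or> degree (C l) < N l"
  proof (cases "l = k")
   case True
   show ?thesis using dp[OF k] unfolding C_def N_def True
    by (cases "degree (p k) = 0") (auto simp: synthetic_div_eq_0_iff degree_synthetic_div)
  next
   case False
   then show ?thesis using dp[OF l] by (auto simp: C_def N_def)
  qed
  show "w l \<in> borel_measurable borel" unfolding w_def by (cases "l = k") simp_all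
  fix t assume t: "t \<in> Delta \<mu> l"
  show "0 < w l t" "w l t \<le> max 1 B"
   using t ne[OF l] x B by (auto simp: w_def le_max_iff_disj)
 next
  fix q :: "real poly" assume q: "degree q < N 1 + N 2"
  then have dq: "degree q < index_size m"
   using np[of 1] np[of 2] k sn by (auto simp: N_def index_size_def entry_def split: if_splits)
  \<comment> \<open>In \<open>q t = q x + (t - x) * q1 t\<close> the constant meets the second-kind
    part of \<open>p\<close>, which vanishes by the choice of \<open>u\<close> and \<open>v\<close>,
    and \<open>q1\<close> meets \<open>p\<close> itself, which is orthogonal to degrees below
    \<open>index_size m - 1\<close>.\<close>
  define q1 where "q1 = sdiv q x"
  have q1: "q = [:poly q x:] + [:-x, 1:] * q1" unfolding q1_def by (rule degree_poly_minus_value)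
  have dq1: "degree q1 < index_size m - 1 \<or> q1 = 0"
   using dq by (auto simp: q1_def degree_synthetic_div synthetic_div_eq_0_iff)
  have pq: "poly q t = poly q x + (t - x) * poly q1 t" for t
   by (subst (1) q1) (simp add: algebra_simps)
  have pk: "poly (p k) t = (t - x) * poly (sdiv (p k) x) t" for t
   by (subst degree_poly_minus_value[of "p k" x]) (simp add: px algebra_simps)
  have e1: "(\<integral>t. poly q t * poly (C k) t * w k t \<partial>\<mu> k) = poly q x * (\<integral>t. poly (sdiv (p k) x) t \<partial>\<mu> k) + (\<integral>t. poly q1 t * poly (p k) t \<partial>\<mu> k)"
  proof -
   have "(\<integral>t. poly q t * poly (C k) t * w k t \<partial>\<mu> k) = (\<integral>t. poly q x * poly (sdiv (p k) x) t + poly q1 t * poly (p k) t \<partial>\<mu> k)"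
   proof (intro Bochner_Integration.integral_cong refl)
    fix t
    show "poly q t * poly (C k) t * w k t = poly q x * poly (sdiv (p k) x) t + poly q1 t * poly (p k) t"
     unfolding pq[of t] pk[of t] by (simp add: C_def w_def algebra_simps)
   qed
   also have "... = poly q x * (\<integral>t. poly (sdiv (p k) x) t \<partial>\<mu> k) + (\<integral>t. poly q1 t * poly (p k) t \<partial>\<mu> k)"
    using integrable_poly_mult[OF k] integrable_mu_poly[OF k] by simp
   finally show ?thesis .
  qed
  have i2: "integrable (\<mu> ?j) (\<lambda>t. poly (p ?j) t / (x - t))" for p
   using integrable_cauchy_kernel[OF j, of x "poly (p ?j)"] x by (auto intro: continuous_intros)
  have e2: "(\<integral>t. poly q t * poly (C ?j) t * w ?j t \<partial>\<mu> ?j) = - (poly q x * (\<integral>t. poly (p ?j) t / (x - t) \<partial>\<mu> ?j)) + (\<integral>t. poly q1 t * poly (p ?j) t \<partial>\<mu> ?j)"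
  proof -
   have "(\<integral>t. poly q t * poly (C ?j) t * w ?j t \<partial>\<mu> ?j) = (\<integral>t. - (poly q x * (poly (p ?j) t / (x - t))) + poly q1 t * poly (p ?j) t \<partial>\<mu> ?j)"
   proof (rule integral_mu_cong[OF j])
    fix t assume t: "t \<in> Delta \<mu> ?j"
    have "?j \<noteq> k" using k by auto
    have "\<bar>x - t\<bar> = \<sigma> * (x - t)" using \<sigma> t by (auto simp: abs_if)
    moreover have "x - t \<noteq> 0" "\<sigma> \<noteq> 0" using t x \<sigma>(1) by auto
    ultimately show "poly q t * poly (C ?j) t * w ?j t = - (poly q x * (poly (p ?j) t / (x - t))) + poly q1 t * poly (p ?j) t"
     using \<open>?j \<noteq> k\<close> unfolding C_def w_def pq[of t] by (simp add: divide_simps) (simp add: algebra_simps)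
   qed (simp_all add: w_def)
   also have "... = - (poly q x * (\<integral>t. poly (p ?j) t / (x - t) \<partial>\<mu> ?j)) + (\<integral>t. poly q1 t * poly (p ?j) t \<partial>\<mu> ?j)"
    using i2[of p] integrable_poly_mult[OF j] by (simp del: times_divide_eq_right)
   finally show ?thesis .
  qed
  have R: "(\<integral>t. poly (sdiv (p k) x) t \<partial>\<mu> k) - (\<integral>t. poly (p ?j) t / (x - t) \<partial>\<mu> ?j) = 0"
  proof -
   have "(\<integral>t. poly (sdiv (p k) x) t \<partial>\<mu> k) = u * (\<integral>t. poly (sdiv (TI n k) x) t \<partial>\<mu> k) + v * (\<integral>t. poly (sdiv (TI m k) x) t \<partial>\<mu> k)"
    using integrable_mu_poly[OF k] by (simp add: p_def synthetic_div_add synthetic_div_smult)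
   moreover have "(\<integral>t. poly (p ?j) t / (x - t) \<partial>\<mu> ?j) = u * (\<integral>t. poly (TI n ?j) t / (x - t) \<partial>\<mu> ?j) + v * (\<integral>t. poly (TI m ?j) t / (x - t) \<partial>\<mu> ?j)"
    using i2[of "TI n"] i2[of "TI m"] by (simp add: p_def add_divide_distrib flip: times_divide_eq_right)
   ultimately show ?thesis using uv(3) unfolding Rf_eq[OF k x] by (simp add: algebra_simps)
  qed
  have F: "(\<integral>t. poly q1 t * poly (p k) t \<partial>\<mu> k) + (\<integral>t. poly q1 t * poly (p ?j) t \<partial>\<mu> ?j) = form p q1"
   using k by (auto simp: form_def)
  have "form p q1 = u * form (TI n) q1 + v * form (TI m) q1"
   unfolding p_def by (simp only: form_add_left form_smult_left)
  also have "... = 0"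
  proof (cases "q1 = 0")
   case False
   then have "degree q1 < index_size m - 1" using dq1 by simp
   then show ?thesis using sn by (simp add: type_I_form coeff_eq_0)
  qed simp
  finally have F0: "form p q1 = 0" .
  have "(\<Sum>l\<in>{1,2}. \<integral>t. poly q t * poly (C l) t * w l t \<partial>\<mu> l) = (\<integral>t. poly q t * poly (C k) t * w k t \<partial>\<mu> k) + (\<integral>t. poly q t * poly (C ?j) t * w ?j t \<partial>\<mu> ?j)"
   using k by auto
  also have "... = poly q x * ((\<integral>t. poly (sdiv (p k) x) t \<partial>\<mu> k) - (\<integral>t. poly (p ?j) t / (x - t) \<partial>\<mu> ?j)) + form p q1"
   unfolding e1 e2 F[symmetric] by (simp add: algebra_simps)
  finally show "(\<Sum>l\<in>{1,2}. \<integral>t. poly q t * poly (C l) t * w l t \<partial>\<mu> l) = 0" using R F0 by simp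
 qed (rule that)
 have "p l = 0" if l: "l \<in> {1,2}" for l
 proof (cases "l = k")
  case True
  then show ?thesis using z[OF k] synthetic_div_correct'[of x "p k"] px by (simp add: C_def)
 next
  case False
  then show ?thesis using z[OF l] \<sigma>(1) by (auto simp: C_def)
 qed
 then have fp: "form p q = 0" for q by (simp add: form_def)
 have fp': "u * form (TI n) q + v * form (TI m) q = 0" for q
  using fp[of q] unfolding p_def by (simp only: form_add_left form_smult_left)
 \<comment> \<open>The form of \<open>n\<close> annihilates
   \<open>monom 1 (index_size m - 1)\<close> and that of \<open>m\<close> does not, which gives
   \<open>v = 0\<close>; the next power then gives \<open>u = 0\<close>.\<close>
 have "v = 0"
 proof -
  let ?q = "monom (1::real) (index_size m - 1)"
  have "form (TI n) ?q = 0" "form (TI m) ?q = 1"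
   using sn m0 by (simp_all add: type_I_form degree_monom_eq coeff_eq_0)
  then show ?thesis using fp'[of ?q] by simp
 qed
 moreover have "u = 0"
 proof -
  let ?q = "monom (1::real) (index_size m)"
  have "form (TI n) ?q = 1"
   using sn m0 by (simp add: type_I_form degree_monom_eq)
  then show ?thesis using fp'[of ?q] \<open>v = 0\<close> by simp
 qed
 ultimately show False using uv(1) by simp
qed

text \<open>The second-kind function with open argument type: real arguments serve for the sign of
  \<open>Fm\<close> at infinity, complex ones give \<open>L_fun\<close>.\<close>

definition cauchy_I :: "nat \<times> nat => 'a => 'a::{real_normed_field, banach, second_countable_topology}" where
 "cauchy_I n z = (\<Sum>k\<in>{1,2}. \<integral>t. of_real (TP n k t) / (z - of_real t) \<partial>\<mu> k)"

definition off_Delta :: "'a::real_normed_field => bool" where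
 "off_Delta z \<longleftrightarrow> (\<forall>k\<in>{1,2}. \<forall>t\<in>Delta \<mu> k. z \<noteq> of_real t)"

lemma Delta_norm_bound: "\<exists>B. \<forall>k\<in>{1,2}. \<forall>t\<in>Delta \<mu> k. \<bar>t\<bar> \<le> B"
proof -
 have "bounded (DD)"
  using compact_Delta[of 1] compact_Delta[of 2] by (simp add: compact_imp_bounded)
 then show ?thesis unfolding bounded_iff by auto
qed

lemma eventually_off_Delta: "eventually (off_Delta :: 'a::real_normed_field => bool) at_infinity"
proof -
 obtain B where B: "\<And>k t. k \<in> {1,2} ==> t \<in> Delta \<mu> k ==> \<bar>t\<bar> \<le> B" using Delta_norm_bound by blast
 show ?thesis unfolding eventually_at_infinity off_Delta_def
 proof (intro exI[of _ "B + 1"] allI impI ballI notI)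
  fix z :: 'a and k t assume "B + 1 \<le> norm z" "k \<in> {1,2}" "t \<in> Delta \<mu> k" "z = of_real t"
  then show False using B[of k t] by simp
 qed
qed

text \<open>In the expansion of \<open>1 / (z - t)\<close> to order \<open>index_size n\<close> the
  type I conditions annihilate all moments but the last, which is 1. So the decay at infinity has
  the exact order \<open>index_size n\<close>.\<close>

lemma cauchy_I_expansion:
 fixes z :: "'a::{real_normed_field, banach, second_countable_topology}"
 assumes N: "index_size n > 0" and z: "off_Delta z"
 shows "z ^ index_size n * cauchy_I n z = 1 + (\<Sum>k\<in>{1,2}. \<integral>t. of_real (t ^ index_size n * TP n k t) / (z - of_real t) \<partial>\<mu> k)"
proof -
 let ?N = "index_size n"
 have a: "z ^ ?N * (\<integral>t. of_real (TP n k t) / (z - of_real t) \<partial>\<mu> k) =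
  (\<Sum>j<?N. z ^ (?N - Suc j) * of_real (\<integral>t. poly (monom 1 j) t * TP n k t \<partial>\<mu> k)) +
  (\<integral>t. of_real (t ^ ?N * TP n k t) / (z - of_real t) \<partial>\<mu> k)" if k: "k \<in> {1,2}" for k
 proof -
  have zt: "t \<in> Delta \<mu> k ==> z \<noteq> of_real t" for t using z k unfolding off_Delta_def by blast
  have i1: "integrable (\<mu> k) (\<lambda>t. of_real (t ^ ?N * TP n k t) / (z - of_real t))"
   by (rule integrable_cauchy_kernel[OF k zt]) (auto intro!: continuous_intros)
  have i2: "integrable (\<mu> k) (\<lambda>t. poly (monom 1 j) t * TP n k t)" for j by (rule integrable_poly_mult[OF k])
  then have i3: "integrable (\<mu> k) (\<lambda>t. of_real (poly (monom 1 j) t * TP n k t) :: 'a)" for j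
   by (rule integrable_of_real)
  have "z ^ ?N * (\<integral>t. of_real (TP n k t) / (z - of_real t) \<partial>\<mu> k) = (\<integral>t. z ^ ?N * (of_real (TP n k t) / (z - of_real t)) \<partial>\<mu> k)"
   by (simp del: times_divide_eq_right)
  also have "... = (\<integral>t. (\<Sum>j<?N. z ^ (?N - Suc j) * of_real (poly (monom 1 j) t * TP n k t)) + of_real (t ^ ?N * TP n k t) / (z - of_real t) \<partial>\<mu> k)"
  proof (rule integral_mu_cong[OF k])
   fix t assume "t \<in> Delta \<mu> k"
   from geometric_resolvent[OF zt[OF this], of ?N]
   have "z ^ ?N * (of_real (TP n k t) / (z - of_real t)) = ((\<Sum>j<?N. z ^ (?N - Suc j) * of_real t ^ j) + of_real t ^ ?N / (z - of_real t)) * of_real (TP n k t)"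
    by (metis (no_types, lifting) mult.commute times_divide_eq_right)
   also have "... = (\<Sum>j<?N. z ^ (?N - Suc j) * of_real (poly (monom 1 j) t * TP n k t)) + of_real (t ^ ?N * TP n k t) / (z - of_real t)"
    by (simp add: distrib_left sum_distrib_left poly_monom mult_ac)
   finally show "z ^ ?N * (of_real (TP n k t) / (z - of_real t)) = (\<Sum>j<?N. z ^ (?N - Suc j) * of_real (poly (monom 1 j) t * TP n k t)) + of_real (t ^ ?N * TP n k t) / (z - of_real t)" .
  qed measurable
  also have "... = (\<Sum>j<?N. z ^ (?N - Suc j) * (\<integral>t. of_real (poly (monom 1 j) t * TP n k t) \<partial>\<mu> k)) + (\<integral>t. of_real (t ^ ?N * TP n k t) / (z - of_real t) \<partial>\<mu> k)"
   using i1 i3 by (subst Bochner_Integration.integral_add) (auto simp del: of_real_mult intro!: Bochner_Integration.integrable_sum)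
  finally show ?thesis using integral_of_real_field[OF i2, where 'a='a] by (simp only:)
 qed
 have "(\<Sum>k\<in>{1,2}. \<Sum>j<?N. z ^ (?N - Suc j) * of_real (\<integral>t. poly (monom 1 j) t * TP n k t \<partial>\<mu> k))
  = (\<Sum>j<?N. z ^ (?N - Suc j) * of_real (form (TI n) (monom 1 j)))"
  by (simp add: form_def distrib_left sum.distrib)
 also have "... = (\<Sum>j<?N. if j = ?N - 1 then 1 else 0)"
  by (rule sum.cong) (auto simp: type_I_form degree_monom_eq)
 also have "... = 1" using N by simp
 finally have e: "(\<Sum>k\<in>{1,2}. \<Sum>j<?N. z ^ (?N - Suc j) * of_real (\<integral>t. poly (monom 1 j) t * TP n k t \<partial>\<mu> k)) = 1" .
 show ?thesis unfolding cauchy_I_def sum_distrib_left e[symmetric] sum.distrib[symmetric]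
  by (intro sum.cong refl a)
qed

lemma cauchy_mu_tendsto_0:
 assumes k: "k \<in> {1,2}"
 shows "((\<lambda>z::'a::{real_normed_field, banach, second_countable_topology}.
   \<integral>t. of_real (poly p t) / (z - of_real t) \<partial>\<mu> k) \<longlongrightarrow> 0) at_infinity"
proof -
 obtain B where B: "\<And>t. t \<in> Delta \<mu> k ==> \<bar>t\<bar> \<le> B" using Delta_norm_bound k by blast
 have "bounded (poly p ` Delta \<mu> k)"
  by (intro compact_imp_bounded compact_continuous_image compact_Delta k) simp
 then obtain C where C: "\<And>x. x \<in> Delta \<mu> k ==> \<bar>poly p x\<bar> \<le> C" unfolding bounded_iff by auto
 show ?thesis
 proof (rule cauchy_transform_tendsto_0[OF finite_mu[OF k] sets_mu[OF k]])
  show "AE t in \<mu> k. \<bar>t\<bar> \<le> B \<and> \<bar>poly p t\<bar> \<le> C"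
   using AE_mu[OF k] by eventually_elim (simp add: B C)
 qed simp
qed

lemma cauchy_I_asymptotics:
 assumes N: "index_size n > 0"
 shows "((\<lambda>z::'a::{real_normed_field, banach, second_countable_topology}. z ^ index_size n * cauchy_I n z) \<longlongrightarrow> 1) at_infinity"
proof -
 have "((\<lambda>z::'a. 1 + (\<Sum>k\<in>{1,2}. \<integral>t. of_real (poly (monom 1 (index_size n) * TI n k) t) / (z - of_real t) \<partial>\<mu> k)) \<longlongrightarrow> 1 + (\<Sum>k\<in>{1,2::nat}. 0)) at_infinity"
  by (intro tendsto_add tendsto_const tendsto_sum cauchy_mu_tendsto_0)
 then have "((\<lambda>z::'a. 1 + (\<Sum>k\<in>{1,2}. \<integral>t. of_real (t ^ index_size n * TP n k t) / (z - of_real t) \<partial>\<mu> k)) \<longlongrightarrow> 1) at_infinity"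
  by (simp only: poly_mult poly_monom) simp
 then show ?thesis
  by (rule Lim_transform_eventually[OF _ eventually_mono[OF eventually_off_Delta]]) (rule cauchy_I_expansion[OF N, symmetric])
qed

text \<open>The terms with \<open>mu_hat \<mu> k\<close> are a common multiple of the polynomial
  column and drop out of the determinant.\<close>

lemma Fm_cauchy:
 fixes x :: real
 assumes k: "k \<in> {1,2}" and x: "off_Delta x"
 shows "Fm m n k x = TP n k x * cauchy_I m x - TP m k x * cauchy_I n x"
proof -
 have xt: "x \<notin> Delta \<mu> j" if "j \<in> {1,2}" for j using x that unfolding off_Delta_def by auto
 have R: "Rf n k x = TP n k x * mu_hat \<mu> k x - cauchy_I n x" for n
 proof -
  let ?A = "TI n k"
  have i1: "integrable (\<mu> k) (\<lambda>t. 1 / (x - t))" "integrable (\<mu> k) (\<lambda>t. poly ?A t / (x - t))"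
   using integrable_cauchy_kernel[OF k, of x "\<lambda>_. 1"] integrable_cauchy_kernel[OF k, of x "poly ?A"] xt[OF k]
   by (auto intro: continuous_intros)
  have "(\<integral>t. poly (sdiv ?A x) t \<partial>\<mu> k) = (\<integral>t. poly ?A x * (1 / (x - t)) - poly ?A t / (x - t) \<partial>\<mu> k)"
  proof (rule integral_mu_cong[OF k])
   fix t assume "t \<in> Delta \<mu> k"
   then have "x \<noteq> t" using xt[OF k] by auto
   then show "poly (sdiv ?A x) t = poly ?A x * (1 / (x - t)) - poly ?A t / (x - t)"
    using minus_divide_divide[of "poly ?A x - poly ?A t" "x - t"] by (simp add: poly_synthetic_div_eq diff_divide_distrib)
  qed measurable
  also have "... = poly ?A x * mu_hat \<mu> k x - (\<integral>t. poly ?A t / (x - t) \<partial>\<mu> k)"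
   using i1 by (simp add: mu_hat_def del: times_divide_eq_right)
  finally show ?thesis using k unfolding Rf_eq[OF k xt[OF other_index[OF k]]] cauchy_I_def by auto
 qed
 show ?thesis by (simp add: Fm_def R algebra_simps)
qed

lemma poly_type_I_eventually_nonzero:
 "fst n > 0 ==> snd n > 0 ==> k \<in> {1,2} ==> eventually (\<lambda>x::real. TP n k x \<noteq> 0) at_infinity"
 using type_I_nonzero by (intro poly_eventually_not_zero) simp

lemma degree_type_I: "fst n > 0 ==> snd n > 0 ==> k \<in> {1,2} ==> degree (TI n k) = entry n k - 1"
proof -
 assume n: "fst n > 0" "snd n > 0" and k: "k \<in> {1,2}"
 obtain s c where s: "\<And>k. k \<in> {1,2} ==> TI n k = smult (c k) (s k)"
  "\<And>k. k \<in> {1,2} ==> splits_in (Delta \<mu> k) (s k)" "\<And>k. k \<in> {1,2} ==> degree (s k) = entry n k - 1"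
  "0 < c 2" "0 < (-1) ^ snd n * c 1"
  by (rule type_I_structure[OF n]; rule that; assumption)
 then show ?thesis using k by auto
qed

text \<open>Of the two products in \<open>Fm_cauchy\<close> the one with \<open>cauchy_I m\<close>
  dominates: \<open>cauchy_I n\<close> decays one order faster, and the degree of
  \<open>TI m k\<close> does not exceed that of \<open>TI n k\<close>.\<close>

lemma Fm_asymptotics:
 assumes m: "fst m > 0" "snd m > 0" and i: "i \<in> {1,2}" and n: "n = m + unit_index i" and k: "k \<in> {1,2}"
 shows "((\<lambda>x. x ^ index_size m * Fm m n k x / TP n k x) \<longlongrightarrow> 1) at_infinity"
proof -
 have sn: "index_size n = Suc (index_size m)" by (simp add: n entry_plus_unit)
 have n0: "index_size n > 0" and m0: "index_size m > 0" using sn m by (auto simp: index_size_def)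
 have np: "fst n > 0" "snd n > 0" using m by (auto simp: n)
 have mn: "entry m k \<le> entry n k" for k by (auto simp: n entry_def unit_index_def)
 \<comment> \<open>The factor \<open>x\<close> comes from
   \<open>x ^ index_size n = x * x ^ index_size m\<close>.\<close>
 let ?X = "[:0,1:] * TI n k"
 have Xd: "degree (TI m k) < degree ?X"
  using degree_type_I[OF m k] degree_type_I[OF np k] type_I_nonzero[OF np k] mn[of k] by (subst degree_mult_eq) auto
 have "((\<lambda>x. x ^ index_size m * cauchy_I m x - (TP m k x / poly ?X x) * (x ^ index_size n * cauchy_I n x)) \<longlongrightarrow> 1 - 0 * 1) at_infinity"
  by (intro tendsto_diff tendsto_mult cauchy_I_asymptotics m0 n0 poly_divide_tendsto_0_at_infinity Xd)
 then have L: "((\<lambda>x. x ^ index_size m * cauchy_I m x - (TP m k x / poly ?X x) * (x ^ index_size n * cauchy_I n x)) \<longlongrightarrow> 1) at_infinity"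
  by simp
 have nz: "eventually (\<lambda>x::real. poly [:0,1:] x \<noteq> 0) at_infinity" by (rule poly_eventually_not_zero) simp
 have off: "eventually (off_Delta :: real => bool) at_infinity" by (rule eventually_off_Delta)
 show ?thesis
 proof (rule Lim_transform_eventually[OF L])
  show "eventually (\<lambda>x. x ^ index_size m * cauchy_I m x - (TP m k x / poly ?X x) * (x ^ index_size n * cauchy_I n x)
   = x ^ index_size m * Fm m n k x / TP n k x) at_infinity"
   using nz off poly_type_I_eventually_nonzero[OF np k]
  proof eventually_elim
   case (elim x)
   then show ?case by (simp add: Fm_cauchy[OF k] sn field_simps)
  qed
 qed
qed

text \<open>\<open>type_I_0\<close> is a polynomial in \<open>x\<close>, and \<open>mu_hat\<close>
  is continuous off its interval by dominated convergence.\<close>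

lemma continuous_on_Fm:
 assumes k: "k \<in> {1,2}"
 shows "continuous_on (- Delta \<mu> (3 - k)) (Fm m n k)"
proof -
 note j = other_index[OF k]
 have type0: "continuous_on S (type_I_0 \<mu> n)" for n S
 proof -
  have "type_I_0 \<mu> n = (\<lambda>x. \<Sum>k\<in>{1,2}. \<Sum>i\<le>degree (TI n k) - 1. (\<integral>t. coeff (sdiv (TI n k) t) i \<partial>\<mu> k) * x ^ i)"
  proof (rule ext)
   fix x
   have "(\<integral>t. poly (sdiv (TI n k) t) x \<partial>\<mu> k) = (\<Sum>i\<le>degree (TI n k) - 1. (\<integral>t. coeff (sdiv (TI n k) t) i \<partial>\<mu> k) * x ^ i)"
    if k: "k \<in> {1,2}" for k
   proof -
    have c: "continuous_on S (\<lambda>t. coeff (sdiv p t) i)" for S and p :: "real poly" and i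
    proof (induction p arbitrary: i)
     case (pCons a p)
     then show ?case by (cases i) (auto simp: coeff_pCons intro: continuous_intros)
    qed simp
    have i: "integrable (\<mu> k) (\<lambda>t. coeff (sdiv (TI n k) t) i)" for i
     by (rule integrable_mu_continuous[OF k]) (auto intro: c borel_measurable_continuous_onI)
    have "poly (sdiv (TI n k) t) x = (\<Sum>i\<le>degree (TI n k) - 1. coeff (sdiv (TI n k) t) i * x ^ i)" for t
     by (simp add: poly_altdef degree_synthetic_div)
    then show ?thesis using i by (simp add: Bochner_Integration.integral_sum)
   qed
   then show "type_I_0 \<mu> n x = (\<Sum>k\<in>{1,2}. \<Sum>i\<le>degree (TI n k) - 1. (\<integral>t. coeff (sdiv (TI n k) t) i \<partial>\<mu> k) * x ^ i)"
    unfolding type_I_0_def by (intro sum.cong) auto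
  qed
  then show ?thesis by (simp only:) (intro continuous_intros)
 qed
 have cl: "closed (Delta \<mu> (3 - k))" by (rule compact_imp_closed[OF compact_Delta[OF j]])
 have mh: "continuous_on (- Delta \<mu> (3 - k)) (mu_hat \<mu> (3 - k))"
  unfolding continuous_on_sequentially comp_def mu_hat_def
 proof (intro allI ballI impI, elim conjE)
  fix X :: "nat => real" and a assume a: "a \<in> - Delta \<mu> (3 - k)" and X: "\<forall>n. X n \<in> - Delta \<mu> (3 - k)" "X \<longlonglongrightarrow> a"
  obtain d where d: "d > 0" "\<And>t. t \<in> Delta \<mu> (3 - k) ==> d \<le> dist a t"
   using separate_point_closed[OF cl, of a] a by blast
  have "eventually (\<lambda>n. dist (X n) a < d / 2) sequentially" using X(2) d(1) by (intro tendstoD) auto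
  then obtain n0 where n0: "\<And>n. n \<ge> n0 ==> dist (X n) a < d / 2" unfolding eventually_sequentially by blast
  have "(\<lambda>n. \<integral>t. 1 / (X (n + n0) - t) \<partial>\<mu> (3 - k)) \<longlonglongrightarrow> (\<integral>t. 1 / (a - t) \<partial>\<mu> (3 - k))"
  proof (rule integral_dominated_convergence[where w="\<lambda>_. 2 / d"])
   show "integrable (\<mu> (3 - k)) (\<lambda>_. 2 / d)" by (rule integrable_mu[OF j, of _ "\<bar>2 / d\<bar>"]) auto
   show "AE t in \<mu> (3 - k). (\<lambda>n. 1 / (X (n + n0) - t)) \<longlonglongrightarrow> 1 / (a - t)"
    using AE_mu[OF j] by eventually_elim (use a in \<open>auto intro!: tendsto_intros LIMSEQ_ignore_initial_segment[OF X(2)]\<close>)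
   show "AE t in \<mu> (3 - k). norm (1 / (X (n + n0) - t)) \<le> 2 / d" for n
    using AE_mu[OF j]
   proof eventually_elim
    case (elim t)
    have "d / 2 \<le> \<bar>X (n + n0) - t\<bar>" using d(2)[OF elim] n0[of "n + n0"] by (auto simp: dist_real_def abs_if split: if_splits)
    then have "1 / \<bar>X (n + n0) - t\<bar> \<le> 1 / (d / 2)" using d(1) by (intro frac_le) auto
    then show ?case by simp
   qed
  qed (simp_all add: measurable_cong_sets[OF sets_mu[OF j]])
  then show "(\<lambda>n. \<integral>t. 1 / (X n - t) \<partial>\<mu> (3 - k)) \<longlonglongrightarrow> (\<integral>t. 1 / (a - t) \<partial>\<mu> (3 - k))"
   by (rule LIMSEQ_offset)
 qed
 show ?thesis unfolding Fm_def Rf_def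
  by (intro continuous_intros type0 mh)
qed

text \<open>\<open>Delta \<mu> k\<close> lies on a half line that avoids the other interval. There
  \<open>Fm\<close> is continuous without zeros, so its sign is the one at infinity, known from
  \<open>Fm_asymptotics\<close> and \<open>type_I_sign_at_infinity\<close>.\<close>

lemma Fm_pos:
 assumes m: "fst m > 0" "snd m > 0" and i: "i \<in> {1,2}" and n: "n = m + unit_index i"
  and k: "k \<in> {1,2}" and x: "x \<in> Delta \<mu> k"
 shows "0 < Fm m n k x"
proof -
 have sn: "index_size n = Suc (index_size m)" by (simp add: n entry_plus_unit)
 have np: "fst n > 0" "snd n > 0" using m by (auto simp: n)
 obtain \<xi> where xi: "\<xi> \<in> gap \<mu>" using gap_ex by blast
 define I where "I = (if k = 1 then {..\<xi>} else {\<xi>..})"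
 have "y \<notin> Delta \<mu> (3 - k)" if "y \<in> I" for y
  using that k gap_between(1)[OF xi, of y] gap_between(2)[OF xi, of y] by (auto simp: I_def)
 moreover have "connected I" "x \<in> I"
  using k x gap_between[OF xi] by (auto simp: I_def less_imp_le)
 ultimately have I: "connected I" "x \<in> I" "I \<subseteq> - Delta \<mu> (3 - k)" by auto
 have ev: "eventually (\<lambda>x. 0 < x ^ index_size m * Fm m n k x / TP n k x) at_infinity"
  using order_tendstoD(1)[OF Fm_asymptotics[OF m i n k], of 0] by simp
 then obtain R where R: "\<And>y. R \<le> \<bar>y\<bar> ==> 0 < y ^ index_size m * Fm m n k y / TP n k y"
  unfolding eventually_at_infinity by auto
 obtain B where B: "\<And>k t. k \<in> {1,2} ==> t \<in> Delta \<mu> k ==> \<bar>t\<bar> \<le> B" using Delta_norm_bound by blast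
 have pos: "0 < c" if "0 < a" "0 < d" "0 < a * c / d" for a c d :: real
  using that by (auto simp: zero_less_divide_iff zero_less_mult_iff)
 have far: "\<exists>y\<in>I. 0 < Fm m n k y"
 proof (cases "k = 1")
  case True
  define y where "y = - (\<bar>R\<bar> + \<bar>B\<bar> + \<bar>\<xi>\<bar> + 1)"
  have y: "y \<in> I" "R \<le> \<bar>y\<bar>" "y < 0" using True by (auto simp: I_def y_def)
  have "\<And>t. t \<in> Delta \<mu> 1 ==> y < t" using B[of 1] by (fastforce simp: y_def)
  then have s: "0 < (-1) ^ (index_size n - 1) * TP n 1 y" using type_I_sign_at_infinity(2)[OF np] by blast
  have "y ^ index_size m = (-1) ^ index_size m * (-y) ^ index_size m" by (simp flip: power_mult_distrib)
  moreover have "0 < (- y) ^ index_size m" using y by simp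
  moreover have "TP n 1 y = (-1) ^ index_size m * ((-1) ^ (index_size n - 1) * TP n 1 y)"
   by (simp add: sn flip: mult.assoc power_add)
  ultimately have "y ^ index_size m * Fm m n k y / TP n k y = (-y) ^ index_size m * Fm m n k y / ((-1) ^ (index_size n - 1) * TP n 1 y)"
   using True by (simp add: sn divide_simps minus_one_power_iff)
  then have "0 < (-y) ^ index_size m * Fm m n k y / ((-1) ^ (index_size n - 1) * TP n 1 y)"
   using R[OF y(2)] by simp
  then have "0 < Fm m n k y" by (rule pos[OF \<open>0 < (- y) ^ index_size m\<close> s])
  then show ?thesis using y(1) by blast
 next
  case False
  then have k2: "k = 2" using k by auto
  define y where "y = \<bar>R\<bar> + \<bar>B\<bar> + \<bar>\<xi>\<bar> + 1"
  have y: "y \<in> I" "R \<le> \<bar>y\<bar>" "y > 0" using False by (auto simp: I_def y_def)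
  have "\<And>t. t \<in> Delta \<mu> 2 ==> t < y" using B[of 2] by (fastforce simp: y_def)
  then have s: "0 < TP n 2 y" using type_I_sign_at_infinity(1)[OF np] by blast
  have "0 < y ^ index_size m" using y by simp
  then have "0 < Fm m n k y" using s R[OF y(2)] pos unfolding k2 by blast
  then show ?thesis using y(1) by blast
 qed
 then obtain y where y: "y \<in> I" "0 < Fm m n k y" by blast
 obtain \<epsilon> where e: "\<epsilon> \<in> {1,-1::real}" "\<forall>x\<in>I. 0 < \<epsilon> * Fm m n k x"
 proof -
  have "\<exists>\<epsilon>\<in>{1,-1::real}. \<forall>x\<in>I. 0 < \<epsilon> * Fm m n k x"
  proof (rule nonzero_const_sign[OF I(1)])
   show "continuous_on I (Fm m n k)" using continuous_on_Fm[OF k] I(3) continuous_on_subset by blast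
   show "Fm m n k x \<noteq> 0" if "x \<in> I" for x using Fm_nonzero[OF m i n k] I(3) that by blast
  qed
  then show ?thesis using that by blast
 qed
 have "\<epsilon> = 1" using e y by auto
 then show ?thesis using e(2) I(2) by simp
qed

end

section \<open>Generalized eigenfunctions on the tree\<close>

lemma path_to_root_size: "Z \<in> path_to_root Y ==> size Z \<le> size Y"
 by (induction Y) auto

lemma finite_path_to_root [simp]: "finite (path_to_root Y)"
 by (induction Y) auto

lemma path_to_root_self [simp]: "Y \<in> path_to_root Y"
 by (cases Y) auto

lemma path_to_root_ch: "i \<in> {1,2} ==> path_to_root (ch i Y) = insert (ch i Y) (path_to_root Y)"
 by (auto simp: ch_def)

lemma size_ch: "size (ch i Y) = Suc (size Y)"
 by (simp add: ch_def)

lemma ch_notin_path: "ch i Y \<notin> path_to_root Y"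
 using path_to_root_size[of "ch i Y" Y] by (auto simp: size_ch)

lemma parent_ch [simp]: "parent (ch i Y) = Y"
 by (simp add: ch_def)

lemma ch_neq_Root [simp]: "ch i Y \<noteq> Root"
 by (simp add: ch_def)

lemma iota_ch: "i \<in> {1,2} ==> iota (ch i Y) = i"
 by (auto simp: ch_def)

lemma Pi_idx_ch: "i \<in> {1,2} ==> Pi_idx (ch i Y) = Pi_idx Y + unit_index i"
 by (auto simp: ch_def)

lemma ch_inject: "i \<in> {1,2} ==> j \<in> {1,2} ==> ch i Y = ch j Z \<longleftrightarrow> i = j \<and> Y = Z"
 by (auto simp: ch_def)

lemma not_Root_ch: "Y \<noteq> Root ==> \<exists>i\<in>{1,2}. \<exists>Y'. Y = ch i Y'"
 by (cases Y) (auto simp: ch_def)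

lemma Pi_idx_pos: "fst (Pi_idx Y) > 0" "snd (Pi_idx Y) > 0"
 by (induction Y) auto

lemma subtree_ch: "i \<in> {1,2} ==> ch i Y \<in> subtree Z \<longleftrightarrow> Z = ch i Y \<or> Y \<in> subtree Z"
 by (auto simp: subtree_def path_to_root_ch)

lemma subtree_self [simp]: "Y \<in> subtree Y"
 by (simp add: subtree_def)

lemma subtree_size: "Y \<in> subtree Z ==> size Z \<le> size Y"
 by (simp add: subtree_def path_to_root_size)

lemma X_notin_subtree_ch: "X \<notin> subtree (ch i X)"
 using subtree_size[of X "ch i X"] by (auto simp: size_ch)

lemma subtree_ch_disjoint:
 assumes "Y \<in> subtree (ch i X)" "Y \<in> subtree (ch j X)" "i \<in> {1,2}" "j \<in> {1,2}"
 shows "i = j"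
 using assms(1,2)
proof (induction "size Y" arbitrary: Y rule: less_induct)
 case less
 have "Y \<noteq> Root" using subtree_size[OF less.prems(1)] by (auto simp: size_ch)
 then obtain l Y' where Y: "l \<in> {1,2}" "Y = ch l Y'" using not_Root_ch by blast
 have a: "ch i X = Y \<or> Y' \<in> subtree (ch i X)" "ch j X = Y \<or> Y' \<in> subtree (ch j X)"
  using less.prems Y subtree_ch by auto
 have nX: "Y' \<notin> subtree (ch r X)" if "ch r' X = Y" "r' \<in> {1,2}" for r r'
  using that Y ch_inject X_notin_subtree_ch by auto
 consider "ch i X = Y" "ch j X = Y" | "Y' \<in> subtree (ch i X)" "Y' \<in> subtree (ch j X)"
  using a nX assms(3,4) by blast
 then show ?case
 proof cases
  case 1
  then show ?thesis using ch_inject assms(3,4) by metis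
 next
  case 2
  then show ?thesis using less.hyps[of Y'] Y by (simp add: size_ch)
 qed
qed

lemma sum_12: "(\<Sum>k\<in>{1,2::nat}. f k) = f 1 + f 2"
 by simp

locale angelesco_recurrence = angelesco_system +
 fixes a b :: "nat \<times> nat => nat => real"
 assumes recurrence: "recurrence_coefficients \<mu> a b"
begin

lemma a_pos: "fst n > 0 ==> snd n > 0 ==> i \<in> {1,2} ==> a n i > 0"
 using recurrence unfolding recurrence_coefficients_def by blast

lemma W_pot_ch: "i \<in> {1,2} ==> W_pot a (ch i Y) = a (Pi_idx Y) i"
 by (simp add: W_pot_def iota_ch)

lemma W_pot_pos: "W_pot a Y > 0"
proof (cases "Y = Root")
 case False
 then show ?thesis using not_Root_ch a_pos Pi_idx_pos by (metis W_pot_ch)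
qed (simp add: W_pot_def)

lemma V_pot_ch: "i \<in> {1,2} ==> V_pot b \<kappa> (ch i Y) = b (Pi_idx Y) i"
 by (simp add: V_pot_def iota_ch)

lemma m_prod_pos: "m_prod a Y > 0"
 unfolding m_prod_def using W_pot_pos by (intro prod_pos) auto

lemma m_prod_ch: "i \<in> {1,2} ==> m_prod a (ch i Y) = m_prod a Y / sqrt (W_pot a (ch i Y))"
 by (simp add: m_prod_def path_to_root_ch ch_notin_path)

lemma Psi_tilde_Fm:
 assumes k: "k \<in> {1,2}" and x: "x \<in> Delta \<mu> k"
 shows "Psi_tilde \<mu> a Z x Y = m_prod a Z / m_prod a Y * Fm (Pi_idx (parent Z)) (Pi_idx Y) k x"
proof -
 have ind: "indicator (Delta \<mu> l) x = (if l = k then 1 else 0::real)" if "l \<in> {1,2}" for l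
 proof (cases "l = k")
  case False
  then have "l = 3 - k" using that k by auto
  then show ?thesis using Delta_other_disjoint[OF k x] False by simp
 qed (use x in simp)
 have mm: "m_prod a (parent Z) \<noteq> 0" using m_prod_pos[of "parent Z"] by simp
 have k0: "k \<noteq> 0" "3 - k \<noteq> 0" using k by auto
 have "Psi_tilde \<mu> a Z x Y = m_prod a (parent Z) * m_prod a Z *
    (bracket (Lambda \<mu> a k x) (Lambda \<mu> a 0 x) (parent Z) Y +
     bracket (Lambda \<mu> a (3 - k) x) (Lambda \<mu> a k x) (parent Z) Y * mu_hat \<mu> (3 - k) x)"
  unfolding Psi_tilde_def sum_12 using k ind[of 1] ind[of 2] by auto
 also have "... = m_prod a Z / m_prod a Y * Fm (Pi_idx (parent Z)) (Pi_idx Y) k x"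
  using mm m_prod_pos[of Y] k0 by (simp add: bracket_def Lambda_def Fm_def Rf_def divide_simps) (simp add: algebra_simps)
 finally show ?thesis .
qed

lemma Psi_tilde_outside: "x \<notin> Delta \<mu> 1 ==> x \<notin> Delta \<mu> 2 ==> Psi_tilde \<mu> a Z x Y = 0"
 unfolding Psi_tilde_def sum_12 by simp

lemma S_root_Fm:
 assumes "k \<in> {1,2}" "x \<in> Delta \<mu> k"
 shows "S_root \<mu> a Z x = Fm (Pi_idx (parent Z)) (Pi_idx Z) k x"
 using m_prod_pos[of Z] by (simp add: S_root_def Psi_tilde_Fm[OF assms])

lemma S_root_pos:
 assumes "k \<in> {1,2}" "x \<in> Delta \<mu> k" "i \<in> {1,2}"
 shows "0 < S_root \<mu> a (ch i X) x"
 using Fm_pos[OF Pi_idx_pos[of X] assms(3) refl assms(1,2)] assms by (simp add: S_root_Fm Pi_idx_ch)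

text \<open>The factors \<open>m_prod\<close> symmetrize \<open>Fm_recurrence\<close>: passing to a
  child multiplies \<open>1 / m_prod\<close> by one square root of its \<open>W_pot\<close>, and the
  operator supplies the second.\<close>

lemma Psi_tilde_recurrence:
 assumes k: "k \<in> {1,2}" and x: "x \<in> Delta \<mu> k" and i: "i \<in> {1,2}"
 shows "V_pot b \<kappa> (ch i Y) * Psi_tilde \<mu> a Z x (ch i Y) + sqrt (W_pot a (ch i Y)) * Psi_tilde \<mu> a Z x Y
  + (\<Sum>j\<in>{1,2}. sqrt (W_pot a (ch j (ch i Y))) * Psi_tilde \<mu> a Z x (ch j (ch i Y))) = x * Psi_tilde \<mu> a Z x (ch i Y)"
proof -
 let ?Y = "ch i Y" and ?l = "Pi_idx (parent Z)"
 define c where "c = m_prod a Z / m_prod a ?Y"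
 define n where "n = Pi_idx ?Y"
 have sq: "sqrt (W_pot a Y) > 0" "sqrt (W_pot a Y) * sqrt (W_pot a Y) = W_pot a Y" for Y
  using W_pot_pos[of Y] by simp_all
 have p1: "sqrt (W_pot a ?Y) * Psi_tilde \<mu> a Z x Y = c * Fm ?l (Pi_idx Y) k x"
  using m_prod_pos[of Y] sq(1)[of ?Y] by (simp add: Psi_tilde_Fm[OF k x] c_def m_prod_ch[OF i] field_simps)
 have p2: "sqrt (W_pot a (ch j ?Y)) * Psi_tilde \<mu> a Z x (ch j ?Y) = c * (a n j * Fm ?l (n + unit_index j) k x)"
  if j: "j \<in> {1,2}" for j
 proof -
  have "sqrt (W_pot a (ch j ?Y)) * Psi_tilde \<mu> a Z x (ch j ?Y) =
   c * ((sqrt (W_pot a (ch j ?Y)) * sqrt (W_pot a (ch j ?Y))) * Fm ?l (Pi_idx (ch j ?Y)) k x)"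
   using m_prod_pos[of ?Y] sq(1)[of "ch j ?Y"] by (simp add: Psi_tilde_Fm[OF k x] c_def m_prod_ch[OF j] del: real_sqrt_mult_self)
  also have "... = c * (a n j * Fm ?l (n + unit_index j) k x)"
   unfolding sq(2) unfolding W_pot_ch[OF j] Pi_idx_ch[OF j] n_def ..
  finally show ?thesis .
 qed
 have rec: "x * Fm ?l n k x = Fm ?l (Pi_idx Y) k x + b (Pi_idx Y) i * Fm ?l n k x + a n 1 * Fm ?l (n + unit_index 1) k x
  + a n 2 * Fm ?l (n + unit_index 2) k x"
  by (rule Fm_recurrence[OF recurrence i Pi_idx_pos _ k]) (simp add: n_def Pi_idx_ch[OF i])
 have V: "V_pot b \<kappa> ?Y * Psi_tilde \<mu> a Z x ?Y = c * (b (Pi_idx Y) i * Fm ?l n k x)"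
  by (simp add: V_pot_ch[OF i] Psi_tilde_Fm[OF k x] c_def n_def)
 have X: "x * Psi_tilde \<mu> a Z x ?Y = c * (x * Fm ?l n k x)"
  by (simp add: Psi_tilde_Fm[OF k x] c_def n_def)
 show ?thesis
  unfolding sum_12 V X p1 p2[OF insertI1] p2[OF insertI2[OF insertI1]] rec by (simp add: distrib_left)
qed

lemma Psi_hat_subtree:
 assumes i: "i \<in> {1,2}" and Y: "Y \<in> subtree (ch i X)"
 shows "Psi_hat \<mu> a X x Y = cor ((-1) ^ i * (1 / sqrt (W_pot a (ch i X))) * Psi \<mu> a (ch i X) x Y)"
proof -
 have "Y \<notin> subtree (ch j X)" if "j \<in> {1,2}" "j \<noteq> i" for j
  using subtree_ch_disjoint[OF Y _ i that(1)] that(2) by blast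
 from this[of 1] this[of 2] show ?thesis
  using i Y unfolding Psi_hat_def sum_12 by (elim insertE emptyE) simp_all
qed

lemma Psi_hat_zero: "(\<And>i. i \<in> {1,2} ==> Y \<notin> subtree (ch i X)) ==> Psi_hat \<mu> a X x Y = 0"
 by (simp add: Psi_hat_def)

lemma Psi_self: "k \<in> {1,2} ==> x \<in> Delta \<mu> k ==> i \<in> {1,2} ==> Psi \<mu> a (ch i X) x (ch i X) = 1"
 using S_root_pos[of k x i X] by (simp add: Psi_def S_root_def)

text \<open>Below \<open>X\<close> this is \<open>Psi_tilde_recurrence\<close>; setting the value at
  \<open>X\<close> to 0 changes nothing, since the determinant of an index with itself vanishes. At
  \<open>X\<close> the signs and factors in \<open>Psi_hat\<close> make the two children
  cancel.\<close>

theorem Psi_hat_eigenfunction: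
 assumes k: "k \<in> {1,2}" and x: "x \<in> Delta \<mu> k"
 shows "Jacobi a b \<kappa> (Psi_hat \<mu> a X x) Y = cor x * Psi_hat \<mu> a X x Y"
proof -
 consider (sub) i where "i \<in> {1,2}" "Y \<in> subtree (ch i X)" | (top) "Y = X"
  | (out) "Y \<noteq> X" "\<And>i. i \<in> {1,2} ==> Y \<notin> subtree (ch i X)" by blast
 then show ?thesis
 proof cases
  case sub
  define c where "c = (-1) ^ i * (1 / sqrt (W_pot a (ch i X))) * (1 / S_root \<mu> a (ch i X) x)"
  let ?f = "Psi_tilde \<mu> a (ch i X) x"
  have P: "Psi_hat \<mu> a X x Y' = cor (c * ?f Y')" if "Y' \<in> subtree (ch i X)" for Y'
   by (simp add: Psi_hat_subtree[OF sub(1) that] Psi_def c_def)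
  have "Y \<noteq> Root" using subtree_size[OF sub(2)] by (auto simp: size_ch)
  then obtain l Y' where Y: "l \<in> {1,2}" "Y = ch l Y'" using not_Root_ch by blast
  have Pp: "Psi_hat \<mu> a X x Y' = cor (c * ?f Y')"
  proof (cases "Y' \<in> subtree (ch i X)")
   case False
   then have "ch l Y' = ch i X" using sub Y subtree_ch by auto
   then have "Y' = X" using ch_inject Y sub by blast
   moreover have "Psi_hat \<mu> a X x X = 0" by (intro Psi_hat_zero X_notin_subtree_ch)
   moreover have "?f X = 0" using Psi_tilde_Fm[OF k x, of "ch i X" X] by simp
   ultimately show ?thesis by simp
  qed (rule P)
  have Pc: "Psi_hat \<mu> a X x (ch j Y) = cor (c * ?f (ch j Y))" if "j \<in> {1,2}" for j
   using sub that by (intro P) (simp add: subtree_ch)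
  have py: "parent Y = Y'" using Y by simp
  have "Jacobi a b \<kappa> (Psi_hat \<mu> a X x) Y = cor (c * (V_pot b \<kappa> Y * ?f Y + sqrt (W_pot a Y) * ?f Y'
   + (\<Sum>j\<in>{1,2}. sqrt (W_pot a (ch j Y)) * ?f (ch j Y))))"
   using \<open>Y \<noteq> Root\<close> py Pc[of 1] Pc[of 2] P[OF sub(2)] Pp by (simp add: Jacobi_def algebra_simps)
  also have "... = cor (c * (x * ?f Y))"
   using Psi_tilde_recurrence[OF k x Y(1), of \<kappa> Y' "ch i X"] unfolding Y(2) by simp
  finally show ?thesis using P[OF sub(2)] by simp
 next
  case top
  have z: "Psi_hat \<mu> a X x X = 0" by (intro Psi_hat_zero X_notin_subtree_ch)
  have zp: "Psi_hat \<mu> a X x (parent X) = 0" if nr: "X \<noteq> Root"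
  proof (intro Psi_hat_zero)
   obtain l X' where "l \<in> {1,2}" "X = ch l X'" using not_Root_ch[OF nr] by blast
   then show "parent X \<notin> subtree (ch i X)" for i
    using subtree_size[of X' "ch i X"] by (auto simp: size_ch)
  qed
  \<comment> \<open>Each child contributes \<open>(-1) ^ i\<close>, because \<open>Psi\<close> is
    normalized to 1 at the root of its subtree.\<close>
  have c: "cor (sqrt (W_pot a (ch i X))) * Psi_hat \<mu> a X x (ch i X) = (-1) ^ i" if i: "i \<in> {1,2}" for i
   using W_pot_pos[of "ch i X"] by (simp add: Psi_hat_subtree[OF i] Psi_self[OF k x i])
  show ?thesis using c[OF insertI1] c[OF insertI2[OF insertI1]] zp unfolding top Jacobi_def z sum_12 by (cases "X = Root") simp_all
 next
  case out
  have z: "Psi_hat \<mu> a X x Y = 0" using out by (intro Psi_hat_zero)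
  have zp: "Psi_hat \<mu> a X x (parent Y) = 0" if nr: "Y \<noteq> Root"
  proof (intro Psi_hat_zero)
   obtain l Y' where "l \<in> {1,2}" "Y = ch l Y'" using not_Root_ch[OF nr] by blast
   then show "parent Y \<notin> subtree (ch i X)" if "i \<in> {1,2}" for i
    using out(2)[OF that] by (auto simp: subtree_ch)
  qed
  have zc: "Psi_hat \<mu> a X x (ch j Y) = 0" if j: "j \<in> {1,2}" for j
  proof (intro Psi_hat_zero)
   show "ch j Y \<notin> subtree (ch i X)" if i: "i \<in> {1,2}" for i
    using out(1) out(2)[OF i] ch_inject[OF i j, of X Y] subtree_ch[OF j, of Y "ch i X"] by blast
  qed
  show ?thesis using zc[of 1] zc[of 2] zp by (simp add: Jacobi_def z)
 qed
qed

end

section \<open>Cauchy transforms\<close>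

abbreviation cpoly :: "real poly => complex => complex" where
 "cpoly p z \<equiv> poly (map_poly cor p) z"

lemma map_poly_of_real_add: "map_poly cor (p + q) = map_poly cor p + map_poly cor q"
 by (rule poly_eqI) (simp add: coeff_map_poly)

lemma map_poly_of_real_diff: "map_poly cor (p - q) = map_poly cor p - map_poly cor q"
 by (rule poly_eqI) (simp add: coeff_map_poly)

lemma map_poly_of_real_smult: "map_poly cor (smult c p) = smult (cor c) (map_poly cor p)"
 by (rule poly_eqI) (simp add: coeff_map_poly)

lemma map_poly_of_real_mult: "map_poly cor (p * q) = map_poly cor p * map_poly cor q"
 by (rule poly_eqI) (simp add: coeff_map_poly coeff_mult)

lemma map_poly_of_real_sum: "map_poly cor (\<Sum>i\<in>I. f i) = (\<Sum>i\<in>I. map_poly cor (f i))"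
 by (induction I rule: infinite_finite_induct) (simp_all add: map_poly_of_real_add)

lemma cpoly_of_real: "cpoly p (cor x) = cor (poly p x)"
 by (induction p) (simp_all add: map_poly_pCons)

lemma cpoly_synthetic_div:
 assumes "z \<noteq> cor t"
 shows "cpoly (sdiv q t) z = (cpoly q z - cor (poly q t)) / (z - cor t)"
proof -
 have "cpoly q z = cpoly ([:-t, 1:] * sdiv q t + [:poly q t:]) z"
  by (simp only: synthetic_div_correct')
 also have "... = (z - cor t) * cpoly (sdiv q t) z + cor (poly q t)"
  by (simp only: map_poly_of_real_add map_poly_of_real_mult) (simp add: map_poly_pCons algebra_simps)
 finally show ?thesis using assms by (simp add: field_simps)
qed

lemma cpoly_eq_sum: "degree q \<le> N ==> cpoly q z = (\<Sum>i\<le>N. cor (coeff q i) * z ^ i)"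
proof -
 assume "degree q \<le> N"
 then have "degree (map_poly cor q) \<le> N" by (simp add: degree_map_poly)
 then have "map_poly cor q = (\<Sum>i\<le>N. monom (coeff (map_poly cor q) i) i)"
  by (rule poly_as_sum_of_monoms'[symmetric])
 then have "cpoly q z = poly (\<Sum>i\<le>N. monom (coeff (map_poly cor q) i) i) z" by simp
 then show ?thesis by (simp add: poly_sum poly_monom coeff_map_poly)
qed

lemma filterlim_imaginary_axis: "filterlim (\<lambda>y. Complex 0 y) at_infinity at_top"
proof (rule filterlim_norm_at_top_imp_at_infinity)
 have "filterlim (\<lambda>y::real. y) at_top at_top" by (rule filterlim_ident)
 then show "filterlim (\<lambda>y. norm (Complex 0 y)) at_top at_top"
  by (rule filterlim_at_top_mono) (auto simp: cmod_def intro!: always_eventually)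
qed

text \<open>This separates polynomial from decaying parts: a polynomial that equals a function
  tending to 0 along the imaginary axis must vanish.\<close>

lemma cpoly_tendsto_0_imp_0:
 assumes "((\<lambda>y. cpoly r (Complex 0 y)) \<longlongrightarrow> 0) at_top"
 shows "r = 0"
proof (cases "degree r = 0")
 case True
 then obtain c where c: "r = [:c:]" by (auto elim: degree_eq_zeroE)
 then have "((\<lambda>y::real. cor c) \<longlongrightarrow> 0) at_top" using assms by (simp add: map_poly_pCons)
 then have "cor c = 0" by (simp add: tendsto_const_iff)
 then show ?thesis using c by simp
next
 case False
 then have "filterlim (poly (map_poly cor r)) at_infinity at_infinity"
  by (intro filterlim_poly_at_infinity) (simp add: degree_map_poly)
 then have "filterlim (\<lambda>y. cpoly r (Complex 0 y)) at_infinity at_top"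
  by (rule filterlim_compose[OF _ filterlim_imaginary_axis])
 then show ?thesis using assms not_tendsto_and_filterlim_at_infinity[of at_top] by (metis trivial_limit_at_top_linorder)
qed

lemma continuous_on_coeff_synthetic_div:
 fixes p :: "real poly"
 shows "continuous_on S (\<lambda>t. coeff (sdiv p t) i)"
proof (induction p arbitrary: i)
 case (pCons a p)
 then show ?case by (cases i) (auto simp: coeff_pCons intro: continuous_intros)
qed simp

text \<open>One locale for the measures \<open>\<mu> k\<close>, the reference measure and
  \<open>rho_tilde\<close>.\<close>

locale compact_measure =
 fixes M :: "real measure" and K :: "real set"
 assumes sets_M [measurable_cong]: "sets M = sets borel" and finite_M: "finite_measure M"
  and K: "compact K" and AE_K: "AE t in M. t \<in> K"
begin

lemma measurable_M: "f \<in> borel_measurable M \<longleftrightarrow> f \<in> borel_measurable borel"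
 by (simp add: measurable_cong_sets[OF sets_M])

lemma space_M: "space M = UNIV"
 using sets_eq_imp_space_eq[OF sets_M] by simp

lemma integrable_bounded:
 fixes f :: "real => 'b::{banach, second_countable_topology}"
 assumes f: "f \<in> borel_measurable borel" and B: "\<And>x. x \<in> K ==> norm (f x) \<le> B"
 shows "integrable M f"
proof -
 interpret finite_measure M by (rule finite_M)
 show ?thesis
 proof (rule integrable_const_bound[of _ B])
  show "AE x in M. norm (f x) \<le> B" using AE_K by eventually_elim (rule B)
  show "f \<in> borel_measurable M" using f by (simp add: measurable_M)
 qed
qed

lemma integrable_const: "integrable M (\<lambda>_. c :: real)"
 by (rule integrable_bounded[of _ "\<bar>c\<bar>"]) auto

lemma integral_cong_K:
 fixes f :: "real => 'b::{banach, second_countable_topology}"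
 assumes m: "f \<in> borel_measurable borel" "g \<in> borel_measurable borel"
  and eq: "\<And>x. x \<in> K ==> f x = g x"
 shows "integral\<^sup>L M f = integral\<^sup>L M g"
proof (rule integral_cong_AE)
 show "AE x in M. f x = g x" using AE_K by eventually_elim (rule eq)
qed (use m in \<open>simp_all add: measurable_M\<close>)

lemma dominated_limit:
 fixes f :: "real => 'b::{banach, second_countable_topology}"
 assumes m: "\<And>i::nat. s i \<in> borel_measurable borel" "f \<in> borel_measurable borel"
  and B: "\<And>i x. x \<in> K ==> norm (s i x) \<le> B" and lim: "AE x in M. (\<lambda>i. s i x) \<longlonglongrightarrow> f x"
 shows "(\<lambda>i. integral\<^sup>L M (s i)) \<longlonglongrightarrow> integral\<^sup>L M f"
proof (rule integral_dominated_convergence[where w="\<lambda>_. B"])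
 show "integrable M (\<lambda>_. B)" by (rule integrable_const)
 show "AE x in M. norm (s i x) \<le> B" for i using AE_K by eventually_elim (rule B)
qed (use m lim in \<open>simp_all add: measurable_M\<close>)

definition admissible :: "(real => real) => bool" where
 "admissible f \<longleftrightarrow> f \<in> borel_measurable borel \<and> (\<exists>C. \<forall>t\<in>K. \<bar>f t\<bar> \<le> C)"

lemma admissible_continuous: "f \<in> borel_measurable borel ==> continuous_on K f ==> admissible f"
 using compact_imp_bounded[OF compact_continuous_image[OF _ K], of f]
 unfolding admissible_def bounded_iff by (simp add: Ball_def image_iff) blast

lemma admissible_poly [simp]: "admissible (poly p)"
 by (rule admissible_continuous) auto

lemma admissible_mult: "admissible f ==> admissible g ==> admissible (\<lambda>t. f t * g t)"
proof -
 assume f: "admissible f" and g: "admissible g"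
 then obtain C D where C: "\<forall>t\<in>K. \<bar>f t\<bar> \<le> C" and D: "\<forall>t\<in>K. \<bar>g t\<bar> \<le> D" unfolding admissible_def by blast
 have "\<bar>f t * g t\<bar> \<le> \<bar>C\<bar> * \<bar>D\<bar>" if "t \<in> K" for t
  unfolding abs_mult using C[rule_format, OF that] D[rule_format, OF that] by (intro mult_mono) auto
 then show ?thesis using f g unfolding admissible_def by auto
qed

lemma admissible_integrable: "admissible f ==> integrable M f"
 unfolding admissible_def real_norm_def[symmetric] by (elim conjE exE, rule integrable_bounded) blast+

lemma admissible_bounded: "admissible f ==> \<exists>C. \<forall>t\<in>K. \<bar>f t\<bar> \<le> C"
 unfolding admissible_def by blast

lemma admissible_measurable: "admissible f ==> f \<in> borel_measurable borel"
 unfolding admissible_def by blast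

lemma separated_from_K:
 assumes "Im z \<noteq> 0"
 shows "\<exists>d>0. \<forall>t. d \<le> norm (z - cor t)"
proof (intro exI conjI allI)
 show "0 < \<bar>Im z\<bar>" using assms by simp
 show "\<bar>Im z\<bar> \<le> norm (z - cor t)" for t
  using abs_Im_le_cmod[of "z - cor t"] by simp
qed

lemma integrable_cauchy:
 assumes z: "Im z \<noteq> 0" and f: "admissible f"
 shows "integrable M (\<lambda>t. cor (f t) / (z - cor t))"
proof -
 obtain d where d: "d > 0" "\<forall>t. d \<le> norm (z - cor t)" using separated_from_K[OF z] by blast
 obtain C where C: "\<forall>t\<in>K. \<bar>f t\<bar> \<le> C" using admissible_bounded[OF f] by blast
 show ?thesis
 proof (rule integrable_bounded[of _ "\<bar>C\<bar> / d"])
  show "(\<lambda>t. cor (f t) / (z - cor t)) \<in> borel_measurable borel"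
   using admissible_measurable[OF f] by measurable
  fix t assume "t \<in> K"
  then show "norm (cor (f t) / (z - cor t)) \<le> \<bar>C\<bar> / d"
   using C d by (auto simp: norm_divide intro!: frac_le order_trans[OF _ abs_ge_self])
 qed
qed

definition cauchy :: "(real => real) => complex => complex" where
 "cauchy f z = (\<integral>t. cor (f t) / (z - cor t) \<partial>M)"

text \<open>The integral of \<open>f t * (q z - q t) / (z - t)\<close> over \<open>t\<close> as a
  polynomial in \<open>z\<close>, that is, the polynomial part of \<open>q\<close> times the Cauchy
  transform of \<open>f\<close>. It is assembled from coefficients so that it is a polynomial by
  type.\<close>

definition ddint :: "(real => real) => real poly => real poly" where
 "ddint f q = (\<Sum>i\<le>degree q. monom (\<integral>t. coeff (sdiv q t) i * f t \<partial>M) i)"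

lemma integrable_coeff_synthetic_div:
 assumes f: "admissible f"
 shows "integrable M (\<lambda>t. coeff (sdiv q t) i * f t)"
proof -
 have "admissible (\<lambda>t. coeff (sdiv q t) i)"
  by (rule admissible_continuous) (auto intro: borel_measurable_continuous_onI continuous_on_coeff_synthetic_div)
 then show ?thesis using f by (intro admissible_integrable admissible_mult)
qed

lemma cpoly_ddint:
 assumes f: "admissible f"
 shows "cpoly (ddint f q) z = (\<integral>t. cpoly (sdiv q t) z * cor (f t) \<partial>M)"
proof -
 have "degree (ddint f q) \<le> degree q" unfolding ddint_def
  by (intro degree_sum_le) (auto intro: order_trans[OF degree_monom_le])
 then have "cpoly (ddint f q) z = (\<Sum>i\<le>degree q. cor (coeff (ddint f q) i) * z ^ i)" by (rule cpoly_eq_sum)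
 also have "... = (\<Sum>i\<le>degree q. cor (\<integral>t. coeff (sdiv q t) i * f t \<partial>M) * z ^ i)"
  by (intro sum.cong) (auto simp: ddint_def coeff_sum if_distrib sum.delta' cong: if_cong)
 also have "... = (\<Sum>i\<le>degree q. \<integral>t. cor (coeff (sdiv q t) i * f t) * z ^ i \<partial>M)"
  by (simp del: of_real_mult)
 also have "... = (\<integral>t. (\<Sum>i\<le>degree q. cor (coeff (sdiv q t) i * f t) * z ^ i) \<partial>M)"
  using integrable_coeff_synthetic_div[OF f, of q]
  by (intro Bochner_Integration.integral_sum[symmetric] integrable_mult_left) (auto intro!: integrable_of_real simp del: of_real_mult)
 also have "... = (\<integral>t. cpoly (sdiv q t) z * cor (f t) \<partial>M)"
 proof (intro Bochner_Integration.integral_cong refl)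
  fix t
  have "degree (sdiv q t) \<le> degree q" by (simp add: degree_synthetic_div)
  then show "(\<Sum>i\<le>degree q. cor (coeff (sdiv q t) i * f t) * z ^ i) = cpoly (sdiv q t) z * cor (f t)"
   by (simp add: cpoly_eq_sum sum_distrib_left mult_ac)
 qed
 finally show ?thesis .
qed

lemma poly_ddint:
 assumes f: "admissible f"
 shows "poly (ddint f q) x = (\<integral>t. poly (sdiv q t) x * f t \<partial>M)"
proof -
 have "cor (poly (ddint f q) x) = (\<integral>t. cor (poly (sdiv q t) x * f t) \<partial>M)"
  using cpoly_ddint[OF f, of q "cor x"] by (simp add: cpoly_of_real)
 then show ?thesis by (simp del: of_real_mult)
qed

text \<open>At \<open>z = 0\<close> the divided difference of \<open>z * q z\<close> equals
  \<open>q t\<close>; after multiplication by \<open>z\<close> the polynomial part therefore reveals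
  the integral of \<open>q * f\<close>.\<close>

lemma poly_ddint_0:
 assumes f: "admissible f"
 shows "poly (ddint f (pCons 0 q)) 0 = (\<integral>t. poly q t * f t \<partial>M)"
proof -
 have "poly (sdiv (pCons 0 q) t) 0 = poly q t" for t
 proof -
  have "poly (pCons 0 q) t = t * poly q t" by simp
  have "poly ([:-t, 1:] * sdiv q t + [:poly q t:]) 0 = poly q 0"
   by (simp only: synthetic_div_correct')
  then show ?thesis by simp
 qed
 then show ?thesis by (simp add: poly_ddint[OF f] del: synthetic_div_pCons)
qed

lemma cauchy_mult_poly:
 assumes z: "Im z \<noteq> 0" and f: "admissible f"
 shows "cpoly q z * cauchy f z = cpoly (ddint f q) z + cauchy (\<lambda>t. poly q t * f t) z"
proof -
 have zt: "z \<noteq> cor t" for t using z by auto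
 have "cpoly (ddint f q) z = (\<integral>t. cpoly q z * (cor (f t) / (z - cor t)) - cor (poly q t * f t) / (z - cor t) \<partial>M)"
  unfolding cpoly_ddint[OF f]
  by (intro Bochner_Integration.integral_cong refl) (simp add: cpoly_synthetic_div[OF zt] left_diff_distrib diff_divide_distrib)
 also have "... = cpoly q z * cauchy f z - cauchy (\<lambda>t. poly q t * f t) z"
  unfolding cauchy_def using integrable_cauchy[OF z f] integrable_cauchy[OF z admissible_mult[OF admissible_poly f]]
  by (subst Bochner_Integration.integral_diff) (auto simp del: times_divide_eq_right)
 finally show ?thesis by simp
qed

lemma cauchy_tendsto_0:
 assumes f: "admissible f"
 shows "((\<lambda>y. cauchy f (Complex 0 y)) \<longlongrightarrow> 0) at_top"
proof -
 obtain C where C: "\<forall>t\<in>K. \<bar>f t\<bar> \<le> C" using admissible_bounded[OF f] by blast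
 obtain B where B: "\<forall>t\<in>K. \<bar>t\<bar> \<le> B" using compact_imp_bounded[OF K] unfolding bounded_iff by auto
 have "((\<lambda>z. cauchy f z) \<longlongrightarrow> 0) at_infinity" unfolding cauchy_def
 proof (rule cauchy_transform_tendsto_0[OF finite_M sets_M admissible_measurable[OF f]])
  show "AE t in M. \<bar>t\<bar> \<le> B \<and> \<bar>f t\<bar> \<le> C" using AE_K by eventually_elim (use B C in auto)
 qed
 then show ?thesis by (rule filterlim_compose[OF _ filterlim_imaginary_axis])
qed

text \<open>The bound by \<open>\<bar>t - E\<bar>\<close> dominates the integrand uniformly in
  \<open>\<epsilon>\<close>. At \<open>t = E\<close> the numerator is 0, so the integrands on both
  sides are 0 there and an atom at \<open>E\<close> does not contribute.\<close>

lemma cauchy_boundary_limit: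
 assumes f: "f \<in> borel_measurable borel" and C: "\<And>t. t \<in> K ==> \<bar>f t\<bar> \<le> C * \<bar>t - E\<bar>"
 shows "((\<lambda>\<epsilon>. cauchy f (Complex E \<epsilon>)) \<longlongrightarrow> cor (\<integral>t. f t / (E - t) \<partial>M)) (at_right 0)"
 unfolding tendsto_at_iff_sequentially comp_def
proof (intro allI impI)
 fix X :: "nat => real" assume X: "\<forall>i. X i \<in> {0<..} - {0}" "X \<longlonglongrightarrow> 0"
 have cE: "Complex E e - cor t = Complex (E - t) e" for e t by (simp add: complex_eq_iff)
 have le: "\<bar>E - t\<bar> \<le> norm (Complex (E - t) e)" for e t
  using abs_Re_le_cmod[of "Complex (E - t) e"] by simp
 have "(\<lambda>i. cauchy f (Complex E (X i))) \<longlonglongrightarrow> (\<integral>t. cor (f t / (E - t)) \<partial>M)"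
  unfolding cauchy_def
 proof (rule dominated_limit)
  show "(\<lambda>t. cor (f t) / (Complex E (X i) - cor t)) \<in> borel_measurable borel" for i
   using f by measurable
  show "(\<lambda>t. cor (f t / (E - t))) \<in> borel_measurable borel" using f by measurable
  show "norm (cor (f t) / (Complex E (X i) - cor t)) \<le> \<bar>C\<bar>" if t: "t \<in> K" for i t
  proof (cases "t = E")
   case True
   then show ?thesis using C[OF t] by simp
  next
   case False
   have "\<bar>f t\<bar> \<le> \<bar>C\<bar> * \<bar>E - t\<bar>"
    using C[OF t] by (intro order_trans[OF C[OF t]]) (simp add: abs_minus_commute mult_right_mono)
   also have "... \<le> \<bar>C\<bar> * norm (Complex (E - t) (X i))" by (intro mult_left_mono le) simp
   finally show ?thesis using False le[of t "X i"] unfolding cE by (simp add: norm_divide divide_le_eq)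
  qed
  show "AE t in M. (\<lambda>i. cor (f t) / (Complex E (X i) - cor t)) \<longlonglongrightarrow> cor (f t / (E - t))"
   using AE_K
  proof eventually_elim
   case (elim t)
   show ?case
   proof (cases "t = E")
    case True
    then have "f t = 0" using C[OF elim] by simp
    then show ?thesis by simp
   next
    case False
    have "(\<lambda>i. cor E + \<i> * cor (X i)) \<longlonglongrightarrow> cor E + \<i> * cor 0"
     by (intro tendsto_intros X(2))
    then have "(\<lambda>i. Complex E (X i)) \<longlonglongrightarrow> cor E" by (simp add: Complex_eq)
    then have "(\<lambda>i. cor (f t) / (Complex E (X i) - cor t)) \<longlonglongrightarrow> cor (f t) / (cor E - cor t)"
     using False by (intro tendsto_intros) auto
    then show ?thesis by simp
   qed
  qed
 qed
 then show "(\<lambda>i. cauchy f (Complex E (X i))) \<longlonglongrightarrow> cor (\<integral>t. f t / (E - t) \<partial>M)"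
  by (simp only: integral_complex_of_real)
qed

lemma integral_off_finite:
 fixes h :: "real => real"
 assumes N: "finite N" and h: "integrable M h"
 shows "(\<integral>t. (if t \<in> N then 0 else h t) \<partial>M) = (\<integral>t. h t \<partial>M) - (\<Sum>E\<in>N. h E * measure M {E})"
proof -
 interpret finite_measure M by (rule finite_M)
 have i: "integrable M (\<lambda>t. h E * indicator {E} t)" for E
  by (intro integrable_mult_right) (simp add: sets_M less_top[symmetric])
 have "(\<integral>t. (if t \<in> N then 0 else h t) \<partial>M) = (\<integral>t. h t - (\<Sum>E\<in>N. h E * indicator {E} t) \<partial>M)"
 proof (intro Bochner_Integration.integral_cong refl)
  fix t
  have "(\<Sum>E\<in>N. h E * indicator {E} t) = (\<Sum>E\<in>N. if E = t then h E else 0)"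
   by (intro sum.cong) auto
  also have "... = (if t \<in> N then h t else 0)" using N by simp
  finally show "(if t \<in> N then 0 else h t) = h t - (\<Sum>E\<in>N. h E * indicator {E} t)" by simp
 qed
 also have "... = (\<integral>t. h t \<partial>M) - (\<Sum>E\<in>N. \<integral>t. h E * indicator {E} t \<partial>M)"
  using h i by (subst Bochner_Integration.integral_diff) (auto simp: Bochner_Integration.integral_sum)
 also have "(\<Sum>E\<in>N. \<integral>t. h E * indicator {E} t \<partial>M) = (\<Sum>E\<in>N. h E * measure M {E})"
  by (simp add: sets_M)
 finally show ?thesis .
qed

end

lemma (in angelesco_system) compact_measure_mu: "k \<in> {1,2} ==> compact_measure (\<mu> k) (Delta \<mu> k)"
 by (intro compact_measure.intro sets_mu finite_mu compact_Delta AE_mu)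

section \<open>The reciprocal of the second-kind function\<close>

context angelesco_system
begin

lemma Delta_borel [measurable]: "k \<in> {1,2} ==> Delta \<mu> k \<in> sets borel"
 using compact_Delta by (intro borel_closed compact_imp_closed) blast

lemma admissible_mu_poly: "k \<in> {1,2} ==> compact_measure.admissible (Delta \<mu> k) (poly p)"
 by (rule compact_measure.admissible_poly[OF compact_measure_mu])

text \<open>\<open>dI l q\<close> and \<open>cI l q\<close> are the polynomial and the decaying part
  of \<open>q\<close> times \<open>L_fun \<mu> l\<close>, see \<open>cpoly_mult_L\<close>.\<close>

definition dI :: "nat \<times> nat => real poly => real poly" where
 "dI l q = (\<Sum>k\<in>{1,2}. compact_measure.ddint (\<mu> k) (TP l k) q)"

definition cI :: "nat \<times> nat => real poly => complex => complex" where
 "cI l q z = (\<Sum>k\<in>{1,2}. compact_measure.cauchy (\<mu> k) (poly (q * TI l k)) z)"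

lemma L_fun_cI: "L_fun \<mu> l z = cI l 1 z"
 by (simp add: L_fun_def cI_def compact_measure.cauchy_def[OF compact_measure_mu])

lemma cauchy_I_L_fun: "cauchy_I l z = L_fun \<mu> l z"
 by (simp add: L_fun_def cauchy_I_def)

lemma cpoly_mult_cI:
 assumes z: "Im z \<noteq> 0"
 shows "cpoly q z * cI l r z = cpoly (\<Sum>k\<in>{1,2}. compact_measure.ddint (\<mu> k) (poly (r * TI l k)) q) z + cI l (q * r) z"
proof -
 have "cpoly q z * compact_measure.cauchy (\<mu> k) (poly (r * TI l k)) z =
  cpoly (compact_measure.ddint (\<mu> k) (poly (r * TI l k)) q) z + compact_measure.cauchy (\<mu> k) (poly (q * r * TI l k)) z"
  if k: "k \<in> {1,2}" for k
 proof -
  have "poly (q * r * TI l k) = (\<lambda>t. poly q t * poly (r * TI l k) t)" by (rule ext) (simp add: mult_ac)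
  then show ?thesis using compact_measure.cauchy_mult_poly[OF compact_measure_mu[OF k] z admissible_mu_poly[OF k], of q "r * TI l k"]
   by (simp only:)
 qed
 then show ?thesis by (simp add: cI_def map_poly_of_real_add distrib_left algebra_simps)
qed

lemma cpoly_mult_L:
 assumes z: "Im z \<noteq> 0"
 shows "cpoly q z * L_fun \<mu> l z = cpoly (dI l q) z + cI l q z"
 using cpoly_mult_cI[OF z, of q l 1] by (simp add: L_fun_cI dI_def)

lemma cI_tendsto_0: "((\<lambda>y. cI l q (Complex 0 y)) \<longlongrightarrow> 0) at_top"
proof -
 have "((\<lambda>y. cI l q (Complex 0 y)) \<longlongrightarrow> (\<Sum>k\<in>{1,2::nat}. 0)) at_top"
  unfolding cI_def
  by (intro tendsto_sum compact_measure.cauchy_tendsto_0[OF compact_measure_mu] admissible_mu_poly) simp_all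
 then show ?thesis by simp
qed

text \<open>The leading coefficient of a Cauchy transform at infinity is the total mass of its
  density, here \<open>form (TI l) q\<close>.\<close>

lemma mult_cI:
 assumes z: "Im z \<noteq> 0"
 shows "z * cI l q z = cor (form (TI l) q) + cI l (pCons 0 q) z"
proof -
 have "cpoly (compact_measure.ddint (\<mu> k) (poly (q * TI l k)) [:0,1:]) z = cor (\<integral>t. poly q t * TP l k t \<partial>\<mu> k)"
  if k: "k \<in> {1,2}" for k
  using compact_measure.cpoly_ddint[OF compact_measure_mu[OF k] admissible_mu_poly[OF k], of "q * TI l k" "[:0,1:]" z]
  by (simp del: of_real_mult add: map_poly_pCons)
 then have "cpoly (\<Sum>k\<in>{1,2}. compact_measure.ddint (\<mu> k) (poly (q * TI l k)) [:0,1:]) z = cor (form (TI l) q)"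
  by (simp add: map_poly_of_real_add form_def)
 moreover have "cpoly [:0,1:] z = z" by (simp add: map_poly_pCons)
 ultimately show ?thesis using cpoly_mult_cI[OF z, of "[:0,1:]" l q] by simp
qed

lemma mult_cI_tendsto: "((\<lambda>y. Complex 0 y * cI l q (Complex 0 y)) \<longlongrightarrow> cor (form (TI l) q)) at_top"
proof -
 have "((\<lambda>y. cor (form (TI l) q) + cI l (pCons 0 q) (Complex 0 y)) \<longlongrightarrow> cor (form (TI l) q) + 0) at_top"
  by (intro tendsto_add tendsto_const cI_tendsto_0)
 moreover have "eventually (\<lambda>y. cor (form (TI l) q) + cI l (pCons 0 q) (Complex 0 y) = Complex 0 y * cI l q (Complex 0 y)) at_top"
  using eventually_gt_at_top[of 0] by eventually_elim (simp add: mult_cI)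
 ultimately show ?thesis by (simp add: filterlim_cong[OF refl refl] Lim_transform_eventually)
qed

lemma poly_dI_shift_0: "poly (dI l (pCons 0 q)) 0 = form (TI l) q"
 unfolding dI_def form_def poly_sum
 by (intro sum.cong refl compact_measure.poly_ddint_0[OF compact_measure_mu] admissible_mu_poly)

lemma poly_dI: "poly (dI l q) x = form (TI l) (sdiv q x)"
 unfolding dI_def form_def poly_sum
 by (intro sum.cong refl) (simp add: compact_measure.poly_ddint[OF compact_measure_mu] admissible_mu_poly poly_synthetic_div_commute[of q _ x])

end

lemma power_inverse_imaginary_tendsto: "((\<lambda>y. (1 / Complex 0 y) ^ d) \<longlongrightarrow> (if d = 0 then 1 else 0)) at_top"
proof -
 have "((\<lambda>y. 1 / Complex 0 y) \<longlongrightarrow> 0) at_top"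
  by (rule tendsto_divide_0[OF tendsto_const filterlim_imaginary_axis])
 then have "((\<lambda>y. (1 / Complex 0 y) ^ d) \<longlongrightarrow> 0 ^ d) at_top" by (rule tendsto_power)
 then show ?thesis by (cases d) simp_all
qed

section \<open>The polynomial part of 1 / L and its moments\<close>

locale angelesco_reference = angelesco_system +
 fixes n :: "nat \<times> nat" and w :: "real measure"
 assumes np: "fst n > 0" "snd n > 0" and ref: "reference_measure \<mu> n w"
begin

lemma sets_w: "sets w = sets borel" and finite_w: "finite_measure w"
 using ref by (simp_all add: reference_measure_def)

sublocale W: compact_measure w "DD"
proof (rule compact_measure.intro)
 have "emeasure w (- (DD)) = 0"
  using ref by (simp add: reference_measure_def)
 then show "AE t in w. t \<in> DD"
  by (intro AE_I[of _ _ "- (DD)"]) (auto simp: sets_w)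
 show "compact (DD)" using compact_Delta by (intro compact_Un) simp_all
qed (rule sets_w finite_w)+

lemma AE_not_zero: "AE x in w. x \<notin> zeros_I \<mu> n"
proof -
 have "AE x in w. x \<noteq> E" if "E \<in> zeros_I \<mu> n" for E
 proof -
  have "emeasure w {E} = 0" using ref that by (simp add: reference_measure_def)
  then show ?thesis by (intro AE_I[of _ _ "{E}"]) (auto simp: sets_w)
 qed
 then have "AE x in w. \<forall>E\<in>zeros_I \<mu> n. x \<noteq> E"
  using finite_zeros_I[OF np] by (simp add: AE_finite_all)
 then show ?thesis by eventually_elim blast
qed

text \<open>The product of \<open>D_poly\<close> and \<open>S_weight\<close>, in which
  \<open>\<xi>\<close> and the other type I polynomial cancel (\<open>D_poly_S_weight\<close>). It
  becomes the density of the Cauchy part of \<open>1 / L\<close> with respect to the reference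
  measure.\<close>

definition sg :: "real => real" where
 "sg x = (if x \<in> Delta \<mu> 1 then TP n 1 x else if x \<in> Delta \<mu> 2 then TP n 2 x else 0)"

lemma sg_Delta: "k \<in> {1,2} ==> x \<in> Delta \<mu> k ==> sg x = TP n k x"
 using Delta_disjoint by (auto simp: sg_def)

lemma admissible_sg: "W.admissible sg"
 unfolding W.admissible_def
proof
 show "sg \<in> borel_measurable borel" unfolding sg_def by measurable
 obtain C1 C2 where C: "\<forall>t\<in>Delta \<mu> 1. \<bar>TP n 1 t\<bar> \<le> C1" "\<forall>t\<in>Delta \<mu> 2. \<bar>TP n 2 t\<bar> \<le> C2"
  using compact_measure.admissible_bounded[OF compact_measure_mu admissible_mu_poly] by (meson insertI1 insertI2)
 show "\<exists>C. \<forall>t\<in>DD. \<bar>sg t\<bar> \<le> C"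
 proof (intro exI ballI)
  fix t assume "t \<in> DD"
  then show "\<bar>sg t\<bar> \<le> max C1 C2" using C sg_Delta[of 1 t] sg_Delta[of 2 t] by (auto simp: le_max_iff_disj)
 qed
qed

lemma S_weight_Delta:
 assumes k: "k \<in> {1,2}" and x: "x \<in> Delta \<mu> k"
 shows "S_weight \<mu> n \<xi> x = 1 / \<bar>x - \<xi>\<bar> * (1 / \<bar>TP n (3 - k) x\<bar>)"
 using k x Delta_other_disjoint[OF k x] unfolding S_weight_def sum_12 by auto

lemma D_poly_S_weight:
 assumes xi: "\<xi> \<in> gap \<mu>" and x: "x \<in> DD"
 shows "poly (D_poly \<mu> n \<xi>) x * S_weight \<mu> n \<xi> x = sg x"
proof -
 obtain k where k: "k \<in> {1,2}" "x \<in> Delta \<mu> k" using x by auto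
 define c where "c = (-1) ^ snd n * ((x - \<xi>) * TP n (3 - k) x)"
 have c: "0 < c" unfolding c_def by (rule type_I_sign[OF np xi k])
 have "\<bar>c\<bar> = \<bar>x - \<xi>\<bar> * \<bar>TP n (3 - k) x\<bar>" by (simp add: c_def abs_mult power_abs)
 then have "S_weight \<mu> n \<xi> x = 1 / c" using c by (simp add: S_weight_Delta[OF k])
 moreover have "poly (D_poly \<mu> n \<xi>) x = c * TP n k x"
  using k(1) by (auto simp: D_poly_def c_def algebra_simps)
 ultimately show ?thesis using c by (simp add: sg_Delta[OF k])
qed

lemma admissible_S_weight:
 assumes xi: "\<xi> \<in> gap \<mu>"
 shows "W.admissible (S_weight \<mu> n \<xi>)"
 unfolding W.admissible_def
proof
 show "S_weight \<mu> n \<xi> \<in> borel_measurable borel" unfolding S_weight_def[abs_def] sum_12 by measurable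
 have b: "\<exists>C. \<forall>t\<in>Delta \<mu> k. \<bar>S_weight \<mu> n \<xi> t\<bar> \<le> C" if k: "k \<in> {1,2}" for k
 proof -
  have nz: "\<bar>x - \<xi>\<bar> \<noteq> 0" "\<bar>TP n (3 - k) x\<bar> \<noteq> 0" if "x \<in> Delta \<mu> k" for x
   using type_I_sign[OF np xi k that] by auto
  have "continuous_on (Delta \<mu> k) (\<lambda>x. 1 / \<bar>x - \<xi>\<bar> * (1 / \<bar>TP n (3 - k) x\<bar>))"
   using nz by (intro continuous_intros) auto
  from compact_imp_bounded[OF compact_continuous_image[OF this compact_Delta[OF k]]]
  obtain C where C: "\<And>x. x \<in> Delta \<mu> k ==> \<bar>1 / \<bar>x - \<xi>\<bar> * (1 / \<bar>TP n (3 - k) x\<bar>)\<bar> \<le> C"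
   unfolding bounded_iff by auto
  have "\<bar>S_weight \<mu> n \<xi> t\<bar> \<le> C" if "t \<in> Delta \<mu> k" for t
   using C[OF that] unfolding S_weight_Delta[OF k that] .
  then show ?thesis by blast
 qed
 obtain C1 C2 where C: "\<forall>t\<in>Delta \<mu> 1. \<bar>S_weight \<mu> n \<xi> t\<bar> \<le> C1" "\<forall>t\<in>Delta \<mu> 2. \<bar>S_weight \<mu> n \<xi> t\<bar> \<le> C2"
  using b[of 1] b[of 2] by auto
 show "\<exists>C. \<forall>t\<in>DD. \<bar>S_weight \<mu> n \<xi> t\<bar> \<le> C"
  using C by (intro exI[of _ "max C1 C2"]) (auto simp: le_max_iff_disj)
qed

text \<open>Multiply the representation of \<open>1 / (D * L)\<close> by \<open>D\<close>. The poles
  sit at zeros of \<open>D\<close> and become divided differences, the linear term stays polynomial,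
  and the integral becomes a polynomial minus the Cauchy transform of \<open>D * S_weight\<close>,
  which is \<open>sg\<close>.\<close>

lemma inverse_L_representation: "\<exists>p. \<forall>z. Im z > 0 \<longrightarrow> 1 / L_fun \<mu> n z = cpoly p z - W.cauchy sg z"
proof -
 obtain \<xi> where xi: "\<xi> \<in> gap \<mu>" using gap_ex by blast
 define D where "D = D_poly \<mu> n \<xi>"
 define Z where "Z = zeros_I \<mu> n \<union> {\<xi>}"
 from ref xi obtain a b where z: "\<forall>E\<in>Z. zeta \<mu> n \<xi> E \<in> \<real>"
  and rep: "\<And>z. Im z > 0 ==> 1 / (cpoly D z * L_fun \<mu> n z) =
        (\<integral>x. cor (S_weight \<mu> n \<xi> x) / (cor x - z) \<partial>w) +
        (\<Sum>E\<in>Z. zeta \<mu> n \<xi> E / (cor E - z)) +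
        cor a + cor b * z"
  unfolding reference_measure_def D_def Z_def by blast
 have DZ: "poly D E = 0" if "E \<in> Z" for E
  using that by (auto simp: D_def Z_def D_poly_def zeros_I_def)
 \<comment> \<open>The minus signs come from passing from the denominators \<open>E - z\<close> and
   \<open>x - z\<close> to \<open>z - E\<close> and \<open>z - x\<close>.\<close>
 define p where "p = D * [:a, b:] - W.ddint (S_weight \<mu> n \<xi>) D - (\<Sum>E\<in>Z. smult (Re (zeta \<mu> n \<xi> E)) (sdiv D E))"
 show ?thesis
 proof (intro exI[of _ p] allI impI)
  fix z assume z0: "Im z > 0"
  then have z1: "Im z \<noteq> 0" by simp
  have zr: "z \<noteq> cor x" for x using z1 by auto
  have "cpoly D z = (-1) ^ snd n * (z - cor \<xi>) * cpoly (TI n 1) z * cpoly (TI n 2) z"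
   by (simp only: D_def D_poly_def map_poly_of_real_smult map_poly_of_real_mult)
    (simp add: map_poly_pCons algebra_simps)
  then have D0: "cpoly D z \<noteq> 0" using zr[of \<xi>] type_I_nonreal[OF np _ z1] by simp
  have i1: "(\<integral>x. cor (S_weight \<mu> n \<xi> x) / (cor x - z) \<partial>w) = - W.cauchy (S_weight \<mu> n \<xi>) z"
  proof -
   have "cor (S_weight \<mu> n \<xi> x) / (cor x - z) = - (cor (S_weight \<mu> n \<xi> x) / (z - cor x))" for x
    by (metis minus_diff_eq minus_divide_right)
   then show ?thesis by (simp add: W.cauchy_def)
  qed
  have i2: "cpoly D z * W.cauchy (S_weight \<mu> n \<xi>) z = cpoly (W.ddint (S_weight \<mu> n \<xi>) D) z + W.cauchy sg z"
  proof -
   have "W.cauchy (\<lambda>t. poly D t * S_weight \<mu> n \<xi> t) z = W.cauchy sg z"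
    unfolding W.cauchy_def
   proof (rule W.integral_cong_K)
    show "(\<lambda>t. cor (poly D t * S_weight \<mu> n \<xi> t) / (z - cor t)) \<in> borel_measurable borel"
     using W.admissible_measurable[OF admissible_S_weight[OF xi]] by measurable
    show "(\<lambda>t. cor (sg t) / (z - cor t)) \<in> borel_measurable borel"
     using W.admissible_measurable[OF admissible_sg] by measurable
   qed (simp add: D_def D_poly_S_weight[OF xi])
   then show ?thesis using W.cauchy_mult_poly[OF z1 admissible_S_weight[OF xi], of D] by simp
  qed
  have i3: "cpoly D z * (zeta \<mu> n \<xi> E / (cor E - z)) = - (cor (Re (zeta \<mu> n \<xi> E)) * cpoly (sdiv D E) z)"
   if E: "E \<in> Z" for E
  proof -
   have "cor (Re (zeta \<mu> n \<xi> E)) = zeta \<mu> n \<xi> E" using z E by (auto elim!: Reals_cases)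
   moreover have "v / (cor E - z) = - (v / (z - cor E))" for v
    by (metis minus_diff_eq minus_divide_right)
   ultimately show ?thesis by (simp add: cpoly_synthetic_div[OF zr] DZ[OF E] mult_ac)
  qed
  have "1 / L_fun \<mu> n z = cpoly D z * (1 / (cpoly D z * L_fun \<mu> n z))" using D0 by simp
  also have "... = - (cpoly D z * W.cauchy (S_weight \<mu> n \<xi>) z) + (\<Sum>E\<in>Z. cpoly D z * (zeta \<mu> n \<xi> E / (cor E - z)))
   + cpoly D z * (cor a + cor b * z)"
   unfolding rep[OF z0] i1 by (simp add: distrib_left right_diff_distrib sum_distrib_left)
  also have "(\<Sum>E\<in>Z. cpoly D z * (zeta \<mu> n \<xi> E / (cor E - z))) = - (\<Sum>E\<in>Z. cor (Re (zeta \<mu> n \<xi> E)) * cpoly (sdiv D E) z)"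
   by (subst sum_negf[symmetric]) (intro sum.cong refl i3)
  also have "cpoly D z * (cor a + cor b * z) = cpoly (D * [:a, b:]) z"
   by (simp only: map_poly_of_real_mult) (simp add: map_poly_pCons algebra_simps)
  also have "- (cpoly D z * W.cauchy (S_weight \<mu> n \<xi>) z) + - (\<Sum>E\<in>Z. cor (Re (zeta \<mu> n \<xi> E)) * cpoly (sdiv D E) z) + cpoly (D * [:a, b:]) z
   = cpoly p z - W.cauchy sg z"
   unfolding i2 p_def by (simp add: map_poly_of_real_diff map_poly_of_real_sum map_poly_of_real_smult poly_sum del: mult_pCons_right)
  finally show "1 / L_fun \<mu> n z = cpoly p z - W.cauchy sg z" .
 qed
qed

definition pn :: "real poly" where
 "pn = (SOME p. \<forall>z. Im z > 0 \<longrightarrow> 1 / L_fun \<mu> n z = cpoly p z - W.cauchy sg z)"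

lemma inverse_L: "Im z > 0 ==> 1 / L_fun \<mu> n z = cpoly pn z - W.cauchy sg z"
 using someI_ex[OF inverse_L_representation] unfolding pn_def by blast

lemma n0: "index_size n > 0"
 using np by (simp add: index_size_def)

lemma L_asymptotics: "index_size l > 0 ==> ((\<lambda>y. Complex 0 y ^ index_size l * L_fun \<mu> l (Complex 0 y)) \<longlongrightarrow> 1) at_top"
 using filterlim_compose[OF cauchy_I_asymptotics[where 'a=complex, of l] filterlim_imaginary_axis]
 by (simp add: cauchy_I_L_fun)

lemma L_eventually_nonzero: "eventually (\<lambda>y. L_fun \<mu> n (Complex 0 y) \<noteq> 0) at_top"
 using tendsto_imp_eventually_ne[OF L_asymptotics[OF n0] zero_neq_one[symmetric]] by eventually_elim auto

text \<open>Let \<open>lm\<close> be the Cauchy transform of \<open>sg\<close>, so that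
  \<open>1 / L = pn - lm\<close>, and split \<open>q * L = u + c\<close> into polynomial and
  decaying part. Then \<open>z * pn * q * L - z * u * lm\<close> equals
  \<open>z * q + z * c * lm\<close>. The polynomial parts on both sides agree, and their values at 0
  give the moment identity.\<close>

lemma form_pn_mult:
 "form (TI n) (pn * q) = (\<integral>x. form (TI n) (sdiv q x) * sg x \<partial>w)"
proof -
 define u where "u = dI n q"
 define r where "r = dI n (pCons 0 (pn * q)) - W.ddint sg (pCons 0 u) - pCons 0 q"
 have "((\<lambda>y. (Complex 0 y * cI n q (Complex 0 y)) * W.cauchy sg (Complex 0 y) - cI n (pCons 0 (pn * q)) (Complex 0 y)
  + W.cauchy (\<lambda>t. poly (pCons 0 u) t * sg t) (Complex 0 y)) \<longlongrightarrow> cor (form (TI n) q) * 0 - 0 + 0) at_top"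
  by (intro tendsto_add tendsto_diff tendsto_mult mult_cI_tendsto cI_tendsto_0 W.cauchy_tendsto_0 admissible_sg
   W.admissible_mult W.admissible_poly)
 then have lim: "((\<lambda>y. (Complex 0 y * cI n q (Complex 0 y)) * W.cauchy sg (Complex 0 y) - cI n (pCons 0 (pn * q)) (Complex 0 y)
  + W.cauchy (\<lambda>t. poly (pCons 0 u) t * sg t) (Complex 0 y)) \<longlongrightarrow> 0) at_top" by simp
 have "((\<lambda>y. cpoly r (Complex 0 y)) \<longlongrightarrow> 0) at_top"
 proof (rule Lim_transform_eventually[OF lim])
  show "eventually (\<lambda>y. (Complex 0 y * cI n q (Complex 0 y)) * W.cauchy sg (Complex 0 y) - cI n (pCons 0 (pn * q)) (Complex 0 y)
   + W.cauchy (\<lambda>t. poly (pCons 0 u) t * sg t) (Complex 0 y) = cpoly r (Complex 0 y)) at_top"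
   using L_eventually_nonzero eventually_gt_at_top[of 0]
  proof eventually_elim
   case (elim y)
   define z where "z = Complex 0 y"
   have z: "Im z > 0" "Im z \<noteq> 0" using elim by (simp_all add: z_def)
   define L P Q U lm c where "L = L_fun \<mu> n z" and "P = cpoly pn z" and "Q = cpoly q z" and "U = cpoly u z"
    and "lm = W.cauchy sg z" and "c = cI n q z"
   have L1: "L * (P - lm) = 1" using inverse_L[OF z(1)] elim(1) unfolding L_def P_def lm_def z_def by (simp add: field_simps)
   have QL: "Q * L = U + c" unfolding Q_def L_def U_def c_def u_def by (rule cpoly_mult_L[OF z(2)])
   have A: "z * (P * Q) * L = cpoly (dI n (pCons 0 (pn * q))) z + cI n (pCons 0 (pn * q)) z"
    using cpoly_mult_L[OF z(2), of "pCons 0 (pn * q)" n]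
    by (simp add: map_poly_pCons map_poly_of_real_mult P_def Q_def L_def)
   have B: "z * U * lm = cpoly (W.ddint sg (pCons 0 u)) z + W.cauchy (\<lambda>t. poly (pCons 0 u) t * sg t) z"
    using W.cauchy_mult_poly[OF z(2) admissible_sg, of "pCons 0 u"]
    by (simp add: map_poly_pCons U_def lm_def)
   \<comment> \<open>The error \<open>z * c * lm\<close> decays, since \<open>z * c\<close>
     converges and \<open>lm\<close> tends to 0.\<close>
   have "z * (P * Q) * L - z * U * lm = z * ((Q * L) * (P - lm)) + z * (Q * L - U) * lm"
    by (simp add: algebra_simps)
   also have "Q * L - U = c" unfolding QL by simp
   also have "(Q * L) * (P - lm) = Q" using L1 by (simp add: mult.assoc)
   finally have "cpoly (dI n (pCons 0 (pn * q))) z - cpoly (W.ddint sg (pCons 0 u)) z - z * Q =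
    z * c * lm - cI n (pCons 0 (pn * q)) z + W.cauchy (\<lambda>t. poly (pCons 0 u) t * sg t) z"
    unfolding A B by (simp add: algebra_simps)
   moreover have "cpoly r z = cpoly (dI n (pCons 0 (pn * q))) z - cpoly (W.ddint sg (pCons 0 u)) z - z * Q"
    by (simp add: r_def map_poly_of_real_diff map_poly_pCons Q_def)
   ultimately show ?case by (simp only: z_def c_def lm_def)
  qed
 qed
 then have "r = 0" by (rule cpoly_tendsto_0_imp_0)
 then have "poly r 0 = 0" by simp
 then have "poly (dI n (pCons 0 (pn * q))) 0 - poly (W.ddint sg (pCons 0 u)) 0 = 0"
  by (simp add: r_def)
 then show ?thesis
  unfolding poly_dI_shift_0 W.poly_ddint_0[OF admissible_sg] u_def by (simp add: poly_dI)
qed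

text \<open>At infinity \<open>z * L_l / L_n\<close> behaves like \<open>z\<close> to the power
  \<open>index_size n + 1 - index_size l\<close>, so it tends to 1 or 0. The polynomial part of
  \<open>z * pn * L_l\<close> must equal this limit, and its value at 0 is the form.\<close>

lemma form_pn:
 assumes l: "index_size l \<ge> Suc (index_size n)"
 shows "form (TI l) pn = (if index_size l = Suc (index_size n) then 1 else 0)"
proof -
 define d where "d = index_size l - Suc (index_size n)"
 have il: "index_size l = d + Suc (index_size n)" using l by (simp add: d_def)
 have l0: "index_size l > 0" using il by simp
 define \<delta> :: real where "\<delta> = (if d = 0 then 1 else 0)"
 define r where "r = dI l (pCons 0 pn) - [:\<delta>:]"
 have t1: "((\<lambda>y. (Complex 0 y ^ index_size l * L_fun \<mu> l (Complex 0 y)) / (Complex 0 y ^ index_size n * L_fun \<mu> n (Complex 0 y)) * (1 / Complex 0 y) ^ d)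
   \<longlongrightarrow> 1 / 1 * (if d = 0 then 1 else 0)) at_top"
  by (intro tendsto_mult tendsto_divide L_asymptotics l0 n0 power_inverse_imaginary_tendsto) simp
 have t2: "((\<lambda>y. (Complex 0 y * cI l 1 (Complex 0 y)) * W.cauchy sg (Complex 0 y)) \<longlongrightarrow> cor (form (TI l) 1) * 0) at_top"
  by (intro tendsto_mult mult_cI_tendsto W.cauchy_tendsto_0 admissible_sg)
 have lim: "((\<lambda>y. (Complex 0 y ^ index_size l * L_fun \<mu> l (Complex 0 y)) / (Complex 0 y ^ index_size n * L_fun \<mu> n (Complex 0 y)) * (1 / Complex 0 y) ^ d
  + (Complex 0 y * cI l 1 (Complex 0 y)) * W.cauchy sg (Complex 0 y) - cI l (pCons 0 pn) (Complex 0 y) - cor \<delta>) \<longlongrightarrow> 0) at_top"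
  using tendsto_diff[OF tendsto_diff[OF tendsto_add[OF t1 t2] cI_tendsto_0[of l "pCons 0 pn"]] tendsto_const[of "cor \<delta>"]]
  by (simp add: \<delta>_def split: if_splits)
 have "((\<lambda>y. cpoly r (Complex 0 y)) \<longlongrightarrow> 0) at_top"
 proof (rule Lim_transform_eventually[OF lim])
  show "eventually (\<lambda>y. (Complex 0 y ^ index_size l * L_fun \<mu> l (Complex 0 y)) / (Complex 0 y ^ index_size n * L_fun \<mu> n (Complex 0 y)) * (1 / Complex 0 y) ^ d
  + (Complex 0 y * cI l 1 (Complex 0 y)) * W.cauchy sg (Complex 0 y) - cI l (pCons 0 pn) (Complex 0 y) - cor \<delta> = cpoly r (Complex 0 y)) at_top"
   using L_eventually_nonzero eventually_gt_at_top[of 0]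
  proof eventually_elim
   case (elim y)
   define z where "z = Complex 0 y"
   have z: "Im z > 0" "Im z \<noteq> 0" "z \<noteq> 0" using elim by (auto simp: z_def complex_eq_iff)
   define L L' P lm where "L = L_fun \<mu> n z" and "L' = L_fun \<mu> l z" and "P = cpoly pn z" and "lm = W.cauchy sg z"
   have L0: "L \<noteq> 0" using elim by (simp add: L_def z_def)
   have L1: "1 / L = P - lm" using inverse_L[OF z(1)] unfolding L_def P_def lm_def .
   have A: "z * P * L' = cpoly (dI l (pCons 0 pn)) z + cI l (pCons 0 pn) z"
    using cpoly_mult_L[OF z(2), of "pCons 0 pn" l] by (simp add: map_poly_pCons P_def L'_def)
   have "(z ^ index_size l * L') / (z ^ index_size n * L) * (1 / z) ^ d = z * L' * (1 / L)"
    using z(3) L0 by (simp add: il power_add power_divide field_simps)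
   also have "... = z * P * L' - z * L' * lm" unfolding L1 by (simp add: algebra_simps)
   finally have "(z ^ index_size l * L') / (z ^ index_size n * L) * (1 / z) ^ d + (z * L') * lm - cI l (pCons 0 pn) z - cor \<delta> = cpoly r z"
    unfolding A by (simp add: r_def map_poly_of_real_diff map_poly_pCons)
   then show ?case by (simp only: z_def L'_def L_def lm_def L_fun_cI)
  qed
 qed
 then have "r = 0" by (rule cpoly_tendsto_0_imp_0)
 then have "poly (dI l (pCons 0 pn)) 0 = \<delta>"
  using arg_cong[of r 0 "\<lambda>r. poly r 0"] by (simp add: r_def)
 then show ?thesis using il by (simp add: poly_dI_shift_0 \<delta>_def)
qed

text \<open>The boundary value of \<open>L\<close> at a zero \<open>E\<close>, a real number. At
  \<open>t = E\<close> the integrand is 0 by division by zero and not its limit, minus the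
  derivative at \<open>E\<close>; an atom at \<open>E\<close> turns this into the extra term of
  \<open>Fm_at_zero\<close>.\<close>

definition ell :: "real => real" where
 "ell E = (\<Sum>k\<in>{1,2}. \<integral>t. TP n k t / (E - t) \<partial>\<mu> k)"

lemma zero_bound:
 assumes E: "E \<in> Delta \<mu> k" "k \<in> {1,2}" "TP n k E = 0" and j: "j \<in> {1,2}"
 shows "\<exists>C. \<forall>t\<in>Delta \<mu> j. \<bar>TP n j t\<bar> \<le> C * \<bar>t - E\<bar>"
proof (cases "j = k")
 case True
 obtain C where C: "\<forall>t\<in>Delta \<mu> j. \<bar>poly (sdiv (TI n k) E) t\<bar> \<le> C"
  using compact_measure.admissible_bounded[OF compact_measure_mu[OF j] admissible_mu_poly[OF j]] by blast
 have "\<bar>TP n j t\<bar> \<le> C * \<bar>t - E\<bar>" if "t \<in> Delta \<mu> j" for t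
 proof -
  have "TP n j t = (t - E) * poly (sdiv (TI n k) E) t"
   unfolding True using E(3) by (subst degree_poly_minus_value[of "TI n k" E]) (simp add: algebra_simps)
  then show ?thesis using C that mult_left_mono[of "\<bar>poly (sdiv (TI n k) E) t\<bar>" C "\<bar>t - E\<bar>"]
   by (simp add: abs_mult mult.commute)
 qed
 then show ?thesis by blast
next
 case False
 have Ej: "E \<notin> Delta \<mu> j" using False E j Delta_disjoint by auto
 have "closed (Delta \<mu> j)" by (rule compact_imp_closed[OF compact_Delta[OF j]])
 then obtain d where d: "d > 0" "\<forall>t\<in>Delta \<mu> j. d \<le> dist E t"
  using separate_point_closed[of "Delta \<mu> j" E] Ej by blast
 obtain C where C: "\<forall>t\<in>Delta \<mu> j. \<bar>TP n j t\<bar> \<le> C"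
  using compact_measure.admissible_bounded[OF compact_measure_mu[OF j] admissible_mu_poly[OF j]] by blast
 have "\<bar>TP n j t\<bar> \<le> (\<bar>C\<bar> / d) * \<bar>t - E\<bar>" if t: "t \<in> Delta \<mu> j" for t
 proof -
  have "\<bar>TP n j t\<bar> \<le> \<bar>C\<bar>" using C t by force
  also have "... = (\<bar>C\<bar> / d) * d" using d by simp
  also have "... \<le> (\<bar>C\<bar> / d) * \<bar>t - E\<bar>" using d t by (intro mult_left_mono) (auto simp: dist_real_def abs_minus_commute)
  finally show ?thesis .
 qed
 then show ?thesis by blast
qed

lemma zeta_pos: "\<xi> \<in> gap \<mu> ==> E \<in> zeros_I \<mu> n ==> Re (zeta \<mu> n \<xi> E) > 0"
 using ref unfolding reference_measure_def by blast

text \<open>Since the type I polynomial vanishes at \<open>E\<close>, both \<open>L\<close> and the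
  Cauchy part of \<open>1 / L\<close> have densities bounded by a multiple of
  \<open>\<bar>t - E\<bar>\<close>. So \<open>cauchy_boundary_limit\<close> applies to both, and
  \<open>inverse_L\<close> relates the limits.\<close>

lemma L_plus_zero:
 assumes E: "E \<in> zeros_I \<mu> n"
 shows L_plus_ell: "L_plus \<mu> n E = cor (ell E)" and ell_nonzero: "ell E \<noteq> 0"
  and inverse_ell: "1 / ell E = poly pn E - (\<integral>x. sg x / (E - x) \<partial>w)"
proof -
 obtain k where k: "k \<in> {1,2}" "E \<in> Delta \<mu> k" "TP n k E = 0" using zeros_I_Delta[OF np E] by blast
 note zb = zero_bound[OF k(2,1,3)]
 have "((\<lambda>\<epsilon>. L_fun \<mu> n (Complex E \<epsilon>)) \<longlongrightarrow> (\<Sum>k\<in>{1,2}. cor (\<integral>t. TP n k t / (E - t) \<partial>\<mu> k))) (at_right 0)"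
  unfolding L_fun_cI cI_def mult_1
 proof (rule tendsto_sum)
  fix j :: nat assume j: "j \<in> {1,2}"
  obtain C where C: "\<forall>t\<in>Delta \<mu> j. \<bar>TP n j t\<bar> \<le> C * \<bar>t - E\<bar>" using zb[OF j] by blast
  show "((\<lambda>\<epsilon>. compact_measure.cauchy (\<mu> j) (TP n j) (Complex E \<epsilon>)) \<longlongrightarrow> cor (\<integral>t. TP n j t / (E - t) \<partial>\<mu> j)) (at_right 0)"
   by (rule compact_measure.cauchy_boundary_limit[OF compact_measure_mu[OF j], of _ C]) (use C in auto)
 qed
 then have lim: "((\<lambda>\<epsilon>. L_fun \<mu> n (Complex E \<epsilon>)) \<longlongrightarrow> cor (ell E)) (at_right 0)"
  by (simp add: ell_def)
 then show L: "L_plus \<mu> n E = cor (ell E)"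
  unfolding L_plus_def by (intro tendsto_Lim trivial_limit_at_right_real)
 obtain \<xi> where xi: "\<xi> \<in> gap \<mu>" using gap_ex by blast
 \<comment> \<open>If \<open>ell E\<close> were 0, the residue \<open>zeta\<close> would be 0 as
   well, as \<open>1 / 0 = 0\<close>, contrary to its positivity.\<close>
 show nz: "ell E \<noteq> 0"
  using zeta_pos[OF xi E] by (auto simp: zeta_def L)
 obtain C1 C2 where C: "\<forall>t\<in>Delta \<mu> 1. \<bar>TP n 1 t\<bar> \<le> C1 * \<bar>t - E\<bar>" "\<forall>t\<in>Delta \<mu> 2. \<bar>TP n 2 t\<bar> \<le> C2 * \<bar>t - E\<bar>"
  using zb[of 1] zb[of 2] by auto
 have lim2: "((\<lambda>\<epsilon>. W.cauchy sg (Complex E \<epsilon>)) \<longlongrightarrow> cor (\<integral>t. sg t / (E - t) \<partial>w)) (at_right 0)"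
 proof (rule W.cauchy_boundary_limit[OF W.admissible_measurable[OF admissible_sg]])
  fix t assume "t \<in> DD"
  then show "\<bar>sg t\<bar> \<le> max C1 C2 * \<bar>t - E\<bar>"
  proof
   assume t: "t \<in> Delta \<mu> 1"
   then have "\<bar>sg t\<bar> \<le> C1 * \<bar>t - E\<bar>" using C sg_Delta[of 1 t] by simp
   also have "... \<le> max C1 C2 * \<bar>t - E\<bar>" by (intro mult_right_mono) auto
   finally show ?thesis .
  next
   assume t: "t \<in> Delta \<mu> 2"
   then have "\<bar>sg t\<bar> \<le> C2 * \<bar>t - E\<bar>" using C sg_Delta[of 2 t] by simp
   also have "... \<le> max C1 C2 * \<bar>t - E\<bar>" by (intro mult_right_mono) auto
   finally show ?thesis .
  qed
 qed
 have "((\<lambda>\<epsilon>. Complex E \<epsilon>) \<longlongrightarrow> Complex E 0) (at_right 0)"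
  by (intro tendsto_Complex tendsto_const tendsto_ident_at)
 then have lim3: "((\<lambda>\<epsilon>. cpoly pn (Complex E \<epsilon>)) \<longlongrightarrow> cpoly pn (Complex E 0)) (at_right 0)"
  by (intro tendsto_poly)
 have lim5: "((\<lambda>\<epsilon>. cpoly pn (Complex E \<epsilon>) - W.cauchy sg (Complex E \<epsilon>)) \<longlongrightarrow> cpoly pn (Complex E 0) - cor (\<integral>t. sg t / (E - t) \<partial>w)) (at_right 0)"
  by (intro tendsto_diff lim3 lim2)
 have lim4: "((\<lambda>\<epsilon>. 1 / L_fun \<mu> n (Complex E \<epsilon>)) \<longlongrightarrow> 1 / cor (ell E)) (at_right 0)"
  using nz by (intro tendsto_intros lim) simp
 have ev: "eventually (\<lambda>\<epsilon>. 1 / L_fun \<mu> n (Complex E \<epsilon>) = cpoly pn (Complex E \<epsilon>) - W.cauchy sg (Complex E \<epsilon>)) (at_right 0)"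
  by (rule eventually_at_rightI[of 0 1]) (auto simp: inverse_L)
 have "1 / cor (ell E) = cpoly pn (Complex E 0) - cor (\<integral>t. sg t / (E - t) \<partial>w)"
  by (rule tendsto_unique[OF trivial_limit_at_right_real Lim_transform_eventually[OF lim4 ev] lim5])
 also have "cpoly pn (Complex E 0) = cor (poly pn E)"
  using cpoly_of_real[of pn E] by (simp add: complex_of_real_def)
 finally have "cor (1 / ell E) = cor (poly pn E - (\<integral>x. sg x / (E - x) \<partial>w))" by simp
 then show "1 / ell E = poly pn E - (\<integral>x. sg x / (E - x) \<partial>w)" by (simp only: of_real_eq_iff)
qed

text \<open>The first product of the determinant vanishes with \<open>TP n k E\<close>. In the
  second one the divided difference at \<open>t = E\<close> is the derivative, whereas the integrand
  of \<open>ell\<close> is 0 there; the atom accounts for the difference.\<close>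

lemma Fm_at_zero:
 assumes k: "k \<in> {1,2}" and E: "E \<in> Delta \<mu> k" "TP n k E = 0"
 shows "Fm n l k E = TP l k E * (ell E - poly (pderiv (TI n k)) E * measure (\<mu> k) {E})"
proof -
 have Eo: "E \<notin> Delta \<mu> (3 - k)" by (rule Delta_other_disjoint[OF k E(1)])
 have "(\<integral>t. TP n k t / (E - t) \<partial>\<mu> k) = (\<integral>t. (if t \<in> {E} then 0 else - poly (sdiv (TI n k) E) t) \<partial>\<mu> k)"
 proof (intro Bochner_Integration.integral_cong refl)
  fix t
  show "TP n k t / (E - t) = (if t \<in> {E} then 0 else - poly (sdiv (TI n k) E) t)"
   using minus_divide_right[of "TP n k t" "t - E"] E(2) by (simp add: poly_synthetic_div_eq)
 qed
 also have "... = (\<integral>t. - poly (sdiv (TI n k) E) t \<partial>\<mu> k) - (\<Sum>E'\<in>{E}. - poly (sdiv (TI n k) E) E' * measure (\<mu> k) {E'})"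
  using integrable_mu_poly[OF k] by (intro compact_measure.integral_off_finite[OF compact_measure_mu[OF k]]) auto
 finally have R: "Rf n k E = - ell E + poly (pderiv (TI n k)) E * measure (\<mu> k) {E}"
  using k by (auto simp: Rf_eq[OF k Eo] ell_def poly_synthetic_div_self)
 show ?thesis unfolding Fm_def R using E(2) by (simp add: algebra_simps)
qed

text \<open>Positivity of the residue \<open>zeta\<close> says that the derivative at
  \<open>E\<close> and \<open>ell E\<close> have opposite signs, so the second factor in
  \<open>Fm_at_zero\<close> has the sign of \<open>ell E\<close>; by positivity of \<open>Fm\<close>
  the polynomial has it too. This gives positivity of \<open>nu\<close> at the zeros.\<close>

lemma type_I_div_ell_pos:
 assumes k: "k \<in> {1,2}" and E: "E \<in> Delta \<mu> k" "TP n k E = 0" and i: "i \<in> {1,2}"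
 shows "0 < TP (n + unit_index i) k E / ell E"
proof -
 let ?B = "TP (n + unit_index i) k E" and ?d = "poly (pderiv (TI n k)) E"
 have Ez: "E \<in> zeros_I \<mu> n" using k E by (auto simp: zeros_I_def)
 obtain \<xi> where xi: "\<xi> \<in> gap \<mu>" using gap_ex by blast
 define c where "c = (-1) ^ snd n * ((E - \<xi>) * TP n (3 - k) E)"
 have c: "0 < c" unfolding c_def by (rule type_I_sign[OF np xi k E(1)])
 define r where "r = smult ((-1) ^ snd n) ([:- \<xi>, 1:] * TI n (3 - k))"
 have r: "poly r E = c" by (simp add: r_def c_def algebra_simps)
 have "D_poly \<mu> n \<xi> = r * TI n k"
  unfolding r_def using k by (auto simp: D_poly_def mult_ac simp del: mult_pCons_left mult_pCons_right)
 then have "poly (pderiv (D_poly \<mu> n \<xi>)) E = c * ?d"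
  using E(2) r by (simp add: pderiv_mult)
 then have "0 < Re (- (1 / (cor (c * ?d) * cor (ell E))))"
  using zeta_pos[OF xi Ez] by (simp add: zeta_def L_plus_ell[OF Ez])
 also have "- (1 / (cor (c * ?d) * cor (ell E))) = cor (- (1 / (c * ?d * ell E)))" by simp
 finally have "0 < - (1 / (c * ?d * ell E))" by (simp only: Re_complex_of_real)
 then have neg: "?d * ell E < 0" using c by (simp add: divide_less_0_iff mult_less_0_iff mult.assoc)
 have "0 < ?B * (ell E - ?d * measure (\<mu> k) {E})"
  using Fm_pos[OF np i refl k E(1)] unfolding Fm_at_zero[OF k E] .
 moreover have "0 \<le> measure (\<mu> k) {E}" by simp
 ultimately show ?thesis using neg
 proof (cases "ell E > 0")
  case True
  then have "?d < 0" using neg by (simp add: mult_less_0_iff)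
  then have "0 < ell E - ?d * measure (\<mu> k) {E}" using True by (smt (verit) measure_nonneg mult_nonpos_nonneg)
  then show ?thesis using \<open>0 < ?B * _\<close> True by (simp add: zero_less_mult_iff zero_less_divide_iff)
 next
  case False
  then have l: "ell E < 0" using ell_nonzero[OF Ez] by simp
  then have "0 < ?d" using neg by (simp add: mult_less_0_iff)
  then have "ell E - ?d * measure (\<mu> k) {E} < 0" using l by (smt (verit) measure_nonneg mult_nonneg_nonneg)
  then show ?thesis using \<open>0 < ?B * _\<close> l by (simp add: zero_less_mult_iff zero_less_divide_iff)
 qed
qed

end

section \<open>Regularized quotients\<close>

lemma poly_antiderivative:
 fixes g :: "real poly"
 shows "\<exists>G. pderiv G = g \<and> poly G a = c"
proof -
 define G where "G = (\<Sum>i\<le>degree g. monom (coeff g i / real (Suc i)) (Suc i))"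
 have "coeff G (Suc m) = coeff g m / real (Suc m)" for m
 proof -
  have "coeff G (Suc m) = (\<Sum>i\<le>degree g. if i = m then coeff g i / real (Suc i) else 0)"
   unfolding G_def coeff_sum by (intro sum.cong) auto
  also have "... = coeff g m / real (Suc m)" by (simp add: coeff_eq_0)
  finally show ?thesis .
 qed
 then have "pderiv G = g" by (intro poly_eqI) (simp add: coeff_pderiv del: of_nat_Suc)
 then have "pderiv (G + [:c - poly G a:]) = g \<and> poly (G + [:c - poly G a:]) a = c"
  by (simp add: pderiv_add pderiv_pCons)
 then show ?thesis by blast
qed

lemma poly_uniform_approximation:
 fixes f :: "real => real"
 assumes "compact S" "continuous_on S f" "0 < e"
 shows "\<exists>g :: real poly. \<forall>x\<in>S. \<bar>poly g x - f x\<bar> < e"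
proof -
 obtain g where g: "real_polynomial_function g" "\<And>x. x \<in> S ==> \<bar>f x - g x\<bar> < e"
  using Stone_Weierstrass_real_polynomial_function[OF assms] by blast
 obtain c m where c: "g = (\<lambda>x. \<Sum>i\<le>m. c i * x ^ i)"
  using g(1) unfolding real_polynomial_function_iff_sum by blast
 have "poly (\<Sum>i\<le>m. monom (c i) i) x = g x" for x
  by (simp add: c poly_sum poly_monom)
 then show ?thesis using g(2) by (intro exI[of _ "\<Sum>i\<le>m. monom (c i) i"]) (auto simp: abs_minus_commute)
qed

lemma continuous_on_Icc_bounded:
 fixes f :: "real => real"
 assumes "continuous_on {a..b} f"
 shows "\<exists>B. \<forall>t\<in>{a..b}. \<bar>f t\<bar> \<le> B"
proof -
 obtain B where "\<forall>y\<in>f ` {a..b}. \<bar>y\<bar> \<le> B"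
  using compact_imp_bounded[OF compact_continuous_image[OF assms compact_Icc]]
  unfolding bounded_iff real_norm_def by blast
 then show ?thesis by blast
qed

definition c1 :: "(real => real) => (real => real) => bool" where
 "c1 q q' \<longleftrightarrow> (\<forall>x. (q has_real_derivative q' x) (at x)) \<and> continuous_on UNIV q'"

text \<open>The analogue of \<open>poly (sdiv q x) t\<close> for a C^1 function, with the derivative
  on the diagonal because the measures may charge it.\<close>

definition dquot :: "(real => real) => (real => real) => real => real => real" where
 "dquot q q' x t = (if t = x then q' x else (q t - q x) / (t - x))"

lemma c1_continuous: "c1 q q' ==> continuous_on S q"
 unfolding c1_def by (meson DERIV_isCont continuous_at_imp_continuous_on)

lemma dquot_bound:
 assumes q: "c1 q q'" and x: "x \<in> {a..b}" and t: "t \<in> {a..b}" and B': "\<And>u. u \<in> {a..b} ==> \<bar>q' u\<bar> \<le> B'"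
 shows "\<bar>dquot q q' x t\<bar> \<le> B'"
proof (cases "t = x")
 case True
 then show ?thesis using B' x by (simp add: dquot_def)
next
 case False
 have "norm (q t - q x) \<le> B' * norm (t - x)"
 proof (rule field_differentiable_bound[where S="{a..b}" and f'=q'])
  show "(q has_field_derivative q' u) (at u within {a..b})" for u
   using q unfolding c1_def by (blast intro: has_field_derivative_at_within)
 qed (use x t B' in auto)
 then show ?thesis using False by (simp add: dquot_def abs_divide divide_le_eq)
qed

lemma synthetic_div_bounded:
 fixes p :: "real poly"
 shows "\<exists>C. \<forall>x\<in>{a..b}. \<forall>t\<in>{a..b}. \<bar>poly (sdiv p x) t\<bar> \<le> C"
proof -
 obtain C where C: "\<And>u. u \<in> {a..b} ==> \<bar>poly (pderiv p) u\<bar> \<le> C"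
  using continuous_on_Icc_bounded[OF continuous_on_poly_id] by blast
 have c1p: "c1 (poly p) (poly (pderiv p))" by (simp add: c1_def poly_DERIV)
 have sd: "poly (sdiv p x) t = dquot (poly p) (poly (pderiv p)) x t" for x t
  by (simp add: dquot_def poly_synthetic_div_eq poly_synthetic_div_self)
 have "\<bar>poly (sdiv p x) t\<bar> \<le> C" if "x \<in> {a..b}" "t \<in> {a..b}" for x t
  unfolding sd by (rule dquot_bound[OF c1p that C])
 then show ?thesis by blast
qed

text \<open>Approximating the derivative and integrating controls the divided differences too, by
  the mean value inequality; uniform approximation of \<open>q\<close> alone would not.\<close>

lemma c1_poly_approximation:
 assumes q: "c1 q q'" and ab: "a \<le> b" and e: "0 < e"
 shows "\<exists>Q. \<forall>x\<in>{a..b}. \<forall>t\<in>{a..b}. \<bar>poly Q t - q t\<bar> \<le> e * (b - a) \<and> \<bar>poly (sdiv Q x) t - dquot q q' x t\<bar> \<le> e"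
proof -
 have "continuous_on {a..b} q'" using q continuous_on_subset unfolding c1_def by blast
 then obtain g :: "real poly" where g: "\<And>x. x \<in> {a..b} ==> \<bar>poly g x - q' x\<bar> < e"
  using poly_uniform_approximation[of "{a..b}" q' e] e compact_Icc by blast
 obtain Q where Q: "pderiv Q = g" "poly Q a = q a" using poly_antiderivative by blast
 have lip: "\<bar>(poly Q t - q t) - (poly Q x - q x)\<bar> \<le> e * \<bar>t - x\<bar>" if "x \<in> {a..b}" "t \<in> {a..b}" for x t
 proof -
  have "norm ((\<lambda>t. poly Q t - q t) t - (\<lambda>t. poly Q t - q t) x) \<le> e * norm (t - x)"
  proof (rule field_differentiable_bound[where S="{a..b}" and f'="\<lambda>u. poly g u - q' u"])
   fix u assume "u \<in> {a..b}"
   have "(q has_real_derivative q' u) (at u within {a..b})"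
    using q unfolding c1_def by (blast intro: has_field_derivative_at_within)
   then show "((\<lambda>t. poly Q t - q t) has_field_derivative poly g u - q' u) (at u within {a..b})"
    using Q(1) by (auto intro!: derivative_eq_intros)
   show "norm (poly g u - q' u) \<le> e" using g[OF \<open>u \<in> {a..b}\<close>] by simp
  qed (use that in auto)
  then show ?thesis by simp
 qed
 show ?thesis
 proof (intro exI[of _ Q] ballI conjI)
  fix x t assume xt: "x \<in> {a..b}" "t \<in> {a..b}"
  have "\<bar>poly Q t - q t\<bar> \<le> e * \<bar>t - a\<bar>" using lip[of a t] ab xt Q(2) by simp
  also have "... \<le> e * (b - a)" using xt e by (intro mult_left_mono) auto
  finally show "\<bar>poly Q t - q t\<bar> \<le> e * (b - a)" .
  show "\<bar>poly (sdiv Q x) t - dquot q q' x t\<bar> \<le> e"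
  proof (cases "t = x")
   case True
   then show ?thesis using g[OF xt(1)] Q(1) by (simp add: dquot_def poly_synthetic_div_self)
  next
   case False
   then have "poly (sdiv Q x) t - dquot q q' x t = ((poly Q t - q t) - (poly Q x - q x)) / (t - x)"
    by (simp add: dquot_def poly_synthetic_div_eq diff_divide_distrib)
   then show ?thesis using lip[OF xt] False by (simp add: abs_divide divide_le_eq)
  qed
 qed
qed

lemma tendsto_inverse_Suc_bound:
 fixes s :: "nat => real"
 assumes "\<And>j. \<bar>s j - l\<bar> \<le> c * inverse (real (Suc j))"
 shows "s \<longlonglongrightarrow> l"
proof -
 have "(\<lambda>j. c * inverse (real (Suc j))) \<longlonglongrightarrow> c * 0"
  by (intro tendsto_intros LIMSEQ_inverse_real_of_nat)
 then have "(\<lambda>j. s j - l) \<longlonglongrightarrow> 0"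
  using assms by (intro Lim_null_comparison[of "\<lambda>j. s j - l" "\<lambda>j. c * inverse (real (Suc j))"]) auto
 then show ?thesis by (simp add: LIM_zero_iff)
qed

lemma square_pos_part_deriv: "((\<lambda>x. (max 0 x)^2) has_real_derivative 2 * max 0 x) (at x)" for x :: real
proof -
 consider "x > 0" | "x < 0" | "x = 0" by linarith
 then show ?thesis
 proof cases
  case 1
  have "((\<lambda>x. x^2) has_real_derivative 2 * max 0 x) (at x)" using 1 by (auto intro!: derivative_eq_intros)
  then show ?thesis by (rule has_field_derivative_transform_within_open[of _ _ _ "{0<..}"]) (use 1 in auto)
 next
  case 2
  have "((\<lambda>x. 0) has_real_derivative 2 * max 0 x) (at x)" using 2 by (auto intro!: derivative_eq_intros)
  then show ?thesis by (rule has_field_derivative_transform_within_open[of _ _ _ "{..<0}"]) (use 2 in auto)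
 next
  case 3
  have "((\<lambda>h::real. (max 0 h)^2 / h) \<longlongrightarrow> 0) (at 0)"
  proof (rule Lim_null_comparison)
   show "eventually (\<lambda>h::real. norm ((max 0 h)^2 / h) \<le> \<bar>h\<bar>) (at 0)"
    by (auto simp: max_def power2_eq_square intro!: always_eventually)
   show "((\<lambda>h::real. \<bar>h\<bar>) \<longlongrightarrow> 0) (at 0)" by (auto intro!: tendsto_eq_intros)
  qed
  then show ?thesis unfolding DERIV_def using 3 by simp
 qed
qed

text \<open>A transition inside the gap lets different functions be prescribed on the two intervals.
  The squared positive parts of \<open>x - u\<close> and \<open>v - x\<close> are C^1 and never
  vanish together, so their normalized quotient serves.\<close>

lemma c1_cutoff:
 assumes "u < (v::real)"
 obtains cut cut' where "c1 cut cut'" "\<And>x. x \<le> u ==> cut x = 0 \<and> cut' x = 0" "\<And>x. v \<le> x ==> cut x = 1 \<and> cut' x = 0"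
proof -
 define h1 h2 :: "real => real" where "h1 x = (max 0 (x - u))^2" and "h2 x = (max 0 (v - x))^2" for x
 define d1 d2 :: "real => real" where "d1 x = 2 * max 0 (x - u)" and "d2 x = - 2 * max 0 (v - x)" for x
 have pos: "h1 x + h2 x > 0" for x
 proof (cases "x \<le> u")
  case True
  then show ?thesis using assms by (auto simp: h1_def h2_def max_def intro!: add_nonneg_pos)
 next
  case False
  then show ?thesis by (auto simp: h1_def h2_def max_def intro!: add_pos_nonneg)
 qed
 have D1: "(h1 has_real_derivative d1 x) (at x)" for x
 proof -
  have "((\<lambda>x. x - u) has_real_derivative 1) (at x)" by (auto intro!: derivative_eq_intros)
  from DERIV_chain2[OF square_pos_part_deriv[of "x - u"] this] show ?thesis
   unfolding h1_def[abs_def] d1_def by (simp only: mult_1_right)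
 qed
 have D2: "(h2 has_real_derivative d2 x) (at x)" for x
 proof -
  have "((\<lambda>x. v - x) has_real_derivative -1) (at x)" by (auto intro!: derivative_eq_intros)
  from DERIV_chain2[OF square_pos_part_deriv[of "v - x"] this] show ?thesis
   unfolding h2_def[abs_def] d2_def by simp
 qed
 define cut' where "cut' x = (d1 x * (h1 x + h2 x) - h1 x * (d1 x + d2 x)) / ((h1 x + h2 x) * (h1 x + h2 x))" for x
 have "c1 (\<lambda>x. h1 x / (h1 x + h2 x)) cut'"
  unfolding c1_def
 proof (intro conjI allI)
  show "((\<lambda>x. h1 x / (h1 x + h2 x)) has_real_derivative cut' x) (at x)" for x
   unfolding cut'_def using pos[of x] by (intro DERIV_divide DERIV_add D1 D2) auto
  have "(h1 x + h2 x) * (h1 x + h2 x) \<noteq> 0" for x using pos[of x] by simp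
  then show "continuous_on UNIV cut'" unfolding cut'_def d1_def d2_def h1_def h2_def
   by (intro continuous_intros) auto
 qed
 moreover have "h1 x / (h1 x + h2 x) = 0 \<and> cut' x = 0" if "x \<le> u" for x
  using that by (simp add: cut'_def h1_def d1_def)
 moreover have "h1 x / (h1 x + h2 x) = 1 \<and> cut' x = 0" if "v \<le> x" for x
  using that pos[of x] by (simp add: cut'_def h2_def d2_def)
 ultimately show ?thesis by (rule that[of "\<lambda>x. h1 x / (h1 x + h2 x)" cut'])
qed

text \<open>
 A \<open>C\<^sup>1\<close> substitute for \<open>B / A\<close>. It vanishes at the zeros of \<open>A\<close>, so in the limit \<open>e \<longlonglongrightarrow> 0\<close> the
 atoms of \<open>\<mu>\<^sub>k\<close> there are lost and enter \<open>stieltjes_identity\<close> as a separate sum.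
\<close>

definition rf :: "real poly => real poly => real => real => real" where
 "rf A B e x = poly B x * poly A x / ((poly A x)^2 + e)"

definition rf_deriv :: "real poly => real poly => real => real => real" where
 "rf_deriv A B e x = poly (pderiv B) x * poly A x / ((poly A x)^2 + e) +
   poly B x * poly (pderiv A) x * (e - (poly A x)^2) / ((poly A x)^2 + e)^2"

text \<open>The divided difference of \<open>rf\<close> with the division by \<open>t - x\<close>
  carried out on the polynomials, so that the limit in \<open>e\<close> can be studied uniformly in
  \<open>x\<close> and \<open>t\<close>.\<close>

definition rf_dd :: "real poly => real poly => real => real => real => real" where
 "rf_dd A B e x t = poly (sdiv B x) t * poly A t / ((poly A t)^2 + e) +
   poly B x * poly (sdiv A x) t * (e - poly A t * poly A x) / (((poly A t)^2 + e) * ((poly A x)^2 + e))"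

lemma rf_denom_pos: "0 < e ==> 0 < (poly A x)^2 + (e::real)"
 by (rule add_nonneg_pos) auto

lemma c1_rf:
 assumes e: "0 < e"
 shows "c1 (rf A B e) (rf_deriv A B e)"
 unfolding c1_def
proof (intro conjI allI)
 fix x
 have p: "(poly A x)^2 + e \<noteq> 0" using rf_denom_pos[OF e, of A x] by simp
 have "((\<lambda>x. poly B x * poly A x / ((poly A x)^2 + e)) has_real_derivative
  ((poly (pderiv B) x * poly A x + poly (pderiv A) x * poly B x) * ((poly A x)^2 + e) - (poly B x * poly A x) * (2 * (poly (pderiv A) x * poly A x))) /
  (((poly A x)^2 + e) * ((poly A x)^2 + e))) (at x)"
  using p by (intro DERIV_divide) (auto intro!: derivative_eq_intros)
 moreover have "((poly (pderiv B) x * poly A x + poly (pderiv A) x * poly B x) * ((poly A x)^2 + e) - (poly B x * poly A x) * (2 * (poly (pderiv A) x * poly A x))) /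
  (((poly A x)^2 + e) * ((poly A x)^2 + e)) = rf_deriv A B e x"
 proof -
  have gen: "((b' * a + a' * b) * (a^2 + e) - (b * a) * (2 * (a' * a))) / ((a^2 + e) * (a^2 + e)) =
   b' * a / (a^2 + e) + b * a' * (e - a^2) / (a^2 + e)^2" if "a^2 + e \<noteq> 0" for a a' b b' :: real
  proof -
   define D where "D = a^2 + e"
   have "(b' * a + a' * b) * D - (b * a) * (2 * (a' * a)) = b' * a * D + b * a' * (e - a^2)"
    unfolding D_def by (simp add: algebra_simps power2_eq_square)
   moreover have "D \<noteq> 0" using that by (simp add: D_def)
   ultimately show ?thesis unfolding D_def[symmetric] by (simp add: add_divide_distrib power2_eq_square)
  qed
  show ?thesis unfolding rf_deriv_def by (rule gen[OF p])
 qed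
 ultimately show "(rf A B e has_real_derivative rf_deriv A B e x) (at x)"
  unfolding rf_def[abs_def] by simp
next
 have "(poly A x)^2 + e \<noteq> 0" for x using rf_denom_pos[OF e, of A x] by simp
 then show "continuous_on UNIV (rf_deriv A B e)" unfolding rf_deriv_def[abs_def]
  by (intro continuous_intros) auto
qed

lemma rf_dd_eq:
 assumes e: "0 < e"
 shows "rf_dd A B e x t = dquot (rf A B e) (rf_deriv A B e) x t"
proof (cases "t = x")
 case True
 then show ?thesis
  by (simp add: rf_dd_def dquot_def rf_deriv_def poly_synthetic_div_self power2_eq_square)
next
 case False
 have gen: "((b - b0) / h) * a / (a^2 + e) + b0 * ((a - a0) / h) * (e - a * a0) / ((a^2 + e) * (a0^2 + e))
  = (b * a / (a^2 + e) - b0 * a0 / (a0^2 + e)) / h" if "h \<noteq> 0" for a a0 b b0 h :: real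
 proof -
  define D D0 where "D = a^2 + e" and "D0 = a0^2 + e"
  have nz: "D \<noteq> 0" "D0 \<noteq> 0" using e by (auto simp: D_def D0_def add_nonneg_eq_0_iff)
  have "(b - b0) * a * D0 + b0 * (a - a0) * (e - a * a0) = b * a * D0 - b0 * a0 * D"
   unfolding D_def D0_def by (simp add: algebra_simps power2_eq_square)
  then have "((b - b0) * a * D0 + b0 * (a - a0) * (e - a * a0)) / (h * D * D0) = (b * a * D0 - b0 * a0 * D) / (h * D * D0)"
   by simp
  moreover have "((b - b0) / h) * a / D = ((b - b0) * a * D0) / (h * D * D0)"
   "b0 * ((a - a0) / h) * (e - a * a0) / (D * D0) = (b0 * (a - a0) * (e - a * a0)) / (h * D * D0)"
   "(b * a / D - b0 * a0 / D0) / h = (b * a * D0 - b0 * a0 * D) / (h * D * D0)"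
   using nz that by (simp_all add: field_simps)
  ultimately show ?thesis unfolding D_def[symmetric] D0_def[symmetric]
   by (simp only: add_divide_distrib[symmetric])
 qed
 show ?thesis using False gen[of "t - x"] by (simp add: rf_dd_def dquot_def rf_def poly_synthetic_div_eq)
qed

text \<open>These are the kernels of \<open>rf_dd_scaled\<close>; bounds independent of
  \<open>e\<close> allow dominated convergence as \<open>e\<close> tends to 0.\<close>

lemma rf_kernel_bound:
 fixes a b e :: real
 assumes e: "0 < e"
 shows "\<bar>a^2 / (a^2 + e)\<bar> \<le> 1" "\<bar>a * b * (e - a * b) / ((a^2 + e) * (b^2 + e))\<bar> \<le> 1"
proof -
 show "\<bar>a^2 / (a^2 + e)\<bar> \<le> 1" using e by (simp add: add_nonneg_pos)
 have "\<bar>a * b\<bar> * \<bar>e - a * b\<bar> \<le> \<bar>a * b\<bar> * (e + \<bar>a * b\<bar>)"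
  using e by (intro mult_left_mono) (auto simp: abs_if)
 also have "... = \<bar>a * b\<bar> * e + (a * b)^2" by (simp add: power2_eq_square distrib_left abs_mult_self_eq flip: abs_mult)
 also have "\<bar>a * b\<bar> * e \<le> (a^2 + b^2) * e"
 proof (intro mult_right_mono)
  have "2 * \<bar>a * b\<bar> \<le> a^2 + b^2" using sum_squares_bound[of "\<bar>a\<bar>" "\<bar>b\<bar>"] by (simp add: abs_mult)
  moreover have "0 \<le> \<bar>a * b\<bar>" by simp
  ultimately show "\<bar>a * b\<bar> \<le> a^2 + b^2" by linarith
 qed (use e in simp)
 also have "(a^2 + b^2) * e + (a * b)^2 \<le> (a^2 + e) * (b^2 + e)"
  by (simp add: algebra_simps power2_eq_square)
 finally have "\<bar>a * b\<bar> * \<bar>e - a * b\<bar> \<le> (a^2 + e) * (b^2 + e)" by simp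
 moreover have p: "0 < (a^2 + e) * (b^2 + e)" using e by (intro mult_pos_pos add_nonneg_pos) auto
 ultimately show "\<bar>a * b * (e - a * b) / ((a^2 + e) * (b^2 + e))\<bar> \<le> 1"
  by (simp only: abs_divide abs_of_pos[OF p] divide_le_eq_1_pos[OF p] abs_mult[of "a * b"])
qed

lemma rf_dd_scaled:
 "rf_dd A B e x t * poly A t * poly A x =
   poly (sdiv B x) t * ((poly A t)^2 / ((poly A t)^2 + e)) * poly A x +
   poly B x * poly (sdiv A x) t * (poly A t * poly A x * (e - poly A t * poly A x) / (((poly A t)^2 + e) * ((poly A x)^2 + e)))"
proof -
 have "(s * a / D + b * r * c / (D * D0)) * a * a0 = s * (a^2 / D) * a0 + b * r * (a * a0 * c / (D * D0))"
  for s a b r c D D0 a0 :: real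
  by (simp add: algebra_simps power2_eq_square)
 then show ?thesis unfolding rf_dd_def by blast
qed

lemma rf_limit:
 fixes a :: real
 shows "(\<lambda>j. a^2 / (a^2 + inverse (real (Suc j)))) \<longlonglongrightarrow> (if a = 0 then 0 else 1)"
proof (cases "a = 0")
 case False
 then have "(\<lambda>j. a^2 / (a^2 + inverse (real (Suc j)))) \<longlonglongrightarrow> a^2 / (a^2 + 0)"
  by (intro tendsto_intros LIMSEQ_inverse_real_of_nat) simp
 then show ?thesis using False by simp
qed simp

text \<open>If \<open>poly A t\<close> is nonzero, the first kernel of \<open>rf_dd_scaled\<close>
  tends to 1 and the second to -1; if it is zero, both vanish for every \<open>e\<close>.\<close>

lemma rf_dd_limit:
 assumes x: "poly A x \<noteq> 0"
 shows "(\<lambda>j. rf_dd A B (inverse (real (Suc j))) x t * poly A t * poly A x) \<longlonglongrightarrow>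
  (if poly A t = 0 then 0 else poly A x * poly (sdiv B x) t - poly B x * poly (sdiv A x) t)"
proof (cases "poly A t = 0")
 case False
 let ?a = "poly A t" and ?b = "poly A x"
 have "(\<lambda>j. poly (sdiv B x) t * (?a^2 / (?a^2 + inverse (real (Suc j)))) * ?b +
   poly B x * poly (sdiv A x) t * (?a * ?b * (inverse (real (Suc j)) - ?a * ?b) / ((?a^2 + inverse (real (Suc j))) * (?b^2 + inverse (real (Suc j)))))) \<longlonglongrightarrow>
   poly (sdiv B x) t * (?a^2 / (?a^2 + 0)) * ?b + poly B x * poly (sdiv A x) t * (?a * ?b * (0 - ?a * ?b) / ((?a^2 + 0) * (?b^2 + 0)))"
  using False x by (intro tendsto_intros LIMSEQ_inverse_real_of_nat) simp_all
 also have "poly (sdiv B x) t * (?a^2 / (?a^2 + 0)) * ?b + poly B x * poly (sdiv A x) t * (?a * ?b * (0 - ?a * ?b) / ((?a^2 + 0) * (?b^2 + 0)))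
  = ?b * poly (sdiv B x) t - poly B x * poly (sdiv A x) t"
  using False x by (simp add: power2_eq_square)
 finally show ?thesis unfolding rf_dd_scaled using False by simp
qed simp

section \<open>From polynomial to C^1 test functions\<close>

context angelesco_reference
begin

lemma hull: "a \<in> {Inf (Delta \<mu> 1)..Sup (Delta \<mu> 2)}" if "k \<in> {1,2}" "a \<in> Delta \<mu> k"
 using that Delta_bounds[of 1 a] Delta_bounds[of 2 a] Delta_less[OF Inf_Sup_in_Delta(1)[of 1], of a]
  Delta_less[of a, OF _ Inf_Sup_in_Delta(2)[of 2]] by auto

lemma hull_le: "Inf (Delta \<mu> 1) \<le> Sup (Delta \<mu> 2)"
 using Delta_less[OF Inf_Sup_in_Delta(1)[of 1] Inf_Sup_in_Delta(2)[of 2]] by simp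

text \<open>The counterpart of \<open>form (TI n) (sdiv q x)\<close> for a C^1 function
  \<open>q\<close>.\<close>

definition Uq :: "(real => real) => (real => real) => real => real" where
 "Uq q q' x = (\<Sum>k\<in>{1,2}. \<integral>t. dquot q q' x t * TP n k t \<partial>\<mu> k)"

lemma sg_0: "x \<notin> DD ==> sg x = 0"
 by (simp add: sg_def)

text \<open>Both sides of \<open>form_pn_mult\<close> depend only on values and divided differences
  of \<open>q\<close>, which \<open>c1_poly_approximation\<close> approximates uniformly on the hull
  of the two intervals; dominated convergence does the rest.\<close>

lemma form_pn_c1:
 assumes q: "c1 q q'"
 shows "(\<lambda>x. Uq q q' x * sg x) \<in> borel_measurable borel"
  "(\<Sum>k\<in>{1,2}. \<integral>t. q t * (poly pn t * TP n k t) \<partial>\<mu> k) = (\<integral>x. Uq q q' x * sg x \<partial>w)"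
proof -
 let ?a = "Inf (Delta \<mu> 1)" and ?b = "Sup (Delta \<mu> 2)"
 define e where "e j = inverse (real (Suc j))" for j
 have e0: "0 < e j" "e j \<le> 1" for j by (auto simp: e_def field_simps)
 have "\<forall>j. \<exists>Q. \<forall>x\<in>{?a..?b}. \<forall>t\<in>{?a..?b}. \<bar>poly Q t - q t\<bar> \<le> e j * (?b - ?a) \<and> \<bar>poly (sdiv Q x) t - dquot q q' x t\<bar> \<le> e j"
  using c1_poly_approximation[OF q hull_le e0(1)] by blast
 then obtain Q where Q: "\<And>j x t. x \<in> {?a..?b} ==> t \<in> {?a..?b} ==> \<bar>poly (Q j) t - q t\<bar> \<le> e j * (?b - ?a)"
  "\<And>j x t. x \<in> {?a..?b} ==> t \<in> {?a..?b} ==> \<bar>poly (sdiv (Q j) x) t - dquot q q' x t\<bar> \<le> e j"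
  by metis
 have qm: "q \<in> borel_measurable borel" "q' \<in> borel_measurable borel"
  using c1_continuous[OF q] q unfolding c1_def by (auto intro: borel_measurable_continuous_onI)
 have dm: "(\<lambda>t. dquot q q' x t) \<in> borel_measurable borel" for x
  unfolding dquot_def using qm by measurable
 obtain C where C: "\<And>k t. k \<in> {1,2} ==> t \<in> Delta \<mu> k ==> \<bar>TP n k t\<bar> \<le> C"
 proof -
  obtain C1 C2 where "\<forall>t\<in>Delta \<mu> 1. \<bar>TP n 1 t\<bar> \<le> C1" "\<forall>t\<in>Delta \<mu> 2. \<bar>TP n 2 t\<bar> \<le> C2"
   using compact_measure.admissible_bounded[OF compact_measure_mu admissible_mu_poly] by (meson insertI1 insertI2)
  then show ?thesis by (intro that[of "max C1 C2"]) (auto simp: le_max_iff_disj)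
 qed
 have C0: "0 \<le> C"
  using C[of 1 "Inf (Delta \<mu> 1)"] Inf_Sup_in_Delta(1)[of 1] by force
 have cont: "continuous_on {?a..?b} q'" using q continuous_on_subset unfolding c1_def by blast
 obtain B where B: "\<And>t. t \<in> {?a..?b} ==> \<bar>q t\<bar> \<le> B"
  using continuous_on_Icc_bounded[OF c1_continuous[OF q]] by blast
 obtain P where P: "\<And>t. t \<in> {?a..?b} ==> \<bar>poly pn t\<bar> \<le> P"
  using continuous_on_Icc_bounded[OF continuous_on_poly_id] by blast
 obtain B' where B': "\<And>t. t \<in> {?a..?b} ==> \<bar>q' t\<bar> \<le> B'"
  using continuous_on_Icc_bounded[OF cont] by blast
 have ddB: "\<bar>dquot q q' x t\<bar> \<le> B'" if "x \<in> {?a..?b}" "t \<in> {?a..?b}" for x t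
  by (rule dquot_bound[OF q that B'])
 have sdB: "\<bar>poly (sdiv (Q j) x) t\<bar> \<le> B' + 1" if "x \<in> {?a..?b}" "t \<in> {?a..?b}" for x t j
  using Q(2)[OF that, of j] ddB[OF that] e0(2)[of j] by linarith
 have sdlim: "(\<lambda>j. poly (sdiv (Q j) x) t) \<longlonglongrightarrow> dquot q q' x t" if "x \<in> {?a..?b}" "t \<in> {?a..?b}" for x t
  by (rule tendsto_inverse_Suc_bound[where c=1]) (use Q(2)[OF that] in \<open>simp add: e_def\<close>)
 have Qlim: "(\<lambda>j. poly (Q j) t) \<longlonglongrightarrow> q t" if "t \<in> {?a..?b}" for t
  by (rule tendsto_inverse_Suc_bound[where c="?b - ?a"]) (use Q(1)[OF that that] in \<open>simp add: e_def mult.commute\<close>)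
 have QB: "\<bar>poly (Q j) t\<bar> \<le> B + (?b - ?a)" if "t \<in> {?a..?b}" for t j
 proof -
  have "e j * (?b - ?a) \<le> 1 * (?b - ?a)" using e0(2) hull_le by (intro mult_right_mono) auto
  then have "\<bar>poly (Q j) t - q t\<bar> \<le> ?b - ?a" using order_trans[OF Q(1)[OF that that, of j]] by simp
  then show ?thesis using B[OF that] abs_triangle_ineq[of "poly (Q j) t - q t" "q t"] by simp
 qed
 have inner: "(\<lambda>j. form (TI n) (sdiv (Q j) x)) \<longlonglongrightarrow> Uq q q' x" if x: "x \<in> {?a..?b}" for x
  unfolding form_def Uq_def
 proof (rule tendsto_sum)
  fix k :: nat assume k: "k \<in> {1,2}"
  show "(\<lambda>j. \<integral>t. poly (sdiv (Q j) x) t * TP n k t \<partial>\<mu> k) \<longlonglongrightarrow> (\<integral>t. dquot q q' x t * TP n k t \<partial>\<mu> k)"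
  proof (rule compact_measure.dominated_limit[OF compact_measure_mu[OF k]])
   show "(\<lambda>t. dquot q q' x t * TP n k t) \<in> borel_measurable borel" using dm by measurable
   show "norm (poly (sdiv (Q j) x) t * TP n k t) \<le> (B' + 1) * C" if "t \<in> Delta \<mu> k" for j t
    using sdB[OF x hull[OF k that], of j] C[OF k that] C0 by (auto simp: abs_mult intro!: mult_mono)
   show "AE t in \<mu> k. (\<lambda>j. poly (sdiv (Q j) x) t * TP n k t) \<longlonglongrightarrow> dquot q q' x t * TP n k t"
    using AE_mu[OF k] by eventually_elim (intro tendsto_intros sdlim x hull[OF k])
  qed simp
 qed
 have lim: "(\<lambda>j. form (TI n) (sdiv (Q j) x) * sg x) \<longlonglongrightarrow> Uq q q' x * sg x" for x
 proof (cases "x \<in> DD")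
  case True
  then have "x \<in> {?a..?b}" using hull[of 1 x] hull[of 2 x] by blast
  then show ?thesis by (intro tendsto_intros inner)
 qed (simp add: sg_0)
 have sgm: "sg \<in> borel_measurable borel" by (rule W.admissible_measurable[OF admissible_sg])
 have mj: "(\<lambda>x. form (TI n) (sdiv (Q j) x) * sg x) \<in> borel_measurable borel" for j
  unfolding poly_dI[symmetric] using sgm by measurable
 show m: "(\<lambda>x. Uq q q' x * sg x) \<in> borel_measurable borel"
  by (rule borel_measurable_LIMSEQ_real[OF lim mj])
 define T where "T = (\<Sum>k\<in>{1,2}. (B' + 1) * C * measure (\<mu> k) (space (\<mu> k)))"
 have bound: "\<bar>form (TI n) (sdiv (Q j) x)\<bar> \<le> T" if x: "x \<in> {?a..?b}" for j x
  unfolding form_def T_def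
 proof (intro order_trans[OF sum_abs sum_mono])
  fix k :: nat assume k: "k \<in> {1,2}"
  interpret finite_measure "\<mu> k" by (rule finite_mu[OF k])
  have "\<bar>\<integral>t. poly (sdiv (Q j) x) t * TP n k t \<partial>\<mu> k\<bar> \<le> (\<integral>t. \<bar>poly (sdiv (Q j) x) t * TP n k t\<bar> \<partial>\<mu> k)"
   by (rule integral_abs_bound)
  also have "... \<le> (\<integral>t. (B' + 1) * C \<partial>\<mu> k)"
  proof (rule integral_mono_AE)
   show "integrable (\<mu> k) (\<lambda>t. \<bar>poly (sdiv (Q j) x) t * TP n k t\<bar>)"
    using integrable_poly_mult[OF k] by simp
   show "AE t in \<mu> k. \<bar>poly (sdiv (Q j) x) t * TP n k t\<bar> \<le> (B' + 1) * C"
    using AE_mu[OF k]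
   proof eventually_elim
    case (elim t)
    then show ?case using sdB[OF x hull[OF k elim], of j] C[OF k elim] C0 by (auto simp: abs_mult intro!: mult_mono)
   qed
  qed simp
  finally show "\<bar>\<integral>t. poly (sdiv (Q j) x) t * TP n k t \<partial>\<mu> k\<bar> \<le> (B' + 1) * C * measure (\<mu> k) (space (\<mu> k))"
   by (simp add: mult_ac)
 qed
 obtain G where G: "\<forall>x\<in>DD. \<bar>sg x\<bar> \<le> G" using W.admissible_bounded[OF admissible_sg] by blast
 have R: "(\<lambda>j. \<integral>x. form (TI n) (sdiv (Q j) x) * sg x \<partial>w) \<longlonglongrightarrow> (\<integral>x. Uq q q' x * sg x \<partial>w)"
 proof (rule W.dominated_limit[OF mj m])
  fix j x assume x: "x \<in> DD"
  then have "x \<in> {?a..?b}" using hull[of 1 x] hull[of 2 x] by blast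
  then show "norm (form (TI n) (sdiv (Q j) x) * sg x) \<le> T * G"
   using bound[of x j] G x by (auto simp: abs_mult intro!: mult_mono)
 qed (simp add: lim)
 have L: "(\<lambda>j. \<Sum>k\<in>{1,2}. \<integral>t. poly (Q j) t * (poly pn t * TP n k t) \<partial>\<mu> k) \<longlonglongrightarrow> (\<Sum>k\<in>{1,2}. \<integral>t. q t * (poly pn t * TP n k t) \<partial>\<mu> k)"
 proof (rule tendsto_sum)
  fix k :: nat assume k: "k \<in> {1,2}"
  show "(\<lambda>j. \<integral>t. poly (Q j) t * (poly pn t * TP n k t) \<partial>\<mu> k) \<longlonglongrightarrow> (\<integral>t. q t * (poly pn t * TP n k t) \<partial>\<mu> k)"
  proof (rule compact_measure.dominated_limit[OF compact_measure_mu[OF k]])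
   show "(\<lambda>t. q t * (poly pn t * TP n k t)) \<in> borel_measurable borel" using qm by measurable
   show "norm (poly (Q j) t * (poly pn t * TP n k t)) \<le> (B + (?b - ?a)) * (P * C)" if "t \<in> Delta \<mu> k" for j t
    unfolding real_norm_def abs_mult
    using QB[OF hull[OF k that], of j] P[OF hull[OF k that]] C[OF k that] C0
    by (intro mult_mono mult_nonneg_nonneg) (auto intro: order_trans[OF abs_ge_zero])
   show "AE t in \<mu> k. (\<lambda>j. poly (Q j) t * (poly pn t * TP n k t)) \<longlonglongrightarrow> q t * (poly pn t * TP n k t)"
    using AE_mu[OF k] by eventually_elim (intro tendsto_intros Qlim hull[OF k])
  qed simp
 qed
 have "(\<Sum>k\<in>{1,2}. \<integral>t. poly (Q j) t * (poly pn t * TP n k t) \<partial>\<mu> k) = (\<integral>x. form (TI n) (sdiv (Q j) x) * sg x \<partial>w)" for j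
  using form_pn_mult[of "Q j"] by (simp add: form_def mult_ac)
 then show "(\<Sum>k\<in>{1,2}. \<integral>t. q t * (poly pn t * TP n k t) \<partial>\<mu> k) = (\<integral>x. Uq q q' x * sg x \<partial>w)"
  using LIMSEQ_unique[OF L] R by simp
qed

end

lemma c1_add: "c1 f f' ==> c1 g g' ==> c1 (\<lambda>x. f x + g x) (\<lambda>x. f' x + g' x)"
 unfolding c1_def by (auto intro!: DERIV_add continuous_intros)

lemma c1_mult: "c1 f f' ==> c1 g g' ==> c1 (\<lambda>x. f x * g x) (\<lambda>x. f' x * g x + g' x * f x)"
 using c1_continuous[of f f' UNIV] c1_continuous[of g g' UNIV]
 unfolding c1_def by (auto intro!: DERIV_mult continuous_intros)

lemma c1_one_minus: "c1 f f' ==> c1 (\<lambda>x. 1 - f x) (\<lambda>x. - f' x)"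
 unfolding c1_def by (auto intro!: derivative_eq_intros continuous_intros)

section \<open>The integral identity for type I forms\<close>

context angelesco_reference
begin

definition Nz :: "nat => real set" where
 "Nz k = {t. TP n k t = 0}"

lemma finite_Nz: "k \<in> {1,2} ==> finite (Nz k)"
 unfolding Nz_def using type_I_nonzero[OF np] by (intro poly_roots_finite) blast

lemma Nz_Delta: "k \<in> {1,2} ==> E \<in> Nz k ==> E \<in> Delta \<mu> k"
proof -
 assume k: "k \<in> {1,2}" and E: "E \<in> Nz k"
 obtain s c where s: "\<And>k. k \<in> {1,2} ==> TI n k = smult (c k) (s k)"
  "\<And>k. k \<in> {1,2} ==> splits_in (Delta \<mu> k) (s k)" "\<And>k. k \<in> {1,2} ==> degree (s k) = entry n k - 1"
  "0 < c 2" "0 < (-1) ^ snd n * c 1"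
  by (rule type_I_structure[OF np]; rule that; assumption)
 have "c k \<noteq> 0" using s(4,5) k by auto
 then have "poly (s k) E = 0" using E s(1)[OF k] by (simp add: Nz_def)
 then show "E \<in> Delta \<mu> k" by (rule splits_in_root[OF s(2)[OF k]])
qed

lemma zeros_I_Nz: "zeros_I \<mu> n = Nz 1 \<union> Nz 2"
 by (auto simp: zeros_I_def Nz_def)

definition Gl :: "nat \<times> nat => real => real" where
 "Gl l x = (if x \<in> Delta \<mu> 1 then Fm n l 1 x else if x \<in> Delta \<mu> 2 then Fm n l 2 x else 0)"

lemma Gl_Delta: "k \<in> {1,2} ==> x \<in> Delta \<mu> k ==> Gl l x = Fm n l k x"
 using Delta_disjoint by (auto simp: Gl_def)

lemma continuous_on_Fm_Delta: "k \<in> {1,2} ==> continuous_on (Delta \<mu> k) (Fm m l k)"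
 using continuous_on_Fm[of k m l] Delta_other_disjoint by (auto elim!: continuous_on_subset)

lemma admissible_Gl: "W.admissible (Gl l)"
 unfolding W.admissible_def
proof
 have m: "(\<lambda>x. indicator (Delta \<mu> k) x *\<^sub>R Fm n l k x) \<in> borel_measurable borel" if "k \<in> {1,2}" for k
  by (intro borel_measurable_continuous_on_indicator Delta_borel continuous_on_Fm_Delta that)
 have "Gl l = (\<lambda>x. indicator (Delta \<mu> 1) x *\<^sub>R Fm n l 1 x + indicator (Delta \<mu> 2) x *\<^sub>R Fm n l 2 x)"
  using Delta_disjoint by (auto simp: Gl_def fun_eq_iff indicator_def)
 then show "Gl l \<in> borel_measurable borel" using m[of 1] m[of 2] by simp
 have b: "\<exists>C. \<forall>t\<in>Delta \<mu> k. \<bar>Gl l t\<bar> \<le> C" if k: "k \<in> {1,2}" for k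
 proof -
  obtain C where C: "\<forall>y\<in>Fm n l k ` Delta \<mu> k. \<bar>y\<bar> \<le> C"
   using compact_imp_bounded[OF compact_continuous_image[OF continuous_on_Fm_Delta[OF k] compact_Delta[OF k]]]
   unfolding bounded_iff real_norm_def by blast
  then show ?thesis using Gl_Delta[OF k] by (intro exI[of _ C]) auto
 qed
 obtain C1 C2 where C: "\<forall>t\<in>Delta \<mu> 1. \<bar>Gl l t\<bar> \<le> C1" "\<forall>t\<in>Delta \<mu> 2. \<bar>Gl l t\<bar> \<le> C2"
  using b[of 1] b[of 2] by auto
 show "\<exists>C. \<forall>t\<in>DD. \<bar>Gl l t\<bar> \<le> C"
  using C by (intro exI[of _ "max C1 C2"]) (auto simp: le_max_iff_disj)
qed

text \<open>The divided difference of the quotient of the type I polynomials of \<open>l\<close> and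
  \<open>n\<close> between \<open>x\<close> and \<open>t\<close>, multiplied by both denominators.
  It is the limit of the kernels in \<open>stieltjes_identity\<close> away from the zeros, and it
  integrates to \<open>Fm\<close>.\<close>

definition Hk :: "nat \<times> nat => nat => nat => real => real => real" where
 "Hk l k j x t = (if j = k then TP n k x * poly (sdiv (TI l k) x) t - TP l k x * poly (sdiv (TI n k) x) t
   else (TP l j t * TP n k x - TP l k x * TP n j t) / (t - x))"

lemma integrable_Hk:
 assumes k: "k \<in> {1,2}" and x: "x \<in> Delta \<mu> k" and j: "j \<in> {1,2}"
 shows "integrable (\<mu> j) (Hk l k j x)"
proof (cases "j = k")
 case True
 then show ?thesis using integrable_mu_poly[OF j] unfolding Hk_def[abs_def] by simp
next
 case False
 have "x \<notin> Delta \<mu> j" using False k j x Delta_disjoint by auto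
 then have "continuous_on (Delta \<mu> j) (\<lambda>t. (TP l j t * TP n k x - TP l k x * TP n j t) / (t - x))"
  by (intro continuous_intros) auto
 then show ?thesis using False unfolding Hk_def[abs_def] by (intro integrable_mu_continuous[OF j]) simp_all
qed

lemma integral_Hk:
 assumes k: "k \<in> {1,2}" and x: "x \<in> Delta \<mu> k"
 shows "(\<Sum>j\<in>{1,2}. \<integral>t. Hk l k j x t \<partial>\<mu> j) = Fm n l k x"
proof -
 let ?j = "3 - k"
 note j = other_index[OF k]
 have xj: "x \<notin> Delta \<mu> ?j" by (rule Delta_other_disjoint[OF k x])
 have jk: "?j \<noteq> k" using k by auto
 have i: "integrable (\<mu> ?j) (\<lambda>t. poly p t / (x - t))" for p
  using xj by (intro integrable_mu_continuous[OF j]) (auto intro!: continuous_intros)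
 have "(\<integral>t. Hk l k k x t \<partial>\<mu> k) = TP n k x * (\<integral>t. poly (sdiv (TI l k) x) t \<partial>\<mu> k) - TP l k x * (\<integral>t. poly (sdiv (TI n k) x) t \<partial>\<mu> k)"
  using integrable_mu_poly[OF k] by (simp add: Hk_def)
 moreover have "(\<integral>t. Hk l k ?j x t \<partial>\<mu> ?j) = (\<integral>t. TP l k x * (poly (TI n ?j) t / (x - t)) - TP n k x * (poly (TI l ?j) t / (x - t)) \<partial>\<mu> ?j)"
 proof (intro Bochner_Integration.integral_cong refl)
  fix t
  have "(a - b) / (t - x) = b / (x - t) - a / (x - t)" for a b :: real
   using minus_divide_divide[of "b - a" "x - t"] by (simp add: diff_divide_distrib)
  then show "Hk l k ?j x t = TP l k x * (poly (TI n ?j) t / (x - t)) - TP n k x * (poly (TI l ?j) t / (x - t))"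
   using jk by (simp add: Hk_def mult.commute)
 qed
 moreover have "... = TP l k x * (\<integral>t. poly (TI n ?j) t / (x - t) \<partial>\<mu> ?j) - TP n k x * (\<integral>t. poly (TI l ?j) t / (x - t) \<partial>\<mu> ?j)"
  using i by (simp del: times_divide_eq_right)
 moreover have "(\<Sum>j\<in>{1,2}. \<integral>t. Hk l k j x t \<partial>\<mu> j) = (\<integral>t. Hk l k k x t \<partial>\<mu> k) + (\<integral>t. Hk l k ?j x t \<partial>\<mu> ?j)"
  using k by auto
 ultimately show ?thesis by (simp add: Fm_def Rf_eq[OF k xj] algebra_simps)
qed

text \<open>What the limit misses at a zero \<open>E\<close>: the kernels tend to 0 there and not to
  this value.\<close>

lemma Hk_zero:
 assumes k: "k \<in> {1,2}" and x: "x \<in> Delta \<mu> k" "x \<notin> zeros_I \<mu> n" and j: "j \<in> {1,2}" and E: "E \<in> Nz j"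
 shows "Hk l k j x E = TP l j E * (sg x / (E - x))"
proof -
 have Ex: "E \<noteq> x" using x(2) E j by (auto simp: zeros_I_Nz)
 have E0: "TP n j E = 0" using E by (simp add: Nz_def)
 show ?thesis
 proof (cases "j = k")
  case True
  have "a * ((b - b0) / h) - b0 * ((0 - a) / h) = b * (a / h)" for a b b0 h :: real
   by (simp add: diff_divide_distrib algebra_simps)
  then show ?thesis using True E0 Ex sg_Delta[OF k x(1)] by (simp add: Hk_def poly_synthetic_div_eq)
 next
  case False
  then show ?thesis using E0 sg_Delta[OF k x(1)] by (simp add: Hk_def)
 qed
qed

text \<open>Test \<open>form_pn_c1\<close> with regularizations of the quotient of
  \<open>TI l\<close> and \<open>TI n\<close>. As \<open>e j\<close> tends to 0, each atom at a zero
  \<open>E\<close> loses the factor \<open>poly pn E * TP l k E\<close> on the left, and on the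
  right \<open>TP l k E\<close> times the integral of \<open>sg x / (E - x)\<close>. By
  \<open>inverse_ell\<close> the two losses differ by \<open>TP l k E / ell E\<close>.\<close>

theorem stieltjes_identity:
 "form (TI l) pn = (\<integral>x. Gl l x \<partial>w) + (\<Sum>k\<in>{1,2}. \<Sum>E\<in>Nz k. TP l k E / ell E * measure (\<mu> k) {E})"
proof -
 let ?a = "Inf (Delta \<mu> 1)" and ?b = "Sup (Delta \<mu> 2)"
 define e where "e j = inverse (real (Suc j))" for j
 have e0: "0 < e j" for j by (simp add: e_def)
 obtain cut cut' where cut: "c1 cut cut'" "\<And>x. x \<le> Sup (Delta \<mu> 1) ==> cut x = 0 \<and> cut' x = 0"
  "\<And>x. Inf (Delta \<mu> 2) \<le> x ==> cut x = 1 \<and> cut' x = 0"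
  by (rule c1_cutoff[OF gap_nonempty]; rule that; assumption)
 define f where "f k j = rf (TI n k) (TI l k) (e j)" for k j
 define f' where "f' k j = rf_deriv (TI n k) (TI l k) (e j)" for k j
 \<comment> \<open>The cutoff is constant on each interval with vanishing derivative, so there
   \<open>q j\<close> and its derivative are those of the regularized quotient of the respective
   components.\<close>
 define q where "q j x = (1 - cut x) * f 1 j x + cut x * f 2 j x" for j x
 define q' where "q' j x = (- cut' x * f 1 j x + f' 1 j x * (1 - cut x)) + (cut' x * f 2 j x + f' 2 j x * cut x)" for j x
 have cf: "c1 (f k j) (f' k j)" for k j unfolding f_def f'_def by (rule c1_rf[OF e0])
 have cq: "c1 (q j) (q' j)" for j
  unfolding q_def[abs_def] q'_def[abs_def] by (intro c1_add c1_mult c1_one_minus cut cf)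
 have qk: "q j x = f k j x" "q' j x = f' k j x" if "k \<in> {1,2}" "x \<in> Delta \<mu> k" for j k x
  using that cut(2)[of x] cut(3)[of x] Delta_bounds[OF that] by (auto simp: q_def q'_def)
 obtain S where S: "\<And>k x t. k \<in> {1,2} ==> x \<in> {?a..?b} ==> t \<in> {?a..?b} ==>
   \<bar>poly (sdiv (TI n k) x) t\<bar> \<le> S \<and> \<bar>poly (sdiv (TI l k) x) t\<bar> \<le> S"
 proof -
  have "\<exists>C. \<forall>x\<in>{?a..?b}. \<forall>t\<in>{?a..?b}. \<bar>poly (sdiv p x) t\<bar> \<le> C" for p by (rule synthetic_div_bounded)
  then obtain C where C: "\<And>p x t. x \<in> {?a..?b} ==> t \<in> {?a..?b} ==> \<bar>poly (sdiv p x) t\<bar> \<le> C p" by metis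
  show ?thesis
   by (rule that[of "max (max (C (TI n 1)) (C (TI n 2))) (max (C (TI l 1)) (C (TI l 2)))"])
    (use C in \<open>auto simp: le_max_iff_disj\<close>)
 qed
 obtain B where B: "\<And>k t. k \<in> {1,2} ==> t \<in> {?a..?b} ==> \<bar>TP n k t\<bar> \<le> B \<and> \<bar>TP l k t\<bar> \<le> B \<and> \<bar>poly pn t\<bar> \<le> B"
 proof -
  have "\<exists>C. \<forall>x\<in>{?a..?b}. \<bar>poly p x\<bar> \<le> C" for p :: "real poly" by (rule continuous_on_Icc_bounded) simp
  then obtain C where C: "\<And>p x. x \<in> {?a..?b} ==> \<bar>poly p x\<bar> \<le> C p" by metis
  show ?thesis
   by (rule that[of "max (C pn) (max (max (C (TI n 1)) (C (TI n 2))) (max (C (TI l 1)) (C (TI l 2))))"])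
    (use C in \<open>auto simp: le_max_iff_disj\<close>)
 qed
 have B0: "0 \<le> B" using B[of 1 ?a] hull_le by force
 have S0: "0 \<le> S" using S[of 1 ?a ?a] hull_le by force
 define d where "d = Inf (Delta \<mu> 2) - Sup (Delta \<mu> 1)"
 have d0: "0 < d" using gap_nonempty by (simp add: d_def)
 have dist: "d \<le> \<bar>t - x\<bar>" if "k \<in> {1,2}" "x \<in> Delta \<mu> k" "j \<in> {1,2}" "t \<in> Delta \<mu> j" "j \<noteq> k" for x t k j
  using that Delta_bounds[of 1 x] Delta_bounds[of 2 x] Delta_bounds[of 1 t] Delta_bounds[of 2 t]
  by (auto simp: d_def abs_if)
 \<comment> \<open>The first summand bounds the kernel when \<open>x\<close> and \<open>t\<close>
   lie in the same interval, the second when they lie in different ones, at distance at least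
   \<open>d\<close>.\<close>
 define K where "K = 2 * S * B + 2 * B * B / d"
 have fA: "f k j t * TP n k t = TP l k t * ((TP n k t)^2 / ((TP n k t)^2 + e j))" for k j t
  by (simp add: f_def rf_def power2_eq_square)
 have fAb: "\<bar>f k j t * TP n k t\<bar> \<le> B" if "k \<in> {1,2}" "t \<in> {?a..?b}" for k j t
 proof -
  have "\<bar>f k j t * TP n k t\<bar> \<le> B * 1"
   unfolding fA abs_mult using B[OF that] rf_kernel_bound(1)[OF e0] B0 by (intro mult_mono) auto
  then show ?thesis by simp
 qed
 have fAl: "(\<lambda>j. f k j t * TP n k t) \<longlonglongrightarrow> (if TP n k t = 0 then 0 else TP l k t)" for k t
 proof -
  have "(\<lambda>j. f k j t * TP n k t) \<longlonglongrightarrow> TP l k t * (if TP n k t = 0 then 0 else 1)"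
   unfolding fA e_def by (intro tendsto_mult tendsto_const rf_limit)
  then show ?thesis by (simp split: if_splits)
 qed
 define kern where "kern i j x t = dquot (q i) (q' i) x t * TP n j t * sg x" for i j x t
 have kern1: "kern i k x t = rf_dd (TI n k) (TI l k) (e i) x t * TP n k t * TP n k x"
  if k: "k \<in> {1,2}" and x: "x \<in> Delta \<mu> k" and t: "t \<in> Delta \<mu> k" for i k x t
  using qk[OF k x] qk[OF k t] by (simp add: kern_def rf_dd_eq[OF e0] dquot_def sg_Delta[OF k x] f_def f'_def)
 have kern2: "kern i j x t = ((f j i t * TP n j t) * TP n k x - (f k i x * TP n k x) * TP n j t) / (t - x)"
  if k: "k \<in> {1,2}" and x: "x \<in> Delta \<mu> k" and j: "j \<in> {1,2}" and t: "t \<in> Delta \<mu> j" and jk: "j \<noteq> k" for i j k x t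
 proof -
  have "t \<noteq> x" using dist[OF k x j t jk] d0 by auto
  then show ?thesis using qk[OF k x] qk[OF j t] by (simp add: kern_def dquot_def sg_Delta[OF k x] algebra_simps)
 qed
 have kern_bound: "\<bar>kern i j x t\<bar> \<le> K" if k: "k \<in> {1,2}" and x: "x \<in> Delta \<mu> k" and j: "j \<in> {1,2}" and t: "t \<in> Delta \<mu> j" for i j k x t
 proof (cases "j = k")
  case True
  note xh = hull[OF k x] and th = hull[OF j t]
  have "\<bar>kern i j x t\<bar> \<le> \<bar>poly (sdiv (TI l k) x) t * ((TP n k t)^2 / ((TP n k t)^2 + e i)) * TP n k x\<bar> +
    \<bar>TP l k x * poly (sdiv (TI n k) x) t * (TP n k t * TP n k x * (e i - TP n k t * TP n k x) / (((TP n k t)^2 + e i) * ((TP n k x)^2 + e i)))\<bar>"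
   using kern1[OF k x, of t i] t True unfolding rf_dd_scaled by (simp only: abs_triangle_ineq)
  also have "... \<le> S * 1 * B + B * S * 1"
   unfolding abs_mult[of "_ * _" "poly _ _"] abs_mult[of "poly _ _" "_ / _"] abs_mult[of "poly _ _ * poly _ _" "_ / _"] abs_mult[of "poly _ _" "poly (sdiv _ _) _"]
   using B[OF k xh] S[OF k xh th] B0 S0 rf_kernel_bound[OF e0[of i]]
   by (intro add_mono mult_mono mult_nonneg_nonneg) auto
  also have "... \<le> K" using B0 d0 by (simp add: K_def)
  finally show ?thesis .
 next
  case False
  note xh = hull[OF k x] and th = hull[OF j t]
  have dd: "d \<le> \<bar>t - x\<bar>" by (rule dist[OF k x j t False])
  have "\<bar>(f j i t * TP n j t) * TP n k x - (f k i x * TP n k x) * TP n j t\<bar> \<le> B * B + B * B"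
   using fAb[OF j th] fAb[OF k xh] B[OF k xh] B[OF j th] B0
   by (intro order_trans[OF abs_triangle_ineq4] add_mono) (auto simp only: abs_mult[of "_ * _" "poly _ _"] intro!: mult_mono)
  then have "\<bar>kern i j x t\<bar> \<le> (B * B + B * B) / d"
   unfolding kern2[OF k x j t False] abs_divide using dd d0 B0 by (intro frac_le) auto
  also have "... = 2 * B * B / d" by simp
  also have "... \<le> K" using mult_nonneg_nonneg[OF S0 B0] by (simp add: K_def mult.commute)
  finally show ?thesis .
 qed
 have kern_lim: "(\<lambda>i. kern i j x t) \<longlonglongrightarrow> (if t \<in> Nz j then 0 else Hk l k j x t)"
  if k: "k \<in> {1,2}" and x: "x \<in> Delta \<mu> k" "x \<notin> zeros_I \<mu> n" and j: "j \<in> {1,2}" and t: "t \<in> Delta \<mu> j" for j k x t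
 proof -
  have x0: "TP n k x \<noteq> 0" using x(2) k by (auto simp: zeros_I_def)
  show ?thesis
  proof (cases "j = k")
   case True
   then have t: "t \<in> Delta \<mu> k" using t by simp
   have "(if t \<in> Nz k then 0 else Hk l k k x t) = (if TP n k t = 0 then 0
    else TP n k x * poly (sdiv (TI l k) x) t - TP l k x * poly (sdiv (TI n k) x) t)"
    by (simp add: Hk_def Nz_def)
   then show ?thesis unfolding True kern1[OF k x(1) t] e_def
    by (simp only: rf_dd_limit[OF x0])
  next
   case False
   have tx: "t - x \<noteq> 0" using dist[OF k x(1) j t False] d0 by auto
   have "(\<lambda>i. kern i j x t) \<longlonglongrightarrow> ((if TP n j t = 0 then 0 else TP l j t) * TP n k x
     - (if TP n k x = 0 then 0 else TP l k x) * TP n j t) / (t - x)"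
    unfolding kern2[OF k x(1) j t False] using tx by (intro tendsto_intros fAl)
   then show ?thesis using False x0 by (auto simp: Hk_def Nz_def split: if_splits)
  qed
 qed
 have qm: "q i \<in> borel_measurable borel" "q' i \<in> borel_measurable borel" for i
  using c1_continuous[OF cq] cq unfolding c1_def by (auto intro: borel_measurable_continuous_onI)
 have km: "kern i j x \<in> borel_measurable borel" for i j x
  unfolding kern_def[abs_def] dquot_def[abs_def] using qm by measurable
 have Hm: "Hk l k j x \<in> borel_measurable borel" for k j x
  unfolding Hk_def[abs_def] by (cases "j = k") simp_all
 have Nm: "Nz j \<in> sets borel" if "j \<in> {1,2}" for j
  using finite_Nz[OF that] by (intro borel_closed finite_imp_closed)
 have U: "Uq (q i) (q' i) x * sg x = (\<Sum>j\<in>{1,2}. \<integral>t. kern i j x t \<partial>\<mu> j)" for i x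
  by (simp add: Uq_def kern_def sum_distrib_right distrib_right)
 \<comment> \<open>The limit of the right integrand: the full integral of \<open>Hk\<close>, which
   is \<open>Gl l x\<close>, minus the atoms at the zeros that the limit drops.\<close>
 define V where "V x = Gl l x - (\<Sum>j\<in>{1,2}. \<Sum>E\<in>Nz j. TP l j E * (sg x / (E - x)) * measure (\<mu> j) {E})" for x
 have Ulim: "(\<lambda>i. Uq (q i) (q' i) x * sg x) \<longlonglongrightarrow> V x"
  if x: "x \<in> DD" "x \<notin> zeros_I \<mu> n" for x
 proof -
  obtain k where k: "k \<in> {1,2}" "x \<in> Delta \<mu> k" using x by auto
  have "(\<lambda>i. \<Sum>j\<in>{1,2}. \<integral>t. kern i j x t \<partial>\<mu> j) \<longlonglongrightarrow> (\<Sum>j\<in>{1,2}. \<integral>t. (if t \<in> Nz j then 0 else Hk l k j x t) \<partial>\<mu> j)"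
  proof (rule tendsto_sum)
   fix j :: nat assume j: "j \<in> {1,2}"
   show "(\<lambda>i. \<integral>t. kern i j x t \<partial>\<mu> j) \<longlonglongrightarrow> (\<integral>t. (if t \<in> Nz j then 0 else Hk l k j x t) \<partial>\<mu> j)"
   proof (rule compact_measure.dominated_limit[OF compact_measure_mu[OF j] km])
    show "(\<lambda>t. if t \<in> Nz j then 0 else Hk l k j x t) \<in> borel_measurable borel"
     using Hm Nm[OF j] by measurable
    show "norm (kern i j x t) \<le> K" if "t \<in> Delta \<mu> j" for i t
     using kern_bound[OF k j that] by simp
    show "AE t in \<mu> j. (\<lambda>i. kern i j x t) \<longlonglongrightarrow> (if t \<in> Nz j then 0 else Hk l k j x t)"
     using AE_mu[OF j] by eventually_elim (rule kern_lim[OF k x(2) j])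
   qed
  qed
  also have "(\<Sum>j\<in>{1,2}. \<integral>t. (if t \<in> Nz j then 0 else Hk l k j x t) \<partial>\<mu> j)
   = (\<Sum>j\<in>{1,2}. (\<integral>t. Hk l k j x t \<partial>\<mu> j) - (\<Sum>E\<in>Nz j. TP l j E * (sg x / (E - x)) * measure (\<mu> j) {E}))"
  proof (rule sum.cong[OF refl])
   fix j :: nat assume j: "j \<in> {1,2}"
   show "(\<integral>t. (if t \<in> Nz j then 0 else Hk l k j x t) \<partial>\<mu> j) = (\<integral>t. Hk l k j x t \<partial>\<mu> j) - (\<Sum>E\<in>Nz j. TP l j E * (sg x / (E - x)) * measure (\<mu> j) {E})"
    using compact_measure.integral_off_finite[OF compact_measure_mu[OF j] finite_Nz[OF j] integrable_Hk[OF k j], of l]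
     Hk_zero[OF k x(2) j] by simp
  qed
  also have "... = V x" by (simp only: sum_subtractf integral_Hk[OF k] V_def Gl_Delta[OF k])
  finally show ?thesis unfolding U .
 qed
 define T where "T = (\<Sum>j\<in>{1,2}. K * measure (\<mu> j) (space (\<mu> j)))"
 have Ubound: "\<bar>Uq (q i) (q' i) x * sg x\<bar> \<le> T" if x: "x \<in> DD" for i x
  unfolding U T_def
 proof (intro order_trans[OF sum_abs sum_mono])
  fix j :: nat assume j: "j \<in> {1,2}"
  obtain k where k: "k \<in> {1,2}" "x \<in> Delta \<mu> k" using x by auto
  interpret finite_measure "\<mu> j" by (rule finite_mu[OF j])
  have "\<bar>\<integral>t. kern i j x t \<partial>\<mu> j\<bar> \<le> (\<integral>t. \<bar>kern i j x t\<bar> \<partial>\<mu> j)" by (rule integral_abs_bound)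
  also have "... \<le> (\<integral>t. K \<partial>\<mu> j)"
  proof (rule integral_mono_AE)
   show "integrable (\<mu> j) (\<lambda>t. \<bar>kern i j x t\<bar>)"
    using integrable_mu[OF j km[of i j x], of K] kern_bound[OF k j] by (intro integrable_abs) auto
   show "AE t in \<mu> j. \<bar>kern i j x t\<bar> \<le> K" using AE_mu[OF j] by eventually_elim (rule kern_bound[OF k j])
  qed simp
  finally show "\<bar>\<integral>t. kern i j x t \<partial>\<mu> j\<bar> \<le> K * measure (\<mu> j) (space (\<mu> j))" by (simp add: mult.commute)
 qed
 have sgm: "sg \<in> borel_measurable borel" by (rule W.admissible_measurable[OF admissible_sg])
 have Vm: "V \<in> borel_measurable borel" unfolding V_def[abs_def]
  using W.admissible_measurable[OF admissible_Gl] sgm by measurable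
 have R: "(\<lambda>i. \<integral>x. Uq (q i) (q' i) x * sg x \<partial>w) \<longlonglongrightarrow> (\<integral>x. V x \<partial>w)"
 proof (rule W.dominated_limit[OF form_pn_c1(1)[OF cq] Vm])
  show "norm (Uq (q i) (q' i) x * sg x) \<le> T" if "x \<in> DD" for i x
   using Ubound[OF that] by simp
  show "AE x in w. (\<lambda>i. Uq (q i) (q' i) x * sg x) \<longlonglongrightarrow> V x"
   using W.AE_K AE_not_zero by eventually_elim (rule Ulim)
 qed
 have L: "(\<lambda>i. \<Sum>k\<in>{1,2}. \<integral>t. q i t * (poly pn t * TP n k t) \<partial>\<mu> k) \<longlonglongrightarrow> (\<Sum>k\<in>{1,2}. \<integral>t. (if t \<in> Nz k then 0 else poly pn t * TP l k t) \<partial>\<mu> k)"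
 proof (rule tendsto_sum)
  fix k :: nat assume k: "k \<in> {1,2}"
  show "(\<lambda>i. \<integral>t. q i t * (poly pn t * TP n k t) \<partial>\<mu> k) \<longlonglongrightarrow> (\<integral>t. (if t \<in> Nz k then 0 else poly pn t * TP l k t) \<partial>\<mu> k)"
  proof (rule compact_measure.dominated_limit[OF compact_measure_mu[OF k]])
   show "(\<lambda>t. q i t * (poly pn t * TP n k t)) \<in> borel_measurable borel" for i using qm by measurable
   show "(\<lambda>t. if t \<in> Nz k then 0 else poly pn t * TP l k t) \<in> borel_measurable borel" using Nm[OF k] by measurable
   fix i t assume t: "t \<in> Delta \<mu> k"
   have "q i t * (poly pn t * TP n k t) = poly pn t * (f k i t * TP n k t)"
    by (simp add: qk[OF k t])
   also have "norm ... \<le> B * B"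
    unfolding norm_mult[of "poly pn t"] using fAb[OF k hull[OF k t]] B[OF k hull[OF k t]] B0 by (intro mult_mono) auto
   finally show "norm (q i t * (poly pn t * TP n k t)) \<le> B * B" .
  next
   show "AE t in \<mu> k. (\<lambda>i. q i t * (poly pn t * TP n k t)) \<longlonglongrightarrow> (if t \<in> Nz k then 0 else poly pn t * TP l k t)"
    using AE_mu[OF k]
   proof eventually_elim
    case (elim t)
    have "(\<lambda>i. poly pn t * (f k i t * TP n k t)) \<longlonglongrightarrow> poly pn t * (if TP n k t = 0 then 0 else TP l k t)"
     by (intro tendsto_mult tendsto_const fAl)
    then show ?case by (simp add: qk[OF k elim] Nz_def mult_ac if_distrib cong: if_cong)
   qed
  qed
 qed
 have LR: "(\<Sum>k\<in>{1,2}. \<integral>t. (if t \<in> Nz k then 0 else poly pn t * TP l k t) \<partial>\<mu> k) = (\<integral>x. V x \<partial>w)"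
  using LIMSEQ_unique[OF L] R unfolding form_pn_c1(2)[OF cq] by blast
 have LL: "(\<Sum>k\<in>{1,2}. \<integral>t. (if t \<in> Nz k then 0 else poly pn t * TP l k t) \<partial>\<mu> k) =
  form (TI l) pn - (\<Sum>k\<in>{1,2}. \<Sum>E\<in>Nz k. poly pn E * TP l k E * measure (\<mu> k) {E})"
  unfolding form_def sum_subtractf[symmetric]
  by (intro sum.cong refl compact_measure.integral_off_finite[OF compact_measure_mu finite_Nz] integrable_poly_mult)
 have si: "integrable w (\<lambda>x. sg x / (E - x))" if j: "j \<in> {1,2}" and E: "E \<in> Nz j" for j E
 proof -
  note zb = zero_bound[OF Nz_Delta[OF j E] j]
  obtain C1 C2 where C: "\<forall>t\<in>Delta \<mu> 1. \<bar>TP n 1 t\<bar> \<le> C1 * \<bar>t - E\<bar>" "\<forall>t\<in>Delta \<mu> 2. \<bar>TP n 2 t\<bar> \<le> C2 * \<bar>t - E\<bar>"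
   using zb[of 1] zb[of 2] E by (auto simp: Nz_def)
  show ?thesis
  proof (rule W.integrable_bounded[of _ "max \<bar>C1\<bar> \<bar>C2\<bar>"])
   show "(\<lambda>x. sg x / (E - x)) \<in> borel_measurable borel" using sgm by measurable
   fix x assume "x \<in> DD"
   then obtain k where k: "k \<in> {1,2}" "x \<in> Delta \<mu> k" by auto
   have "\<bar>sg x\<bar> \<le> (if k = 1 then C1 else C2) * \<bar>x - E\<bar>"
    using k C sg_Delta[OF k] by auto
   also have "... \<le> max \<bar>C1\<bar> \<bar>C2\<bar> * \<bar>x - E\<bar>" by (intro mult_right_mono) auto
   finally show "norm (sg x / (E - x)) \<le> max \<bar>C1\<bar> \<bar>C2\<bar>"
    by (cases "x = E") (auto simp: abs_divide divide_le_eq abs_minus_commute)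
  qed
 qed
 have "(\<integral>x. V x \<partial>w) = (\<integral>x. Gl l x \<partial>w) - (\<Sum>j\<in>{1,2}. \<Sum>E\<in>Nz j. TP l j E * (\<integral>x. sg x / (E - x) \<partial>w) * measure (\<mu> j) {E})"
 proof -
  have i: "integrable w (\<lambda>x. TP l j E * (sg x / (E - x)) * measure (\<mu> j) {E})" if "j \<in> {1,2}" "E \<in> Nz j" for j E
   by (intro integrable_mult_left integrable_mult_right si[OF that])
  have "(\<integral>x. (\<Sum>j\<in>{1,2}. \<Sum>E\<in>Nz j. TP l j E * (sg x / (E - x)) * measure (\<mu> j) {E}) \<partial>w) =
   (\<Sum>j\<in>{1,2}. \<Sum>E\<in>Nz j. \<integral>x. TP l j E * (sg x / (E - x)) * measure (\<mu> j) {E} \<partial>w)"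
   using i by (subst Bochner_Integration.integral_sum) (auto intro!: sum.cong Bochner_Integration.integral_sum Bochner_Integration.integrable_sum)
  also have "... = (\<Sum>j\<in>{1,2}. \<Sum>E\<in>Nz j. TP l j E * (\<integral>x. sg x / (E - x) \<partial>w) * measure (\<mu> j) {E})"
   by (simp del: times_divide_eq_right)
  finally show ?thesis unfolding V_def
   using i by (subst Bochner_Integration.integral_diff[OF W.admissible_integrable[OF admissible_Gl]])
    (auto intro!: Bochner_Integration.integrable_sum)
 qed
 then have "form (TI l) pn = (\<integral>x. Gl l x \<partial>w) + (\<Sum>k\<in>{1,2}. \<Sum>E\<in>Nz k. (poly pn E * TP l k E * measure (\<mu> k) {E}
   - TP l k E * (\<integral>x. sg x / (E - x) \<partial>w) * measure (\<mu> k) {E}))"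
  using LL LR by (simp add: sum_subtractf)
 also have "(\<Sum>k\<in>{1,2}. \<Sum>E\<in>Nz k. (poly pn E * TP l k E * measure (\<mu> k) {E}
   - TP l k E * (\<integral>x. sg x / (E - x) \<partial>w) * measure (\<mu> k) {E})) = (\<Sum>k\<in>{1,2}. \<Sum>E\<in>Nz k. TP l k E / ell E * measure (\<mu> k) {E})"
 proof (intro sum.cong refl)
  fix k :: nat and E assume "k \<in> {1,2}" "E \<in> Nz k"
  then have "E \<in> zeros_I \<mu> n" by (auto simp: zeros_I_Nz)
  from inverse_ell[OF this] have ie: "inverse (ell E) = poly pn E - (\<integral>x. sg x / (E - x) \<partial>w)" by (simp add: inverse_eq_divide)
  show "poly pn E * TP l k E * measure (\<mu> k) {E} - TP l k E * (\<integral>x. sg x / (E - x) \<partial>w) * measure (\<mu> k) {E} = TP l k E / ell E * measure (\<mu> k) {E}"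
   unfolding divide_inverse[of "TP l k E"] ie by (simp add: algebra_simps)
 qed
 finally show ?thesis .
qed

end

section \<open>The measure attached to a vertex\<close>

lemma path_to_root_size_less: "Z \<in> path_to_root Y ==> Z \<noteq> Y ==> size Z < size Y"
 by (induction Y) (auto dest: path_to_root_size)

lemma index_size_Pi_idx: "index_size (Pi_idx Y) = size Y + 2"
 by (induction Y) (auto simp: index_size_def unit_index_def)

text \<open>The index size grows by one with each generation, so within the subtree the value 1 in
  \<open>form_pn\<close> occurs only at the root.\<close>

lemma index_size_subtree_ch:
 assumes "Y \<in> subtree (ch i X)"
 shows "index_size (Pi_idx Y) \<ge> Suc (index_size (Pi_idx X))"
  "index_size (Pi_idx Y) = Suc (index_size (Pi_idx X)) \<longleftrightarrow> Y = ch i X"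
 using subtree_size[OF assms] path_to_root_size_less[of "ch i X" Y] assms
 by (cases "Y = ch i X", auto simp: index_size_Pi_idx size_ch subtree_def)+

lemma emeasure_measure_of_borel:
 fixes f :: "real set => ennreal"
 assumes "f {} = 0" "countably_additive (sets borel) f" "B \<in> sets borel"
 shows "emeasure (measure_of UNIV (sets borel) f) B = f B"
 using assms sets.sigma_algebra_axioms[of "borel :: real measure"]
 by (intro emeasure_measure_of_sigma) (auto simp: positive_def)

lemma countably_additive_add:
 fixes f g :: "'a set => ennreal"
 assumes "countably_additive S f" "countably_additive S g"
 shows "countably_additive S (\<lambda>B. f B + g B)"
 using assms unfolding countably_additive_def by (simp add: suminf_add[symmetric])

lemma countably_additive_sum:
 fixes f :: "'i => 'a set => ennreal"
 assumes "\<And>i. i \<in> I ==> countably_additive S (f i)"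
 shows "countably_additive S (\<lambda>B. \<Sum>i\<in>I. f i B)"
 using assms
proof (induction I rule: infinite_finite_induct)
 case (insert x F)
 then show ?case using countably_additive_add[of S "f x" "\<lambda>B. \<Sum>i\<in>F. f i B"] by simp
qed (simp_all add: countably_additive_def)

lemma countably_additive_point_mass:
 "countably_additive S (\<lambda>B. c * (indicator B E :: ennreal))"
 unfolding countably_additive_def
proof (intro allI impI)
 fix A :: "nat => 'a set" assume "disjoint_family A"
 then have "(\<Sum>i. indicator (A i) E :: ennreal) = indicator (\<Union>i. A i) E" by (rule suminf_indicator)
 then show "(\<Sum>i. c * (indicator (A i) E :: ennreal)) = c * indicator (\<Union>(range A)) E"
  by (simp add: ennreal_suminf_cmult)
qed

lemma countably_additive_emeasure: "sets M = S ==> countably_additive S (emeasure M)"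
 using emeasure_countably_additive by blast

lemma countably_additive_emeasure_Int:
 assumes "sets M = S" "D \<in> S"
 shows "countably_additive S (\<lambda>B. emeasure M (B \<inter> D))"
 unfolding countably_additive_def
proof (intro allI impI)
 fix A :: "nat => 'a set" assume A: "range A \<subseteq> S" "disjoint_family A"
 have "range (\<lambda>i. A i \<inter> D) \<subseteq> sets M" using A(1) assms by auto
 moreover have "disjoint_family (\<lambda>i. A i \<inter> D)" using A(2) unfolding disjoint_family_on_def by blast
 ultimately have "(\<Sum>i. emeasure M (A i \<inter> D)) = emeasure M (\<Union>i. A i \<inter> D)" by (rule suminf_emeasure)
 then show "(\<Sum>i. emeasure M (A i \<inter> D)) = emeasure M (\<Union>(range A) \<inter> D)" by (simp add: Int_UN_distrib2)
qed

context angelesco_system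
begin

lemma emeasure_mu_star_point:
 assumes k: "k \<in> {1,2}" and E: "E \<in> Delta \<mu> k"
 shows "emeasure (mu_star \<mu>) {E} = emeasure (\<mu> k) {E}"
proof -
 have "emeasure (mu_star \<mu>) {E} = (\<Sum>k\<in>{1,2}. emeasure (\<mu> k) ({E} \<inter> Delta \<mu> k))"
  unfolding mu_star_def
 proof (rule emeasure_measure_of_borel)
  show "countably_additive (sets borel) (\<lambda>B. \<Sum>k\<in>{1,2}. emeasure (\<mu> k) (B \<inter> Delta \<mu> k))"
   by (intro countably_additive_sum countably_additive_emeasure_Int sets_mu borel_closed compact_imp_closed compact_Delta)
 qed simp_all
 also have "... = (\<Sum>j\<in>{1,2}. if j = k then emeasure (\<mu> k) {E} else 0)"
 proof (intro sum.cong refl)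
  fix j :: nat assume j: "j \<in> {1,2}"
  have "j \<noteq> k ==> E \<notin> Delta \<mu> j" using E j k Delta_disjoint[of E] by auto
  then show "emeasure (\<mu> j) ({E} \<inter> Delta \<mu> j) = (if j = k then emeasure (\<mu> k) {E} else 0)"
   using E by (cases "j = k") auto
 qed
 also have "... = emeasure (\<mu> k) {E}" using k by auto
 finally show ?thesis .
qed

end

section \<open>Densities and atoms at a fixed vertex\<close>

locale angelesco_tree = angelesco_recurrence +
 fixes \<omega> :: "nat \<times> nat => real measure" and X :: vertex
 assumes reference: "\<And>n. fst n > 0 ==> snd n > 0 ==> reference_measure \<mu> n (\<omega> n)"
begin

abbreviation "nv == nu \<mu> a X"
abbreviation "Ph == Psi_hat \<mu> a X"
abbreviation "Wc i == W_pot a (ch i X)"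
abbreviation "Ps i == Psi \<mu> a (ch i X)"
abbreviation "nX \<equiv> Pi_idx X"
abbreviation "\<rho> \<equiv> rho_tilde \<mu> \<omega> X"

sublocale R: angelesco_reference \<mu> nX "\<omega> nX"
 by unfold_locales (use Pi_idx_pos reference in auto)

lemma DD_cases: "x \<in> DD ==> (\<And>k. k \<in> {1,2} ==> x \<in> Delta \<mu> k ==> P) ==> P"
 by auto

lemma sets_rho: "sets \<rho> = sets borel"
 unfolding rho_tilde_def using sets.sigma_sets_eq[of "borel :: real measure"] by (simp add: sets_measure_of_conv)

lemma emeasure_rho:
 "B \<in> sets borel ==> emeasure \<rho> B = emeasure (\<omega> nX) B + (\<Sum>E\<in>zeros_I \<mu> nX. emeasure (mu_star \<mu>) {E} * indicator B E)"
 unfolding rho_tilde_def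
 by (rule emeasure_measure_of_borel)
  (auto intro!: countably_additive_add countably_additive_sum countably_additive_point_mass countably_additive_emeasure simp: R.sets_w)

lemma zeros_finite: "finite (zeros_I \<mu> nX)"
 by (rule finite_zeros_I[OF Pi_idx_pos])

lemma zeros_cases:
 assumes "E \<in> zeros_I \<mu> nX"
 obtains k where "k \<in> {1,2}" "E \<in> Delta \<mu> k" "TP nX k E = 0"
 using zeros_I_Delta[OF Pi_idx_pos assms] by blast

lemma emeasure_mu_star_finite: "E \<in> zeros_I \<mu> nX ==> emeasure (mu_star \<mu>) {E} < \<infinity>"
proof -
 assume "E \<in> zeros_I \<mu> nX"
 then obtain k where k: "k \<in> {1,2}" "E \<in> Delta \<mu> k" by (rule zeros_cases)
 interpret finite_measure "\<mu> k" by (rule finite_mu[OF k(1)])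
 show ?thesis using emeasure_mu_star_point[OF k] by (simp add: less_top[symmetric])
qed

lemma emeasure_rho_point:
 assumes "E \<in> zeros_I \<mu> nX"
 shows "emeasure \<rho> {E} = emeasure (mu_star \<mu>) {E}"
proof -
 have "emeasure (\<omega> nX) {E} = 0" using reference[OF Pi_idx_pos] assms by (simp add: reference_measure_def)
 moreover have "(\<Sum>E'\<in>zeros_I \<mu> nX. emeasure (mu_star \<mu>) {E'} * indicator {E} E') = (\<Sum>E'\<in>zeros_I \<mu> nX. if E' = E then emeasure (mu_star \<mu>) {E} else 0)"
  by (intro sum.cong) auto
 ultimately show ?thesis using assms zeros_finite by (simp add: emeasure_rho)
qed

sublocale M: compact_measure \<rho> DD
proof (rule compact_measure.intro)
 show "sets \<rho> = sets borel" by (rule sets_rho)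
 have sp: "space \<rho> = UNIV" using sets_eq_imp_space_eq[OF sets_rho] by simp
 interpret w: finite_measure "\<omega> nX" by (rule R.finite_w)
 have "emeasure \<rho> UNIV \<noteq> \<infinity>"
  using emeasure_mu_star_finite zeros_finite w.emeasure_finite[of UNIV] by (simp add: emeasure_rho less_top)
 then show "finite_measure \<rho>" by (intro finite_measureI) (simp add: sp)
 show "compact DD" by (rule R.W.K)
 have cl: "- DD \<in> sets borel" using R.W.K by (intro borel_comp borel_closed compact_imp_closed)
 have "emeasure \<rho> (- DD) = 0"
 proof -
  have "emeasure (\<omega> nX) (- DD) = 0" using reference[OF Pi_idx_pos] by (simp add: reference_measure_def)
  moreover have "indicator (- DD) E = (0::ennreal)" if "E \<in> zeros_I \<mu> nX" for E
   using that by (auto elim!: zeros_cases)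
  ultimately show ?thesis using cl by (simp add: emeasure_rho)
 qed
 then show "AE t in \<rho>. t \<in> DD"
  using cl by (intro AE_I[of _ _ "- DD"]) (auto simp: sets_rho)
qed

text \<open>The reference measure has no atoms at the zeros and \<open>rho_tilde\<close> agrees with
  it elsewhere; its point masses at the zeros are those of \<open>\<mu> k\<close>.\<close>

lemma integral_rho:
 fixes f :: "real => real"
 assumes f: "f \<in> borel_measurable borel" and B: "\<And>x. x \<in> DD ==> \<bar>f x\<bar> \<le> B"
 shows "(\<integral>x. f x \<partial>\<rho>) = (\<integral>x. (if x \<in> zeros_I \<mu> nX then 0 else f x) \<partial>\<omega> nX)
  + (\<Sum>k\<in>{1,2}. \<Sum>E\<in>R.Nz k. f E * measure (\<mu> k) {E})"
proof -
 let ?Z = "zeros_I \<mu> nX"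
 have Zm: "?Z \<in> sets borel" using zeros_finite by (intro borel_closed finite_imp_closed)
 have fi: "integrable \<rho> f" by (rule M.integrable_bounded[OF f, of B]) (use B in simp)
 have "(\<integral>x. (if x \<in> ?Z then 0 else f x) \<partial>\<rho>) = (\<integral>x. (if x \<in> ?Z then 0 else f x) \<partial>\<omega> nX)"
 proof -
  \<comment> \<open>The two measures coincide on the complement of the zeros, and restriction is
    expressed as the density of an indicator.\<close>
  have d: "density \<rho> (indicator (- ?Z)) = density (\<omega> nX) (indicator (- ?Z))"
  proof (rule measure_eqI)
   show "sets (density \<rho> (indicator (- ?Z))) = sets (density (\<omega> nX) (indicator (- ?Z)))"
    by (simp add: sets_rho R.sets_w)
   fix A assume "A \<in> sets (density \<rho> (indicator (- ?Z)))"
   then have A: "A \<in> sets borel" by (simp add: sets_rho)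
   then have AZ: "- ?Z \<inter> A \<in> sets borel" using Zm by (intro sets.Int borel_comp)
   have "emeasure \<rho> (- ?Z \<inter> A) = emeasure (\<omega> nX) (- ?Z \<inter> A)"
    using AZ by (simp add: emeasure_rho)
   then show "emeasure (density \<rho> (indicator (- ?Z))) A = emeasure (density (\<omega> nX) (indicator (- ?Z))) A"
    using A Zm by (simp add: emeasure_restricted sets_rho R.sets_w borel_comp)
  qed
  have i: "(\<integral>x. f x \<partial>density N (indicator (- ?Z))) = (\<integral>x. (if x \<in> ?Z then 0 else f x) \<partial>N)"
   if N: "sets N = sets borel" for N
  proof -
   have "(\<integral>x. f x \<partial>density N (\<lambda>x. ennreal (indicator (- ?Z) x))) = (\<integral>x. indicator (- ?Z) x *\<^sub>R f x \<partial>N)"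
    using f Zm by (intro integral_density) (auto simp: measurable_cong_sets[OF N refl] intro!: borel_measurable_indicator simp: N borel_comp)
   also have "... = (\<integral>x. (if x \<in> ?Z then 0 else f x) \<partial>N)"
    by (intro Bochner_Integration.integral_cong refl) (auto simp: indicator_def)
   finally show ?thesis by (simp add: ennreal_indicator)
  qed
  show ?thesis using i[OF sets_rho] i[OF R.sets_w] d by simp
 qed
 moreover have "(\<integral>x. (if x \<in> ?Z then 0 else f x) \<partial>\<rho>) = (\<integral>x. f x \<partial>\<rho>) - (\<Sum>E\<in>?Z. f E * measure \<rho> {E})"
  by (rule M.integral_off_finite[OF zeros_finite fi])
 moreover have "(\<Sum>E\<in>?Z. f E * measure \<rho> {E}) = (\<Sum>k\<in>{1,2}. \<Sum>E\<in>R.Nz k. f E * measure (\<mu> k) {E})"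
 proof -
  have m: "measure \<rho> {E} = measure (\<mu> k) {E}" if k: "k \<in> {1,2}" "E \<in> R.Nz k" for k E
  proof -
   have "E \<in> ?Z" using k by (auto simp: R.zeros_I_Nz)
   from emeasure_rho_point[OF this] show ?thesis
    using emeasure_mu_star_point[OF k(1) R.Nz_Delta[OF k]] by (simp add: measure_def)
  qed
  have dj: "R.Nz 1 \<inter> R.Nz 2 = {}" using R.Nz_Delta[of 1] R.Nz_Delta[of 2] Delta_disjoint by auto
  have "(\<Sum>E\<in>?Z. f E * measure \<rho> {E}) = (\<Sum>E\<in>R.Nz 1. f E * measure \<rho> {E}) + (\<Sum>E\<in>R.Nz 2. f E * measure \<rho> {E})"
   unfolding R.zeros_I_Nz by (rule sum.union_disjoint) (use R.finite_Nz dj in auto)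
  then show ?thesis using m[of 1] m[of 2] by simp
 qed
 ultimately show ?thesis by simp
qed

lemma Gl_outside: "x \<notin> DD ==> R.Gl l x = 0"
 by (simp add: R.Gl_def)

lemma Psi_tilde_Gl: "Psi_tilde \<mu> a (ch i X) x Y = m_prod a (ch i X) / m_prod a Y * R.Gl (Pi_idx Y) x"
proof (cases "x \<in> DD")
 case True
 then obtain k where k: "k \<in> {1,2}" "x \<in> Delta \<mu> k" by auto
 then show ?thesis using Psi_tilde_Fm[OF k, of "ch i X" Y] R.Gl_Delta[OF k] by simp
next
 case False
 then show ?thesis using Psi_tilde_outside[of x] Gl_outside by simp
qed

lemma S_root_Gl: "S_root \<mu> a (ch i X) x = R.Gl (Pi_idx (ch i X)) x"
 using m_prod_pos[of "ch i X"] by (simp add: S_root_def Psi_tilde_Gl)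

lemma Gl_pos:
 assumes "i \<in> {1,2}" "x \<in> DD"
 shows "0 < R.Gl (Pi_idx (ch i X)) x"
proof -
 obtain k where k: "k \<in> {1,2}" "x \<in> Delta \<mu> k" using assms by auto
 then show ?thesis using S_root_pos[OF k assms(1), of X] by (simp add: S_root_Gl)
qed

lemma Psi_Gl:
 assumes "i \<in> {1,2}"
 shows "Ps i x Y = m_prod a (ch i X) / m_prod a Y * R.Gl (Pi_idx Y) x / R.Gl (Pi_idx (ch i X)) x"
 by (simp add: Psi_def S_root_Gl Psi_tilde_Gl)

lemma Gl_zero:
 assumes k: "k \<in> {1,2}" and E: "E \<in> R.Nz k"
 shows "R.Gl l E = TP l k E * (R.ell E - poly (pderiv (TI nX k)) E * measure (\<mu> k) {E})"
 using R.Fm_at_zero[OF k R.Nz_Delta[OF k E], of l] R.Gl_Delta[OF k R.Nz_Delta[OF k E]] E by (simp add: R.Nz_def)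

lemma nu_zero:
 assumes k: "k \<in> {1,2}" and E: "E \<in> R.Nz k" and i: "i \<in> {1,2}"
 shows "nv i E = poly (TI (Pi_idx (ch i X)) k) E / R.ell E" "0 < nv i E"
proof -
 have Ed: "E \<in> Delta \<mu> k" by (rule R.Nz_Delta[OF k E])
 have Z: "E \<in> zeros_I \<mu> nX" using k E by (auto simp: R.zeros_I_Nz)
 have "(if E \<in> Delta \<mu> 1 then 1 else 2) = k" using k Ed Delta_disjoint by auto
 then have "nv i E = Re (cor (poly (TI (Pi_idx (ch i X)) k) E) / cor (R.ell E))"
  using Z by (simp add: nu_def R.L_plus_ell[OF Z])
 also have "... = poly (TI (Pi_idx (ch i X)) k) E / R.ell E"
  by (simp only: of_real_divide[symmetric] Re_complex_of_real)
 finally show n: "nv i E = poly (TI (Pi_idx (ch i X)) k) E / R.ell E" .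
 show "0 < nv i E"
  using R.type_I_div_ell_pos[OF k Ed _ i] E by (simp add: n Pi_idx_ch[OF i] R.Nz_def)
qed

lemma nu_off: "x \<notin> zeros_I \<mu> nX ==> nv i x = R.Gl (Pi_idx (ch i X)) x"
 by (simp add: nu_def S_root_Gl)

lemma nu_pos:
 assumes i: "i \<in> {1,2}" and x: "x \<in> DD"
 shows "0 < nv i x"
proof (cases "x \<in> zeros_I \<mu> nX")
 case True
 then obtain k where "k \<in> {1,2}" "x \<in> R.Nz k" by (auto simp: R.zeros_I_Nz)
 then show ?thesis using nu_zero(2)[OF _ _ i] by blast
next
 case False
 then show ?thesis using Gl_pos[OF i x] by (simp add: nu_off)
qed

lemma Gl_measurable [measurable]: "R.Gl l \<in> borel_measurable borel"
 by (rule R.W.admissible_measurable[OF R.admissible_Gl])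

lemma nu_measurable [measurable]: "nv i \<in> borel_measurable borel"
proof -
 let ?Z = "zeros_I \<mu> nX"
 have Zm: "?Z \<in> sets borel" using zeros_finite by (intro borel_closed finite_imp_closed)
 have "nv i = (\<lambda>x. if x \<in> ?Z then (\<Sum>E\<in>?Z. indicator {E} x * nv i E) else R.Gl (Pi_idx (ch i X)) x)"
 proof (rule ext)
  fix x
  have "(\<Sum>E\<in>?Z. indicator {E} x * nv i E) = (\<Sum>E\<in>?Z. if E = x then nv i E else 0)"
   by (intro sum.cong) auto
  then have "x \<in> ?Z ==> (\<Sum>E\<in>?Z. indicator {E} x * nv i E) = nv i x"
   using zeros_finite by simp
  then show "nv i x = (if x \<in> ?Z then (\<Sum>E\<in>?Z. indicator {E} x * nv i E) else R.Gl (Pi_idx (ch i X)) x)"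
   by (simp add: nu_off)
 qed
 moreover have "(\<lambda>x. if x \<in> ?Z then (\<Sum>E\<in>?Z. indicator {E} x * nv i E) else R.Gl (Pi_idx (ch i X)) x) \<in> borel_measurable borel"
  using Zm by measurable
 ultimately show ?thesis by simp
qed

lemma Gl_bounds:
 assumes i: "i \<in> {1,2}"
 shows "\<exists>c>0. \<forall>x\<in>DD. c \<le> R.Gl (Pi_idx (ch i X)) x"
proof -
 have b: "\<exists>c>0. \<forall>x\<in>Delta \<mu> k. c \<le> R.Gl (Pi_idx (ch i X)) x" if k: "k \<in> {1,2}" for k
 proof -
  have "continuous_on (Delta \<mu> k) (Fm nX (Pi_idx (ch i X)) k)" by (rule R.continuous_on_Fm_Delta[OF k])
  moreover have "Delta \<mu> k \<noteq> {}" using infinite_Delta[OF k] by auto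
  ultimately obtain y where y: "y \<in> Delta \<mu> k" "\<And>x. x \<in> Delta \<mu> k ==> Fm nX (Pi_idx (ch i X)) k y \<le> Fm nX (Pi_idx (ch i X)) k x"
   using continuous_attains_inf[OF compact_Delta[OF k]] by blast
  have "0 < Fm nX (Pi_idx (ch i X)) k y" using Gl_pos[OF i, of y] y(1) k R.Gl_Delta[OF k y(1)] by auto
  then show ?thesis using y(2) R.Gl_Delta[OF k] by (intro exI[of _ "Fm nX (Pi_idx (ch i X)) k y"]) auto
 qed
 obtain c1 c2 where "0 < c1" "\<forall>x\<in>Delta \<mu> 1. c1 \<le> R.Gl (Pi_idx (ch i X)) x" "0 < c2" "\<forall>x\<in>Delta \<mu> 2. c2 \<le> R.Gl (Pi_idx (ch i X)) x"
  using b[of 1] b[of 2] by auto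
 then show ?thesis by (intro exI[of _ "min c1 c2"]) (auto simp: min_le_iff_disj)
qed

text \<open>On the compact intervals \<open>nv i\<close> is a continuous positive function, changed
  at finitely many points to other positive values.\<close>

lemma nu_bounds:
 assumes i: "i \<in> {1,2}"
 shows "\<exists>c C. 0 < c \<and> (\<forall>x\<in>DD. c \<le> nv i x \<and> nv i x \<le> C)"
proof -
 let ?Z = "zeros_I \<mu> nX"
 obtain c where c: "0 < c" "\<forall>x\<in>DD. c \<le> R.Gl (Pi_idx (ch i X)) x" using Gl_bounds[OF i] by blast
 obtain C where C: "\<forall>x\<in>DD. \<bar>R.Gl (Pi_idx (ch i X)) x\<bar> \<le> C" using R.W.admissible_bounded[OF R.admissible_Gl] by blast
 have fin: "finite (insert c (nv i ` ?Z))" "finite (insert C (nv i ` ?Z))" using zeros_finite by auto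
 have ZD: "?Z \<subseteq> DD" by (auto elim!: zeros_cases)
 show ?thesis
 proof (intro exI conjI ballI)
  show "0 < Min (insert c (nv i ` ?Z))"
   using fin c(1) nu_pos[OF i] ZD by (subst Min_gr_iff) auto
  fix x assume x: "x \<in> DD"
  show "Min (insert c (nv i ` ?Z)) \<le> nv i x"
  proof (cases "x \<in> ?Z")
   case False
   then have "c \<le> nv i x" using c x nu_off by auto
   then show ?thesis using fin by (intro order_trans[OF Min_le]) auto
  qed (use fin in \<open>auto intro!: Min_le\<close>)
  show "nv i x \<le> Max (insert C (nv i ` ?Z))"
  proof (cases "x \<in> ?Z")
   case False
   then have "nv i x \<le> C" using C x nu_off by (metis abs_le_D1)
   then show ?thesis using fin by (intro order_trans[OF _ Max_ge]) auto
  qed (use fin in \<open>auto intro!: Max_ge\<close>)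
 qed
qed

lemma Psi_measurable [measurable]: "i \<in> {1,2} ==> (\<lambda>x. Ps i x Y) \<in> borel_measurable borel"
 by (simp add: Psi_Gl)

lemma Psi_bounded:
 assumes i: "i \<in> {1,2}"
 shows "\<exists>C. \<forall>x\<in>DD. \<bar>Ps i x Y\<bar> \<le> C"
proof -
 obtain c where c: "0 < c" "\<forall>x\<in>DD. c \<le> R.Gl (Pi_idx (ch i X)) x" using Gl_bounds[OF i] by blast
 obtain C where C: "\<forall>x\<in>DD. \<bar>R.Gl (Pi_idx Y) x\<bar> \<le> C" using R.W.admissible_bounded[OF R.admissible_Gl] by blast
 have "\<bar>Ps i x Y\<bar> \<le> m_prod a (ch i X) / m_prod a Y * C / c" if x: "x \<in> DD" for x
 proof -
  have "0 < R.Gl (Pi_idx (ch i X)) x" using c x by force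
  then have "\<bar>Ps i x Y\<bar> = m_prod a (ch i X) / m_prod a Y * \<bar>R.Gl (Pi_idx Y) x\<bar> / R.Gl (Pi_idx (ch i X)) x"
   using m_prod_pos[of "ch i X"] m_prod_pos[of Y] by (simp add: Psi_Gl[OF i] abs_mult abs_divide)
  also have "... \<le> m_prod a (ch i X) / m_prod a Y * C / c"
   using C c x m_prod_pos[of "ch i X"] m_prod_pos[of Y]
   by (intro frac_le mult_left_mono mult_nonneg_nonneg) (auto intro: order_trans[OF abs_ge_zero])
  finally show ?thesis .
 qed
 then show ?thesis by blast
qed

text \<open>Off the zeros \<open>nv i\<close> cancels the normalization of \<open>Psi\<close>,
  leaving a multiple of \<open>Gl\<close> at the index of \<open>Y\<close>. At the zeros the special
  value of \<open>nu\<close> produces exactly the point terms of \<open>stieltjes_identity\<close>.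
  The total is a multiple of the form of \<open>Y\<close> at \<open>pn\<close>, which
  \<open>form_pn\<close> evaluates.\<close>

theorem delta_identity:
 assumes i: "i \<in> {1,2}" and Y: "Y \<in> subtree (ch i X)"
 shows "(\<integral>x. nv i x * Ps i x Y \<partial>\<rho>) = (if Y = ch i X then 1 else 0)"
proof -
 let ?n = "Pi_idx (ch i X)" and ?l = "Pi_idx Y" and ?Z = "zeros_I \<mu> nX"
 define c where "c = m_prod a (ch i X) / m_prod a Y"
 obtain C where C: "\<forall>x\<in>DD. \<bar>Ps i x Y\<bar> \<le> C" using Psi_bounded[OF i] by blast
 obtain d D where D: "0 < d" "\<forall>x\<in>DD. d \<le> nv i x \<and> nv i x \<le> D" using nu_bounds[OF i] by blast
 have "(\<integral>x. nv i x * Ps i x Y \<partial>\<rho>) = (\<integral>x. (if x \<in> ?Z then 0 else nv i x * Ps i x Y) \<partial>\<omega> nX)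
  + (\<Sum>k\<in>{1,2}. \<Sum>E\<in>R.Nz k. (nv i E * Ps i E Y) * measure (\<mu> k) {E})"
 proof (rule integral_rho)
  show "(\<lambda>x. nv i x * Ps i x Y) \<in> borel_measurable borel" using i by measurable
  fix x assume x: "x \<in> DD"
  have "0 \<le> nv i x" "nv i x \<le> D" using D(1) D(2)[rule_format, OF x] by linarith+
  then show "\<bar>nv i x * Ps i x Y\<bar> \<le> D * C"
   using C x by (auto simp: abs_mult intro!: mult_mono)
 qed
 also have "(\<integral>x. (if x \<in> ?Z then 0 else nv i x * Ps i x Y) \<partial>\<omega> nX) = (\<integral>x. c * R.Gl ?l x \<partial>\<omega> nX)"
 proof (rule integral_cong_AE)
  show "AE x in \<omega> nX. (if x \<in> ?Z then 0 else nv i x * Ps i x Y) = c * R.Gl ?l x"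
   using R.W.AE_K R.AE_not_zero
  proof eventually_elim
   case (elim x)
   then show ?case using Gl_pos[OF i elim(1)] by (simp add: nu_off Psi_Gl[OF i] c_def)
  qed
  have Zm: "?Z \<in> sets borel" using zeros_finite by (intro borel_closed finite_imp_closed)
  show "(\<lambda>x. if x \<in> ?Z then 0 else nv i x * Ps i x Y) \<in> borel_measurable (\<omega> nX)"
   unfolding R.W.measurable_M using i Zm by measurable
  show "(\<lambda>x. c * R.Gl ?l x) \<in> borel_measurable (\<omega> nX)" unfolding R.W.measurable_M by measurable
 qed
 also have "... = c * (\<integral>x. R.Gl ?l x \<partial>\<omega> nX)" by simp
 also have "(\<Sum>k\<in>{1,2}. \<Sum>E\<in>R.Nz k. (nv i E * Ps i E Y) * measure (\<mu> k) {E})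
  = (\<Sum>k\<in>{1,2}. \<Sum>E\<in>R.Nz k. c * (poly (TI ?l k) E / R.ell E * measure (\<mu> k) {E}))"
 proof (intro sum.cong refl)
  fix k :: nat and E assume k: "k \<in> {1,2}" and E: "E \<in> R.Nz k"
  \<comment> \<open>This factor of \<open>Fm_at_zero\<close> is common to \<open>Y\<close> and the
    root of the subtree, so it cancels in \<open>Psi\<close>. What is left is a quotient of type I
    polynomials, and the value of \<open>nu\<close> at \<open>E\<close> replaces its denominator by
    \<open>R.ell E\<close>.\<close>
  define v where "v = R.ell E - poly (pderiv (TI nX k)) E * measure (\<mu> k) {E}"
  have g: "R.Gl ?l E = poly (TI ?l k) E * v" "R.Gl ?n E = poly (TI ?n k) E * v"
   unfolding v_def by (rule Gl_zero[OF k E])+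
  have "E \<in> DD" using R.Nz_Delta[OF k E] k by auto
  then have "R.Gl ?n E \<noteq> 0" using Gl_pos[OF i, of E] by force
  then have "poly (TI ?n k) E \<noteq> 0" "v \<noteq> 0" using g by auto
  then have "Ps i E Y = c * (poly (TI ?l k) E / poly (TI ?n k) E)"
   by (simp add: Psi_Gl[OF i] g c_def)
  then have "nv i E * Ps i E Y = c * (poly (TI ?l k) E / R.ell E)"
   using \<open>poly (TI ?n k) E \<noteq> 0\<close> by (simp add: nu_zero(1)[OF k E i])
  then show "(nv i E * Ps i E Y) * measure (\<mu> k) {E} = c * (poly (TI ?l k) E / R.ell E * measure (\<mu> k) {E})"
   by simp
 qed
 also have "c * (\<integral>x. R.Gl ?l x \<partial>\<omega> nX) + (\<Sum>k\<in>{1,2}. \<Sum>E\<in>R.Nz k. c * (poly (TI ?l k) E / R.ell E * measure (\<mu> k) {E}))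
  = c * form (TI ?l) R.pn"
  unfolding R.stieltjes_identity[of ?l] by (simp only: distrib_left sum_distrib_left)
 also have "... = (if Y = ch i X then 1 else 0)"
  using R.form_pn[OF index_size_subtree_ch(1)[OF Y]] index_size_subtree_ch(2)[OF Y] m_prod_pos[of "ch i X"] by (simp add: c_def)
 finally show ?thesis .
qed

end

section \<open>Square-summable functions and bounded symmetric operators\<close>

lemma ell2_iff: "f \<in> ell2 \<longleftrightarrow> (\<lambda>y. (cmod (f y))^2) summable_on UNIV"
 by (simp add: ell2_def)

lemma ell2_norm_nonneg [simp]: "0 \<le> ell2_norm f"
 by (simp add: ell2_norm_def infsum_nonneg)

lemma ell2_norm_power2: "(ell2_norm f)^2 = (\<Sum>\<^sub>\<infinity>y. (cmod (f y))^2)"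
 by (simp add: ell2_norm_def infsum_nonneg)

lemma ell2_bound:
 assumes "\<And>F. finite F ==> (\<Sum>y\<in>F. (cmod (f y))^2) \<le> C"
 shows "f \<in> ell2" "(ell2_norm f)^2 \<le> C"
proof -
 show s: "f \<in> ell2" unfolding ell2_iff
  using assms by (intro nonneg_bdd_above_summable_on) (auto intro!: bdd_aboveI)
 show "(ell2_norm f)^2 \<le> C" unfolding ell2_norm_power2
  using s assms by (intro infsum_le_finite_sums) (auto simp: ell2_iff)
qed

lemma ell2_finite_sum_le:
 assumes "f \<in> ell2" "finite F"
 shows "(\<Sum>y\<in>F. (cmod (f y))^2) \<le> (ell2_norm f)^2"
 unfolding ell2_norm_power2 using assms by (intro finite_sum_le_infsum) (auto simp: ell2_iff)

lemma ell2_pointwise_le: "f \<in> ell2 ==> cmod (f y) \<le> ell2_norm f"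
 using ell2_finite_sum_le[of f "{y}"] by (simp add: power2_le_iff_abs_le)

lemma ell2_zero [simp]: "(\<lambda>_. 0) \<in> ell2"
 by (simp add: ell2_iff)

lemma ell2_finite_support: "finite {y. f y \<noteq> 0} ==> f \<in> ell2"
 unfolding ell2_iff by (rule finite_nonzero_values_imp_summable_on) (simp add: )

lemma ell2_mult: "f \<in> ell2 ==> (\<lambda>y. c * f y) \<in> ell2"
 by (auto simp: ell2_iff norm_mult power_mult_distrib intro: summable_on_cmult_right)

lemma ell2_norm_mult: "f \<in> ell2 ==> ell2_norm (\<lambda>y. c * f y) = cmod c * ell2_norm f"
 by (simp add: ell2_norm_def ell2_iff norm_mult power_mult_distrib infsum_cmult_right real_sqrt_mult)

lemma ell2_add:
 assumes "f \<in> ell2" "g \<in> ell2"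
 shows "(\<lambda>y. f y + g y) \<in> ell2"
proof -
 have "(\<lambda>y. 2 * (cmod (f y))^2 + 2 * (cmod (g y))^2) summable_on UNIV"
  using assms by (intro summable_on_add summable_on_cmult_right) (auto simp: ell2_iff)
 moreover have "(cmod (f y + g y))^2 \<le> 2 * (cmod (f y))^2 + 2 * (cmod (g y))^2" for y
 proof -
  have "(cmod (f y + g y))^2 \<le> (cmod (f y) + cmod (g y))^2"
   by (intro power_mono norm_triangle_ineq) simp
  also have "... \<le> 2 * (cmod (f y))^2 + 2 * (cmod (g y))^2"
   using sum_squares_bound[of "cmod (f y)" "cmod (g y)"] by (simp add: power2_sum)
  finally show ?thesis .
 qed
 ultimately show ?thesis unfolding ell2_iff
  by (rule summable_on_comparison_test) simp
qed

lemma ell2_diff: "f \<in> ell2 ==> g \<in> ell2 ==> (\<lambda>y. f y - g y) \<in> ell2"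
 using ell2_add[of f "\<lambda>y. (-1) * g y"] ell2_mult[of g "-1"] by simp

lemma ell2_inner_summable:
 assumes "f \<in> ell2" "g \<in> ell2"
 shows "(\<lambda>y. f y * cnj (g y)) summable_on UNIV"
proof -
 have "(\<lambda>y. (cmod (f y))^2 + (cmod (g y))^2) summable_on UNIV"
  using assms by (intro summable_on_add) (auto simp: ell2_iff)
 then have "(\<lambda>y. norm (f y * cnj (g y))) summable_on UNIV"
 proof (rule summable_on_comparison_test)
  show "norm (f y * cnj (g y)) \<le> (cmod (f y))^2 + (cmod (g y))^2" for y
  proof -
   have "2 * cmod (f y) * cmod (g y) \<le> (cmod (f y))^2 + (cmod (g y))^2" by (rule sum_squares_bound)
   moreover have "0 \<le> cmod (f y) * cmod (g y)" by simp
   ultimately show ?thesis unfolding norm_mult complex_mod_cnj by linarith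
  qed
 qed auto
 then show ?thesis by (rule abs_summable_summable)
qed

lemma ell2_inner_add_left:
 assumes "f \<in> ell2" "g \<in> ell2" "h \<in> ell2"
 shows "ell2_inner (\<lambda>y. f y + g y) h = ell2_inner f h + ell2_inner g h"
 unfolding ell2_inner_def using ell2_inner_summable[OF assms(1,3)] ell2_inner_summable[OF assms(2,3)]
 by (simp add: distrib_right infsum_add)

lemma ell2_inner_add_right:
 assumes "f \<in> ell2" "g \<in> ell2" "h \<in> ell2"
 shows "ell2_inner h (\<lambda>y. f y + g y) = ell2_inner h f + ell2_inner h g"
 unfolding ell2_inner_def using ell2_inner_summable[OF assms(3,1)] ell2_inner_summable[OF assms(3,2)]
 by (simp add: distrib_left infsum_add)

lemma ell2_inner_mult_left: "ell2_inner (\<lambda>y. c * f y) g = c * ell2_inner f g"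
 unfolding ell2_inner_def by (simp add: mult.assoc infsum_cmult_right')

lemma ell2_inner_mult_right: "ell2_inner f (\<lambda>y. c * g y) = cnj c * ell2_inner f g"
 unfolding ell2_inner_def by (simp add: mult.left_commute infsum_cmult_right')

lemma ell2_inner_self:
 assumes "f \<in> ell2"
 shows "ell2_inner f f = cor ((ell2_norm f)^2)"
proof -
 have "ell2_inner f f = (\<Sum>\<^sub>\<infinity>y. cor ((cmod (f y))^2))"
  unfolding ell2_inner_def by (intro infsum_cong) (simp add: complex_mult_cnj cmod_power2)
 also have "... = cor (\<Sum>\<^sub>\<infinity>y. (cmod (f y))^2)"
  using assms by (intro infsumI has_sum_of_real has_sum_infsum) (simp add: ell2_iff)
 finally show ?thesis by (simp only: ell2_norm_power2)
qed

lemma ell2_inner_commute: "ell2_inner g f = cnj (ell2_inner f g)"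
 unfolding ell2_inner_def by (simp add: infsum_cnj[symmetric] mult.commute)

lemma ell2_norm_add_power2:
 assumes "f \<in> ell2" "g \<in> ell2"
 shows "(ell2_norm (\<lambda>y. f y + g y))^2 = (ell2_norm f)^2 + (ell2_norm g)^2 + 2 * Re (ell2_inner f g)"
proof -
 have "cor ((ell2_norm (\<lambda>y. f y + g y))^2) = ell2_inner f f + ell2_inner g g + (ell2_inner f g + cnj (ell2_inner f g))"
  unfolding ell2_inner_self[OF ell2_add[OF assms], symmetric] using assms
  by (simp add: ell2_inner_add_left ell2_inner_add_right ell2_add ell2_inner_commute[of g f])
 also have "... = cor ((ell2_norm f)^2 + (ell2_norm g)^2 + 2 * Re (ell2_inner f g))"
  by (simp add: ell2_inner_self assms complex_add_cnj)
 finally show ?thesis by (simp only: of_real_eq_iff)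
qed

lemma ell2_cauchy_schwarz:
 assumes f: "f \<in> ell2" and g: "g \<in> ell2"
 shows "cmod (ell2_inner f g) \<le> ell2_norm f * ell2_norm g"
proof (cases "ell2_norm g = 0")
 case True
 then have "g = (\<lambda>_. 0)" using ell2_pointwise_le[OF g] by (auto simp: fun_eq_iff)
 then show ?thesis by (simp add: ell2_inner_def)
next
 case False
 define c where "c = ell2_inner f g / cor ((ell2_norm g)^2)"
 have "0 \<le> (ell2_norm (\<lambda>y. f y + (- c) * g y))^2" by simp
 also have "... = (ell2_norm f)^2 + (cmod c * ell2_norm g)^2 + 2 * Re (cnj (- c) * ell2_inner f g)"
  unfolding ell2_norm_add_power2[OF f ell2_mult[OF g]] ell2_norm_mult[OF g] ell2_inner_mult_right by simp
 also have "cnj (- c) * ell2_inner f g = - cor ((cmod (ell2_inner f g))^2 / (ell2_norm g)^2)"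
  using complex_norm_square[of "ell2_inner f g"] by (simp add: c_def mult.commute)
 also have "(cmod c * ell2_norm g)^2 = (cmod (ell2_inner f g))^2 / (ell2_norm g)^2"
  using False by (simp add: c_def norm_divide norm_power norm_mult power2_eq_square)
 finally have "(cmod (ell2_inner f g))^2 / (ell2_norm g)^2 \<le> (ell2_norm f)^2" by simp
 then have "(cmod (ell2_inner f g))^2 \<le> (ell2_norm f * ell2_norm g)^2"
  using False by (simp add: divide_le_eq power_mult_distrib)
 then show ?thesis by (rule power2_le_imp_le) simp
qed

lemma ell2_triangle:
 assumes f: "f \<in> ell2" and g: "g \<in> ell2"
 shows "ell2_norm (\<lambda>y. f y + g y) \<le> ell2_norm f + ell2_norm g"
proof (rule power2_le_imp_le)
 have "Re (ell2_inner f g) \<le> ell2_norm f * ell2_norm g"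
  using ell2_cauchy_schwarz[OF f g] complex_Re_le_cmod order_trans by blast
 then show "(ell2_norm (\<lambda>y. f y + g y))^2 \<le> (ell2_norm f + ell2_norm g)^2"
  using ell2_norm_add_power2[OF f g] by (simp add: power2_sum)
qed simp

lemma ell2_norm_minus_commute: "ell2_norm (\<lambda>y. f y - g y) = ell2_norm (\<lambda>y. g y - f y)"
 by (simp add: ell2_norm_def norm_minus_commute)

lemma ell2_triangle_diff:
 assumes "f \<in> ell2" "g \<in> ell2" "h \<in> ell2"
 shows "ell2_norm (\<lambda>y. f y - h y) \<le> ell2_norm (\<lambda>y. f y - g y) + ell2_norm (\<lambda>y. g y - h y)"
 using ell2_triangle[OF ell2_diff[OF assms(1,2)] ell2_diff[OF assms(2,3)]] by simp

lemma ell2_norm_eq_0: "f \<in> ell2 ==> ell2_norm f = 0 ==> f = (\<lambda>_. 0)"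
 using ell2_pointwise_le[of f] by (auto simp: fun_eq_iff)

lemma ell2_tendsto_pointwise:
 assumes "ell2_tendsto s f"
 shows "(\<lambda>n. s n y) \<longlonglongrightarrow> f y"
proof -
 have "(\<lambda>n. s n y - f y) \<longlonglongrightarrow> 0"
 proof (rule Lim_null_comparison)
  show "eventually (\<lambda>n. norm (s n y - f y) \<le> ell2_norm (\<lambda>y. s n y - f y)) sequentially"
   using assms unfolding ell2_tendsto_def
   by (intro always_eventually allI ell2_pointwise_le[OF ell2_diff, of "s _" f y]) auto
  show "(\<lambda>n. ell2_norm (\<lambda>y. s n y - f y)) \<longlonglongrightarrow> 0" using assms by (simp add: ell2_tendsto_def)
 qed
 then show ?thesis by (simp add: LIM_zero_iff)
qed

lemma ell2_tendsto_unique: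
 assumes "ell2_tendsto s f" "ell2_tendsto s g"
 shows "f = g"
proof
 show "f y = g y" for y
  using LIMSEQ_unique[OF ell2_tendsto_pointwise[OF assms(1)] ell2_tendsto_pointwise[OF assms(2)]] .
qed

lemma ell2_tendsto_norm:
 assumes "ell2_tendsto s f"
 shows "(\<lambda>n. ell2_norm (s n)) \<longlonglongrightarrow> ell2_norm f"
proof -
 have s: "s n \<in> ell2" and f: "f \<in> ell2" for n using assms by (auto simp: ell2_tendsto_def)
 have "\<bar>ell2_norm (s n) - ell2_norm f\<bar> \<le> ell2_norm (\<lambda>y. s n y - f y)" for n
  using ell2_triangle[OF ell2_diff[OF s[of n] f] f] ell2_triangle[OF ell2_diff[OF f s[of n]] s[of n]]
   ell2_norm_minus_commute[of f "s n"] by simp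
 then have "(\<lambda>n. ell2_norm (s n) - ell2_norm f) \<longlonglongrightarrow> 0"
  using assms unfolding ell2_tendsto_def
  by (intro Lim_null_comparison[of "\<lambda>n. ell2_norm (s n) - ell2_norm f" "\<lambda>n. ell2_norm (\<lambda>y. s n y - f y)"]) auto
 then show ?thesis by (simp add: LIM_zero_iff)
qed

section \<open>Completeness and invertibility\<close>

definition ell2_Cauchy :: "(nat => 'a => complex) => bool" where
 "ell2_Cauchy s \<longleftrightarrow> (\<forall>n. s n \<in> ell2) \<and> (\<forall>e>0. \<exists>N. \<forall>m\<ge>N. \<forall>n\<ge>N. ell2_norm (\<lambda>y. s m y - s n y) < e)"

text \<open>Finite partial sums of the squared distance pass to the limit. Besides completeness this
  serves \<open>Q_isometry\<close>, where the pointwise limit is known beforehand and has to be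
  recognized as the norm limit.\<close>

lemma ell2_Cauchy_pointwise_limit:
 assumes C: "ell2_Cauchy s" and lim: "\<And>y. (\<lambda>n. s n y) \<longlonglongrightarrow> f y"
 shows "ell2_tendsto s f"
proof -
 have s: "s n \<in> ell2" for n using C by (simp add: ell2_Cauchy_def)
 have Ce: "\<And>e. e > 0 ==> \<exists>N. \<forall>m\<ge>N. \<forall>n\<ge>N. ell2_norm (\<lambda>y. s m y - s n y) < e"
  using C by (simp add: ell2_Cauchy_def)
 have key: "(\<lambda>y. s n y - f y) \<in> ell2 \<and> (ell2_norm (\<lambda>y. s n y - f y))^2 \<le> e^2"
  if e: "e > 0" and N: "\<And>m. m \<ge> N ==> ell2_norm (\<lambda>y. s m y - s n y) < e" for e n N
 proof -
  have "(\<Sum>y\<in>F. (cmod (s n y - f y))^2) \<le> e^2" if F: "finite F" for F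
  proof (rule LIMSEQ_le_const2)
   show "(\<lambda>m. \<Sum>y\<in>F. (cmod (s n y - s m y))^2) \<longlonglongrightarrow> (\<Sum>y\<in>F. (cmod (s n y - f y))^2)"
    by (intro tendsto_intros lim)
   have "(\<Sum>y\<in>F. (cmod (s n y - s m y))^2) \<le> e^2" if m: "m \<ge> N" for m
   proof -
    have "(\<Sum>y\<in>F. (cmod (s n y - s m y))^2) \<le> (ell2_norm (\<lambda>y. s n y - s m y))^2"
     by (intro ell2_finite_sum_le ell2_diff s F)
    also have "... \<le> e^2"
     using N[OF m] ell2_norm_minus_commute[of "s n" "s m"] by (intro power_mono) auto
    finally show ?thesis .
   qed
   then show "\<exists>N. \<forall>m\<ge>N. (\<Sum>y\<in>F. (cmod (s n y - s m y))^2) \<le> e^2" by blast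
  qed
  then show ?thesis using ell2_bound[of "\<lambda>y. s n y - f y" "e^2"] by blast
 qed
 obtain N1 where "\<forall>m\<ge>N1. \<forall>n\<ge>N1. ell2_norm (\<lambda>y. s m y - s n y) < 1"
  using Ce[of 1] by auto
 then have "(\<lambda>y. s N1 y - f y) \<in> ell2" using key[of 1 N1 N1] by auto
 from ell2_diff[OF s[of N1] this] have f: "f \<in> ell2" by simp
 have "(\<lambda>n. ell2_norm (\<lambda>y. s n y - f y)) \<longlonglongrightarrow> 0"
 proof (rule LIMSEQ_I)
  fix r :: real assume r: "0 < r"
  then obtain N where N: "\<forall>m\<ge>N. \<forall>n\<ge>N. ell2_norm (\<lambda>y. s m y - s n y) < r / 2"
   using Ce[of "r / 2"] by auto
  have "norm (ell2_norm (\<lambda>y. s n y - f y) - 0) < r" if n: "n \<ge> N" for n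
  proof -
   have "(ell2_norm (\<lambda>y. s n y - f y))^2 \<le> (r / 2)^2" using key[OF _ N[rule_format, OF _ n], of N] r by simp
   then have "ell2_norm (\<lambda>y. s n y - f y) \<le> r / 2" by (rule power2_le_imp_le) (use r in simp)
   then show ?thesis using r by simp
  qed
  then show "\<exists>N. \<forall>n\<ge>N. norm (ell2_norm (\<lambda>y. s n y - f y) - 0) < r" by blast
 qed
 then show ?thesis using s f by (simp add: ell2_tendsto_def)
qed

lemma ell2_complete:
 assumes C: "ell2_Cauchy s"
 shows "\<exists>f. ell2_tendsto s f"
proof -
 have s: "s n \<in> ell2" for n using C by (simp add: ell2_Cauchy_def)
 have "\<exists>l. (\<lambda>n. s n y) \<longlonglongrightarrow> l" for y
 proof -
  have "Cauchy (\<lambda>n. s n y)"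
  proof (rule metric_CauchyI)
   fix e :: real assume "0 < e"
   then obtain N where N: "\<forall>m\<ge>N. \<forall>n\<ge>N. ell2_norm (\<lambda>y. s m y - s n y) < e"
    using C unfolding ell2_Cauchy_def by blast
   have "dist (s m y) (s n y) < e" if "m \<ge> N" "n \<ge> N" for m n
    using N that ell2_pointwise_le[OF ell2_diff[OF s[of m] s[of n]], of y] by (auto simp: dist_norm intro: le_less_trans)
   then show "\<exists>M. \<forall>m\<ge>M. \<forall>n\<ge>M. dist (s m y) (s n y) < e" by blast
  qed
  then show ?thesis by (simp add: Cauchy_convergent_iff convergent_def)
 qed
 then obtain f where "\<And>y. (\<lambda>n. s n y) \<longlonglongrightarrow> f y" by metis
 then show ?thesis using ell2_Cauchy_pointwise_limit[OF C] by blast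
qed

text \<open>Iterating the map from \<open>s\<close> to \<open>g + R s\<close>, starting at 0,
  converges geometrically to a solution of \<open>f - R f = g\<close>; the contraction also gives
  injectivity and the norm bound.\<close>

lemma ell2_contraction_bijective:
 fixes R :: "('a => complex) => 'a => complex"
 assumes R: "\<And>f. f \<in> ell2 ==> R f \<in> ell2"
  and diff: "\<And>f g y. R (\<lambda>y. f y - g y) y = R f y - R g y"
  and q: "0 \<le> q" "q < 1" and c: "\<And>f. f \<in> ell2 ==> ell2_norm (R f) \<le> q * ell2_norm f"
 shows "bij_betw (\<lambda>f y. f y - R f y) ell2 ell2"
  "f \<in> ell2 ==> ell2_norm f \<le> 1 / (1 - q) * ell2_norm (\<lambda>y. f y - R f y)"
proof -
 have diff': "R (\<lambda>y. f y - g y) = (\<lambda>y. R f y - R g y)" for f g using diff by (intro ext)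
 have b: "ell2_norm f \<le> 1 / (1 - q) * ell2_norm (\<lambda>y. f y - R f y)" if f: "f \<in> ell2" for f
 proof -
  have "ell2_norm f \<le> ell2_norm (\<lambda>y. f y - R f y) + ell2_norm (R f)"
   using ell2_triangle[OF ell2_diff[OF f R[OF f]] R[OF f]] by simp
  then have "(1 - q) * ell2_norm f \<le> ell2_norm (\<lambda>y. f y - R f y)" using c[OF f] by (simp add: algebra_simps)
  then show ?thesis using q by (simp add: field_simps)
 qed
 then show "f \<in> ell2 ==> ell2_norm f \<le> 1 / (1 - q) * ell2_norm (\<lambda>y. f y - R f y)" .
 have inj: "inj_on (\<lambda>f y. f y - R f y) ell2"
 proof (rule inj_onI)
  fix f g assume fg: "f \<in> ell2" "g \<in> ell2" and "(\<lambda>y. f y - R f y) = (\<lambda>y. g y - R g y)"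
  then have "(\<lambda>y. (f y - g y) - R (\<lambda>y. f y - g y) y) = (\<lambda>_. 0)"
   by (auto simp: diff fun_eq_iff algebra_simps)
  then have "ell2_norm (\<lambda>y. f y - g y) \<le> 0" using b[OF ell2_diff[OF fg]] by (simp add: ell2_norm_def)
  then have "ell2_norm (\<lambda>y. f y - g y) = 0" by (simp add: order_antisym)
  then show "f = g" using ell2_norm_eq_0[OF ell2_diff[OF fg]] by (auto simp: fun_eq_iff)
 qed
 have "\<exists>f\<in>ell2. (\<lambda>y. f y - R f y) = g" if g: "g \<in> ell2" for g
 proof -
  define s where "s = rec_nat (\<lambda>_. 0) (\<lambda>_ f y. g y + R f y)"
  have s_Suc: "s (Suc n) = (\<lambda>y. g y + R (s n) y)" and s_0: "s 0 = (\<lambda>_. 0)" for n by (simp_all add: s_def)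
  have s: "s n \<in> ell2" for n
   by (induction n) (auto simp: s_Suc s_0 intro: ell2_add g R)
  define D where "D = ell2_norm (\<lambda>y. s 1 y - s 0 y)"
  have step: "ell2_norm (\<lambda>y. s (Suc n) y - s n y) \<le> q ^ n * D" for n
  proof (induction n)
   case (Suc n)
   have "(\<lambda>y. s (Suc (Suc n)) y - s (Suc n) y) = R (\<lambda>y. s (Suc n) y - s n y)"
    unfolding diff' s_Suc[of "Suc n"] by (subst (2) s_Suc) simp
   then have "ell2_norm (\<lambda>y. s (Suc (Suc n)) y - s (Suc n) y) \<le> q * ell2_norm (\<lambda>y. s (Suc n) y - s n y)"
    using c[OF ell2_diff[OF s s]] by simp
   also have "... \<le> q * (q ^ n * D)" using Suc q by (intro mult_left_mono) auto
   finally show ?case by simp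
  qed (simp add: D_def)
  have D0: "0 \<le> D" by (simp add: D_def)
  \<comment> \<open>The increments are summed as a geometric series in closed form.\<close>
  have far: "ell2_norm (\<lambda>y. s (n + k) y - s n y) \<le> q ^ n * D / (1 - q) * (1 - q ^ k)" for n k
  proof (induction k)
   case 0
   then show ?case by (simp add: ell2_norm_def)
  next
   case (Suc k)
   have "ell2_norm (\<lambda>y. s (n + Suc k) y - s n y) \<le> ell2_norm (\<lambda>y. s (Suc (n + k)) y - s (n + k) y) + ell2_norm (\<lambda>y. s (n + k) y - s n y)"
    using ell2_triangle_diff[OF s s s] by simp
   also have "... \<le> q ^ (n + k) * D + q ^ n * D / (1 - q) * (1 - q ^ k)"
    by (intro add_mono step Suc)
   also have "... = q ^ n * D / (1 - q) * (1 - q ^ Suc k)"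
    using q by (simp add: power_add field_simps)
   finally show ?case .
  qed
  have far': "ell2_norm (\<lambda>y. s m y - s n y) \<le> q ^ min m n * (D / (1 - q))" for m n
  proof -
   have le: "ell2_norm (\<lambda>y. s m y - s n y) \<le> q ^ n * (D / (1 - q))" if "n \<le> m" for m n
   proof -
    have "ell2_norm (\<lambda>y. s m y - s n y) \<le> q ^ n * D / (1 - q) * (1 - q ^ (m - n))" using far[of n "m - n"] that by simp
    also have "... \<le> q ^ n * D / (1 - q) * 1" using q D0 by (intro mult_left_mono) auto
    finally show ?thesis by simp
   qed
   show ?thesis using le[of n m] le[of m n] ell2_norm_minus_commute[of "s m" "s n"] by (cases "n \<le> m") (auto simp: min_def)
  qed
  have "ell2_Cauchy s" unfolding ell2_Cauchy_def
  proof (intro conjI allI impI s)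
   fix e :: real assume e: "0 < e"
   have "(\<lambda>n. q ^ n * (D / (1 - q))) \<longlonglongrightarrow> 0 * (D / (1 - q))"
    using q by (intro tendsto_mult LIMSEQ_power_zero tendsto_const) auto
   then obtain N where N: "\<And>n. n \<ge> N ==> q ^ n * (D / (1 - q)) < e"
    using order_tendstoD(2)[of _ 0 sequentially e] e by (auto simp: eventually_sequentially)
   show "\<exists>N. \<forall>m\<ge>N. \<forall>n\<ge>N. ell2_norm (\<lambda>y. s m y - s n y) < e"
   proof (intro exI[of _ N] allI impI)
    fix m n assume "N \<le> m" "N \<le> n"
    then show "ell2_norm (\<lambda>y. s m y - s n y) < e"
     using le_less_trans[OF far' N[of "min m n"]] by simp
   qed
  qed
  then obtain f where f: "ell2_tendsto s f" using ell2_complete by blast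
  have fe: "f \<in> ell2" using f by (simp add: ell2_tendsto_def)
  have "(\<lambda>n. R (s n) y) \<longlonglongrightarrow> R f y" for y
  proof -
   have "(\<lambda>n. R (s n) y - R f y) \<longlonglongrightarrow> 0"
   proof (rule Lim_null_comparison)
    show "eventually (\<lambda>n. norm (R (s n) y - R f y) \<le> q * ell2_norm (\<lambda>y. s n y - f y)) sequentially"
    proof (intro always_eventually allI)
     fix n
     have "norm (R (s n) y - R f y) \<le> ell2_norm (R (\<lambda>y. s n y - f y))"
      using ell2_pointwise_le[OF R[OF ell2_diff[OF s fe]], of n y] by (simp add: diff)
     then show "norm (R (s n) y - R f y) \<le> q * ell2_norm (\<lambda>y. s n y - f y)"
      using c[OF ell2_diff[OF s fe], of n] by simp
    qed
    have "(\<lambda>n. q * ell2_norm (\<lambda>y. s n y - f y)) \<longlonglongrightarrow> q * 0"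
     using f unfolding ell2_tendsto_def by (intro tendsto_intros) auto
    then show "(\<lambda>n. q * ell2_norm (\<lambda>y. s n y - f y)) \<longlonglongrightarrow> 0" by simp
   qed
   then show ?thesis by (simp add: LIM_zero_iff)
  qed
  then have "(\<lambda>n. g y + R (s n) y) \<longlonglongrightarrow> g y + R f y" for y by (intro tendsto_intros)
  then have "(\<lambda>n. s (Suc n) y) \<longlonglongrightarrow> g y + R f y" for y by (simp add: s_Suc)
  then have "f y = g y + R f y" for y
   using LIMSEQ_unique[OF LIMSEQ_Suc[OF ell2_tendsto_pointwise[OF f]]] by blast
  then have "(\<lambda>y. f y - R f y) = g" by (auto simp: fun_eq_iff algebra_simps)
  then show ?thesis using fe by blast
 qed
 then have "ell2 \<subseteq> (\<lambda>f y. f y - R f y) ` ell2" by blast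
 moreover have "(\<lambda>f y. f y - R f y) ` ell2 \<subseteq> ell2" by (auto intro!: ell2_diff R)
 ultimately show "bij_betw (\<lambda>f y. f y - R f y) ell2 ell2"
  using inj by (simp add: bij_betw_def subset_antisym)
qed

locale bounded_symmetric =
 fixes T :: "('a => complex) => 'a => complex" and B :: real
 assumes T_add: "T (\<lambda>y. f y + g y) = (\<lambda>y. T f y + T g y)"
  and T_mult: "T (\<lambda>y. c * f y) = (\<lambda>y. c * T f y)"
  and T_ell2: "f \<in> ell2 ==> T f \<in> ell2"
  and T_bound: "f \<in> ell2 ==> ell2_norm (T f) \<le> B * ell2_norm f"
  and T_symmetric: "f \<in> ell2 ==> g \<in> ell2 ==> ell2_inner (T f) g = ell2_inner f (T g)"
  and B_pos: "0 < B"
begin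

lemma T_diff: "T (\<lambda>y. f y - g y) = (\<lambda>y. T f y - T g y)"
 using T_add[of f "\<lambda>y. (-1) * g y"] T_mult[of "-1" g] by (simp add: fun_eq_iff)

text \<open>Reduces invertibility of \<open>T - z\<close> to the choice of a scalar
  \<open>c\<close>: \<open>- 1 / z\<close> for large \<open>z\<close>, an imaginary number for
  nonreal \<open>z\<close>.\<close>

lemma op_shift_bijective_of_contraction:
 assumes c: "c \<noteq> 0" and q: "0 \<le> q" "q < 1"
  and contr: "\<And>f. f \<in> ell2 ==> ell2_norm (\<lambda>y. f y - c * op_shift T z f y) \<le> q * ell2_norm f"
 shows "z \<notin> op_spectrum T"
proof -
 define R where "R f = (\<lambda>y. f y - c * op_shift T z f y)" for f :: "'a => complex"
 have Re: "R f \<in> ell2" if "f \<in> ell2" for f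
  unfolding R_def op_shift_def using that by (intro ell2_diff ell2_mult T_ell2)
 have Rd: "R (\<lambda>y. f y - g y) y = R f y - R g y" for f g y
  by (simp add: R_def op_shift_def T_diff algebra_simps)
 have Rc: "ell2_norm (R f) \<le> q * ell2_norm f" if "f \<in> ell2" for f
  unfolding R_def using contr[OF that] .
 have RR: "(\<lambda>y. f y - R f y) = (\<lambda>y. c * op_shift T z f y)" for f by (simp add: R_def fun_eq_iff)
 have bij: "bij_betw (\<lambda>f y. c * op_shift T z f y) ell2 ell2"
  using ell2_contraction_bijective(1)[OF Re Rd q Rc] unfolding RR .
 have bij2: "bij_betw (\<lambda>f (y::'a). (1 / c) * f y) ell2 ell2"
 proof (rule bij_betwI[where g="\<lambda>f y. c * f y"])
  show "(\<lambda>f (y::'a). (1 / c) * f y) \<in> ell2 \<rightarrow> ell2" "(\<lambda>f (y::'a). c * f y) \<in> ell2 \<rightarrow> ell2" using ell2_mult by blast+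
 qed (use c in \<open>simp_all add: fun_eq_iff\<close>)
 have "(\<lambda>f (y::'a). (1 / c) * f y) \<circ> (\<lambda>f y. c * op_shift T z f y) = op_shift T z"
  using c by (simp add: fun_eq_iff)
 then have "bij_betw (op_shift T z) ell2 ell2" using bij_betw_trans[OF bij bij2] by simp
 moreover have "\<forall>f\<in>ell2. ell2_norm f \<le> (1 / (1 - q) * cmod c) * ell2_norm (op_shift T z f)"
 proof
  fix f :: "'a => complex" assume f: "f \<in> ell2"
  have "op_shift T z f \<in> ell2" unfolding op_shift_def using f by (intro ell2_diff ell2_mult T_ell2)
  then show "ell2_norm f \<le> (1 / (1 - q) * cmod c) * ell2_norm (op_shift T z f)"
   using ell2_contraction_bijective(2)[OF Re Rd q Rc f] unfolding RR by (simp add: ell2_norm_mult)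
 qed
 ultimately show ?thesis unfolding op_spectrum_def by blast
qed

text \<open>This bounds the spectrum, so that continuous functions can be approximated on it
  uniformly by polynomials.\<close>

lemma large_notin_spectrum:
 assumes "B < cmod z"
 shows "z \<notin> op_spectrum T"
proof (rule op_shift_bijective_of_contraction[of "- 1 / z" "B / cmod z"])
 have z: "z \<noteq> 0" using assms B_pos by auto
 then show "- 1 / z \<noteq> 0" by simp
 show "0 \<le> B / cmod z" "B / cmod z < 1" using assms B_pos z by auto
 fix f :: "'a => complex" assume f: "f \<in> ell2"
 have "(\<lambda>y. f y - - 1 / z * op_shift T z f y) = (\<lambda>y. (1 / z) * T f y)"
  using z by (auto simp: op_shift_def fun_eq_iff field_simps)
 then show "ell2_norm (\<lambda>y. f y - - 1 / z * op_shift T z f y) \<le> B / cmod z * ell2_norm f"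
  using ell2_norm_mult[OF T_ell2[OF f], of "1 / z"] T_bound[OF f] z
  by (simp add: norm_divide divide_right_mono)
qed

text \<open>With \<open>z = x + \<i> * y\<close> and \<open>c = \<i> * \<eta>\<close> the operator
  to be estimated is \<open>(1 - \<eta> * y) - \<i> * \<eta> * (T - x)\<close>. By symmetry the real
  part of the cross term vanishes, so the squared norms add up to at most
  \<open>(1 - \<eta> * y)^2 + \<eta>^2 * D^2\<close> times that of \<open>f\<close>.\<close>

lemma nonreal_notin_spectrum:
 assumes z: "Im z \<noteq> 0"
 shows "z \<notin> op_spectrum T"
proof -
 define x y where "x = Re z" and "y = Im z"
 define D where "D = B + \<bar>x\<bar>"
 \<comment> \<open>The minimizer of \<open>(1 - \<eta> * y)^2 + \<eta>^2 * D^2\<close>; the minimum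
   is \<open>1 - y^2 / (y^2 + D^2)\<close>, which is below 1.\<close>
 define \<eta> where "\<eta> = y / (y^2 + D^2)"
 have y0: "y \<noteq> 0" and p: "0 < y^2 + D^2" using z by (auto simp: y_def intro: add_pos_nonneg)
 define q where "q = sqrt (1 - y^2 / (y^2 + D^2))"
 have q1: "0 \<le> 1 - y^2 / (y^2 + D^2)" "1 - y^2 / (y^2 + D^2) < 1" using y0 p by (auto simp: divide_le_eq)
 show ?thesis
 proof (rule op_shift_bijective_of_contraction[of "\<i> * cor \<eta>" q])
  have "\<eta> \<noteq> 0" using y0 p by (simp add: \<eta>_def)
  then show "\<i> * cor \<eta> \<noteq> 0" by simp
  show "0 \<le> q" "q < 1" using q1 by (simp_all add: q_def)
  fix f :: "'a => complex" assume f: "f \<in> ell2"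
  define h where "h = op_shift T (cor x) f"
  have h: "h \<in> ell2" unfolding h_def op_shift_def using f by (intro ell2_diff ell2_mult T_ell2)
  have zxy: "z = cor x + \<i> * cor y" by (simp add: x_def y_def complex_eq_iff)
  have e: "(\<lambda>v. f v - \<i> * cor \<eta> * op_shift T z f v) = (\<lambda>v. cor (1 - \<eta> * y) * f v + (- \<i> * cor \<eta>) * h v)"
   by (rule ext) (simp add: zxy h_def op_shift_def algebra_simps)
  have hb: "ell2_norm h \<le> D * ell2_norm f"
  proof -
   have "ell2_norm h \<le> ell2_norm (T f) + ell2_norm (\<lambda>v. (- cor x) * f v)"
    using ell2_triangle[OF T_ell2[OF f] ell2_mult[OF f, of "- cor x"]] by (simp add: h_def op_shift_def)
   also have "... \<le> B * ell2_norm f + \<bar>x\<bar> * ell2_norm f"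
    using T_bound[OF f] ell2_norm_mult[OF f, of "- cor x"] by simp
   finally show ?thesis by (simp add: D_def algebra_simps)
  qed
  have sym: "Im (ell2_inner f h) = 0"
  proof -
   have "ell2_inner f h = ell2_inner f (T f) - cor x * ell2_inner f f"
    using ell2_inner_add_right[OF T_ell2[OF f] ell2_mult[OF f, of "- cor x"] f]
     ell2_inner_mult_right[of f "- cor x" f] by (simp add: h_def op_shift_def)
   moreover have "ell2_inner f (T f) = cnj (ell2_inner f (T f))"
    using T_symmetric[OF f f] ell2_inner_commute[of "T f" f] by simp
   then have "Im (ell2_inner f (T f)) = 0" by (metis cnj.simps(2) equal_neg_zero)
   ultimately show ?thesis by (simp add: ell2_inner_self[OF f])
  qed
  have cross: "Re (ell2_inner (\<lambda>v. cor (1 - \<eta> * y) * f v) (\<lambda>v. (- \<i> * cor \<eta>) * h v)) = 0"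
   unfolding ell2_inner_mult_left ell2_inner_mult_right by (simp add: sym)
  have "(ell2_norm (\<lambda>v. f v - \<i> * cor \<eta> * op_shift T z f v))^2
   = (\<bar>1 - \<eta> * y\<bar> * ell2_norm f)^2 + (\<bar>\<eta>\<bar> * ell2_norm h)^2"
   unfolding e ell2_norm_add_power2[OF ell2_mult[OF f] ell2_mult[OF h]] cross ell2_norm_mult[OF f] ell2_norm_mult[OF h]
   by (simp add: norm_mult del: of_real_diff)
  also have "... \<le> (\<bar>1 - \<eta> * y\<bar> * ell2_norm f)^2 + (\<bar>\<eta>\<bar> * (D * ell2_norm f))^2"
   using hb by (intro add_left_mono power_mono mult_left_mono) auto
  also have "... = ((1 - \<eta> * y)^2 + \<eta>^2 * D^2) * (ell2_norm f)^2"
   by (simp add: power_mult_distrib distrib_right)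
  also have "(1 - \<eta> * y)^2 + \<eta>^2 * D^2 = 1 - y^2 / (y^2 + D^2)"
  proof -
   have "(1 - \<eta> * y)^2 + \<eta>^2 * D^2 = 1 - 2 * (\<eta> * y) + \<eta> * (\<eta> * (y^2 + D^2))"
    by (simp add: power2_eq_square algebra_simps)
   also have "\<eta> * (y^2 + D^2) = y" using p by (simp add: \<eta>_def)
   finally show ?thesis by (simp add: \<eta>_def power2_eq_square)
  qed
  finally have "(ell2_norm (\<lambda>v. f v - \<i> * cor \<eta> * op_shift T z f v))^2 \<le> (q * ell2_norm f)^2"
   using q1 by (simp add: q_def power_mult_distrib)
  then show "ell2_norm (\<lambda>v. f v - \<i> * cor \<eta> * op_shift T z f v) \<le> q * ell2_norm f"
   by (rule power2_le_imp_le) (use q1 in \<open>simp add: q_def\<close>)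
 qed
qed

lemma resolvent_eqI:
 assumes z: "z \<notin> op_spectrum T" and h: "h \<in> ell2" and eq: "op_shift T z h = f"
 shows "resolvent T z f = h"
proof -
 have "inj_on (op_shift T z) ell2" using z unfolding op_spectrum_def bij_betw_def by blast
 then show ?thesis unfolding resolvent_def using inv_into_f_f[OF _ h] eq by blast
qed

end

section \<open>Square-integrable functions\<close>

lemma norm_add_power2_le:
 fixes u v :: "'a::real_normed_vector"
 shows "(norm (u + v))^2 \<le> 2 * (norm u)^2 + 2 * (norm v)^2"
proof -
 have "(norm (u + v))^2 \<le> (norm u + norm v)^2" by (intro power_mono norm_triangle_ineq norm_ge_zero)
 moreover have "0 \<le> (norm u - norm v)^2" by simp
 ultimately show ?thesis by (simp add: power2_eq_square algebra_simps)
qed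

lemma complex_poly_uniform_approximation:
 fixes f :: "real => complex"
 assumes S: "compact S" and f: "continuous_on S f" and e: "0 < e"
 shows "\<exists>p. \<forall>x\<in>S. cmod (f x - poly p (cor x)) < e"
proof -
 have "continuous_on S (\<lambda>x. Re (f x))" "continuous_on S (\<lambda>x. Im (f x))"
  using f by (auto intro: continuous_intros)
 then obtain g h :: "real poly" where g: "\<forall>x\<in>S. \<bar>poly g x - Re (f x)\<bar> < e / 2" and h: "\<forall>x\<in>S. \<bar>poly h x - Im (f x)\<bar> < e / 2"
  using poly_uniform_approximation[OF S, of _ "e / 2"] e by (metis half_gt_zero)
 show ?thesis
 proof (intro exI[of _ "map_poly cor g + smult \<i> (map_poly cor h)"] ballI)
  fix x assume x: "x \<in> S"
  have "cmod (f x - (cor (poly g x) + \<i> * cor (poly h x))) \<le>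
    \<bar>Re (f x) - poly g x\<bar> + \<bar>Im (f x) - poly h x\<bar>"
   using cmod_le[of "f x - (cor (poly g x) + \<i> * cor (poly h x))"] by simp
  also have "... < e" using bspec[OF g x] bspec[OF h x] by linarith
  finally show "cmod (f x - poly (map_poly cor g + smult \<i> (map_poly cor h)) (cor x)) < e"
   by (simp add: cpoly_of_real)
 qed
qed

context compact_measure
begin

definition sqnorm :: "(real => complex) => real" where
 "sqnorm \<alpha> = (\<integral>x. (cmod (\<alpha> x))^2 \<partial>M)"

lemma sqnorm_nonneg [simp]: "0 \<le> sqnorm \<alpha>"
 unfolding sqnorm_def by (rule Bochner_Integration.integral_nonneg) simp

lemma L2_iff: "\<alpha> \<in> L2 M \<longleftrightarrow> \<alpha> \<in> borel_measurable borel \<and> integrable M (\<lambda>x. (cmod (\<alpha> x))^2)"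
 by (simp add: L2_def measurable_M)

lemma L2_measurable: "\<alpha> \<in> L2 M ==> \<alpha> \<in> borel_measurable borel"
 by (simp add: L2_iff)

lemma L2_dominated:
 assumes b: "\<beta> \<in> borel_measurable borel" and a: "\<alpha> \<in> L2 M" and le: "\<And>x. x \<in> K ==> cmod (\<beta> x) \<le> C * cmod (\<alpha> x)"
 shows "\<beta> \<in> L2 M" "sqnorm \<beta> \<le> C^2 * sqnorm \<alpha>"
proof -
 have le2: "AE x in M. (cmod (\<beta> x))^2 \<le> C^2 * (cmod (\<alpha> x))^2" using AE_K
 proof eventually_elim
  case (elim x)
  show ?case using power_mono[OF le[OF elim], of 2] by (simp add: power_mult_distrib)
 qed
 have ia: "integrable M (\<lambda>x. C^2 * (cmod (\<alpha> x))^2)" using a by (simp add: L2_iff)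
 show b2: "\<beta> \<in> L2 M" unfolding L2_iff
 proof
  show "integrable M (\<lambda>x. (cmod (\<beta> x))^2)"
   by (rule Bochner_Integration.integrable_bound[OF ia]) (use b le2 in \<open>auto simp: measurable_M\<close>)
 qed (rule b)
 have "sqnorm \<beta> \<le> (\<integral>x. C^2 * (cmod (\<alpha> x))^2 \<partial>M)"
  unfolding sqnorm_def by (rule integral_mono_AE) (use b2 ia le2 in \<open>auto simp: L2_iff\<close>)
 then show "sqnorm \<beta> \<le> C^2 * sqnorm \<alpha>" by (simp add: sqnorm_def)
qed

lemma L2_bounded:
 assumes b: "\<beta> \<in> borel_measurable borel" and le: "\<And>x. x \<in> K ==> cmod (\<beta> x) \<le> C"
 shows "\<beta> \<in> L2 M" "sqnorm \<beta> \<le> C^2 * measure M UNIV"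
proof -
 have one: "(\<lambda>_. 1) \<in> L2 M" using integrable_const[of 1] by (simp add: L2_iff)
 show "\<beta> \<in> L2 M" by (rule L2_dominated(1)[OF b one, of C]) (use le in auto)
 show "sqnorm \<beta> \<le> C^2 * measure M UNIV"
  using L2_dominated(2)[OF b one, of C] le by (simp add: sqnorm_def space_M)
qed

lemma L2_mult: "\<beta> \<in> L2 M ==> (\<lambda>x. c * \<beta> x) \<in> L2 M"
 by (rule L2_dominated(1)[where C="cmod c"]) (auto simp: norm_mult L2_iff)

lemma L2_add:
 assumes a: "\<alpha> \<in> L2 M" and b: "\<beta> \<in> L2 M"
 shows "(\<lambda>x. \<alpha> x + \<beta> x) \<in> L2 M" "sqnorm (\<lambda>x. \<alpha> x + \<beta> x) \<le> 2 * sqnorm \<alpha> + 2 * sqnorm \<beta>"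
proof -
 have i: "integrable M (\<lambda>x. 2 * (cmod (\<alpha> x))^2 + 2 * (cmod (\<beta> x))^2)" using a b by (simp add: L2_iff)
 have m: "(\<lambda>x. \<alpha> x + \<beta> x) \<in> borel_measurable borel"
  by (intro borel_measurable_add L2_measurable a b)
 have m': "(\<lambda>x. \<alpha> x + \<beta> x) \<in> borel_measurable M" using m by (simp add: measurable_M)
 have i2: "integrable M (\<lambda>x. (cmod (\<alpha> x + \<beta> x))^2)"
  by (rule Bochner_Integration.integrable_bound[OF i]) (use m' norm_add_power2_le in auto)
 show "(\<lambda>x. \<alpha> x + \<beta> x) \<in> L2 M" using m i2 by (simp add: L2_iff)
 have "sqnorm (\<lambda>x. \<alpha> x + \<beta> x) \<le> (\<integral>x. 2 * (cmod (\<alpha> x))^2 + 2 * (cmod (\<beta> x))^2 \<partial>M)"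
  unfolding sqnorm_def by (rule integral_mono[OF i2 i]) (rule norm_add_power2_le)
 also have "... = 2 * sqnorm \<alpha> + 2 * sqnorm \<beta>" using a b by (simp add: sqnorm_def L2_iff)
 finally show "sqnorm (\<lambda>x. \<alpha> x + \<beta> x) \<le> 2 * sqnorm \<alpha> + 2 * sqnorm \<beta>" .
qed

lemma L2_diff: "\<alpha> \<in> L2 M ==> \<beta> \<in> L2 M ==> (\<lambda>x. \<alpha> x - \<beta> x) \<in> L2 M"
 using L2_add(1)[of \<alpha> "\<lambda>x. (-1) * \<beta> x"] L2_mult[of \<beta> "-1"] by simp

lemma sqnorm_mult: "sqnorm (\<lambda>x. c * \<alpha> x) = (cmod c)^2 * sqnorm \<alpha>"
 by (simp add: sqnorm_def norm_mult power_mult_distrib)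

lemma sqnorm_minus_commute: "sqnorm (\<lambda>x. \<alpha> x - \<beta> x) = sqnorm (\<lambda>x. \<beta> x - \<alpha> x)"
 by (simp add: sqnorm_def norm_minus_commute)

lemma sqnorm_triangle:
 assumes "\<alpha> \<in> L2 M" "\<beta> \<in> L2 M" "\<gamma> \<in> L2 M"
 shows "sqnorm (\<lambda>x. \<alpha> x - \<gamma> x) \<le> 2 * sqnorm (\<lambda>x. \<alpha> x - \<beta> x) + 2 * sqnorm (\<lambda>x. \<beta> x - \<gamma> x)"
 using L2_add(2)[OF L2_diff[OF assms(1,2)] L2_diff[OF assms(2,3)]] by simp

lemma L2_continuous:
 assumes f: "continuous_on UNIV f"
 shows "f \<in> L2 M"
proof -
 have "bounded (f ` K)"
  by (rule compact_imp_bounded[OF compact_continuous_image[OF continuous_on_subset[OF f subset_UNIV] K]])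
 then obtain C where "\<forall>y\<in>f ` K. cmod y \<le> C" unfolding bounded_iff by blast
 then show ?thesis by (intro L2_bounded(1)[of f C] borel_measurable_continuous_onI f) auto
qed

lemma L2_poly: "(\<lambda>x. poly p (cor x)) \<in> L2 M"
 by (intro L2_continuous continuous_intros)

lemma L2_integrable:
 assumes "\<alpha> \<in> L2 M"
 shows "integrable M \<alpha>"
proof -
 have i: "integrable M (\<lambda>x. 1 + (cmod (\<alpha> x))^2)"
  using assms integrable_const[of 1] by (simp add: L2_iff)
 have le: "cmod u \<le> 1 + (cmod u)^2" for u using sum_squares_bound[of 1 "cmod u"] norm_ge_zero[of u] by (simp add: power2_eq_square del: norm_ge_zero)
 show ?thesis
  by (rule Bochner_Integration.integrable_bound[OF i]) (use assms le in \<open>auto simp: L2_iff measurable_M\<close>)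
qed

lemma L2_integrable_product:
 assumes "\<alpha> \<in> L2 M" "h \<in> borel_measurable borel" "\<And>x. x \<in> K ==> cmod (h x) \<le> C"
 shows "integrable M (\<lambda>x. \<alpha> x * h x)"
 using assms L2_measurable[OF assms(1)]
 by (intro L2_integrable L2_dominated(1)[OF _ assms(1), of _ C]) (auto simp: norm_mult mult.commute[of _ "cmod (h _)"] intro: mult_right_mono)

lemma L1_le_L2:
 assumes a: "\<alpha> \<in> L2 M"
 shows "(\<integral>x. cmod (\<alpha> x) \<partial>M)^2 \<le> (measure M UNIV + 1) * sqnorm \<alpha>"
proof -
 interpret finite_measure M by (rule finite_M)
 \<comment> \<open>The added 1 keeps \<open>m\<close> positive even for the zero measure.\<close>
 define t m where "t = (\<integral>x. cmod (\<alpha> x) \<partial>M)" and "m = measure M UNIV + 1"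
 have m: "m > 0" unfolding m_def by (simp add: add_nonneg_pos)
 have i1: "integrable M (\<lambda>x. cmod (\<alpha> x))" using L2_integrable[OF a] by simp
 have i2: "integrable M (\<lambda>x. (cmod (\<alpha> x))^2)" using a by (simp add: L2_iff)
 have "0 \<le> (\<integral>x. (m * cmod (\<alpha> x) - t)^2 \<partial>M)" by (rule Bochner_Integration.integral_nonneg) simp
 also have "... = (\<integral>x. m^2 * (cmod (\<alpha> x))^2 - 2 * m * t * cmod (\<alpha> x) + t^2 \<partial>M)"
  by (rule Bochner_Integration.integral_cong) (auto simp: power2_eq_square algebra_simps)
 also have "... = m^2 * sqnorm \<alpha> - 2 * m * t * t + t^2 * (m - 1)"
  using i1 i2 by (simp add: sqnorm_def t_def m_def space_M algebra_simps)
 finally have "m * t^2 \<le> m * (m * sqnorm \<alpha>)"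
  by (simp add: power2_eq_square algebra_simps) (smt (verit) mult_nonneg_nonneg zero_le_square)
 then have "t^2 \<le> m * sqnorm \<alpha>" using m by simp
 then show ?thesis by (simp add: t_def m_def)
qed

text \<open>With \<open>h\<close> built from a component of \<open>Psi_hat\<close>, this is
  convergence of the transforms at a single vertex.\<close>

lemma L2_weak_convergence:
 assumes s: "\<And>n::nat. s n \<in> L2 M" and a: "\<alpha> \<in> L2 M" and lim: "(\<lambda>n. sqnorm (\<lambda>x. s n x - \<alpha> x)) \<longlonglongrightarrow> 0"
  and h: "h \<in> borel_measurable borel" "\<And>x. x \<in> K ==> cmod (h x) \<le> C"
 shows "(\<lambda>n. \<integral>x. s n x * h x \<partial>M) \<longlonglongrightarrow> (\<integral>x. \<alpha> x * h x \<partial>M)"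
proof -
 define c where "c = (measure M UNIV + 1) * C^2"
 have bd: "cmod ((\<integral>x. s n x * h x \<partial>M) - (\<integral>x. \<alpha> x * h x \<partial>M)) \<le> sqrt (c * sqnorm (\<lambda>x. s n x - \<alpha> x))" for n
 proof -
  have d: "(\<lambda>x. s n x - \<alpha> x) \<in> L2 M" by (rule L2_diff[OF s a])
  have dm: "(\<lambda>x. (s n x - \<alpha> x) * h x) \<in> borel_measurable borel"
   using L2_measurable[OF d] h(1) by measurable
  have le: "cmod ((s n x - \<alpha> x) * h x) \<le> C * cmod (s n x - \<alpha> x)" if "x \<in> K" for x
   using mult_right_mono[OF h(2)[OF that] norm_ge_zero[of "s n x - \<alpha> x"]] by (simp add: norm_mult mult.commute)
  have dd: "(\<lambda>x. (s n x - \<alpha> x) * h x) \<in> L2 M" "sqnorm (\<lambda>x. (s n x - \<alpha> x) * h x) \<le> C^2 * sqnorm (\<lambda>x. s n x - \<alpha> x)"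
   by (rule L2_dominated[OF dm d le], assumption)+
  have "(\<integral>x. s n x * h x \<partial>M) - (\<integral>x. \<alpha> x * h x \<partial>M) = (\<integral>x. (s n x - \<alpha> x) * h x \<partial>M)"
   using L2_integrable_product[OF s h] L2_integrable_product[OF a h] by (simp add: left_diff_distrib)
  then have "(cmod ((\<integral>x. s n x * h x \<partial>M) - (\<integral>x. \<alpha> x * h x \<partial>M)))^2 \<le> (\<integral>x. cmod ((s n x - \<alpha> x) * h x) \<partial>M)^2"
   by (simp only:) (intro power_mono integral_norm_bound norm_ge_zero)
  also have "... \<le> (measure M UNIV + 1) * sqnorm (\<lambda>x. (s n x - \<alpha> x) * h x)" by (rule L1_le_L2[OF dd(1)])
  also have "... \<le> c * sqnorm (\<lambda>x. s n x - \<alpha> x)"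
   unfolding c_def mult.assoc using dd(2) by (intro mult_left_mono) (auto simp: add_nonneg_nonneg)
  finally show ?thesis by (rule real_le_rsqrt)
 qed
 have "(\<lambda>n. sqrt (c * sqnorm (\<lambda>x. s n x - \<alpha> x))) \<longlonglongrightarrow> sqrt (c * 0)"
  by (intro tendsto_intros lim)
 then have "(\<lambda>n. sqrt (c * sqnorm (\<lambda>x. s n x - \<alpha> x))) \<longlonglongrightarrow> 0" by (simp only: mult_zero_right real_sqrt_zero)
 then have "(\<lambda>n. (\<integral>x. s n x * h x \<partial>M) - (\<integral>x. \<alpha> x * h x \<partial>M)) \<longlonglongrightarrow> 0"
  by (rule Lim_null_comparison[OF always_eventually[OF allI[OF bd]]])
 then show ?thesis by (rule LIM_zero_cancel)
qed

section \<open>Density of the polynomials\<close>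

definition poly_approximable :: "(real => complex) => bool" where
 "poly_approximable \<alpha> \<longleftrightarrow> \<alpha> \<in> L2 M \<and> (\<forall>e>0. \<exists>p. sqnorm (\<lambda>x. \<alpha> x - poly p (cor x)) < e)"

lemma poly_approximable_closed:
 assumes a: "\<alpha> \<in> L2 M" and ap: "\<And>e. 0 < e ==> \<exists>\<beta>. poly_approximable \<beta> \<and> sqnorm (\<lambda>x. \<alpha> x - \<beta> x) < e"
 shows "poly_approximable \<alpha>"
 unfolding poly_approximable_def
proof (intro conjI a allI impI)
 fix e :: real assume e: "0 < e"
 then obtain \<beta> where b: "poly_approximable \<beta>" "sqnorm (\<lambda>x. \<alpha> x - \<beta> x) < e / 4" using ap[of "e/4"] by auto
 have "e / 4 > 0" using e by simp
 then obtain p where p: "sqnorm (\<lambda>x. \<beta> x - poly p (cor x)) < e / 4" using b(1) unfolding poly_approximable_def by blast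
 have "sqnorm (\<lambda>x. \<alpha> x - poly p (cor x)) \<le> 2 * sqnorm (\<lambda>x. \<alpha> x - \<beta> x) + 2 * sqnorm (\<lambda>x. \<beta> x - poly p (cor x))"
  using b(1) by (intro sqnorm_triangle a L2_poly) (simp add: poly_approximable_def)
 then show "\<exists>p. sqnorm (\<lambda>x. \<alpha> x - poly p (cor x)) < e" using b(2) p by (intro exI[of _ p]) simp
qed

lemma poly_approximable_limit:
 assumes a: "\<alpha> \<in> L2 M" and s: "\<And>n::nat. poly_approximable (s n)" and lim: "(\<lambda>n. sqnorm (\<lambda>x. \<alpha> x - s n x)) \<longlonglongrightarrow> 0"
 shows "poly_approximable \<alpha>"
proof (rule poly_approximable_closed[OF a])
 fix e :: real assume "0 < e"
 then have "\<forall>\<^sub>F n in sequentially. sqnorm (\<lambda>x. \<alpha> x - s n x) < e" by (rule order_tendstoD(2)[OF lim])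
 then obtain n where "sqnorm (\<lambda>x. \<alpha> x - s n x) < e" unfolding eventually_sequentially by blast
 then show "\<exists>\<beta>. poly_approximable \<beta> \<and> sqnorm (\<lambda>x. \<alpha> x - \<beta> x) < e" using s by blast
qed

lemma poly_approximable_continuous:
 assumes f: "continuous_on UNIV f"
 shows "poly_approximable f"
 unfolding poly_approximable_def
proof (intro conjI allI impI L2_continuous[OF f])
 fix e :: real assume e: "0 < e"
 \<comment> \<open>\<open>d^2\<close> times the total mass is then below \<open>e\<close>; the added
   1 covers the zero measure.\<close>
 define d where "d = sqrt (e / (measure M UNIV + 1))"
 have m: "measure M UNIV + 1 > 0" by (simp add: add_nonneg_pos)
 have d: "d > 0" "d^2 = e / (measure M UNIV + 1)" unfolding d_def using e m by auto
 obtain p where p: "\<And>x. x \<in> K ==> cmod (f x - poly p (cor x)) < d"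
  using complex_poly_uniform_approximation[OF K continuous_on_subset[OF f subset_UNIV] d(1)] by blast
 have "continuous_on UNIV (\<lambda>x. f x - poly p (cor x))" using f by (intro continuous_intros)
 then have "sqnorm (\<lambda>x. f x - poly p (cor x)) \<le> d^2 * measure M UNIV"
  by (intro L2_bounded(2) borel_measurable_continuous_onI less_imp_le[OF p])
 also have "... < e" using e m d(2) by (simp add: divide_less_eq)
 finally show "\<exists>p. sqnorm (\<lambda>x. f x - poly p (cor x)) < e" by blast
qed

lemma poly_approximable_add:
 assumes a: "poly_approximable \<alpha>" and b: "poly_approximable \<beta>"
 shows "poly_approximable (\<lambda>x. \<alpha> x + \<beta> x)"
 unfolding poly_approximable_def
proof (intro conjI allI impI)
 have ab: "\<alpha> \<in> L2 M" "\<beta> \<in> L2 M" using a b by (simp_all add: poly_approximable_def)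
 show "(\<lambda>x. \<alpha> x + \<beta> x) \<in> L2 M" by (rule L2_add(1)[OF ab])
 fix e :: real assume "0 < e"
 then have e: "0 < e / 4" by simp
 obtain p q where p: "sqnorm (\<lambda>x. \<alpha> x - poly p (cor x)) < e / 4" and q: "sqnorm (\<lambda>x. \<beta> x - poly q (cor x)) < e / 4"
  using a b e unfolding poly_approximable_def by blast
 have "sqnorm (\<lambda>x. (\<alpha> x - poly p (cor x)) + (\<beta> x - poly q (cor x))) < e"
  using L2_add(2)[OF L2_diff[OF ab(1) L2_poly[of p]] L2_diff[OF ab(2) L2_poly[of q]]] p q by simp
 then have "sqnorm (\<lambda>x. \<alpha> x + \<beta> x - poly (p + q) (cor x)) < e" by (simp add: algebra_simps)
 then show "\<exists>p. sqnorm (\<lambda>x. \<alpha> x + \<beta> x - poly p (cor x)) < e" by blast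
qed

lemma poly_approximable_mult:
 assumes a: "poly_approximable \<alpha>"
 shows "poly_approximable (\<lambda>x. c * \<alpha> x)"
 unfolding poly_approximable_def
proof (intro conjI allI impI)
 show "(\<lambda>x. c * \<alpha> x) \<in> L2 M" using a by (auto simp: poly_approximable_def intro: L2_mult)
 fix e :: real assume e: "0 < e"
 have c: "(cmod c)^2 + 1 > 0" by (simp add: add_nonneg_pos)
 obtain p where p: "sqnorm (\<lambda>x. \<alpha> x - poly p (cor x)) < e / ((cmod c)^2 + 1)"
  using a e c unfolding poly_approximable_def by (meson divide_pos_pos)
 have "(cmod c)^2 * sqnorm (\<lambda>x. \<alpha> x - poly p (cor x)) \<le> ((cmod c)^2 + 1) * sqnorm (\<lambda>x. \<alpha> x - poly p (cor x))"
  by (intro mult_right_mono) auto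
 also have "... < e" using p c by (simp add: pos_less_divide_eq mult.commute)
 finally have "sqnorm (\<lambda>x. c * \<alpha> x - poly (smult c p) (cor x)) < e"
  by (simp add: sqnorm_mult[symmetric] algebra_simps)
 then show "\<exists>p. sqnorm (\<lambda>x. c * \<alpha> x - poly p (cor x)) < e" by blast
qed

lemma poly_approximable_sum:
 assumes "finite I" "\<And>i. i \<in> I ==> poly_approximable (f i)"
 shows "poly_approximable (\<lambda>x. \<Sum>i\<in>I. f i x)"
 using assms
proof (induction I rule: finite_induct)
 case empty
 show ?case using poly_approximable_continuous[of "\<lambda>_. 0"] by simp
next
 case (insert i I)
 then show ?case using poly_approximable_add[of "f i" "\<lambda>x. \<Sum>i\<in>I. f i x"] by simp
qed

lemma sqnorm_tendsto_0:
 assumes s: "\<And>n::nat. s n \<in> borel_measurable borel" and w: "\<beta> \<in> L2 M"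
  and le: "\<And>n x. cmod (s n x) \<le> C * cmod (\<beta> x)" and lim: "\<And>x. (\<lambda>n. s n x) \<longlonglongrightarrow> 0"
 shows "(\<lambda>n. sqnorm (s n)) \<longlonglongrightarrow> 0"
proof -
 have "(\<lambda>n. \<integral>x. (cmod (s n x))^2 \<partial>M) \<longlonglongrightarrow> (\<integral>x. 0 \<partial>M)"
 proof (rule integral_dominated_convergence[where w="\<lambda>x. C^2 * (cmod (\<beta> x))^2"])
  show "integrable M (\<lambda>x. C^2 * (cmod (\<beta> x))^2)" using w by (simp add: L2_iff)
  show "AE x in M. (\<lambda>n. (cmod (s n x))^2) \<longlonglongrightarrow> 0"
   using tendsto_power[OF tendsto_norm_zero[OF lim], of _ 2] by simp
  show "AE x in M. norm ((cmod (s n x))^2) \<le> C^2 * (cmod (\<beta> x))^2" for n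
   using power_mono[OF le norm_ge_zero, of _ _ 2] by (simp add: power_mult_distrib)
 qed (use s in \<open>auto simp: measurable_M\<close>)
 then show ?thesis by (simp add: sqnorm_def)
qed

text \<open>Continuous functions that fall from 1 on \<open>C\<close> to 0 at distance
  \<open>1 / n\<close> converge pointwise to the indicator.\<close>

lemma poly_approximable_indicator_closed:
 assumes C: "closed C"
 shows "poly_approximable (\<lambda>x. indicator C x)"
proof (cases "C = {}")
 case True
 then show ?thesis using poly_approximable_continuous[of "\<lambda>_. 0"] by simp
next
 case False
 define s where "s n x = cor (max 0 (1 - real n * infdist x C))" for n :: nat and x
 have cs: "continuous_on UNIV (s n)" for n unfolding s_def by (intro continuous_intros)
 have m: "(\<lambda>x. indicator C x :: complex) \<in> borel_measurable borel" using C by simp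
 have b01: "cmod (indicator C x - s n x) \<le> 1" for n x
 proof (cases "x \<in> C")
  case False
  have "0 \<le> max 0 (1 - real n * infdist x C)" "max 0 (1 - real n * infdist x C) \<le> 1" using infdist_nonneg[of x C] by auto
  then show ?thesis using False unfolding s_def by (simp del: max.bounded_iff)
 qed (simp add: s_def)
 show ?thesis
 proof (rule poly_approximable_limit[of _ s])
  show "(\<lambda>x. indicator C x) \<in> L2 M" by (rule L2_bounded(1)[OF m, of 1]) (simp add: indicator_def)
  show "(\<lambda>n. sqnorm (\<lambda>x. indicator C x - s n x)) \<longlonglongrightarrow> 0"
  proof (rule sqnorm_tendsto_0[of _ "\<lambda>_. 1" 1])
   show "(\<lambda>x. indicator C x - s n x) \<in> borel_measurable borel" for n
    by (intro borel_measurable_diff m borel_measurable_continuous_onI cs)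
   show "(\<lambda>_. 1) \<in> L2 M" by (rule L2_continuous) simp
   show "cmod (indicator C x - s n x) \<le> 1 * cmod 1" for n x using b01[of x n] by simp
   show "(\<lambda>n. indicator C x - s n x) \<longlonglongrightarrow> 0" for x
   proof (cases "x \<in> C")
    case False
    then have d: "infdist x C > 0" using infdist_pos_not_in_closed[OF C \<open>C \<noteq> {}\<close>] by blast
    obtain N :: nat where N: "1 < real N * infdist x C" using ex_less_of_nat_mult[OF d] by blast
    have "\<forall>\<^sub>F n in sequentially. indicator C x - s n x = 0"
    proof (rule eventually_sequentiallyI[of N])
     fix n assume "N \<le> n"
     then have "real N * infdist x C \<le> real n * infdist x C" using d by (intro mult_right_mono) auto
     then show "indicator C x - s n x = 0" using N False by (simp add: s_def)
    qed
    then show ?thesis by (rule tendsto_eventually)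
   qed (simp add: s_def)
  qed
 qed (rule poly_approximable_continuous[OF cs])
qed

text \<open>Inner regularity of a finite Borel measure on the line reduces Borel sets to compact
  ones.\<close>

lemma poly_approximable_indicator:
 assumes B: "B \<in> sets borel"
 shows "poly_approximable (\<lambda>x. indicator B x)"
proof (rule poly_approximable_closed)
 have m: "(\<lambda>x. indicator B x :: complex) \<in> borel_measurable borel" using B by simp
 show "(\<lambda>x. indicator B x) \<in> L2 M" by (rule L2_bounded(1)[OF m, of 1]) (simp add: indicator_def)
 fix e :: real assume e: "0 < e"
 interpret finite_measure M by (rule finite_M)
 have r: "emeasure M B = (SUP K \<in> {K. K \<subseteq> B \<and> compact K}. emeasure M K)"
  by (rule inner_regular) (use B sets_M in auto)
 have "\<exists>C. C \<subseteq> B \<and> compact C \<and> emeasure M B < emeasure M C + ennreal e"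
 proof (rule ccontr)
  assume "\<not> ?thesis"
  then have le: "emeasure M C + ennreal e \<le> emeasure M B" if "C \<subseteq> B" "compact C" for C using that by (auto simp: not_less)
  have "(SUP K \<in> {K. K \<subseteq> B \<and> compact K}. emeasure M K + ennreal e) \<le> emeasure M B"
   by (rule SUP_least) (use le in auto)
  moreover have "(SUP K \<in> {K. K \<subseteq> B \<and> compact K}. emeasure M K + ennreal e) = emeasure M B + ennreal e"
   unfolding r by (rule ennreal_SUP_add_left) auto
  ultimately show False using e by (metis add.right_neutral emeasure_finite ennreal_add_left_cancel_le ennreal_eq_0_iff infinity_ennreal_def le_zero_eq not_less)
 qed
 then obtain C where C: "C \<subseteq> B" "compact C" "emeasure M B < emeasure M C + ennreal e" by blast
 have Cm: "C \<in> sets M" "B \<in> sets M" using C(2) B by (auto simp: sets_M intro: borel_closed compact_imp_closed)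
 have "measure M B < measure M C + e"
  using C(3) e by (simp add: emeasure_eq_measure ennreal_plus[symmetric] ennreal_less_iff del: ennreal_plus)
 then have "measure M (B - C) < e" using finite_measure_Diff[OF Cm(2,1) C(1)] by simp
 moreover have "sqnorm (\<lambda>x. indicator B x - indicator C x) = (\<integral>x. indicator (B - C) x \<partial>M)"
  unfolding sqnorm_def using C(1) by (intro Bochner_Integration.integral_cong) (auto simp: indicator_def)
 moreover have "... = measure M (B - C)" using Cm by (simp add: space_M)
 ultimately have "sqnorm (\<lambda>x. indicator B x - indicator C x) < e" by simp
 then show "\<exists>\<beta>. poly_approximable \<beta> \<and> sqnorm (\<lambda>x. indicator B x - \<beta> x) < e"
  using poly_approximable_indicator_closed[OF compact_imp_closed[OF C(2)]] by blast
qed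

text \<open>Simple functions are finite combinations of indicators and converge pointwise to
  \<open>\<alpha>\<close>, with error bounded by \<open>3 * cmod (\<alpha> x)\<close>, which is
  square integrable.\<close>

lemma poly_dense_L2:
 assumes a: "\<alpha> \<in> L2 M"
 shows "poly_approximable \<alpha>"
proof -
 have m: "\<alpha> \<in> borel_measurable M" using a by (simp add: L2_iff measurable_M)
 obtain F where F: "\<And>i::nat. simple_function M (F i)" "\<And>x. (\<lambda>i. F i x) \<longlonglongrightarrow> \<alpha> x"
  "\<And>i x. cmod (F i x) \<le> 2 * cmod (\<alpha> x)"
  using borel_measurable_implies_sequence_metric[OF m, of 0] by (auto simp: space_M)
 have Fm: "F i \<in> borel_measurable borel" for i using borel_measurable_simple_function[OF F(1)] by (simp add: measurable_M)
 show ?thesis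
 proof (rule poly_approximable_limit[OF a])
  fix i
  have fin: "finite (F i ` space M)" by (rule simple_functionD(1)[OF F(1)])
  have "poly_approximable (\<lambda>x. y * indicator (F i -` {y} \<inter> space M) x)" for y
   using simple_functionD(2)[OF F(1), of i "{y}"] by (intro poly_approximable_mult poly_approximable_indicator) (simp add: sets_M)
  then have "poly_approximable (\<lambda>x. \<Sum>y\<in>F i ` space M. y * indicator (F i -` {y} \<inter> space M) x)"
   by (intro poly_approximable_sum fin)
  moreover have "F i = (\<lambda>x. \<Sum>y\<in>F i ` space M. y * indicator (F i -` {y} \<inter> space M) x)"
  proof
   fix x
   have "F i x = (\<Sum>y\<in>F i ` space M. indicator (F i -` {y} \<inter> space M) x *\<^sub>R y)"
    by (rule simple_function_indicator_representation_banach[OF F(1)]) (simp add: space_M)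
   also have "... = (\<Sum>y\<in>F i ` space M. y * indicator (F i -` {y} \<inter> space M) x)"
    by (intro sum.cong) (auto simp: indicator_def)
   finally show "F i x = (\<Sum>y\<in>F i ` space M. y * indicator (F i -` {y} \<inter> space M) x)" .
  qed
  ultimately show "poly_approximable (F i)" by simp
 next
  show "(\<lambda>i. sqnorm (\<lambda>x. \<alpha> x - F i x)) \<longlonglongrightarrow> 0"
  proof (rule sqnorm_tendsto_0[OF _ a, of _ 3])
   show "(\<lambda>x. \<alpha> x - F i x) \<in> borel_measurable borel" for i using L2_measurable[OF a] Fm by simp
   show "cmod (\<alpha> x - F i x) \<le> 3 * cmod (\<alpha> x)" for i x using norm_triangle_ineq4[of "\<alpha> x" "F i x"] F(3)[of i x] by simp
   show "(\<lambda>i. \<alpha> x - F i x) \<longlonglongrightarrow> 0" for x using tendsto_diff[OF tendsto_const F(2)[of x], of "\<alpha> x"] by simp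
  qed
 qed
qed

lemma L2_poly_sequence:
 assumes a: "\<alpha> \<in> L2 M"
 obtains p :: "nat => complex poly" where "(\<lambda>n. sqnorm (\<lambda>x. poly (p n) (cor x) - \<alpha> x)) \<longlonglongrightarrow> 0"
proof -
 have "\<forall>n::nat. \<exists>p. sqnorm (\<lambda>x. \<alpha> x - poly p (cor x)) < inverse (Suc n)"
  using poly_dense_L2[OF a] unfolding poly_approximable_def by (auto simp del: of_nat_Suc)
 then obtain p where p: "\<And>n::nat. sqnorm (\<lambda>x. \<alpha> x - poly (p n) (cor x)) < inverse (Suc n)" by metis
 have "(\<lambda>n. sqnorm (\<lambda>x. \<alpha> x - poly (p n) (cor x))) \<longlonglongrightarrow> 0"
  by (rule Lim_null_comparison[OF always_eventually LIMSEQ_inverse_real_of_nat]) (use p in \<open>auto intro: less_imp_le\<close>)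
 then show ?thesis by (intro that[of p]) (simp add: sqnorm_minus_commute)
qed

text \<open>For a finite measure the sequence is also Cauchy in L1, so a subsequence converges
  almost everywhere; Fatou's lemma shows that its limit is the limit in norm.\<close>

lemma L2_complete:
 assumes s: "\<And>n::nat. s n \<in> L2 M"
  and C: "\<And>e. 0 < e ==> \<exists>N. \<forall>i\<ge>N. \<forall>j\<ge>N. sqnorm (\<lambda>x. s i x - s j x) < e"
 obtains \<alpha> r where "\<alpha> \<in> L2 M" "strict_mono r" "(\<lambda>n. sqnorm (\<lambda>x. s (r n) x - \<alpha> x)) \<longlonglongrightarrow> 0"
proof -
 define c where "c = measure M UNIV + 1"
 have c: "c > 0" unfolding c_def by (simp add: add_nonneg_pos)
 have sm: "s n \<in> borel_measurable borel" for n by (rule L2_measurable[OF s])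
 obtain r where r: "strict_mono r" "AE x in M. Cauchy (\<lambda>i. s (r i) x)"
 proof (rule cauchy_L1_AE_cauchy_subseq[of M s])
  show "integrable M (s n)" for n by (rule L2_integrable[OF s])
  fix e :: real assume e: "0 < e"
  then have "0 < e^2 / c" using c by simp
  then obtain N where N: "\<forall>i\<ge>N. \<forall>j\<ge>N. sqnorm (\<lambda>x. s i x - s j x) < e^2 / c" using C by blast
  have "(LINT x|M. norm (s i x - s j x)) < e" if "i \<ge> N" "j \<ge> N" for i j
  proof -
   have "(LINT x|M. norm (s i x - s j x))^2 \<le> c * sqnorm (\<lambda>x. s i x - s j x)"
    unfolding c_def by (rule L1_le_L2[OF L2_diff[OF s s]])
   also have "... < c * (e^2 / c)" using N that c by (intro mult_strict_left_mono) auto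
   also have "... = e^2" using c by simp
   finally show ?thesis using e by (simp add: power_less_imp_less_base)
  qed
  then show "\<exists>N. \<forall>i\<ge>N. \<forall>j\<ge>N. (LINT x|M. norm (s i x - s j x)) < e" by blast
 qed
 define \<alpha> where "\<alpha> x = lim (\<lambda>n. s (r n) x)" for x
 have am: "\<alpha> \<in> borel_measurable borel" unfolding \<alpha>_def using sm by (rule borel_measurable_lim_metric)
 have lim: "AE x in M. (\<lambda>n. s (r n) x) \<longlonglongrightarrow> \<alpha> x"
  using r(2) by eventually_elim (simp add: \<alpha>_def Cauchy_convergent_iff convergent_LIMSEQ_iff)
 have key: "integrable M (\<lambda>x. (cmod (s (r i) x - \<alpha> x))^2) \<and> sqnorm (\<lambda>x. s (r i) x - \<alpha> x) \<le> e"
  if e: "0 < e" and N: "\<And>j. j \<ge> N ==> sqnorm (\<lambda>x. s (r i) x - s (r j) x) < e" for e :: real and N i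
 proof -
  have "(\<integral>\<^sup>+x. ennreal ((cmod (s (r i) x - \<alpha> x))^2) \<partial>M) \<le> (\<integral>\<^sup>+x. liminf (\<lambda>j. ennreal ((cmod (s (r i) x - s (r j) x))^2)) \<partial>M)"
  proof (rule nn_integral_mono_AE)
   show "AE x in M. ennreal ((cmod (s (r i) x - \<alpha> x))^2) \<le> liminf (\<lambda>j. ennreal ((cmod (s (r i) x - s (r j) x))^2))"
    using lim
   proof eventually_elim
    case (elim x)
    have "(\<lambda>j. ennreal ((cmod (s (r i) x - s (r j) x))^2)) \<longlonglongrightarrow> ennreal ((cmod (s (r i) x - \<alpha> x))^2)"
     by (intro tendsto_ennrealI tendsto_intros elim)
    then have "liminf (\<lambda>j. ennreal ((cmod (s (r i) x - s (r j) x))^2)) = ennreal ((cmod (s (r i) x - \<alpha> x))^2)"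
     by (rule lim_imp_Liminf[OF sequentially_bot])
    then show ?case by (simp only: order_refl)
   qed
  qed
  also have "... \<le> liminf (\<lambda>j. \<integral>\<^sup>+x. ennreal ((cmod (s (r i) x - s (r j) x))^2) \<partial>M)"
   using sm by (intro nn_integral_liminf) (simp add: measurable_M)
  also have "... \<le> ennreal e"
  proof (rule order_trans[OF Liminf_le_Limsup Limsup_bounded])
   show "\<forall>\<^sub>F j in sequentially. (\<integral>\<^sup>+x. ennreal ((cmod (s (r i) x - s (r j) x))^2) \<partial>M) \<le> ennreal e"
   proof (rule eventually_sequentiallyI[of N])
    fix j assume "N \<le> j"
    then have "sqnorm (\<lambda>x. s (r i) x - s (r j) x) \<le> e" using N by (simp add: less_imp_le)
    moreover have "integrable M (\<lambda>x. (cmod (s (r i) x - s (r j) x))^2)" using L2_diff[OF s s] by (simp add: L2_iff)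
    ultimately show "(\<integral>\<^sup>+x. ennreal ((cmod (s (r i) x - s (r j) x))^2) \<partial>M) \<le> ennreal e"
     by (simp add: nn_integral_eq_integral sqnorm_def ennreal_leI)
   qed
  qed simp
  finally have nn: "(\<integral>\<^sup>+x. ennreal ((cmod (s (r i) x - \<alpha> x))^2) \<partial>M) \<le> ennreal e" .
  have int: "integrable M (\<lambda>x. (cmod (s (r i) x - \<alpha> x))^2)"
  proof (rule integrableI_nonneg)
   show "(\<integral>\<^sup>+x. ennreal ((cmod (s (r i) x - \<alpha> x))^2) \<partial>M) < \<infinity>"
    using nn by (rule order.strict_trans1) simp
  qed (use sm am in \<open>auto simp: measurable_M\<close>)
  then have "sqnorm (\<lambda>x. s (r i) x - \<alpha> x) \<le> e"
   using nn e by (simp add: nn_integral_eq_integral sqnorm_def ennreal_le_iff)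
  with int show ?thesis by blast
 qed
 have ev: "\<exists>N. \<forall>i\<ge>N. integrable M (\<lambda>x. (cmod (s (r i) x - \<alpha> x))^2) \<and> sqnorm (\<lambda>x. s (r i) x - \<alpha> x) \<le> e" if e: "0 < e" for e
 proof -
  obtain N where N: "\<forall>i\<ge>N. \<forall>j\<ge>N. sqnorm (\<lambda>x. s i x - s j x) < e" using C[OF e] by blast
  have "sqnorm (\<lambda>x. s (r i) x - s (r j) x) < e" if "i \<ge> N" "j \<ge> N" for i j
   using N that order_trans[OF _ seq_suble[OF r(1)]] by blast
  then show ?thesis using key[OF e, of N] by blast
 qed
 obtain N where "integrable M (\<lambda>x. (cmod (s (r N) x - \<alpha> x))^2)" using ev[of 1] by auto
 then have d: "(\<lambda>x. s (r N) x - \<alpha> x) \<in> L2 M" using sm am by (simp add: L2_iff)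
 have "\<alpha> \<in> L2 M" using L2_diff[OF s[of "r N"] d] by simp
 moreover have "(\<lambda>n. sqnorm (\<lambda>x. s (r n) x - \<alpha> x)) \<longlonglongrightarrow> 0"
 proof (rule LIMSEQ_I)
  fix e :: real assume "0 < e"
  then obtain N where "\<forall>i\<ge>N. sqnorm (\<lambda>x. s (r i) x - \<alpha> x) \<le> e / 2" using ev[of "e/2"] by auto
  then show "\<exists>N. \<forall>n\<ge>N. norm (sqnorm (\<lambda>x. s (r n) x - \<alpha> x) - 0) < e" using \<open>0 < e\<close> by (intro exI[of _ N]) fastforce
 qed
 ultimately show ?thesis by (rule that[OF _ r(1)])
qed

lemma L2_tendsto_iff: "L2_tendsto M s \<alpha> \<longleftrightarrow> (\<forall>n. s n \<in> L2 M) \<and> \<alpha> \<in> L2 M \<and> (\<lambda>n. sqnorm (\<lambda>x. s n x - \<alpha> x)) \<longlonglongrightarrow> 0"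
proof -
 have "((\<lambda>n. sqrt (sqnorm (\<lambda>x. s n x - \<alpha> x))) \<longlonglongrightarrow> 0) \<longleftrightarrow> (\<lambda>n. sqnorm (\<lambda>x. s n x - \<alpha> x)) \<longlonglongrightarrow> 0"
  using tendsto_real_sqrt[of "\<lambda>n. sqnorm (\<lambda>x. s n x - \<alpha> x)" 0 sequentially] tendsto_power[of "\<lambda>n. sqrt (sqnorm (\<lambda>x. s n x - \<alpha> x))" 0 sequentially 2] by auto
 then show ?thesis unfolding L2_tendsto_def sqnorm_def by blast
qed

end

section \<open>The Jacobi operator\<close>

lemma ell2_restrict: "f \<in> ell2 ==> restrict_to U f \<in> ell2"
 by (rule ell2_bound(1)[where C="(ell2_norm f)^2"], rule order_trans[OF sum_mono ell2_finite_sum_le]) (auto simp: restrict_to_def)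

lemma ell2_inner_restrict: "ell2_inner (restrict_to U f) g = ell2_inner f (restrict_to U g)"
 by (auto simp: ell2_inner_def restrict_to_def intro!: infsum_cong)

lemma delta_ell2: "delta Z \<in> ell2"
 by (rule ell2_finite_support) (simp add: delta_def)

lemma ell2_inner_delta: "ell2_inner (delta Z) g = cnj (g Z)"
proof -
 have "ell2_inner (delta Z) g = (\<Sum>\<^sub>\<infinity>y\<in>{Z}. delta Z y * cnj (g y))"
  unfolding ell2_inner_def by (rule infsum_cong_neutral) (auto simp: delta_def)
 then show ?thesis by (simp add: delta_def)
qed

text \<open>Every vertex but the root is a child of exactly one vertex, as its first or its second;
  this converts the parent term of the operator into sums over children.\<close>

lemma infsum_not_Root:
 fixes h :: "vertex => complex"
 assumes "\<And>i. i \<in> {1,2} ==> (\<lambda>Z. h (ch i Z)) summable_on UNIV"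
 shows "(\<lambda>Y. if Y = Root then 0 else h Y) summable_on UNIV"
  "(\<Sum>\<^sub>\<infinity>Y. if Y = Root then 0 else h Y) = (\<Sum>\<^sub>\<infinity>Z. h (ch 1 Z)) + (\<Sum>\<^sub>\<infinity>Z. h (ch 2 Z))"
proof -
 let ?R = "\<lambda>i. range (ch i)"
 have inj: "inj (ch i)" if "i \<in> {1,2}" for i using that by (auto simp: inj_def ch_inject)
 have s: "h summable_on ?R i" "infsum h (?R i) = (\<Sum>\<^sub>\<infinity>Z. h (ch i Z))" if "i \<in> {1,2}" for i
  using assms[OF that] summable_on_reindex[OF inj[OF that], of h] infsum_reindex[OF inj[OF that], of h] by (simp_all add: o_def)
 have disj: "?R 1 \<inter> ?R 2 = {}" by (auto simp: ch_def)
 have un: "?R 1 \<union> ?R 2 = - {Root}" using not_Root_ch ch_neq_Root[symmetric] by blast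
 have "h summable_on - {Root}" "infsum h (- {Root}) = infsum h (?R 1) + infsum h (?R 2)"
  unfolding un[symmetric] using s disj by (intro summable_on_Un_disjoint infsum_Un_disjoint; simp)+
 moreover have "(\<lambda>Y. if Y = Root then 0 else h Y) summable_on UNIV \<longleftrightarrow> h summable_on - {Root}"
  by (rule summable_on_cong_neutral) auto
 moreover have "(\<Sum>\<^sub>\<infinity>Y. if Y = Root then 0 else h Y) = infsum h (- {Root})"
  by (rule infsum_cong_neutral) auto
 ultimately show "(\<lambda>Y. if Y = Root then 0 else h Y) summable_on UNIV"
  "(\<Sum>\<^sub>\<infinity>Y. if Y = Root then 0 else h Y) = (\<Sum>\<^sub>\<infinity>Z. h (ch 1 Z)) + (\<Sum>\<^sub>\<infinity>Z. h (ch 2 Z))"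
  using s by simp_all
qed

lemma Jacobi_add: "Jacobi a b \<kappa> (\<lambda>y. f y + g y) = (\<lambda>y. Jacobi a b \<kappa> f y + Jacobi a b \<kappa> g y)"
 by (rule ext) (simp add: Jacobi_def sum.distrib algebra_simps)

lemma Jacobi_mult: "Jacobi a b \<kappa> (\<lambda>y. c * f y) = (\<lambda>y. c * Jacobi a b \<kappa> f y)"
 by (rule ext) (simp add: Jacobi_def sum_distrib_left algebra_simps)

lemma ell2_child_sum_le:
 assumes f: "f \<in> ell2" and i: "i \<in> {1,2}" and F: "finite F"
 shows "(\<Sum>Y\<in>F. (cmod (f (ch i Y)))^2) \<le> (ell2_norm f)^2"
proof -
 have "inj_on (ch i) F" using i by (auto simp: inj_on_def ch_inject)
 then have "(\<Sum>Y\<in>F. (cmod (f (ch i Y)))^2) = (\<Sum>Y\<in>ch i ` F. (cmod (f Y))^2)" by (simp add: sum.reindex)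
 also have "... \<le> (ell2_norm f)^2" by (rule ell2_finite_sum_le[OF f]) (use F in simp)
 finally show ?thesis .
qed

lemma ell2_child: "f \<in> ell2 ==> i \<in> {1,2} ==> (\<lambda>Y. f (ch i Y)) \<in> ell2"
 by (rule ell2_bound(1)[OF ell2_child_sum_le])

text \<open>Each vertex is the parent of two others, whence the factor 2.\<close>

lemma ell2_parent_sum_le:
 assumes f: "f \<in> ell2" and F: "finite F"
 shows "(\<Sum>Y\<in>F. (cmod (if Y = Root then 0 else f (parent Y)))^2) \<le> 2 * (ell2_norm f)^2"
proof -
 let ?g = "\<lambda>Y. (cmod (if Y = Root then 0 else f (parent Y)))^2"
 have p: "sum ?g (F \<inter> range (ch i)) \<le> (ell2_norm f)^2" if i: "i \<in> {1,2}" for i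
 proof -
  have "inj_on parent (F \<inter> range (ch i))" by (auto simp: inj_on_def)
  then have "(\<Sum>Z\<in>parent ` (F \<inter> range (ch i)). (cmod (f Z))^2) = (\<Sum>Y\<in>F \<inter> range (ch i). (cmod (f (parent Y)))^2)"
   by (simp add: sum.reindex)
  also have "... = sum ?g (F \<inter> range (ch i))" by (rule sum.cong) auto
  finally show ?thesis using ell2_finite_sum_le[OF f, of "parent ` (F \<inter> range (ch i))"] F by simp
 qed
 have "sum ?g F = sum ?g (F \<inter> range (ch 1) \<union> F \<inter> range (ch 2))"
 proof (intro sum.mono_neutral_right ballI)
  fix Y assume Y: "Y \<in> F - (F \<inter> range (ch 1) \<union> F \<inter> range (ch 2))"
  then have "Y = Root" using not_Root_ch by blast
  then show "?g Y = 0" by simp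
 qed (use F in auto)
 also have "... = sum ?g (F \<inter> range (ch 1)) + sum ?g (F \<inter> range (ch 2))"
  using F by (intro sum.union_disjoint) (auto simp: ch_def)
 also have "... \<le> 2 * (ell2_norm f)^2" using p[of 1] p[of 2] by simp
 finally show ?thesis .
qed

lemma norm_sum4_power2_le:
 fixes t u v w :: complex
 shows "(cmod (t + u + (v + w)))^2 \<le> 4 * ((cmod t)^2 + (cmod u)^2 + (cmod v)^2 + (cmod w)^2)"
 using norm_add_power2_le[of "t + u" "v + w"] norm_add_power2_le[of t u] norm_add_power2_le[of v w] by simp

locale angelesco_jacobi = angelesco_tree +
 fixes \<kappa> :: "real \<times> real"
begin

abbreviation "J \<equiv> Jacobi a b \<kappa>"

lemma potentials_bounded: "\<exists>C. 0 < C \<and> (\<forall>Y. \<bar>V_pot b \<kappa> Y\<bar> \<le> C \<and> W_pot a Y \<le> C^2)"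
proof -
 obtain C where C: "\<And>n i. i \<in> {1,2} ==> \<bar>b n i\<bar> \<le> C \<and> (entry n i > 0 \<longrightarrow> \<bar>a n i\<bar> \<le> C)"
  using recurrence unfolding recurrence_coefficients_def by blast
 define D where "D = 1 + \<bar>C\<bar> + \<bar>V_pot b \<kappa> Root\<bar>"
 have D: "1 \<le> D" "\<bar>C\<bar> \<le> D" "\<bar>V_pot b \<kappa> Root\<bar> \<le> D" unfolding D_def by auto
 have DD: "D \<le> D^2" "1 \<le> D^2" using D(1) self_le_power[of D 2] one_le_power[of D 2] by auto
 have "\<bar>V_pot b \<kappa> Y\<bar> \<le> D \<and> W_pot a Y \<le> D^2" for Y
 proof (cases "Y = Root")
  case False
  then obtain i Z where Z: "i \<in> {1,2}" "Y = ch i Z" using not_Root_ch by blast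
  have "entry (Pi_idx Z) i > 0" using Pi_idx_pos by (simp add: entry_def)
  then show ?thesis using C[OF Z(1), of "Pi_idx Z"] D DD Z by (auto simp: V_pot_ch W_pot_ch)
 qed (use D DD in \<open>auto simp: W_pot_def\<close>)
 then show ?thesis using D by (intro exI[of _ D]) auto
qed

text \<open>The square of a sum of four terms is at most 4 times the sum of the squares. These
  contribute \<open>1 + 2 + 1 + 1\<close> squared norms of \<open>f\<close>, the 2 coming from the
  parent term, and \<open>4 * 5 \<le> 5^2\<close>.\<close>

lemma Jacobi_bound:
 assumes C: "0 < C" "\<And>Y. \<bar>V_pot b \<kappa> Y\<bar> \<le> C" "\<And>Y. W_pot a Y \<le> C^2" and f: "f \<in> ell2"
 shows "J f \<in> ell2" "ell2_norm (J f) \<le> 5 * C * ell2_norm f"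
proof -
 let ?p = "\<lambda>Y. if Y = Root then 0 else f (parent Y)"
 have W: "sqrt (W_pot a Y) \<le> C" for Y using C by (simp add: real_le_lsqrt)
 have pt: "(cmod (J f Y))^2 \<le> 4 * C^2 * ((cmod (f Y))^2 + (cmod (?p Y))^2 + (cmod (f (ch 1 Y)))^2 + (cmod (f (ch 2 Y)))^2)" for Y
 proof -
  have J: "J f Y = cor (V_pot b \<kappa> Y) * f Y + cor (sqrt (W_pot a Y)) * ?p Y
   + (cor (sqrt (W_pot a (ch 1 Y))) * f (ch 1 Y) + cor (sqrt (W_pot a (ch 2 Y))) * f (ch 2 Y))"
   unfolding Jacobi_def by simp
  have sc: "(cmod (cor r * u))^2 \<le> C^2 * (cmod u)^2" if "\<bar>r\<bar> \<le> C" for r u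
   using power_mono[OF mult_right_mono[OF that norm_ge_zero[of u]], of 2] by (simp add: norm_mult power_mult_distrib)
  have W': "\<bar>sqrt (W_pot a Y)\<bar> \<le> C" for Y using W W_pot_pos[of Y] by simp
  have "(cmod (J f Y))^2 \<le> 4 * (C^2 * (cmod (f Y))^2 + C^2 * (cmod (?p Y))^2 + C^2 * (cmod (f (ch 1 Y)))^2 + C^2 * (cmod (f (ch 2 Y)))^2)"
   unfolding J by (rule order_trans[OF norm_sum4_power2_le]) (intro mult_left_mono add_mono sc C(2) W', simp)
  then show ?thesis by (simp only: distrib_left mult.assoc)
 qed
 have s: "(\<Sum>Y\<in>F. (cmod (J f Y))^2) \<le> (5 * C * ell2_norm f)^2" if F: "finite F" for F
 proof -
  have "(\<Sum>Y\<in>F. (cmod (J f Y))^2) \<le> (\<Sum>Y\<in>F. 4 * C^2 * ((cmod (f Y))^2 + (cmod (?p Y))^2 + (cmod (f (ch 1 Y)))^2 + (cmod (f (ch 2 Y)))^2))"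
   by (rule sum_mono) (rule pt)
  also have "... = 4 * C^2 * ((\<Sum>Y\<in>F. (cmod (f Y))^2) + (\<Sum>Y\<in>F. (cmod (?p Y))^2) + (\<Sum>Y\<in>F. (cmod (f (ch 1 Y)))^2) + (\<Sum>Y\<in>F. (cmod (f (ch 2 Y)))^2))"
   by (simp only: sum_distrib_left[symmetric] sum.distrib)
  also have "... \<le> 4 * C^2 * (5 * (ell2_norm f)^2)"
   using ell2_finite_sum_le[OF f F] ell2_parent_sum_le[OF f F] ell2_child_sum_le[OF f _ F, of 1] ell2_child_sum_le[OF f _ F, of 2]
   by (intro mult_left_mono) auto
  also have "... \<le> (5 * C * ell2_norm f)^2" by (simp add: power_mult_distrib mult_right_mono)
  finally show ?thesis .
 qed
 show "J f \<in> ell2" by (rule ell2_bound(1)[OF s])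
 have "(ell2_norm (J f))^2 \<le> (5 * C * ell2_norm f)^2" by (rule ell2_bound(2)[OF s])
 then show "ell2_norm (J f) \<le> 5 * C * ell2_norm f" using C by (rule_tac power2_le_imp_le) auto
qed

text \<open>Regrouped by edges, the expression goes over into its conjugate when \<open>f\<close>
  and \<open>g\<close> are exchanged, as all coefficients are real.\<close>

lemma Jacobi_inner:
 assumes f: "f \<in> ell2" and g: "g \<in> ell2"
 shows "ell2_inner (J f) g = (\<Sum>\<^sub>\<infinity>Y. cor (V_pot b \<kappa> Y) * f Y * cnj (g Y))
  + (\<Sum>i\<in>{1,2}. (\<Sum>\<^sub>\<infinity>Y. cor (sqrt (W_pot a (ch i Y))) * f Y * cnj (g (ch i Y)))
    + (\<Sum>\<^sub>\<infinity>Y. cor (sqrt (W_pot a (ch i Y))) * f (ch i Y) * cnj (g Y)))"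
proof -
 obtain C where C: "0 < C" "\<And>Y. \<bar>V_pot b \<kappa> Y\<bar> \<le> C" "\<And>Y. W_pot a Y \<le> C^2" using potentials_bounded by blast
 have bounded: "(\<lambda>Y. cor (r Y) * h Y) \<in> ell2" if h: "h \<in> ell2" and r: "\<And>Y. \<bar>r Y\<bar> \<le> C" for r :: "vertex => real" and h
 proof (rule ell2_bound(1)[where C="C^2 * (ell2_norm h)^2"])
  fix F :: "vertex set" assume F: "finite F"
  have "(\<Sum>y\<in>F. (cmod (cor (r y) * h y))^2) \<le> (\<Sum>y\<in>F. C^2 * (cmod (h y))^2)"
  proof (rule sum_mono)
   show "(cmod (cor (r y) * h y))^2 \<le> C^2 * (cmod (h y))^2" for y
    using power_mono[OF mult_right_mono[OF r[of y] norm_ge_zero[of "h y"]], of 2] by (simp add: norm_mult power_mult_distrib)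
  qed
  also have "... \<le> C^2 * (ell2_norm h)^2" using ell2_finite_sum_le[OF h F] by (simp add: sum_distrib_left[symmetric] mult_left_mono)
  finally show "(\<Sum>y\<in>F. (cmod (cor (r y) * h y))^2) \<le> C^2 * (ell2_norm h)^2" .
 qed
 have W: "\<bar>sqrt (W_pot a Y)\<bar> \<le> C" for Y using C W_pot_pos[of Y] by (simp add: real_le_lsqrt)
 define v where "v Y = cor (V_pot b \<kappa> Y) * f Y * cnj (g Y)" for Y
 define h where "h Y = cor (sqrt (W_pot a Y)) * f (parent Y) * cnj (g Y)" for Y
 define d where "d i Y = cor (sqrt (W_pot a (ch i Y))) * f (ch i Y) * cnj (g Y)" for i Y
 have sv: "v summable_on UNIV" unfolding v_def by (rule ell2_inner_summable[OF bounded[OF f C(2)] g])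
 have sh: "(\<lambda>Z. h (ch i Z)) summable_on UNIV" if "i \<in> {1,2}" for i
  unfolding h_def parent_ch by (rule ell2_inner_summable[OF bounded[OF f W] ell2_child[OF g that]])
 have sd: "d i summable_on UNIV" if "i \<in> {1,2}" for i
  unfolding d_def by (rule ell2_inner_summable[OF bounded[OF ell2_child[OF f that] W] g])
 have H: "(\<lambda>Y. if Y = Root then 0 else h Y) summable_on UNIV"
  "(\<Sum>\<^sub>\<infinity>Y. if Y = Root then 0 else h Y) = (\<Sum>\<^sub>\<infinity>Z. h (ch 1 Z)) + (\<Sum>\<^sub>\<infinity>Z. h (ch 2 Z))"
  by (rule infsum_not_Root, rule sh, assumption)+
 have "ell2_inner (J f) g = (\<Sum>\<^sub>\<infinity>Y. v Y + ((if Y = Root then 0 else h Y) + (d 1 Y + d 2 Y)))"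
  unfolding ell2_inner_def by (rule infsum_cong) (simp add: Jacobi_def v_def h_def d_def algebra_simps)
 also have "... = infsum v UNIV + ((\<Sum>\<^sub>\<infinity>Y. if Y = Root then 0 else h Y) + (infsum (d 1) UNIV + infsum (d 2) UNIV))"
  using sd[OF insertI1] sd[OF insertI2[OF insertI1]] by (simp only: infsum_add summable_on_add sv H(1))
 finally show ?thesis unfolding H(2) unfolding v_def[abs_def] h_def d_def[abs_def] parent_ch sum_12 by (simp only: add_ac)
qed

lemma Jacobi_symmetric:
 assumes f: "f \<in> ell2" and g: "g \<in> ell2"
 shows "ell2_inner (J f) g = ell2_inner f (J g)"
proof -
 have "ell2_inner f (J g) = cnj (ell2_inner (J g) f)" by (rule ell2_inner_commute)
 also have "... = ell2_inner (J f) g"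
  unfolding Jacobi_inner[OF f g] Jacobi_inner[OF g f] by (simp add: infsum_cnj[symmetric] mult_ac add_ac)
 finally show ?thesis by simp
qed

text \<open>Fixes one bound as a constant, so that the locale can be instantiated.\<close>

definition J_bound :: real where
 "J_bound = (SOME B. bounded_symmetric J B)"

sublocale J: bounded_symmetric J J_bound
 unfolding J_bound_def
proof (rule someI_ex)
 obtain C where C: "0 < C" "\<And>Y. \<bar>V_pot b \<kappa> Y\<bar> \<le> C" "\<And>Y. W_pot a Y \<le> C^2" using potentials_bounded by blast
 have "bounded_symmetric J (5 * C)"
  by unfold_locales (use C in \<open>simp_all add: Jacobi_add Jacobi_mult Jacobi_bound Jacobi_symmetric\<close>)
 then show "\<exists>B. bounded_symmetric J B" ..
qed

end

section \<open>The eigenfunction transform\<close>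

lemma abs_power2_diff_le:
 fixes u v :: "'a::real_normed_vector"
 shows "\<bar>(norm u)^2 - (norm v)^2\<bar> \<le> 2 * (norm (u - v) * norm v) + (norm (u - v))^2"
proof -
 define d where "d = norm (u - v)"
 have u: "norm u \<le> norm v + d" and v: "norm v \<le> norm u + d"
  unfolding d_def using norm_triangle_sub[of u v] norm_triangle_sub[of v u] by (simp_all add: norm_minus_commute add.commute)
 have d: "0 \<le> d" by (simp add: d_def)
 have "\<bar>(norm u)^2 - (norm v)^2\<bar> = \<bar>norm u - norm v\<bar> * (norm u + norm v)"
  by (simp add: power2_eq_square square_diff_square_factored abs_mult mult.commute)
 also have "... \<le> d * (2 * norm v + d)" using u v d by (intro mult_mono) auto
 finally show ?thesis by (simp add: d_def power2_eq_square algebra_simps)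
qed

context compact_measure
begin

lemma L2_bounded_mult:
 assumes b: "\<beta> \<in> L2 M" and h: "h \<in> borel_measurable borel" "\<And>x. x \<in> K ==> cmod (h x) \<le> C"
 shows "(\<lambda>x. h x * \<beta> x) \<in> L2 M" "sqnorm (\<lambda>x. h x * \<beta> x) \<le> C^2 * sqnorm \<beta>"
proof -
 have m: "(\<lambda>x. h x * \<beta> x) \<in> borel_measurable borel" by (intro borel_measurable_times h L2_measurable b)
 have le: "cmod (h x * \<beta> x) \<le> C * cmod (\<beta> x)" if "x \<in> K" for x
  using mult_right_mono[OF h(2)[OF that] norm_ge_zero[of "\<beta> x"]] by (simp add: norm_mult)
 show "(\<lambda>x. h x * \<beta> x) \<in> L2 M" "sqnorm (\<lambda>x. h x * \<beta> x) \<le> C^2 * sqnorm \<beta>"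
  by (rule L2_dominated[OF m b le], assumption)+
qed

lemma L2_product_integrable:
 assumes a: "\<alpha> \<in> L2 M" and b: "\<beta> \<in> L2 M"
 shows "integrable M (\<lambda>x. \<alpha> x * \<beta> x)"
proof (rule Bochner_Integration.integrable_bound)
 show "integrable M (\<lambda>x. (cmod (\<alpha> x))^2 + (cmod (\<beta> x))^2)" using a b by (simp add: L2_iff)
 show "(\<lambda>x. \<alpha> x * \<beta> x) \<in> borel_measurable M"
  unfolding measurable_M by (intro borel_measurable_times L2_measurable a b)
 have "cmod u * cmod v \<le> (cmod u)^2 + (cmod v)^2" for u v
  using sum_squares_bound[of "cmod u" "cmod v"] mult_nonneg_nonneg[OF norm_ge_zero[of u] norm_ge_zero[of v]] by linarith
 then show "AE x in M. norm (\<alpha> x * \<beta> x) \<le> norm ((cmod (\<alpha> x))^2 + (cmod (\<beta> x))^2)"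
  by (intro AE_I2) (simp add: norm_mult)
qed

lemma L2_cauchy_schwarz:
 assumes a: "\<alpha> \<in> L2 M" and b: "\<beta> \<in> L2 M"
 shows "(\<integral>x. cmod (\<alpha> x) * cmod (\<beta> x) \<partial>M)^2 \<le> sqnorm \<alpha> * sqnorm \<beta>"
proof -
 define t where "t = (\<integral>x. cmod (\<alpha> x) * cmod (\<beta> x) \<partial>M)"
 have it: "integrable M (\<lambda>x. cmod (\<alpha> x) * cmod (\<beta> x))"
  using integrable_norm[OF L2_product_integrable[OF a b]] by (simp add: norm_mult)
 have ia: "integrable M (\<lambda>x. (cmod (\<alpha> x))^2)" "integrable M (\<lambda>x. (cmod (\<beta> x))^2)" using a b by (simp_all add: L2_iff)
 have q: "0 \<le> r^2 * sqnorm \<alpha> - 2 * r * s * t + s^2 * sqnorm \<beta>" for r s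
 proof -
  have "0 \<le> (\<integral>x. (r * cmod (\<alpha> x) - s * cmod (\<beta> x))^2 \<partial>M)" by (rule Bochner_Integration.integral_nonneg) simp
  also have "... = (\<integral>x. r^2 * (cmod (\<alpha> x))^2 - 2 * r * s * (cmod (\<alpha> x) * cmod (\<beta> x)) + s^2 * (cmod (\<beta> x))^2 \<partial>M)"
   by (rule Bochner_Integration.integral_cong) (auto simp: power2_eq_square algebra_simps)
  also have "... = r^2 * sqnorm \<alpha> - 2 * r * s * t + s^2 * sqnorm \<beta>"
   using it ia by (simp add: sqnorm_def t_def)
  finally show ?thesis .
 qed
 have "t^2 \<le> sqnorm \<alpha> * sqnorm \<beta>"
 proof (cases "sqnorm \<beta> = 0")
  case True
  have "t = 0"
  proof (rule ccontr)
   assume "t \<noteq> 0"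
   then show False using q[of 1 "(sqnorm \<alpha> + 1) / t"] True sqnorm_nonneg[of \<alpha>] by simp
  qed
  then show ?thesis by simp
 next
  case False
  then have B: "0 < sqnorm \<beta>" using sqnorm_nonneg[of \<beta>] by linarith
  have "0 \<le> sqnorm \<beta> * (sqnorm \<alpha> * sqnorm \<beta> - t^2)"
   using q[of "sqnorm \<beta>" t] by (simp add: power2_eq_square algebra_simps)
  then show ?thesis using B by (simp add: zero_le_mult_iff)
 qed
 then show ?thesis by (simp add: t_def)
qed

lemma weighted_integrable:
 assumes b: "\<beta> \<in> L2 M" and h: "h \<in> borel_measurable borel" "\<And>x. x \<in> K ==> \<bar>h x\<bar> \<le> C"
 shows "integrable M (\<lambda>x. (cmod (\<beta> x))^2 * h x)"
proof (rule Bochner_Integration.integrable_bound)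
 show "integrable M (\<lambda>x. (cmod (\<beta> x))^2 * \<bar>C\<bar>)" using b by (simp add: L2_iff)
 show "(\<lambda>x. (cmod (\<beta> x))^2 * h x) \<in> borel_measurable M"
  using h(1) L2_measurable[OF b] unfolding measurable_M by measurable
 have C': "\<bar>h x\<bar> \<le> \<bar>C\<bar>" if "x \<in> K" for x using h(2)[OF that] by linarith
 show "AE x in M. norm ((cmod (\<beta> x))^2 * h x) \<le> norm ((cmod (\<beta> x))^2 * \<bar>C\<bar>)"
  using AE_K by eventually_elim (auto simp: abs_mult intro!: mult_left_mono C')
qed

text \<open>The difference of the squared moduli is bounded by \<open>abs_power2_diff_le\<close>,
  whose mixed term is controlled by the Cauchy-Schwarz inequality.\<close>

lemma sqnorm_weighted_limit:
 assumes s: "\<And>n::nat. s n \<in> L2 M" and a: "\<alpha> \<in> L2 M" and lim: "(\<lambda>n. sqnorm (\<lambda>x. s n x - \<alpha> x)) \<longlonglongrightarrow> 0"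
  and h: "h \<in> borel_measurable borel" "\<And>x. x \<in> K ==> \<bar>h x\<bar> \<le> C"
 shows "(\<lambda>n. \<integral>x. (cmod (s n x))^2 * h x \<partial>M) \<longlonglongrightarrow> (\<integral>x. (cmod (\<alpha> x))^2 * h x \<partial>M)"
proof -
 define N where "N n = sqnorm (\<lambda>x. s n x - \<alpha> x)" for n
 have C': "\<bar>h x\<bar> \<le> \<bar>C\<bar>" if "x \<in> K" for x using h(2)[OF that] by linarith
 note iw = weighted_integrable[OF _ h]
 have bd: "norm ((\<integral>x. (cmod (s n x))^2 * h x \<partial>M) - (\<integral>x. (cmod (\<alpha> x))^2 * h x \<partial>M)) \<le> \<bar>C\<bar> * (2 * sqrt (N n * sqnorm \<alpha>) + N n)" for n
 proof -
  let ?d = "\<lambda>x. s n x - \<alpha> x"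
  have d: "?d \<in> L2 M" by (rule L2_diff[OF s a])
  have id: "integrable M (\<lambda>x. cmod (?d x) * cmod (\<alpha> x))" "integrable M (\<lambda>x. (cmod (?d x))^2)"
   using integrable_norm[OF L2_product_integrable[OF d a]] d by (simp_all add: norm_mult L2_iff)
  have "norm ((\<integral>x. (cmod (s n x))^2 * h x \<partial>M) - (\<integral>x. (cmod (\<alpha> x))^2 * h x \<partial>M)) = norm (\<integral>x. (cmod (s n x))^2 * h x - (cmod (\<alpha> x))^2 * h x \<partial>M)"
   using iw[OF s] iw[OF a] by simp
  also have "... \<le> (\<integral>x. \<bar>(cmod (s n x))^2 * h x - (cmod (\<alpha> x))^2 * h x\<bar> \<partial>M)"
   by (rule order_trans[OF integral_norm_bound]) (simp only: real_norm_def order_refl)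
  also have "... \<le> (\<integral>x. \<bar>C\<bar> * (2 * (cmod (?d x) * cmod (\<alpha> x)) + (cmod (?d x))^2) \<partial>M)"
  proof (rule integral_mono_AE)
   show "AE x in M. \<bar>(cmod (s n x))^2 * h x - (cmod (\<alpha> x))^2 * h x\<bar> \<le> \<bar>C\<bar> * (2 * (cmod (?d x) * cmod (\<alpha> x)) + (cmod (?d x))^2)"
    using AE_K
   proof eventually_elim
    case (elim x)
    have "\<bar>(cmod (s n x))^2 * h x - (cmod (\<alpha> x))^2 * h x\<bar> = \<bar>h x\<bar> * \<bar>(cmod (s n x))^2 - (cmod (\<alpha> x))^2\<bar>"
     by (simp add: abs_mult[symmetric] algebra_simps)
    also have "... \<le> \<bar>C\<bar> * (2 * (cmod (?d x) * cmod (\<alpha> x)) + (cmod (?d x))^2)"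
     by (intro mult_mono C' elim abs_power2_diff_le) auto
    finally show ?case .
   qed
  qed (use id iw[OF s] iw[OF a] in auto)
  also have "... = \<bar>C\<bar> * (2 * (\<integral>x. cmod (?d x) * cmod (\<alpha> x) \<partial>M) + N n)" using id by (simp add: N_def sqnorm_def)
  also have "... \<le> \<bar>C\<bar> * (2 * sqrt (N n * sqnorm \<alpha>) + N n)"
   using L2_cauchy_schwarz[OF d a] unfolding N_def by (intro mult_left_mono add_right_mono) (auto intro: real_le_rsqrt)
  finally show ?thesis .
 qed
 have "(\<lambda>n. \<bar>C\<bar> * (2 * sqrt (N n * sqnorm \<alpha>) + N n)) \<longlonglongrightarrow> \<bar>C\<bar> * (2 * sqrt (0 * sqnorm \<alpha>) + 0)"
  unfolding N_def by (intro tendsto_intros lim)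
 then have "(\<lambda>n. \<bar>C\<bar> * (2 * sqrt (N n * sqnorm \<alpha>) + N n)) \<longlonglongrightarrow> 0" by simp
 then have "(\<lambda>n. (\<integral>x. (cmod (s n x))^2 * h x \<partial>M) - (\<integral>x. (cmod (\<alpha> x))^2 * h x \<partial>M)) \<longlonglongrightarrow> 0"
  by (rule Lim_null_comparison[OF always_eventually[OF allI[OF bd]]])
 then show ?thesis by (rule LIM_zero_cancel)
qed

end

section \<open>Isometry on a single subtree\<close>

context angelesco_jacobi
begin

abbreviation "P \<equiv> Psi_transform \<mu> a \<omega> X"
abbreviation "ag \<equiv> alpha_gen \<mu> a X"
abbreviation "Rs i \<equiv> restrict_to (subtree (ch i X))"

lemma Psi_hat_measurable [measurable]: "(\<lambda>x. Ph x Y) \<in> borel_measurable borel"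
proof (cases "\<exists>i\<in>{1,2}. Y \<in> subtree (ch i X)")
 case True
 then obtain i where i: "i \<in> {1,2}" "Y \<in> subtree (ch i X)" by blast
 show ?thesis unfolding Psi_hat_subtree[OF i] using Psi_measurable[OF i(1), of Y] by simp
next
 case False
 then have "Ph x Y = 0" for x by (intro Psi_hat_zero) blast
 then show ?thesis by simp
qed

lemma Psi_hat_bounded: "\<exists>C. \<forall>x\<in>DD. cmod (Ph x Y) \<le> C"
proof (cases "\<exists>i\<in>{1,2}. Y \<in> subtree (ch i X)")
 case True
 then obtain i where i: "i \<in> {1,2}" "Y \<in> subtree (ch i X)" by blast
 obtain C where C: "\<forall>x\<in>DD. \<bar>Ps i x Y\<bar> \<le> C" using Psi_bounded[OF i(1)] by blast
 show ?thesis
 proof (intro exI[of _ "1 / sqrt (Wc i) * C"] ballI)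
  fix x assume "x \<in> DD"
  then have "1 / sqrt (Wc i) * \<bar>Ps i x Y\<bar> \<le> 1 / sqrt (Wc i) * C"
   using C W_pot_pos[of "ch i X"] by (intro mult_left_mono) (auto intro: less_imp_le)
  then show "cmod (Ph x Y) \<le> 1 / sqrt (Wc i) * C"
   unfolding Psi_hat_subtree[OF i] using W_pot_pos[of "ch i X"] by (simp add: norm_mult norm_power norm_divide)
 qed
next
 case False
 then have "Ph x Y = 0" for x by (intro Psi_hat_zero) blast
 then show ?thesis by (intro exI[of _ 0]) simp
qed

lemma transform_integrable: "\<alpha> \<in> L2 \<rho> ==> integrable \<rho> (\<lambda>x. \<alpha> x * Ph x Y)"
proof -
 assume \<alpha>: "\<alpha> \<in> L2 \<rho>"
 obtain C where C: "\<forall>x\<in>DD. cmod (Ph x Y) \<le> C" using Psi_hat_bounded by blast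
 show ?thesis by (rule M.L2_integrable_product[OF \<alpha> Psi_hat_measurable, of Y C]) (use C in blast)
qed

lemma transform_add: "\<alpha> \<in> L2 \<rho> ==> \<beta> \<in> L2 \<rho> ==> P (\<lambda>x. \<alpha> x + \<beta> x) = (\<lambda>Y. P \<alpha> Y + P \<beta> Y)"
 by (rule ext) (simp add: Psi_transform_def distrib_right transform_integrable)

lemma transform_mult: "P (\<lambda>x. c * \<alpha> x) = (\<lambda>Y. c * P \<alpha> Y)"
 by (rule ext) (simp add: Psi_transform_def mult.assoc)

lemma transform_diff: "\<alpha> \<in> L2 \<rho> ==> \<beta> \<in> L2 \<rho> ==> P (\<lambda>x. \<alpha> x - \<beta> x) = (\<lambda>Y. P \<alpha> Y - P \<beta> Y)"
 using transform_add[of \<alpha> "\<lambda>x. (-1) * \<beta> x"] transform_mult[of "-1" \<beta>] M.L2_mult[of \<beta> "-1"] by (simp add: fun_eq_iff)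

lemma transform_cong:
 assumes "\<alpha> \<in> borel_measurable borel" "\<beta> \<in> borel_measurable borel" "\<And>x. x \<in> DD ==> \<alpha> x = \<beta> x"
 shows "P \<alpha> = P \<beta>"
 unfolding Psi_transform_def using assms by (intro ext M.integral_cong_K borel_measurable_times Psi_hat_measurable) auto

lemma DD_norm_bounded: "\<exists>C. \<forall>x\<in>DD. cmod (cor x) \<le> C"
 using compact_imp_bounded[OF M.K] unfolding bounded_iff by simp

lemma mult_x_L2: "\<alpha> \<in> L2 \<rho> ==> (\<lambda>x. cor x * \<alpha> x) \<in> L2 \<rho>"
proof -
 assume \<alpha>: "\<alpha> \<in> L2 \<rho>"
 obtain C where "\<forall>x\<in>DD. cmod (cor x) \<le> C" using DD_norm_bounded by blast
 then show ?thesis by (intro M.L2_bounded_mult(1)[OF \<alpha>, of cor C]) auto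
qed

lemma Jacobi_transform:
 assumes \<alpha>: "\<alpha> \<in> L2 \<rho>"
 shows "J (P \<alpha>) = P (\<lambda>x. cor x * \<alpha> x)"
proof
 fix Y
 let ?h = "\<lambda>Y x. Ph x Y"
 let ?c0 = "cor (V_pot b \<kappa> Y)" and ?c1 = "if Y = Root then 0 else cor (sqrt (W_pot a Y))"
 let ?d = "\<lambda>i. cor (sqrt (W_pot a (ch i Y)))"
 have J: "J f Y = ?c0 * f Y + ?c1 * f (parent Y) + (?d 1 * f (ch 1 Y) + ?d 2 * f (ch 2 Y))" for f
  unfolding Jacobi_def by simp
 have "P (\<lambda>x. cor x * \<alpha> x) Y = (\<integral>x. \<alpha> x * (?c0 * ?h Y x + ?c1 * ?h (parent Y) x + (?d 1 * ?h (ch 1 Y) x + ?d 2 * ?h (ch 2 Y) x)) \<partial>\<rho>)"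
  unfolding Psi_transform_def
 proof (rule M.integral_cong_K)
  fix x assume "x \<in> DD"
  then obtain k where k: "k \<in> {1,2}" "x \<in> Delta \<mu> k" by (rule DD_cases)
  show "cor x * \<alpha> x * ?h Y x = \<alpha> x * (?c0 * ?h Y x + ?c1 * ?h (parent Y) x + (?d 1 * ?h (ch 1 Y) x + ?d 2 * ?h (ch 2 Y) x))"
   unfolding J[of "Ph x", symmetric] Psi_hat_eigenfunction[OF k] by (simp add: mult_ac)
 next
  show "(\<lambda>x. cor x * \<alpha> x * ?h Y x) \<in> borel_measurable borel"
   by (intro borel_measurable_times M.L2_measurable[OF mult_x_L2[OF \<alpha>]] Psi_hat_measurable)
  show "(\<lambda>x. \<alpha> x * (?c0 * ?h Y x + ?c1 * ?h (parent Y) x + (?d 1 * ?h (ch 1 Y) x + ?d 2 * ?h (ch 2 Y) x))) \<in> borel_measurable borel"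
   by (intro borel_measurable_times borel_measurable_add M.L2_measurable[OF \<alpha>] Psi_hat_measurable borel_measurable_const)
 qed
 also have "... = (\<integral>x. ?c0 * (\<alpha> x * ?h Y x) + ?c1 * (\<alpha> x * ?h (parent Y) x) + (?d 1 * (\<alpha> x * ?h (ch 1 Y) x) + ?d 2 * (\<alpha> x * ?h (ch 2 Y) x)) \<partial>\<rho>)"
  by (rule Bochner_Integration.integral_cong) (simp_all only: algebra_simps)
 also have "... = ?c0 * P \<alpha> Y + ?c1 * P \<alpha> (parent Y) + (?d 1 * P \<alpha> (ch 1 Y) + ?d 2 * P \<alpha> (ch 2 Y))"
  unfolding Psi_transform_def
  by (simp only: Bochner_Integration.integral_add integral_mult_right_zero integrable_mult_right Bochner_Integration.integrable_add transform_integrable[OF \<alpha>])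
 also have "... = J (P \<alpha>) Y" by (rule J[symmetric])
 finally show "J (P \<alpha>) Y = P (\<lambda>x. cor x * \<alpha> x) Y" by simp
qed

lemma transform_outside: "(\<And>i. i \<in> {1,2} ==> Y \<notin> subtree (ch i X)) ==> P \<alpha> Y = 0"
 unfolding Psi_transform_def by (subst Psi_hat_zero) auto

lemma transform_at_X: "P \<alpha> X = 0"
 by (rule transform_outside) (rule X_notin_subtree_ch)

text \<open>The only edge leaving the subtree leads to \<open>X\<close>, where \<open>f\<close>
  vanishes; so cutting off outside the subtree before the operator is applied has no effect inside
  it.\<close>

lemma restrict_Jacobi:
 assumes i: "i \<in> {1,2}" and X: "f X = 0"
 shows "Rs i (J (Rs i f)) = Rs i (J f)"
proof
 fix Y
 show "Rs i (J (Rs i f)) Y = Rs i (J f) Y"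
 proof (cases "Y \<in> subtree (ch i X)")
  case True
  have c: "ch j Y \<in> subtree (ch i X)" if "j \<in> {1,2}" for j using True that by (simp only: subtree_ch) simp
  have p: "Rs i f (parent Y) = f (parent Y)" if nr: "Y \<noteq> Root"
  proof -
   obtain j Z where Z: "j \<in> {1,2}" "Y = ch j Z" using not_Root_ch[OF nr] by blast
   have "ch i X = ch j Z \<or> Z \<in> subtree (ch i X)" using True Z by (simp only: subtree_ch)
   then have "Z = X \<or> Z \<in> subtree (ch i X)" unfolding ch_inject[OF i Z(1)] by blast
   then show ?thesis using X X_notin_subtree_ch[of X i] Z(2) by (auto simp: restrict_to_def)
  qed
  have "J (Rs i f) Y = J f Y"
   unfolding Jacobi_def sum_12 using p c[OF insertI1] c[OF insertI2[OF insertI1]] True by (simp add: restrict_to_def)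
  then show ?thesis by (simp add: restrict_to_def)
 qed (simp add: restrict_to_def)
qed

lemma alpha_gen_measurable [measurable]: "ag i \<in> borel_measurable borel"
 using nu_measurable[of i] unfolding alpha_gen_def[abs_def] by simp

lemma norm_alpha_gen: "i \<in> {1,2} ==> x \<in> DD ==> cmod (ag i x) = sqrt (Wc i) * nv i x"
 using nu_pos[of i x] W_pot_pos[of "ch i X"] by (simp add: alpha_gen_def norm_mult norm_power)

lemma alpha_gen_bounds:
 assumes i: "i \<in> {1,2}"
 shows "\<exists>c C. 0 < c \<and> (\<forall>x\<in>DD. c \<le> cmod (ag i x) \<and> cmod (ag i x) \<le> C)"
proof -
 obtain c C where c: "0 < c" "\<And>x. x \<in> DD ==> c \<le> nv i x \<and> nv i x \<le> C" using nu_bounds[OF i] by blast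
 have w: "0 < sqrt (Wc i)" using W_pot_pos by simp
 have "sqrt (Wc i) * c \<le> cmod (ag i x) \<and> cmod (ag i x) \<le> sqrt (Wc i) * C" if x: "x \<in> DD" for x
  unfolding norm_alpha_gen[OF i x] using c(2)[OF x] w by simp
 then show ?thesis using c(1) w by (intro exI[of _ "sqrt (Wc i) * c"] exI[of _ "sqrt (Wc i) * C"]) simp
qed

lemma alpha_gen_nonzero:
 assumes "i \<in> {1,2}" "x \<in> DD"
 shows "ag i x \<noteq> 0"
 unfolding norm_le_zero_iff[symmetric] norm_alpha_gen[OF assms] not_le using nu_pos[OF assms] W_pot_pos[of "ch i X"] by simp

lemma alpha_gen_L2: "i \<in> {1,2} ==> ag i \<in> L2 \<rho>"
proof -
 assume "i \<in> {1,2}"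
 then obtain c C where C: "\<forall>x\<in>DD. c \<le> cmod (ag i x) \<and> cmod (ag i x) \<le> C" using alpha_gen_bounds by blast
 show ?thesis by (rule M.L2_bounded(1)[OF alpha_gen_measurable, of i C]) (use C in blast)
qed

lemma mult_alpha_gen_L2: "i \<in> {1,2} ==> \<beta> \<in> L2 \<rho> ==> (\<lambda>x. \<beta> x * ag i x) \<in> L2 \<rho>"
proof -
 assume i: "i \<in> {1,2}" and \<beta>: "\<beta> \<in> L2 \<rho>"
 obtain c C where C: "\<forall>x\<in>DD. c \<le> cmod (ag i x) \<and> cmod (ag i x) \<le> C" using alpha_gen_bounds[OF i] by blast
 have "(\<lambda>x. ag i x * \<beta> x) \<in> L2 \<rho>"
  by (rule M.L2_bounded_mult(1)[OF \<beta> alpha_gen_measurable, of i C]) (use C in blast)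
 then show ?thesis by (simp only: mult.commute)
qed

lemma div_alpha_gen_L2:
 assumes i: "i \<in> {1,2}" and \<alpha>: "\<alpha> \<in> L2 \<rho>"
 shows "(\<lambda>x. \<alpha> x / ag i x) \<in> L2 \<rho>"
proof -
 obtain c C where c: "0 < c" "\<And>x. x \<in> DD ==> c \<le> cmod (ag i x)" using alpha_gen_bounds[OF i] by blast
 have "(\<lambda>x. 1 / ag i x * \<alpha> x) \<in> L2 \<rho>"
 proof (rule M.L2_bounded_mult(1)[OF \<alpha>, of _ "1 / c"])
  show "(\<lambda>x. 1 / ag i x) \<in> borel_measurable borel" using alpha_gen_measurable[of i] by simp
  show "cmod (1 / ag i x) \<le> 1 / c" if "x \<in> DD" for x using c(1) c(2)[OF that] by (simp add: norm_divide frac_le)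
 qed
 then show ?thesis by simp
qed

text \<open>The transform on one subtree in the variable \<open>\<beta>\<close> with
  \<open>\<alpha> = \<beta> * ag i\<close>, normalized so that the constant 1 corresponds to the
  delta function at the root of the subtree (\<open>Q_one\<close>).\<close>

definition Q :: "nat => (real => complex) => vertex => complex" where
 "Q i \<beta> = Rs i (P (\<lambda>x. \<beta> x * ag i x))"

lemma Rs_Rs [simp]: "Rs i (Rs i f) = Rs i f"
 by (simp add: restrict_to_def fun_eq_iff)

lemma Rs_Q [simp]: "Rs i (Q i \<beta>) = Q i \<beta>"
 by (simp add: Q_def)

lemma Q_add: "i \<in> {1,2} ==> \<alpha> \<in> L2 \<rho> ==> \<beta> \<in> L2 \<rho> ==> Q i (\<lambda>x. \<alpha> x + \<beta> x) = (\<lambda>Y. Q i \<alpha> Y + Q i \<beta> Y)"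
 by (rule ext) (simp add: Q_def distrib_right transform_add[OF mult_alpha_gen_L2 mult_alpha_gen_L2] restrict_to_def)

lemma Q_mult: "Q i (\<lambda>x. c * \<beta> x) = (\<lambda>Y. c * Q i \<beta> Y)"
 by (rule ext) (simp add: Q_def mult.assoc transform_mult restrict_to_def)

lemma Q_diff: "i \<in> {1,2} ==> \<alpha> \<in> L2 \<rho> ==> \<beta> \<in> L2 \<rho> ==> Q i (\<lambda>x. \<alpha> x - \<beta> x) = (\<lambda>Y. Q i \<alpha> Y - Q i \<beta> Y)"
 using Q_add[of i \<alpha> "\<lambda>x. (-1) * \<beta> x"] Q_mult[of i "-1" \<beta>] M.L2_mult[of \<beta> "-1"] by (simp add: fun_eq_iff)

lemma Q_mult_x:
 assumes i: "i \<in> {1,2}" and \<beta>: "\<beta> \<in> L2 \<rho>"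
 shows "Q i (\<lambda>x. cor x * \<beta> x) = Rs i (J (Q i \<beta>))"
 unfolding Q_def restrict_Jacobi[OF i, of "P (\<lambda>x. \<beta> x * ag i x)", OF transform_at_X] Jacobi_transform[OF mult_alpha_gen_L2[OF i \<beta>]] by (simp add: mult.assoc)

lemma alpha_gen_Psi_hat:
 assumes i: "i \<in> {1,2}" and Y: "Y \<in> subtree (ch i X)"
 shows "ag i x * Ph x Y = cor (nv i x * Ps i x Y)"
proof -
 have "((-1) ^ i * (-1) ^ i :: real) = 1" by (simp flip: power_mult_distrib)
 moreover have "sqrt (Wc i) \<noteq> 0" using W_pot_pos[of "ch i X"] by simp
 ultimately have "((-1) ^ i * sqrt (Wc i) * nv i x) * ((-1) ^ i * (1 / sqrt (Wc i)) * Ps i x Y)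
   = nv i x * Ps i x Y" by (simp add: field_simps)
 then show ?thesis unfolding alpha_gen_def Psi_hat_subtree[OF i Y] of_real_mult[symmetric] by (simp only:)
qed

lemma Q_one:
 assumes i: "i \<in> {1,2}"
 shows "Q i (\<lambda>_. 1) = delta (ch i X)"
proof
 fix Y
 show "Q i (\<lambda>_. 1) Y = delta (ch i X) Y"
 proof (cases "Y \<in> subtree (ch i X)")
  case True
  have "Q i (\<lambda>_. 1) Y = (\<integral>x. cor (nv i x * Ps i x Y) \<partial>\<rho>)"
   using True by (simp add: Q_def restrict_to_def Psi_transform_def alpha_gen_Psi_hat[OF i True])
  also have "... = delta (ch i X) Y"
   by (simp only: integral_complex_of_real delta_identity[OF i True]) (simp add: delta_def)
  finally show ?thesis .
 next
  case False
  then have "Y \<noteq> ch i X" by auto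
  then show ?thesis using False by (simp add: Q_def restrict_to_def delta_def)
 qed
qed

lemma Q_root:
 assumes i: "i \<in> {1,2}" and \<beta>: "\<beta> \<in> L2 \<rho>"
 shows "Q i \<beta> (ch i X) = (\<integral>x. \<beta> x * cor (nv i x) \<partial>\<rho>)"
proof -
 have "Q i \<beta> (ch i X) = (\<integral>x. \<beta> x * ag i x * Ph x (ch i X) \<partial>\<rho>)"
  by (simp add: Q_def restrict_to_def Psi_transform_def)
 also have "... = (\<integral>x. \<beta> x * cor (nv i x) \<partial>\<rho>)"
 proof (rule M.integral_cong_K)
  fix x assume "x \<in> DD"
  then obtain k where k: "k \<in> {1,2}" "x \<in> Delta \<mu> k" by (rule DD_cases)
  show "\<beta> x * ag i x * Ph x (ch i X) = \<beta> x * cor (nv i x)"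
   unfolding mult.assoc alpha_gen_Psi_hat[OF i subtree_self] Psi_self[OF k i] by simp
 next
  show "(\<lambda>x. \<beta> x * ag i x * Ph x (ch i X)) \<in> borel_measurable borel"
   by (intro borel_measurable_times M.L2_measurable[OF \<beta>] Psi_hat_measurable alpha_gen_measurable)
  show "(\<lambda>x. \<beta> x * cor (nv i x)) \<in> borel_measurable borel"
   using M.L2_measurable[OF \<beta>] nu_measurable[of i] by simp
 qed
 finally show ?thesis .
qed

abbreviation "pl p x \<equiv> poly p (cor x)"

lemma Q_pCons:
 assumes i: "i \<in> {1,2}"
 shows "Q i (pl (pCons c p)) = (\<lambda>Y. c * delta (ch i X) Y + Rs i (J (Q i (pl p))) Y)"
proof -
 have "pl (pCons c p) = (\<lambda>x. c * 1 + cor x * pl p x)" by (simp add: fun_eq_iff)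
 then have "Q i (pl (pCons c p)) = (\<lambda>Y. Q i (\<lambda>x. c * 1) Y + Q i (\<lambda>x. cor x * pl p x) Y)"
  by (simp only:) (rule Q_add[OF i M.L2_continuous mult_x_L2[OF M.L2_poly]], simp)
 then show ?thesis by (simp only: Q_mult[of i c "\<lambda>_. 1"] Q_one[OF i] Q_mult_x[OF i M.L2_poly])
qed

lemma Q_poly_ell2: "i \<in> {1,2} ==> Q i (pl p) \<in> ell2"
proof (induction p)
 case 0
 show ?case using Q_mult[of i 0 "\<lambda>_. 0"] by simp
next
 case (pCons c p)
 show ?case unfolding Q_pCons[OF pCons.prems]
  by (intro ell2_add ell2_mult delta_ell2 ell2_restrict J.T_ell2 pCons.IH pCons.prems)
qed

lemma nu_complex_bounded:
 assumes i: "i \<in> {1,2}"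
 shows "\<exists>C. \<forall>x\<in>DD. cmod (cor (nv i x)) \<le> C"
proof -
 obtain c C where c: "0 < c" "\<And>x. x \<in> DD ==> c \<le> nv i x \<and> nv i x \<le> C" using nu_bounds[OF i] by blast
 show ?thesis using c by (intro exI[of _ C]) fastforce
qed

lemma nu_weight_integrable: "i \<in> {1,2} ==> \<beta> \<in> L2 \<rho> ==> integrable \<rho> (\<lambda>x. \<beta> x * cor (nv i x))"
proof -
 assume i: "i \<in> {1,2}" and \<beta>: "\<beta> \<in> L2 \<rho>"
 obtain C where C: "\<forall>x\<in>DD. cmod (cor (nv i x)) \<le> C" using nu_complex_bounded[OF i] by blast
 show ?thesis by (rule M.L2_integrable_product[OF \<beta> measurable_compose[OF nu_measurable borel_measurable_of_real], of i C]) (use C in blast)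
qed

text \<open>Induction on \<open>p\<close> for all \<open>q\<close>: the constant coefficient pairs
  with the delta function and reads off the value of the other transform at the root, and a factor
  \<open>x\<close> moves from \<open>p\<close> to \<open>q\<close> by symmetry of the restricted
  operator.\<close>

lemma Q_poly_inner:
 assumes i: "i \<in> {1,2}"
 shows "ell2_inner (Q i (pl p)) (Q i (pl q)) = (\<integral>x. pl p x * cnj (pl q x) * cor (nv i x) \<partial>\<rho>)"
proof (induction p arbitrary: q)
 case 0
 have "Q i (pl 0) = (\<lambda>_. 0)" using Q_mult[of i 0 "\<lambda>_. 0"] by simp
 then show ?case by (simp add: ell2_inner_def)
next
 case (pCons c p)
 let ?n = "\<lambda>x. cor (nv i x)"
 have Jp: "J (Q i (pl p)) \<in> ell2" by (intro J.T_ell2 Q_poly_ell2 i)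
 have qq: "Q i (pl (pCons 0 q)) = Rs i (J (Q i (pl q)))" unfolding Q_pCons[OF i] by simp
 have cont: "continuous_on UNIV (\<lambda>x. cnj (pl q x))" "continuous_on UNIV (\<lambda>x. pl p x * cnj (pl (pCons 0 q) x))"
  by (intro continuous_intros)+
 have i1: "integrable \<rho> (\<lambda>x. cnj (pl q x) * ?n x)" "integrable \<rho> (\<lambda>x. pl p x * cnj (pl (pCons 0 q) x) * ?n x)"
  by (rule nu_weight_integrable[OF i M.L2_continuous[OF cont(1)]], rule nu_weight_integrable[OF i M.L2_continuous[OF cont(2)]])
 have "ell2_inner (Rs i (J (Q i (pl p)))) (Q i (pl q)) = ell2_inner (J (Q i (pl p))) (Q i (pl q))"
  by (simp add: ell2_inner_restrict)
 also have "... = ell2_inner (Q i (pl p)) (J (Q i (pl q)))" by (intro J.T_symmetric Q_poly_ell2 i)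
 also have "... = ell2_inner (Q i (pl p)) (Q i (pl (pCons 0 q)))"
  unfolding qq ell2_inner_restrict[symmetric] by simp
 also have "... = (\<integral>x. pl p x * cnj (pl (pCons 0 q) x) * ?n x \<partial>\<rho>)" by (rule pCons.IH)
 finally have e2: "ell2_inner (Rs i (J (Q i (pl p)))) (Q i (pl q)) = (\<integral>x. pl p x * cnj (pl (pCons 0 q) x) * ?n x \<partial>\<rho>)" .
 have "ell2_inner (delta (ch i X)) (Q i (pl q)) = cnj (\<integral>x. pl q x * ?n x \<partial>\<rho>)"
  unfolding ell2_inner_delta Q_root[OF i M.L2_poly] ..
 also have "... = (\<integral>x. cnj (pl q x * ?n x) \<partial>\<rho>)" by (rule integral_bounded_linear'[OF bounded_linear_cnj bounded_linear_cnj, symmetric]) simp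
 also have "... = (\<integral>x. cnj (pl q x) * ?n x \<partial>\<rho>)" by simp
 finally have e1: "ell2_inner (delta (ch i X)) (Q i (pl q)) = (\<integral>x. cnj (pl q x) * ?n x \<partial>\<rho>)" .
 have "ell2_inner (Q i (pl (pCons c p))) (Q i (pl q)) = c * (\<integral>x. cnj (pl q x) * ?n x \<partial>\<rho>) + (\<integral>x. pl p x * cnj (pl (pCons 0 q) x) * ?n x \<partial>\<rho>)"
  unfolding Q_pCons[OF i]
  by (subst ell2_inner_add_left) (simp_all only: ell2_mult delta_ell2 ell2_restrict Jp Q_poly_ell2[OF i] ell2_inner_mult_left e1 e2)
 also have "... = (\<integral>x. c * (cnj (pl q x) * ?n x) + pl p x * cnj (pl (pCons 0 q) x) * ?n x \<partial>\<rho>)"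
  using i1 by (simp only: Bochner_Integration.integral_add integral_mult_right_zero integrable_mult_right)
 also have "... = (\<integral>x. pl (pCons c p) x * cnj (pl q x) * ?n x \<partial>\<rho>)"
  by (rule Bochner_Integration.integral_cong) (simp_all add: algebra_simps)
 finally show ?case .
qed

lemma Q_poly_norm:
 assumes i: "i \<in> {1,2}"
 shows "(ell2_norm (Q i (pl p)))^2 = (\<integral>x. (cmod (pl p x))^2 * nv i x \<partial>\<rho>)"
proof -
 have "cor ((ell2_norm (Q i (pl p)))^2) = (\<integral>x. pl p x * cnj (pl p x) * cor (nv i x) \<partial>\<rho>)"
  by (simp only: ell2_inner_self[OF Q_poly_ell2[OF i], symmetric] Q_poly_inner[OF i])
 also have "... = (\<integral>x. cor ((cmod (pl p x))^2 * nv i x) \<partial>\<rho>)"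
  by (rule Bochner_Integration.integral_cong) (simp_all only: complex_norm_square of_real_mult)
 finally show ?thesis by (simp only: integral_complex_of_real of_real_eq_iff)
qed

text \<open>Polynomials approximate \<open>\<beta>\<close>, and by \<open>Q_poly_norm\<close> their
  images form a Cauchy sequence. Its limit is identified vertex by vertex, because each component of
  \<open>Psi_hat\<close> is bounded.\<close>

lemma Q_isometry:
 assumes i: "i \<in> {1,2}" and \<beta>: "\<beta> \<in> L2 \<rho>"
 shows "Q i \<beta> \<in> ell2" "(ell2_norm (Q i \<beta>))^2 = (\<integral>x. (cmod (\<beta> x))^2 * nv i x \<partial>\<rho>)"
proof -
 obtain p where p: "(\<lambda>n. M.sqnorm (\<lambda>x. pl (p n) x - \<beta> x)) \<longlonglongrightarrow> 0" by (rule M.L2_poly_sequence[OF \<beta>])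
 obtain c C where c: "0 < c" "\<And>x. x \<in> DD ==> c \<le> nv i x \<and> nv i x \<le> C" using nu_bounds[OF i] by blast
 have nC: "\<bar>nv i x\<bar> \<le> \<bar>C\<bar>" if "x \<in> DD" for x using c(1) c(2)[OF that] by linarith
 have pt: "(\<lambda>n. Q i (pl (p n)) Y) \<longlonglongrightarrow> Q i \<beta> Y" for Y
 proof (cases "Y \<in> subtree (ch i X)")
  case True
  obtain B where B: "\<forall>x\<in>DD. cmod (Ph x Y) \<le> B" using Psi_hat_bounded by blast
  obtain c' C' where C': "\<forall>x\<in>DD. c' \<le> cmod (ag i x) \<and> cmod (ag i x) \<le> C'" using alpha_gen_bounds[OF i] by blast
  have "cmod (ag i x * Ph x Y) \<le> C' * B" if x: "x \<in> DD" for x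
   unfolding norm_mult using bspec[OF B x] bspec[OF C' x] order_trans[OF norm_ge_zero, of "ag i x" C'] by (intro mult_mono) auto
  then have "(\<lambda>n. \<integral>x. pl (p n) x * (ag i x * Ph x Y) \<partial>\<rho>) \<longlonglongrightarrow> (\<integral>x. \<beta> x * (ag i x * Ph x Y) \<partial>\<rho>)"
   by (intro M.L2_weak_convergence[OF M.L2_poly \<beta> p]) simp_all
  then show ?thesis using True by (simp add: Q_def restrict_to_def Psi_transform_def mult.assoc)
 qed (simp add: Q_def restrict_to_def)
 have nb: "(ell2_norm (\<lambda>y. Q i (pl (p m)) y - Q i (pl (p n)) y))^2 \<le> \<bar>C\<bar> * (2 * M.sqnorm (\<lambda>x. pl (p m) x - \<beta> x) + 2 * M.sqnorm (\<lambda>x. pl (p n) x - \<beta> x))" for m n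
 proof -
  have d: "(\<lambda>x. pl (p m) x - pl (p n) x) \<in> L2 \<rho>" by (intro M.L2_diff M.L2_poly)
  have "(\<lambda>y. Q i (pl (p m)) y - Q i (pl (p n)) y) = Q i (pl (p m - p n))"
   by (simp add: Q_diff[OF i M.L2_poly M.L2_poly])
  then have "(ell2_norm (\<lambda>y. Q i (pl (p m)) y - Q i (pl (p n)) y))^2 = (\<integral>x. (cmod (pl (p m) x - pl (p n) x))^2 * nv i x \<partial>\<rho>)"
   using Q_poly_norm[OF i, of "p m - p n"] by simp
  also have "... \<le> (\<integral>x. (cmod (pl (p m) x - pl (p n) x))^2 * \<bar>C\<bar> \<partial>\<rho>)"
  proof (rule integral_mono_AE')
   show "integrable \<rho> (\<lambda>x. (cmod (pl (p m) x - pl (p n) x))^2 * \<bar>C\<bar>)" using d by (simp add: M.L2_iff)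
   show "AE x in \<rho>. (cmod (pl (p m) x - pl (p n) x))^2 * nv i x \<le> (cmod (pl (p m) x - pl (p n) x))^2 * \<bar>C\<bar>"
    using M.AE_K by eventually_elim (use nC in \<open>fastforce intro: mult_left_mono\<close>)
   show "AE x in \<rho>. 0 \<le> (cmod (pl (p m) x - pl (p n) x))^2 * \<bar>C\<bar>" by simp
  qed
  also have "... = \<bar>C\<bar> * M.sqnorm (\<lambda>x. pl (p m) x - pl (p n) x)" by (simp add: M.sqnorm_def)
  also have "... \<le> \<bar>C\<bar> * (2 * M.sqnorm (\<lambda>x. pl (p m) x - \<beta> x) + 2 * M.sqnorm (\<lambda>x. pl (p n) x - \<beta> x))"
   using M.sqnorm_triangle[OF M.L2_poly \<beta> M.L2_poly, of "p m" "p n"]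
   by (intro mult_left_mono) (simp_all add: M.sqnorm_minus_commute[of \<beta>])
  finally show ?thesis .
 qed
 have "ell2_Cauchy (\<lambda>n. Q i (pl (p n)))"
  unfolding ell2_Cauchy_def
 proof (intro conjI allI impI)
  fix e :: real assume e: "0 < e"
  \<comment> \<open>By \<open>nb\<close> the squared distance is at most
    \<open>4 * \<bar>C\<bar> * d\<close>, which is below \<open>e^2\<close> for this
    \<open>d\<close>.\<close>
  define d where "d = e^2 / (4 * (\<bar>C\<bar> + 1))"
  have d: "0 < d" "d * (4 * (\<bar>C\<bar> + 1)) = e^2" unfolding d_def using e by auto
  have "\<forall>\<^sub>F n in sequentially. M.sqnorm (\<lambda>x. pl (p n) x - \<beta> x) < d" by (rule order_tendstoD(2)[OF p d(1)])
  then obtain N where N: "\<And>n. n \<ge> N ==> M.sqnorm (\<lambda>x. pl (p n) x - \<beta> x) < d" unfolding eventually_sequentially by blast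
  have "ell2_norm (\<lambda>y. Q i (pl (p m)) y - Q i (pl (p n)) y) < e" if "m \<ge> N" "n \<ge> N" for m n
  proof (rule power_less_imp_less_base)
   have "(ell2_norm (\<lambda>y. Q i (pl (p m)) y - Q i (pl (p n)) y))^2 \<le> \<bar>C\<bar> * (2 * d + 2 * d)"
    using N[OF that(1)] N[OF that(2)] by (intro order_trans[OF nb mult_left_mono]) auto
   also have "... < e^2" unfolding d(2)[symmetric] using d(1) by (simp add: algebra_simps)
   finally show "(ell2_norm (\<lambda>y. Q i (pl (p m)) y - Q i (pl (p n)) y))^2 < e^2" .
  qed (use e in simp)
  then show "\<exists>N. \<forall>m\<ge>N. \<forall>n\<ge>N. ell2_norm (\<lambda>y. Q i (pl (p m)) y - Q i (pl (p n)) y) < e" by blast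
 qed (rule Q_poly_ell2[OF i])
 then have t: "ell2_tendsto (\<lambda>n. Q i (pl (p n))) (Q i \<beta>)" using pt by (rule ell2_Cauchy_pointwise_limit)
 then show "Q i \<beta> \<in> ell2" by (simp add: ell2_tendsto_def)
 have "(\<lambda>n. (ell2_norm (Q i (pl (p n))))^2) \<longlonglongrightarrow> (ell2_norm (Q i \<beta>))^2" by (intro tendsto_power ell2_tendsto_norm t)
 moreover have "(\<lambda>n. (ell2_norm (Q i (pl (p n))))^2) \<longlonglongrightarrow> (\<integral>x. (cmod (\<beta> x))^2 * nv i x \<partial>\<rho>)"
  unfolding Q_poly_norm[OF i] by (rule M.sqnorm_weighted_limit[OF M.L2_poly \<beta> p nu_measurable nC])
 ultimately show "(ell2_norm (Q i \<beta>))^2 = (\<integral>x. (cmod (\<beta> x))^2 * nv i x \<partial>\<rho>)" by (rule LIMSEQ_unique)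
qed

end

text \<open>Different indices may give the same function, whereas \<open>complex_span\<close> sums
  over a set; the coefficients of equal functions are added up.\<close>

lemma complex_span_sum:
 assumes I: "finite I" and u: "\<And>j. j \<in> I ==> u j \<in> F"
 shows "(\<lambda>y. \<Sum>j\<in>I. c j * u j y) \<in> complex_span F"
proof -
 define d where "d f = (\<Sum>j\<in>{j\<in>I. u j = f}. c j)" for f
 have "(\<Sum>j\<in>I. c j * u j y) = (\<Sum>f\<in>u ` I. d f * f y)" for y
 proof -
  have "(\<Sum>j\<in>I. c j * u j y) = (\<Sum>f\<in>u ` I. \<Sum>j\<in>{j\<in>I. u j = f}. c j * u j y)" by (rule sum.image_gen[OF I])
  also have "... = (\<Sum>f\<in>u ` I. d f * f y)" by (rule sum.cong) (simp_all add: d_def sum_distrib_right)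
  finally show ?thesis .
 qed
 then show ?thesis
  unfolding complex_span_def mem_Collect_eq by (intro exI[of _ "u ` I"] exI[of _ d]) (use I u in auto)
qed

section \<open>Both subtrees, cyclicity, functional calculus and spectral measure\<close>

context angelesco_jacobi
begin

text \<open>The density in \<open>transform_isometry\<close>. With
  \<open>\<alpha> = \<beta> * ag i\<close> the squared norm on the \<open>i\<close>-th subtree has
  the weight \<open>nv i x / (cmod (ag i x))^2\<close>, which is the \<open>i\<close>-th
  summand.\<close>

definition wt :: "real => real" where
 "wt x = (\<Sum>i\<in>{1,2}. 1 / (Wc i * nv i x))"

lemma wt_term_bounds:
 assumes i: "i \<in> {1,2}"
 shows "\<exists>c C. 0 < c \<and> (\<forall>x\<in>DD. c \<le> 1 / (Wc i * nv i x) \<and> 1 / (Wc i * nv i x) \<le> C)"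
proof -
 obtain c C where c: "0 < c" "\<And>x. x \<in> DD ==> c \<le> nv i x \<and> nv i x \<le> C" using nu_bounds[OF i] by blast
 let ?W = "Wc i"
 have W: "0 < ?W" by (rule W_pot_pos)
 have "1 / (?W * (\<bar>C\<bar> + 1)) \<le> 1 / (?W * nv i x) \<and> 1 / (?W * nv i x) \<le> 1 / (?W * c)" if x: "x \<in> DD" for x
  using c(1) c(2)[OF x] W by (intro conjI divide_left_mono mult_left_mono mult_pos_pos) auto
 moreover have "0 < 1 / (?W * (\<bar>C\<bar> + 1))" using W by simp
 ultimately show ?thesis by blast
qed

lemma wt_bounds: "\<exists>c C. 0 < c \<and> (\<forall>x\<in>DD. c \<le> wt x \<and> wt x \<le> C)"
proof -
 obtain c1 C1 where 1: "0 < c1" "\<forall>x\<in>DD. c1 \<le> 1 / (Wc 1 * nv 1 x) \<and> 1 / (Wc 1 * nv 1 x) \<le> C1"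
  using wt_term_bounds[OF insertI1] by blast
 obtain c2 C2 where 2: "0 < c2" "\<forall>x\<in>DD. c2 \<le> 1 / (Wc 2 * nv 2 x) \<and> 1 / (Wc 2 * nv 2 x) \<le> C2"
  using wt_term_bounds[OF insertI2[OF insertI1]] by blast
 have "c1 + c2 \<le> wt x \<and> wt x \<le> C1 + C2" if x: "x \<in> DD" for x
  unfolding wt_def sum_12 using bspec[OF 1(2) x] bspec[OF 2(2) x] by linarith
 then show ?thesis using 1(1) 2(1) by (intro exI[of _ "c1 + c2"] exI[of _ "C1 + C2"]) auto
qed

lemma wt_measurable [measurable]: "wt \<in> borel_measurable borel"
 unfolding wt_def[abs_def] using nu_measurable by simp

lemma wt_abs_bounded: "\<exists>C. \<forall>x\<in>DD. \<bar>wt x\<bar> \<le> C"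
 using wt_bounds by (metis abs_of_nonneg less_le_trans less_imp_le)

lemma restrict_transform:
 assumes i: "i \<in> {1,2}" and \<alpha>: "\<alpha> \<in> L2 \<rho>"
 shows "Rs i (P \<alpha>) = Q i (\<lambda>x. \<alpha> x / ag i x)"
proof -
 have "P (\<lambda>x. \<alpha> x / ag i x * ag i x) = P \<alpha>"
 proof (rule transform_cong)
  show "\<alpha> x / ag i x * ag i x = \<alpha> x" if "x \<in> DD" for x using alpha_gen_nonzero[OF i that] by simp
  show "(\<lambda>x. \<alpha> x / ag i x * ag i x) \<in> borel_measurable borel"
   by (rule M.L2_measurable[OF mult_alpha_gen_L2[OF i div_alpha_gen_L2[OF i \<alpha>]]])
 qed (rule M.L2_measurable[OF \<alpha>])
 then show ?thesis by (simp add: Q_def)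
qed

lemma transform_split: "P \<alpha> = (\<lambda>Y. Rs 1 (P \<alpha>) Y + Rs 2 (P \<alpha>) Y)"
proof
 fix Y
 have "\<not> (Y \<in> subtree (ch 1 X) \<and> Y \<in> subtree (ch 2 X))" using subtree_ch_disjoint[of Y 1 X 2] by auto
 moreover have "P \<alpha> Y = 0" if "Y \<notin> subtree (ch 1 X)" "Y \<notin> subtree (ch 2 X)"
  by (rule transform_outside) (use that in blast)
 ultimately show "P \<alpha> Y = Rs 1 (P \<alpha>) Y + Rs 2 (P \<alpha>) Y" by (auto simp: restrict_to_def)
qed

lemma inner_restrict_disjoint: "ell2_inner (Rs 1 f) (Rs 2 g) = 0"
proof -
 have "Rs 1 f Y * cnj (Rs 2 g Y) = 0" for Y
  using subtree_ch_disjoint[of Y 1 X 2] by (auto simp: restrict_to_def)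
 then show ?thesis unfolding ell2_inner_def by (simp only: infsum_0_simp)
qed

lemma restrict_transform_norm:
 assumes i: "i \<in> {1,2}" and \<alpha>: "\<alpha> \<in> L2 \<rho>"
 shows "Rs i (P \<alpha>) \<in> ell2"
  "(ell2_norm (Rs i (P \<alpha>)))^2 = (\<integral>x. (cmod (\<alpha> x))^2 * (1 / (Wc i * nv i x)) \<partial>\<rho>)"
proof -
 note Qi = Q_isometry[OF i div_alpha_gen_L2[OF i \<alpha>]]
 show "Rs i (P \<alpha>) \<in> ell2" unfolding restrict_transform[OF i \<alpha>] by (rule Qi(1))
 have "(ell2_norm (Rs i (P \<alpha>)))^2 = (\<integral>x. (cmod (\<alpha> x / ag i x))^2 * nv i x \<partial>\<rho>)"
  unfolding restrict_transform[OF i \<alpha>] by (rule Qi(2))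
 also have "... = (\<integral>x. (cmod (\<alpha> x))^2 * (1 / (Wc i * nv i x)) \<partial>\<rho>)"
 proof (rule M.integral_cong_K)
  fix x assume x: "x \<in> DD"
  have "0 < nv i x" "0 < Wc i" by (rule nu_pos[OF i x], rule W_pot_pos)
  then show "(cmod (\<alpha> x / ag i x))^2 * nv i x = (cmod (\<alpha> x))^2 * (1 / (Wc i * nv i x))"
   by (simp add: norm_divide norm_alpha_gen[OF i x] power_divide power_mult_distrib power2_eq_square[of "nv i x"])
 next
  show "(\<lambda>x. (cmod (\<alpha> x / ag i x))^2 * nv i x) \<in> borel_measurable borel"
   using M.L2_measurable[OF \<alpha>] alpha_gen_measurable[of i] nu_measurable[of i] by measurable
  show "(\<lambda>x. (cmod (\<alpha> x))^2 * (1 / (Wc i * nv i x))) \<in> borel_measurable borel"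
   using M.L2_measurable[OF \<alpha>] nu_measurable[of i] by measurable
 qed
 finally show "(ell2_norm (Rs i (P \<alpha>)))^2 = (\<integral>x. (cmod (\<alpha> x))^2 * (1 / (Wc i * nv i x)) \<partial>\<rho>)" .
qed

text \<open>The parts on the two subtrees have disjoint supports, so their squared norms
  add.\<close>

lemma transform_isometry:
 assumes \<alpha>: "\<alpha> \<in> L2 \<rho>"
 shows "P \<alpha> \<in> ell2" "(ell2_norm (P \<alpha>))^2 = (\<integral>x. (cmod (\<alpha> x))^2 * wt x \<partial>\<rho>)"
proof -
 have r: "Rs 1 (P \<alpha>) \<in> ell2" "Rs 2 (P \<alpha>) \<in> ell2" by (rule restrict_transform_norm(1)[OF _ \<alpha>], simp)+
 show "P \<alpha> \<in> ell2" by (subst transform_split) (rule ell2_add[OF r])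
 have int: "integrable \<rho> (\<lambda>x. (cmod (\<alpha> x))^2 * (1 / (Wc i * nv i x)))" if i: "i \<in> {1,2}" for i
 proof -
  obtain c C where c: "0 < c" "\<forall>x\<in>DD. c \<le> 1 / (Wc i * nv i x) \<and> 1 / (Wc i * nv i x) \<le> C"
   using wt_term_bounds[OF i] by blast
  have "\<bar>1 / (Wc i * nv i x)\<bar> \<le> C" if x: "x \<in> DD" for x
   using bspec[OF c(2) x] c(1) by linarith
  then show ?thesis using nu_measurable[of i] by (intro M.weighted_integrable[OF \<alpha>]) simp_all
 qed
 have "(ell2_norm (P \<alpha>))^2 = (ell2_norm (Rs 1 (P \<alpha>)))^2 + (ell2_norm (Rs 2 (P \<alpha>)))^2"
  by (subst transform_split) (simp only: ell2_norm_add_power2[OF r] inner_restrict_disjoint, simp)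
 also have "... = (\<integral>x. (cmod (\<alpha> x))^2 * (1 / (Wc 1 * nv 1 x)) + (cmod (\<alpha> x))^2 * (1 / (Wc 2 * nv 2 x)) \<partial>\<rho>)"
  unfolding restrict_transform_norm(2)[OF insertI1 \<alpha>] restrict_transform_norm(2)[OF insertI2[OF insertI1] \<alpha>]
  by (rule Bochner_Integration.integral_add[symmetric]) (rule int, simp)+
 finally show "(ell2_norm (P \<alpha>))^2 = (\<integral>x. (cmod (\<alpha> x))^2 * wt x \<partial>\<rho>)"
  unfolding wt_def sum_12 distrib_left .
qed

text \<open>The lower bound makes the range of the transform closed, in \<open>C_hat_cyclic\<close>,
  and excludes mass off the spectrum, in \<open>AE_spectrum\<close>.\<close>

lemma transform_norm_bounds:
 "\<exists>c C. 0 < c \<and> 0 < C \<and> (\<forall>\<alpha>\<in>L2 \<rho>. c * M.sqnorm \<alpha> \<le> (ell2_norm (P \<alpha>))^2 \<and> (ell2_norm (P \<alpha>))^2 \<le> C * M.sqnorm \<alpha>)"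
proof -
 obtain c C where c: "0 < c" "\<forall>x\<in>DD. c \<le> wt x \<and> wt x \<le> C" using wt_bounds by blast
 obtain B where B: "\<forall>x\<in>DD. \<bar>wt x\<bar> \<le> B" using wt_abs_bounded by blast
 have "c * M.sqnorm \<alpha> \<le> (ell2_norm (P \<alpha>))^2 \<and> (ell2_norm (P \<alpha>))^2 \<le> (\<bar>C\<bar> + 1) * M.sqnorm \<alpha>" if \<alpha>: "\<alpha> \<in> L2 \<rho>" for \<alpha>
 proof -
  have i: "integrable \<rho> (\<lambda>x. (cmod (\<alpha> x))^2)" using \<alpha> by (simp add: M.L2_iff)
  have iw: "integrable \<rho> (\<lambda>x. (cmod (\<alpha> x))^2 * wt x)"
   by (rule M.weighted_integrable[OF \<alpha> wt_measurable, of B]) (use B in blast)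
  have le: "AE x in \<rho>. (cmod (\<alpha> x))^2 * c \<le> (cmod (\<alpha> x))^2 * wt x \<and> (cmod (\<alpha> x))^2 * wt x \<le> (cmod (\<alpha> x))^2 * (\<bar>C\<bar> + 1)"
   using M.AE_K
  proof eventually_elim
   case (elim x)
   show ?case using bspec[OF c(2) elim] by (intro conjI mult_left_mono) auto
  qed
  have "(\<integral>x. (cmod (\<alpha> x))^2 * c \<partial>\<rho>) \<le> (\<integral>x. (cmod (\<alpha> x))^2 * wt x \<partial>\<rho>)"
   by (rule integral_mono_AE) (use i iw le in auto)
  moreover have "(\<integral>x. (cmod (\<alpha> x))^2 * wt x \<partial>\<rho>) \<le> (\<integral>x. (cmod (\<alpha> x))^2 * (\<bar>C\<bar> + 1) \<partial>\<rho>)"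
   by (rule integral_mono_AE) (use i iw le in \<open>auto simp del: distrib_left\<close>)
  ultimately show ?thesis unfolding transform_isometry(2)[OF \<alpha>] M.sqnorm_def by (simp add: mult.commute)
 qed
 then show ?thesis using c(1) by (intro exI[of _ c] exI[of _ "\<bar>C\<bar> + 1"]) auto
qed

text \<open>Polarization: the real part comes from the norm of a sum, the imaginary part from
  replacing \<open>\<alpha>\<close> by \<open>- \<i> * \<alpha>\<close>.\<close>

lemma transform_inner:
 assumes \<alpha>: "\<alpha> \<in> L2 \<rho>" and \<beta>: "\<beta> \<in> L2 \<rho>"
 shows "ell2_inner (P \<alpha>) (P \<beta>) = (\<integral>x. \<alpha> x * cnj (\<beta> x) * cor (wt x) \<partial>\<rho>)"
proof -
 obtain B where B: "\<And>x. x \<in> DD ==> \<bar>wt x\<bar> \<le> B" using wt_abs_bounded by blast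
 have int: "integrable \<rho> (\<lambda>x. \<alpha> x * cnj (\<beta> x) * cor (wt x))" if \<alpha>: "\<alpha> \<in> L2 \<rho>" for \<alpha>
 proof -
  have "(\<lambda>x. cnj (\<beta> x)) \<in> borel_measurable borel"
   by (rule measurable_compose[OF M.L2_measurable[OF \<beta>] borel_measurable_continuous_onI]) (intro continuous_intros)
  then have "(\<lambda>x. cnj (\<beta> x)) \<in> L2 \<rho>" using \<beta> by (simp add: M.L2_iff)
  then have "(\<lambda>x. cor (wt x) * cnj (\<beta> x)) \<in> L2 \<rho>"
   by (rule M.L2_bounded_mult(1)[OF _ measurable_compose[OF wt_measurable borel_measurable_of_real], of _ B]) (use B in simp)
  from M.L2_product_integrable[OF \<alpha> this] show ?thesis by (simp add: mult_ac)
 qed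
 have re: "Re (ell2_inner (P \<alpha>) (P \<beta>)) = Re (\<integral>x. \<alpha> x * cnj (\<beta> x) * cor (wt x) \<partial>\<rho>)" if \<alpha>: "\<alpha> \<in> L2 \<rho>" for \<alpha>
 proof -
  have ab: "(\<lambda>x. \<alpha> x + \<beta> x) \<in> L2 \<rho>" by (rule M.L2_add(1)[OF \<alpha> \<beta>])
  have i: "integrable \<rho> (\<lambda>x. (cmod (\<gamma> x))^2 * wt x)" if "\<gamma> \<in> L2 \<rho>" for \<gamma>
   by (rule M.weighted_integrable[OF that wt_measurable B])
  have ir: "integrable \<rho> (\<lambda>x. Re (\<alpha> x * cnj (\<beta> x) * cor (wt x)))" by (rule integrable_Re[OF int[OF \<alpha>]])
  have "(cmod (u + v))^2 = (cmod u)^2 + (cmod v)^2 + 2 * Re (u * cnj v)" for u v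
   by (simp add: cmod_power2) (simp add: power2_eq_square algebra_simps)
  then have "(\<integral>x. (cmod (\<alpha> x + \<beta> x))^2 * wt x \<partial>\<rho>) = (\<integral>x. (cmod (\<alpha> x))^2 * wt x + (cmod (\<beta> x))^2 * wt x + 2 * Re (\<alpha> x * cnj (\<beta> x) * cor (wt x)) \<partial>\<rho>)"
   by (intro Bochner_Integration.integral_cong) (simp_all add: algebra_simps)
  also have "... = (\<integral>x. (cmod (\<alpha> x))^2 * wt x \<partial>\<rho>) + (\<integral>x. (cmod (\<beta> x))^2 * wt x \<partial>\<rho>) + 2 * (\<integral>x. Re (\<alpha> x * cnj (\<beta> x) * cor (wt x)) \<partial>\<rho>)"
   by (simp only: Bochner_Integration.integral_add Bochner_Integration.integrable_add integrable_mult_right integral_mult_right_zero i[OF \<alpha>] i[OF \<beta>] ir)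
  finally have "(ell2_norm (P (\<lambda>x. \<alpha> x + \<beta> x)))^2 = (ell2_norm (P \<alpha>))^2 + (ell2_norm (P \<beta>))^2 + 2 * (\<integral>x. Re (\<alpha> x * cnj (\<beta> x) * cor (wt x)) \<partial>\<rho>)"
   by (simp only: transform_isometry(2) ab \<alpha> \<beta>)
  moreover have "(ell2_norm (P (\<lambda>x. \<alpha> x + \<beta> x)))^2 = (ell2_norm (P \<alpha>))^2 + (ell2_norm (P \<beta>))^2 + 2 * Re (ell2_inner (P \<alpha>) (P \<beta>))"
   unfolding transform_add[OF \<alpha> \<beta>] by (rule ell2_norm_add_power2[OF transform_isometry(1)[OF \<alpha>] transform_isometry(1)[OF \<beta>]])
  ultimately have "Re (ell2_inner (P \<alpha>) (P \<beta>)) = (\<integral>x. Re (\<alpha> x * cnj (\<beta> x) * cor (wt x)) \<partial>\<rho>)" by linarith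
  then show ?thesis by (simp only: integral_Re[OF int[OF \<alpha>]])
 qed
 show ?thesis
 proof (rule complex_eqI)
  show "Re (ell2_inner (P \<alpha>) (P \<beta>)) = Re (\<integral>x. \<alpha> x * cnj (\<beta> x) * cor (wt x) \<partial>\<rho>)" by (rule re[OF \<alpha>])
  have "(\<integral>x. - \<i> * \<alpha> x * cnj (\<beta> x) * cor (wt x) \<partial>\<rho>) = - \<i> * (\<integral>x. \<alpha> x * cnj (\<beta> x) * cor (wt x) \<partial>\<rho>)"
   by (simp only: mult.assoc integral_mult_right_zero)
  then have "Re (- \<i> * ell2_inner (P \<alpha>) (P \<beta>)) = Re (- \<i> * (\<integral>x. \<alpha> x * cnj (\<beta> x) * cor (wt x) \<partial>\<rho>))"
   using re[OF M.L2_mult[OF \<alpha>, of "- \<i>"]] unfolding transform_mult ell2_inner_mult_left by (simp only:)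
  then show "Im (ell2_inner (P \<alpha>) (P \<beta>)) = Im (\<integral>x. \<alpha> x * cnj (\<beta> x) * cor (wt x) \<partial>\<rho>)" by simp
 qed
qed

lemma transform_tendsto:
 assumes s: "\<And>n. s n \<in> L2 \<rho>" and \<alpha>: "\<alpha> \<in> L2 \<rho>" and lim: "(\<lambda>n. M.sqnorm (\<lambda>x. s n x - \<alpha> x)) \<longlonglongrightarrow> 0"
 shows "ell2_tendsto (\<lambda>n. P (s n)) (P \<alpha>)"
proof -
 obtain c C where C: "\<forall>\<alpha>\<in>L2 \<rho>. c * M.sqnorm \<alpha> \<le> (ell2_norm (P \<alpha>))^2 \<and> (ell2_norm (P \<alpha>))^2 \<le> C * M.sqnorm \<alpha>"
  using transform_norm_bounds by blast
 have bd: "norm (ell2_norm (\<lambda>Y. P (s n) Y - P \<alpha> Y)) \<le> sqrt (C * M.sqnorm (\<lambda>x. s n x - \<alpha> x))" for n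
  using bspec[OF C M.L2_diff[OF s[of n] \<alpha>]] unfolding transform_diff[OF s \<alpha>] by (auto intro: real_le_rsqrt)
 have "(\<lambda>n. sqrt (C * M.sqnorm (\<lambda>x. s n x - \<alpha> x))) \<longlonglongrightarrow> sqrt (C * 0)" by (intro tendsto_intros lim)
 then have "(\<lambda>n. sqrt (C * M.sqnorm (\<lambda>x. s n x - \<alpha> x))) \<longlonglongrightarrow> 0" by (simp only: mult_zero_right real_sqrt_zero)
 then have "(\<lambda>n. ell2_norm (\<lambda>Y. P (s n) Y - P \<alpha> Y)) \<longlonglongrightarrow> 0"
  by (rule Lim_null_comparison[OF always_eventually[OF allI[OF bd]]])
 then show ?thesis unfolding ell2_tendsto_def using transform_isometry(1) s \<alpha> by blast
qed

lemma poly_mult_L2: "\<alpha> \<in> L2 \<rho> ==> (\<lambda>x. pl p x * \<alpha> x) \<in> L2 \<rho>"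
proof -
 assume \<alpha>: "\<alpha> \<in> L2 \<rho>"
 have c: "continuous_on UNIV (\<lambda>x. pl p x)" by (intro continuous_intros)
 have "bounded ((\<lambda>x. pl p x) ` DD)"
  by (rule compact_imp_bounded[OF compact_continuous_image[OF continuous_on_subset[OF c subset_UNIV] M.K]])
 then obtain C where "\<forall>y\<in>(\<lambda>x. pl p x) ` DD. cmod y \<le> C" unfolding bounded_iff by blast
 then show ?thesis by (intro M.L2_bounded_mult(1)[OF \<alpha>, of _ C] borel_measurable_continuous_onI c) auto
qed

lemma Jacobi_power_transform:
 assumes \<alpha>: "\<alpha> \<in> L2 \<rho>"
 shows "(J ^^ n) (P \<alpha>) = P (\<lambda>x. cor x ^ n * \<alpha> x)"
proof (induction n)
 case (Suc n)
 have "(\<lambda>x. cor x ^ n * \<alpha> x) \<in> L2 \<rho>" using poly_mult_L2[OF \<alpha>, of "monom 1 n"] by (simp add: poly_monom)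
 then show ?case by (simp add: Suc Jacobi_transform mult.assoc)
qed simp

lemma transform_poly_mult:
 assumes \<alpha>: "\<alpha> \<in> L2 \<rho>"
 shows "P (\<lambda>x. pl p x * \<alpha> x) = (\<lambda>Y. \<Sum>j\<le>degree p. coeff p j * (J ^^ j) (P \<alpha>) Y)"
proof -
 have m: "(\<lambda>x. cor x ^ j * \<alpha> x) \<in> L2 \<rho>" for j using poly_mult_L2[OF \<alpha>, of "monom 1 j"] by (simp add: poly_monom)
 have L: "(\<lambda>x. \<Sum>j\<le>n. c j * (cor x ^ j * \<alpha> x)) \<in> L2 \<rho> \<and>
  P (\<lambda>x. \<Sum>j\<le>n. c j * (cor x ^ j * \<alpha> x)) = (\<lambda>Y. \<Sum>j\<le>n. c j * (J ^^ j) (P \<alpha>) Y)" for c :: "nat => complex" and n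
 proof (induction n)
  case 0
  show ?case using M.L2_mult[OF \<alpha>] by (simp add: transform_mult)
 next
  case (Suc n)
  have t: "(\<lambda>x. c (Suc n) * (cor x ^ Suc n * \<alpha> x)) \<in> L2 \<rho>" by (rule M.L2_mult[OF m])
  show ?case
   unfolding sum.atMost_Suc transform_add[OF conjunct1[OF Suc] t] conjunct2[OF Suc] transform_mult Jacobi_power_transform[OF \<alpha>]
   by (intro conjI M.L2_add(1) t conjunct1[OF Suc] refl)
 qed
 have "(\<lambda>x. pl p x * \<alpha> x) = (\<lambda>x. \<Sum>j\<le>degree p. coeff p j * (cor x ^ j * \<alpha> x))"
  by (simp add: poly_altdef sum_distrib_right mult.assoc)
 then show ?thesis using L by simp
qed

lemma poly_op_transform: "\<alpha> \<in> L2 \<rho> ==> poly_op J p (P \<alpha>) = P (\<lambda>x. pl p x * \<alpha> x)"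
 by (simp add: transform_poly_mult poly_op_def)

text \<open>Powers of \<open>J\<close> act as multiplication by powers of \<open>x\<close>, and
  linear combinations of these are polynomials.\<close>

lemma cyclic_span:
 assumes \<alpha>: "\<alpha> \<in> L2 \<rho>"
 shows "complex_span {(J ^^ n) (P \<alpha>) | n. True} = {P (\<lambda>x. pl p x * \<alpha> x) | p. True}"
proof (rule set_eqI, rule iffI)
 fix f assume "f \<in> complex_span {(J ^^ n) (P \<alpha>) | n. True}"
 then obtain t c where t: "finite t" "t \<subseteq> {(J ^^ n) (P \<alpha>) | n. True}" "f = (\<lambda>y. \<Sum>f\<in>t. c f * f y)"
  unfolding complex_span_def by blast
 have "\<exists>p. (\<lambda>y. \<Sum>f\<in>t. c f * f y) = P (\<lambda>x. pl p x * \<alpha> x)" using t(1,2)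
 proof (induction t rule: finite_induct)
  case empty
  show ?case using transform_mult[of 0 \<alpha>] by (intro exI[of _ 0]) simp
 next
  case (insert h t)
  then obtain p where p: "(\<lambda>y. \<Sum>f\<in>t. c f * f y) = P (\<lambda>x. pl p x * \<alpha> x)" by auto
  obtain n where n: "h = P (\<lambda>x. cor x ^ n * \<alpha> x)" using insert.prems Jacobi_power_transform[OF \<alpha>] by auto
  have "P (\<lambda>x. pl (monom (c h) n) x * \<alpha> x + pl p x * \<alpha> x) = (\<lambda>Y. P (\<lambda>x. pl (monom (c h) n) x * \<alpha> x) Y + P (\<lambda>x. pl p x * \<alpha> x) Y)"
   by (intro transform_add poly_mult_L2 \<alpha>)
  moreover have "P (\<lambda>x. pl (monom (c h) n) x * \<alpha> x) = (\<lambda>Y. c h * h Y)"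
   unfolding n transform_mult[symmetric] by (simp add: poly_monom mult.assoc)
  ultimately have "(\<lambda>y. \<Sum>f\<in>insert h t. c f * f y) = P (\<lambda>x. pl (monom (c h) n + p) x * \<alpha> x)"
   using insert.hyps fun_cong[OF p] by (simp add: distrib_right)
  then show ?case by blast
 qed
 then show "f \<in> {P (\<lambda>x. pl p x * \<alpha> x) | p. True}" using t(3) by blast
next
 fix f assume "f \<in> {P (\<lambda>x. pl p x * \<alpha> x) | p. True}"
 then obtain p where p: "f = P (\<lambda>x. pl p x * \<alpha> x)" by blast
 show "f \<in> complex_span {(J ^^ n) (P \<alpha>) | n. True}"
  unfolding p transform_poly_mult[OF \<alpha>] by (rule complex_span_sum) auto
qed

lemma mult_alpha_gen_sqnorm:
 assumes i: "i \<in> {1,2}"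
 shows "\<exists>C. \<forall>\<beta>\<in>L2 \<rho>. M.sqnorm (\<lambda>x. \<beta> x * ag i x) \<le> C * M.sqnorm \<beta>"
proof -
 obtain c C where C: "\<forall>x\<in>DD. c \<le> cmod (ag i x) \<and> cmod (ag i x) \<le> C" using alpha_gen_bounds[OF i] by blast
 have "M.sqnorm (\<lambda>x. ag i x * \<beta> x) \<le> C^2 * M.sqnorm \<beta>" if "\<beta> \<in> L2 \<rho>" for \<beta>
  by (rule M.L2_bounded_mult(2)[OF that alpha_gen_measurable]) (use C in blast)
 then show ?thesis by (intro exI[of _ "C^2"]) (simp add: mult.commute)
qed

lemma transform_generator_tendsto:
 assumes i: "i \<in> {1,2}" and s: "\<And>n. s n \<in> L2 \<rho>" and \<alpha>: "\<alpha> \<in> L2 \<rho>" and lim: "(\<lambda>n. M.sqnorm (\<lambda>x. s n x - \<alpha> x)) \<longlonglongrightarrow> 0"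
 shows "ell2_tendsto (\<lambda>n. P (\<lambda>x. s n x * ag i x)) (P (\<lambda>x. \<alpha> x * ag i x))"
proof (rule transform_tendsto)
 obtain C where C: "\<forall>\<beta>\<in>L2 \<rho>. M.sqnorm (\<lambda>x. \<beta> x * ag i x) \<le> C * M.sqnorm \<beta>" using mult_alpha_gen_sqnorm[OF i] by blast
 have bd: "norm (M.sqnorm (\<lambda>x. s n x * ag i x - \<alpha> x * ag i x)) \<le> C * M.sqnorm (\<lambda>x. s n x - \<alpha> x)" for n
  using bspec[OF C M.L2_diff[OF s[of n] \<alpha>]] by (simp add: left_diff_distrib)
 have "(\<lambda>n. C * M.sqnorm (\<lambda>x. s n x - \<alpha> x)) \<longlonglongrightarrow> C * 0" by (intro tendsto_intros lim)
 then have "(\<lambda>n. C * M.sqnorm (\<lambda>x. s n x - \<alpha> x)) \<longlonglongrightarrow> 0" by (simp only: mult_zero_right)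
 then show "(\<lambda>n. M.sqnorm (\<lambda>x. s n x * ag i x - \<alpha> x * ag i x)) \<longlonglongrightarrow> 0"
  by (rule Lim_null_comparison[OF always_eventually[OF allI[OF bd]]])
qed (intro mult_alpha_gen_L2 i s \<alpha>)+

lemma C_hat_eq: "C_hat \<mu> a \<omega> X = {P \<alpha> | \<alpha>. \<alpha> \<in> L2 \<rho>}"
 by (simp add: C_hat_def)

text \<open>One inclusion approximates \<open>\<alpha> / ag i\<close> by polynomials; this quotient
  is square integrable because \<open>ag i\<close> is bounded away from 0 on the intervals. The
  other uses the lower bound in \<open>transform_norm_bounds\<close>: convergent images have Cauchy
  preimages, and L2 is complete.\<close>

lemma C_hat_cyclic:
 assumes i: "i \<in> {1,2}"
 shows "C_hat \<mu> a \<omega> X = ell2_closure (complex_span {(J ^^ n) (P (ag i)) | n. True})"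
 unfolding cyclic_span[OF alpha_gen_L2[OF i]] C_hat_eq
proof (rule set_eqI, rule iffI)
 fix f assume "f \<in> {P \<alpha> | \<alpha>. \<alpha> \<in> L2 \<rho>}"
 then obtain \<alpha> where \<alpha>: "\<alpha> \<in> L2 \<rho>" "f = P \<alpha>" by blast
 have \<beta>: "(\<lambda>x. \<alpha> x / ag i x) \<in> L2 \<rho>" by (rule div_alpha_gen_L2[OF i \<alpha>(1)])
 obtain p where p: "(\<lambda>n. M.sqnorm (\<lambda>x. pl (p n) x - \<alpha> x / ag i x)) \<longlonglongrightarrow> 0" by (rule M.L2_poly_sequence[OF \<beta>])
 have "ell2_tendsto (\<lambda>n. P (\<lambda>x. pl (p n) x * ag i x)) (P (\<lambda>x. \<alpha> x / ag i x * ag i x))"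
  by (rule transform_generator_tendsto[OF i M.L2_poly \<beta> p])
 moreover have "P (\<lambda>x. \<alpha> x / ag i x * ag i x) = P \<alpha>"
 proof (rule transform_cong)
  show "\<alpha> x / ag i x * ag i x = \<alpha> x" if "x \<in> DD" for x using alpha_gen_nonzero[OF i that] by simp
 qed (rule M.L2_measurable[OF mult_alpha_gen_L2[OF i \<beta>]], rule M.L2_measurable[OF \<alpha>(1)])
 ultimately have "ell2_tendsto (\<lambda>n. P (\<lambda>x. pl (p n) x * ag i x)) f" using \<alpha>(2) by simp
 then show "f \<in> ell2_closure {P (\<lambda>x. pl p x * ag i x) | p. True}"
  unfolding ell2_closure_def mem_Collect_eq by (intro exI[of _ "\<lambda>n. P (\<lambda>x. pl (p n) x * ag i x)"] conjI allI) blast+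
next
 fix f assume "f \<in> ell2_closure {P (\<lambda>x. pl p x * ag i x) | p. True}"
 then obtain s where s: "\<And>n. s n \<in> {P (\<lambda>x. pl p x * ag i x) | p. True}" "ell2_tendsto s f" unfolding ell2_closure_def by blast
 then have "\<forall>n. \<exists>p. s n = P (\<lambda>x. pl p x * ag i x)" by blast
 then obtain p where p: "\<And>n. s n = P (\<lambda>x. pl (p n) x * ag i x)" by metis
 define \<alpha> where "\<alpha> n x = pl (p n) x * ag i x" for n x
 have \<alpha>: "\<alpha> n \<in> L2 \<rho>" and sa: "s n = P (\<alpha> n)" for n
  using p poly_mult_L2[OF alpha_gen_L2[OF i]] by (simp_all add: \<alpha>_def[abs_def])
 obtain c C where c: "0 < c" "\<forall>\<alpha>\<in>L2 \<rho>. c * M.sqnorm \<alpha> \<le> (ell2_norm (P \<alpha>))^2 \<and> (ell2_norm (P \<alpha>))^2 \<le> C * M.sqnorm \<alpha>"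
  using transform_norm_bounds by blast
 have f: "f \<in> ell2" "\<And>n. s n \<in> ell2" "(\<lambda>n. ell2_norm (\<lambda>y. s n y - f y)) \<longlonglongrightarrow> 0" using s(2) by (simp_all add: ell2_tendsto_def)
 have "\<exists>N. \<forall>m\<ge>N. \<forall>n\<ge>N. M.sqnorm (\<lambda>x. \<alpha> m x - \<alpha> n x) < e" if e: "0 < e" for e
 proof -
  have "0 < sqrt (c * e) / 2" using c(1) e by simp
  then have "\<forall>\<^sub>F n in sequentially. ell2_norm (\<lambda>y. s n y - f y) < sqrt (c * e) / 2" by (rule order_tendstoD(2)[OF f(3)])
  then obtain N where N: "\<And>n. n \<ge> N ==> ell2_norm (\<lambda>y. s n y - f y) < sqrt (c * e) / 2" unfolding eventually_sequentially by blast
  have "M.sqnorm (\<lambda>x. \<alpha> m x - \<alpha> n x) < e" if "m \<ge> N" "n \<ge> N" for m n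
  proof -
   have "ell2_norm (\<lambda>y. s m y - s n y) < sqrt (c * e)"
    using ell2_triangle_diff[OF f(2)[of m] f(1) f(2)[of n]] N[OF that(1)] N[OF that(2)] ell2_norm_minus_commute[of f "s n"] by simp
   then have "(ell2_norm (\<lambda>y. s m y - s n y))^2 < (sqrt (c * e))^2" by (intro power_strict_mono) auto
   then have "(ell2_norm (P (\<lambda>x. \<alpha> m x - \<alpha> n x)))^2 < c * e"
    using c(1) e by (simp add: transform_diff[OF \<alpha> \<alpha>] sa)
   then have "c * M.sqnorm (\<lambda>x. \<alpha> m x - \<alpha> n x) < c * e"
    using bspec[OF c(2) M.L2_diff[OF \<alpha>[of m] \<alpha>[of n]]] by linarith
   then show ?thesis using c(1) by simp
  qed
  then show ?thesis by blast
 qed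
 then obtain \<beta> r where r: "\<beta> \<in> L2 \<rho>" "strict_mono r" "(\<lambda>n. M.sqnorm (\<lambda>x. \<alpha> (r n) x - \<beta> x)) \<longlonglongrightarrow> 0"
  by (rule M.L2_complete[of \<alpha>, OF \<alpha>])
 have "ell2_tendsto (\<lambda>n. s (r n)) (P \<beta>)" unfolding sa by (rule transform_tendsto[OF \<alpha> r(1,3)])
 moreover have "ell2_tendsto (\<lambda>n. s (r n)) f"
  unfolding ell2_tendsto_def using f LIMSEQ_subseq_LIMSEQ[OF f(3) r(2)] by (simp add: o_def)
 ultimately have "f = P \<beta>" by (rule ell2_tendsto_unique[rotated])
 then show "f \<in> {P \<alpha> | \<alpha>. \<alpha> \<in> L2 \<rho>}" using r(1) by blast
qed

text \<open>\<open>fun_op\<close> controls the approximating polynomials on the spectrum only, so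
  the measure must not charge its complement. Near a point \<open>x0\<close> off the spectrum, the
  transform of the indicator of a small ball is nearly an eigenvector; the lower bound for
  \<open>J - x0\<close> then forces the ball to be null.\<close>

lemma AE_spectrum: "AE x in \<rho>. cor x \<in> op_spectrum J"
proof -
 interpret finite_measure \<rho> by (rule M.finite_M)
 obtain c C where c: "0 < c" "0 < C" "\<forall>\<alpha>\<in>L2 \<rho>. c * M.sqnorm \<alpha> \<le> (ell2_norm (P \<alpha>))^2 \<and> (ell2_norm (P \<alpha>))^2 \<le> C * M.sqnorm \<alpha>"
  using transform_norm_bounds by blast
 have null: "\<exists>d>0. ball x0 d \<in> null_sets \<rho>" if x0: "cor x0 \<notin> op_spectrum J" for x0
 proof -
  obtain B where B: "\<And>f. f \<in> ell2 ==> ell2_norm f \<le> B * ell2_norm (op_shift J (cor x0) f)"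
   using x0 unfolding op_spectrum_def by blast
  \<comment> \<open>Chosen so that the estimates combine to \<open>c * S \<le> c / 2 * S\<close> for
    the mass \<open>S\<close> of the ball; the added 1 avoids division by 0 when
    \<open>B = 0\<close>.\<close>
  define d where "d = sqrt (c / (2 * (B^2 + 1) * C))"
  have d: "0 < d" "(B^2 + 1) * C * d^2 = c / 2"
   unfolding d_def using c(1,2) by (simp_all add: field_simps add_pos_nonneg add_nonneg_eq_0_iff)
  let ?I = "\<lambda>x. indicator (ball x0 d) x :: complex"
  have Im: "?I \<in> borel_measurable borel" by (intro borel_measurable_indicator borel_open open_ball)
  have I: "?I \<in> L2 \<rho>" by (rule M.L2_bounded(1)[OF Im, of 1]) (simp add: indicator_def)
  let ?S = "\<lambda>x. cor x * ?I x - cor x0 * ?I x"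
  have S: "?S \<in> L2 \<rho>" by (intro M.L2_diff mult_x_L2 M.L2_mult I)
  have sh: "op_shift J (cor x0) (P ?I) = P ?S"
   unfolding op_shift_def Jacobi_transform[OF I] transform_diff[OF mult_x_L2[OF I] M.L2_mult[OF I]] transform_mult ..
  have le: "cmod (?S x) \<le> d * cmod (?I x)" for x
   by (auto simp: indicator_def dist_real_def norm_minus_commute simp flip: of_real_diff)
  have Sle: "M.sqnorm ?S \<le> d^2 * M.sqnorm ?I" by (rule M.L2_dominated(2)[OF M.L2_measurable[OF S] I le])
  have P2: "(ell2_norm (P ?S))^2 \<le> C * (d^2 * M.sqnorm ?I)"
   by (rule order_trans[OF conjunct2[OF bspec[OF c(3) S]] mult_left_mono[OF Sle less_imp_le[OF c(2)]]])
  have "c * M.sqnorm ?I \<le> (ell2_norm (P ?I))^2" using bspec[OF c(3) I] by blast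
  also have "... \<le> (B * ell2_norm (P ?S))^2"
   using B[OF transform_isometry(1)[OF I]] unfolding sh by (intro power_mono) simp_all
  also have "... \<le> (B^2 + 1) * (C * (d^2 * M.sqnorm ?I))"
   unfolding power_mult_distrib by (rule mult_mono[OF _ P2]) simp_all
  also have "... = c / 2 * M.sqnorm ?I" unfolding d(2)[symmetric] by (simp add: mult.assoc)
  finally have "M.sqnorm ?I \<le> 0" using c(1) by (simp add: mult_le_0_iff)
  then have "M.sqnorm ?I = 0" by (intro antisym M.sqnorm_nonneg)
  moreover have "M.sqnorm ?I = measure \<rho> (ball x0 d)"
  proof -
   have "M.sqnorm ?I = (\<integral>x. indicator (ball x0 d) x \<partial>\<rho>)"
    unfolding M.sqnorm_def by (rule Bochner_Integration.integral_cong) (auto simp: indicator_def)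
   then show ?thesis by (simp add: M.space_M)
  qed
  ultimately have "emeasure \<rho> (ball x0 d) = 0" by (simp add: emeasure_eq_measure)
  then show ?thesis using d(1) by (intro exI[of _ d]) (auto simp: null_sets_def sets_rho)
 qed
 \<comment> \<open>By Lindelof countably many of these null balls cover all real points off the
   spectrum.\<close>
 define F where "F = {U. \<exists>x d. U = ball x d \<and> 0 < d \<and> ball x d \<in> null_sets \<rho>}"
 have "\<And>U. U \<in> F ==> open U" unfolding F_def by auto
 then obtain F' where F': "F' \<subseteq> F" "countable F'" "\<Union>F' = \<Union>F" by (rule Lindelof)
 have "(\<Union>U\<in>F'. U) \<in> null_sets \<rho>"
  by (rule null_sets_UN'[OF F'(2)]) (use F'(1) in \<open>auto simp: F_def\<close>)
 then have n: "\<Union>F \<in> null_sets \<rho>" using F'(3) by simp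
 have "{x \<in> space \<rho>. \<not> cor x \<in> op_spectrum J} \<subseteq> \<Union>F"
 proof
  fix x assume "x \<in> {x \<in> space \<rho>. \<not> cor x \<in> op_spectrum J}"
  then obtain d where "0 < d" "ball x d \<in> null_sets \<rho>" using null by blast
  then show "x \<in> \<Union>F" unfolding F_def by (intro UnionI[of "ball x d"]) auto
 qed
 then show ?thesis by (rule AE_I'[OF n])
qed

text \<open>The description in \<open>fun_op\<close> has a unique value only if some polynomials
  converge uniformly on the spectrum; the spectrum is bounded, so Weierstrass approximation provides
  them. Along any such sequence the convergence is uniform almost everywhere by
  \<open>AE_spectrum\<close>, hence holds in L2 and passes to the transforms.\<close>

lemma fun_op_generator:
 assumes i: "i \<in> {1,2}" and \<alpha>: "continuous_on UNIV \<alpha>"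
 shows "fun_op J \<alpha> (P (ag i)) = P (\<lambda>x. \<alpha> x * ag i x)"
proof -
 define \<sigma> where "\<sigma> = {x. cor x \<in> op_spectrum J}"
 have po: "poly_op J p (P (ag i)) = P (\<lambda>x. pl p x * ag i x)" for p by (rule poly_op_transform[OF alpha_gen_L2[OF i]])
 have lim: "ell2_tendsto (\<lambda>n. poly_op J (p n) (P (ag i))) (P (\<lambda>x. \<alpha> x * ag i x))"
  if p: "uniform_limit \<sigma> (\<lambda>n x. pl (p n) x) \<alpha> sequentially" for p
  unfolding po
 proof (rule transform_generator_tendsto[OF i M.L2_poly M.L2_continuous[OF \<alpha>]])
  let ?m = "measure \<rho> UNIV + 1"
  have m: "?m > 0" by (simp add: add_nonneg_pos)
  have sm: "M.sqnorm (\<lambda>x. pl (p n) x - \<alpha> x) \<le> e^2 * ?m" if d: "\<forall>x\<in>\<sigma>. dist (pl (p n) x) (\<alpha> x) < e" for n e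
  proof -
   have "M.sqnorm (\<lambda>x. pl (p n) x - \<alpha> x) \<le> (\<integral>x. e^2 \<partial>\<rho>)"
    unfolding M.sqnorm_def
   proof (rule integral_mono_AE)
    show "integrable \<rho> (\<lambda>x. (cmod (pl (p n) x - \<alpha> x))^2)"
     using M.L2_diff[OF M.L2_poly M.L2_continuous[OF \<alpha>]] by (simp add: M.L2_iff)
    show "integrable \<rho> (\<lambda>x. e^2)" by (rule M.integrable_const)
    show "AE x in \<rho>. (cmod (pl (p n) x - \<alpha> x))^2 \<le> e^2" using AE_spectrum
    proof eventually_elim
     case (elim x)
     then have "cmod (pl (p n) x - \<alpha> x) < e" using d by (simp add: \<sigma>_def dist_norm)
     then show ?case by (intro power_mono) auto
    qed
   qed
   also have "... \<le> e^2 * ?m" by (simp add: M.space_M algebra_simps)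
   finally show ?thesis .
  qed
  show "(\<lambda>n. M.sqnorm (\<lambda>x. pl (p n) x - \<alpha> x)) \<longlonglongrightarrow> 0"
  proof (rule LIMSEQ_I)
   fix e :: real assume e: "0 < e"
   define d where "d = sqrt (e / (2 * ?m))"
   have d: "0 < d" "d^2 * ?m = e / 2" unfolding d_def using e m by (simp_all add: field_simps)
   obtain N where N: "\<And>n. n \<ge> N ==> \<forall>x\<in>\<sigma>. dist (pl (p n) x) (\<alpha> x) < d"
    using uniform_limitD[OF p d(1)] unfolding eventually_sequentially by blast
   have "norm (M.sqnorm (\<lambda>x. pl (p n) x - \<alpha> x) - 0) < e" if "n \<ge> N" for n
    using sm[OF N[OF that]] d(2) e by simp
   then show "\<exists>N. \<forall>n\<ge>N. norm (M.sqnorm (\<lambda>x. pl (p n) x - \<alpha> x) - 0) < e" by blast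
  qed
 qed
 have ex: "\<exists>p. uniform_limit \<sigma> (\<lambda>n x. pl (p n) x) \<alpha> sequentially"
 proof -
  have sub: "\<sigma> \<subseteq> {- J_bound .. J_bound}"
  proof
   fix x assume "x \<in> \<sigma>"
   then have "\<not> J_bound < cmod (cor x)" using J.large_notin_spectrum[of "cor x"] unfolding \<sigma>_def by blast
   then show "x \<in> {- J_bound .. J_bound}" by auto
  qed
  have "\<forall>n::nat. \<exists>p. \<forall>x\<in>{- J_bound .. J_bound}. cmod (\<alpha> x - pl p x) < inverse (real (Suc n))"
   by (intro allI complex_poly_uniform_approximation compact_Icc continuous_on_subset[OF \<alpha> subset_UNIV]) simp
  then obtain p where p: "\<And>n x. x \<in> {- J_bound .. J_bound} ==> cmod (\<alpha> x - pl (p n) x) < inverse (real (Suc n))" by metis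
  have "uniform_limit \<sigma> (\<lambda>n x. pl (p n) x) \<alpha> sequentially"
  proof (rule uniform_limitI)
   fix e :: real assume "0 < e"
   then have "\<forall>\<^sub>F n in sequentially. inverse (real (Suc n)) < e" by (rule order_tendstoD(2)[OF LIMSEQ_inverse_real_of_nat])
   then show "\<forall>\<^sub>F n in sequentially. \<forall>x\<in>\<sigma>. dist (pl (p n) x) (\<alpha> x) < e"
   proof eventually_elim
    case (elim n)
    show ?case using less_trans[OF p elim] sub by (auto simp: dist_norm norm_minus_commute)
   qed
  qed
  then show ?thesis by blast
 qed
 show ?thesis
  unfolding fun_op_def \<sigma>_def[symmetric]
 proof (rule the_equality)
  show "\<forall>p. uniform_limit \<sigma> (\<lambda>n x. pl (p n) x) \<alpha> sequentially \<longrightarrow> ell2_tendsto (\<lambda>n. poly_op J (p n) (P (ag i))) (P (\<lambda>x. \<alpha> x * ag i x))"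
   using lim by blast
 next
  fix h assume h: "\<forall>p. uniform_limit \<sigma> (\<lambda>n x. pl (p n) x) \<alpha> sequentially \<longrightarrow> ell2_tendsto (\<lambda>n. poly_op J (p n) (P (ag i))) h"
  obtain p where p: "uniform_limit \<sigma> (\<lambda>n x. pl (p n) x) \<alpha> sequentially" using ex by blast
  show "h = P (\<lambda>x. \<alpha> x * ag i x)" by (rule ell2_tendsto_unique[OF h[rule_format, OF p] lim[OF p]])
 qed
qed

text \<open>Under the transform \<open>J - z\<close> becomes multiplication by \<open>x - z\<close>,
  whose inverse is bounded for nonreal \<open>z\<close>.\<close>

lemma resolvent_generator:
 assumes i: "i \<in> {1,2}" and z: "Im z \<noteq> 0"
 shows "(\<lambda>x. 1 / (cor x - z) * ag i x) \<in> L2 \<rho>"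
  "resolvent J z (P (ag i)) = P (\<lambda>x. 1 / (cor x - z) * ag i x)"
proof -
 have nz: "cor x - z \<noteq> 0" for x using z by (metis Im_complex_of_real eq_iff_diff_eq_0)
 have bd: "cmod (1 / (cor x - z)) \<le> 1 / \<bar>Im z\<bar>" for x
  unfolding norm_divide norm_one using z nz[of x] abs_Im_le_cmod[of "cor x - z"] by (intro divide_left_mono mult_pos_pos) auto
 have m: "(\<lambda>x. 1 / (cor x - z)) \<in> borel_measurable borel" by measurable
 show r: "(\<lambda>x. 1 / (cor x - z) * ag i x) \<in> L2 \<rho>" (is "?r \<in> _")
  by (rule M.L2_bounded_mult(1)[OF alpha_gen_L2[OF i] m bd])
 show "resolvent J z (P (ag i)) = P ?r"
 proof (rule J.resolvent_eqI)
  show "z \<notin> op_spectrum J" by (rule J.nonreal_notin_spectrum[OF z])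
  show "P ?r \<in> ell2" by (rule transform_isometry(1)[OF r])
  have eq: "(\<lambda>x. cor x * ?r x - z * ?r x) = ag i"
  proof
   fix x
   have "cor x * ?r x - z * ?r x = (cor x - z) * (1 / (cor x - z)) * ag i x"
    by (simp only: left_diff_distrib mult.assoc)
   also have "... = ag i x" using nz[of x] by simp
   finally show "cor x * ?r x - z * ?r x = ag i x" .
  qed
  have "op_shift J z (P ?r) = P (\<lambda>x. cor x * ?r x - z * ?r x)"
   unfolding op_shift_def Jacobi_transform[OF r] transform_diff[OF mult_x_L2[OF r] M.L2_mult[OF r]] transform_mult ..
  then show "op_shift J z (P ?r) = P (ag i)" unfolding eq .
 qed
qed

text \<open>On the intervals the density equals \<open>(cmod (ag i x))^2 * wt x\<close>, and the
  resolvent multiplies by \<open>1 / (x - z)\<close>; so the claim is an instance of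
  \<open>transform_inner\<close>.\<close>

lemma spectral_measure_generator:
 assumes i: "i \<in> {1,2}"
 shows "is_spectral_measure J (P (ag i))
  (density \<rho> (\<lambda>x. ennreal (\<Sum>k\<in>{1,2}. Wc i / Wc k * ((nv i x)^2 / nv k x))))"
proof -
 define D where "D x = (\<Sum>k\<in>{1,2}. Wc i / Wc k * ((nv i x)^2 / nv k x))" for x
 have Dm: "D \<in> borel_measurable borel"
  unfolding D_def[abs_def] sum_12 using nu_measurable[of 1] nu_measurable[of 2] nu_measurable[of i] by measurable
 have Dw: "D x = (cmod (ag i x))^2 * wt x" and D0: "0 \<le> D x" if x: "x \<in> DD" for x
 proof -
  have W: "0 < Wc k" for k by (rule W_pot_pos)
  have n: "0 < nv 1 x" "0 < nv 2 x" using nu_pos[OF insertI1 x] nu_pos[OF insertI2[OF insertI1] x] by auto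
  show "D x = (cmod (ag i x))^2 * wt x"
   unfolding norm_alpha_gen[OF i x] D_def wt_def sum_12 power_mult_distrib using W[of i]
   by (simp add: distrib_left less_imp_le)
  show "0 \<le> D x" unfolding D_def sum_12 using W n by (intro add_nonneg_nonneg mult_nonneg_nonneg divide_nonneg_pos) (auto intro: less_imp_le)
 qed
 have AE0: "AE x in \<rho>. 0 \<le> D x" using M.AE_K by eventually_elim (rule D0)
 obtain B where B: "\<And>x. x \<in> DD ==> \<bar>wt x\<bar> \<le> B" using wt_abs_bounded by blast
 have Di: "integrable \<rho> D"
 proof (rule integrable_cong_AE_imp)
  show "integrable \<rho> (\<lambda>x. (cmod (ag i x))^2 * wt x)" by (rule M.weighted_integrable[OF alpha_gen_L2[OF i] wt_measurable B])
  show "D \<in> borel_measurable \<rho>" using Dm by (simp add: M.measurable_M)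
  show "AE x in \<rho>. (cmod (ag i x))^2 * wt x = D x" using M.AE_K by eventually_elim (rule Dw[symmetric])
 qed
 have Dm': "D \<in> borel_measurable \<rho>" using Dm by (simp add: M.measurable_M)
 have fin: "finite_measure (density \<rho> (\<lambda>x. ennreal (D x)))"
 proof (rule finite_measureI)
  have "emeasure (density \<rho> (\<lambda>x. ennreal (D x))) (space (density \<rho> (\<lambda>x. ennreal (D x)))) = (\<integral>\<^sup>+x. ennreal (D x) * indicator (space \<rho>) x \<partial>\<rho>)"
   using Dm' by (simp add: emeasure_density)
  also have "... = (\<integral>\<^sup>+x. ennreal (D x) \<partial>\<rho>)" by (simp add: M.space_M)
  also have "... = ennreal (\<integral>x. D x \<partial>\<rho>)" by (rule nn_integral_eq_integral[OF Di AE0])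
  finally show "emeasure (density \<rho> (\<lambda>x. ennreal (D x))) (space (density \<rho> (\<lambda>x. ennreal (D x)))) \<noteq> \<infinity>" by simp
 qed
 have res: "ell2_inner (resolvent J z (P (ag i))) (P (ag i)) = (\<integral>x. 1 / (cor x - z) \<partial>density \<rho> (\<lambda>x. ennreal (D x)))"
  if z: "Im z \<noteq> 0" for z
 proof -
  have m: "(\<lambda>x. 1 / (cor x - z)) \<in> borel_measurable borel" by measurable
  have "(\<integral>x. 1 / (cor x - z) \<partial>density \<rho> (\<lambda>x. ennreal (D x))) = (\<integral>x. D x *\<^sub>R (1 / (cor x - z)) \<partial>\<rho>)"
   by (rule integral_density) (use m Dm' AE0 in \<open>simp_all add: M.measurable_M\<close>)
  also have "... = (\<integral>x. 1 / (cor x - z) * ag i x * cnj (ag i x) * cor (wt x) \<partial>\<rho>)"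
  proof (rule M.integral_cong_K)
   show "(\<lambda>x. D x *\<^sub>R (1 / (cor x - z))) \<in> borel_measurable borel" using Dm m by measurable
   have "(\<lambda>x. cnj (ag i x)) \<in> borel_measurable borel"
    by (rule measurable_compose[OF alpha_gen_measurable borel_measurable_continuous_onI]) (intro continuous_intros)
   then show "(\<lambda>x. 1 / (cor x - z) * ag i x * cnj (ag i x) * cor (wt x)) \<in> borel_measurable borel"
    using m by (intro borel_measurable_times alpha_gen_measurable measurable_compose[OF wt_measurable borel_measurable_of_real])
   show "D x *\<^sub>R (1 / (cor x - z)) = 1 / (cor x - z) * ag i x * cnj (ag i x) * cor (wt x)" if "x \<in> DD" for x
    unfolding Dw[OF that] scaleR_conv_of_real of_real_mult complex_norm_square by (simp only: mult_ac)
  qed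
  also have "... = ell2_inner (resolvent J z (P (ag i))) (P (ag i))"
   unfolding resolvent_generator(2)[OF i z] transform_inner[OF resolvent_generator(1)[OF i z] alpha_gen_L2[OF i]] ..
  finally show ?thesis by simp
 qed
 show ?thesis
  unfolding is_spectral_measure_def D_def[symmetric]
  using transform_isometry(1)[OF alpha_gen_L2[OF i]] fin res J.nonreal_notin_spectrum by (simp add: sets_rho)
qed

lemma restrict_generator:
 assumes i: "i \<in> {1,2}"
 shows "Rs i (P (ag i)) = Rs i (delta (ch i X))"
 using Q_one[OF i] unfolding Q_def by (simp add: restrict_to_def delta_def fun_eq_iff)

end

theorem proposition3p4p2:
  fixes \<mu> :: "nat \<Rightarrow> real measure"
    and a b :: "nat \<times> nat \<Rightarrow> nat \<Rightarrow> real"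
    and \<omega> :: "nat \<times> nat \<Rightarrow> real measure"
    and \<kappa> :: "real \<times> real"
    and X :: vertex
  assumes "angelesco \<mu>"
    and "recurrence_coefficients \<mu> a b"
    and "\<And>n. fst n > 0 \<Longrightarrow> snd n > 0 \<Longrightarrow> reference_measure \<mu> n (\<omega> n)"
    and "fst \<kappa> + snd \<kappa> = 1"
  shows
    "(\<forall>x\<in>Delta \<mu> 1 \<union> Delta \<mu> 2.
        Jacobi a b \<kappa> (Psi_hat \<mu> a X x) = (\<lambda>Y. complex_of_real x * Psi_hat \<mu> a X x Y)) \<and>
     (\<forall>i\<in>{1, 2}.
        alpha_gen \<mu> a X i \<in> L2 (rho_tilde \<mu> \<omega> X) \<and>
        g_gen \<mu> a \<omega> X i \<in> C_hat \<mu> a \<omega> X \<and>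
        restrict_to (subtree (ch i X)) (g_gen \<mu> a \<omega> X i) =
          restrict_to (subtree (ch i X)) (delta (ch i X)) \<and>
        C_hat \<mu> a \<omega> X =
          ell2_closure (complex_span {(Jacobi a b \<kappa> ^^ n) (g_gen \<mu> a \<omega> X i) | n. True}) \<and>
        (\<forall>\<alpha>. continuous_on UNIV \<alpha> \<longrightarrow>
           fun_op (Jacobi a b \<kappa>) \<alpha> (g_gen \<mu> a \<omega> X i) =
             Psi_transform \<mu> a \<omega> X (\<lambda>x. \<alpha> x * alpha_gen \<mu> a X i x)) \<and>
        (\<forall>\<alpha>\<in>L2 (rho_tilde \<mu> \<omega> X).
           Psi_transform \<mu> a \<omega> X (\<lambda>x. \<alpha> x * alpha_gen \<mu> a X i x) \<in> C_hat \<mu> a \<omega> X \<and>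
           (\<exists>s. (\<forall>n. continuous_on UNIV (s n)) \<and> L2_tendsto (rho_tilde \<mu> \<omega> X) s \<alpha>) \<and>
           (\<forall>s. (\<forall>n. continuous_on UNIV (s n)) \<and> L2_tendsto (rho_tilde \<mu> \<omega> X) s \<alpha> \<longrightarrow>
              ell2_tendsto (\<lambda>n. fun_op (Jacobi a b \<kappa>) (s n) (g_gen \<mu> a \<omega> X i))
                (Psi_transform \<mu> a \<omega> X (\<lambda>x. \<alpha> x * alpha_gen \<mu> a X i x)))) \<and>
        is_spectral_measure (Jacobi a b \<kappa>) (g_gen \<mu> a \<omega> X i)
          (density (rho_tilde \<mu> \<omega> X)
             (\<lambda>x. ennreal (\<Sum>k\<in>{1, 2}.
                W_pot a (ch i X) / W_pot a (ch k X) * ((nu \<mu> a X i x)\<^sup>2 / nu \<mu> a X k x)))))"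
proof -
 interpret angelesco_jacobi \<mu> a b \<omega> X \<kappa>
  by unfold_locales (use assms in blast)+
 show ?thesis
  unfolding g_gen_def
 proof (intro conjI ballI allI impI)
  fix x assume "x \<in> Delta \<mu> 1 \<union> Delta \<mu> 2"
  then obtain k where k: "k \<in> {1,2}" "x \<in> Delta \<mu> k" by (rule DD_cases)
  show "J (Psi_hat \<mu> a X x) = (\<lambda>Y. cor x * Psi_hat \<mu> a X x Y)"
   by (rule ext) (rule Psi_hat_eigenfunction[OF k])
 next
  fix i :: nat assume i: "i \<in> {1,2}"
  show "ag i \<in> L2 \<rho>" by (rule alpha_gen_L2[OF i])
  then show "P (ag i) \<in> C_hat \<mu> a \<omega> X" unfolding C_hat_eq by blast
  show "Rs i (P (ag i)) = Rs i (delta (ch i X))" by (rule restrict_generator[OF i])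
  show "C_hat \<mu> a \<omega> X = ell2_closure (complex_span {(J ^^ n) (P (ag i)) | n. True})" by (rule C_hat_cyclic[OF i])
  show "fun_op J \<alpha> (P (ag i)) = P (\<lambda>x. \<alpha> x * ag i x)" if "continuous_on UNIV \<alpha>" for \<alpha>
   by (rule fun_op_generator[OF i that])
  show "is_spectral_measure J (P (ag i)) (density \<rho> (\<lambda>x. ennreal (\<Sum>k\<in>{1, 2}.
    W_pot a (ch i X) / W_pot a (ch k X) * ((nu \<mu> a X i x)^2 / nu \<mu> a X k x))))"
   by (rule spectral_measure_generator[OF i])
  fix \<alpha> assume \<alpha>: "\<alpha> \<in> L2 \<rho>"
  show "P (\<lambda>x. \<alpha> x * ag i x) \<in> C_hat \<mu> a \<omega> X" unfolding C_hat_eq using mult_alpha_gen_L2[OF i \<alpha>] by blast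
  show "\<exists>s. (\<forall>n. continuous_on UNIV (s n)) \<and> L2_tendsto \<rho> s \<alpha>"
  proof -
   obtain p where p: "(\<lambda>n. M.sqnorm (\<lambda>x. pl (p n) x - \<alpha> x)) \<longlonglongrightarrow> 0" by (rule M.L2_poly_sequence[OF \<alpha>])
   show ?thesis
    by (intro exI[of _ "\<lambda>n x. pl (p n) x"] conjI allI continuous_intros) (use p \<alpha> M.L2_poly in \<open>simp add: M.L2_tendsto_iff\<close>)
  qed
  fix s assume s: "(\<forall>n. continuous_on UNIV (s n)) \<and> L2_tendsto \<rho> s \<alpha>"
  then have f: "fun_op J (s n) (P (ag i)) = P (\<lambda>x. s n x * ag i x)" for n by (intro fun_op_generator[OF i]) blast
  show "ell2_tendsto (\<lambda>n. fun_op J (s n) (P (ag i))) (P (\<lambda>x. \<alpha> x * ag i x))"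
   unfolding f by (rule transform_generator_tendsto[OF i _ \<alpha>]) (use s in \<open>simp_all add: M.L2_tendsto_iff\<close>)
 qed
qed

end
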